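(* Let $K^0$ be either one of the two compact open subgroups $K^0_{\mathrm{st}}$ or $K^0_{\mathrm{par}}$ of $G^0(F)$ defined in the context, with the associated $K_{M^0}$, $\rho_{M^0}$, $\rho^0$, $N(\rho_{M^0})$ and $W(\rho_{M^0})=N(\rho_{M^0})/K_{M^0}$. Let $\mathcal T=\{T_n\}_{n\in N(\rho_{M^0})}$ be a family of intertwining operators as in the context and let $\mu^{\mathcal T}\colon W(\rho_{M^0})\times W(\rho_{M^0})\to\mathbb C^\times$ be the associated $2$-cocycle. Then there is an isomorphism of $\mathbb C$-algebras $$\mathcal H(G^0(F),(K^0,\rho^0))\;\simeq\;\mathbb C[W(\rho_{M^0}),\mu^{\mathcal T}],$$ and the $2$-cocycle $\mu^{\mathcal T}$ is non-trivial (i.e. its class in $H^2(W(\rho_{M^0}),\mathbb C^\times)$, with trivial action on $\mathbb C^\times$, is non-trivial).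
   Context: Let $F$ be a non-archimedean local field with residue field $\mathfrak f$ of odd characteristic $p$ and order $q$, with $4\mid q-1$. For a finite extension $E/F$, $\mathcal O_E$, $\mathfrak p_E$, $N_{E/F}$ denote the ring of integers, its maximal ideal and the norm map. Fix a uniformizer $\varpi_F$ of $F$, a primitive $(q-1)$-st root of unity $\zeta\in F$, and a square root $\sqrt{-1}\in\mathbb C^\times$ of $-1$. Let $\eta\colon F^\times\to\mathbb C^\times$ be the unique character trivial on $\varpi_F$ and on $1+\mathfrak p_F$ with $\eta(\zeta)=\sqrt{-1}$. Let $E_2$ (resp. $E_4$) be the splitting field over $F$ of $X^2+\varpi_F$ (resp. $X^4+\zeta\varpi_F$); these are totally ramified of degree $2$ and $4$, so their residue fields are identified with $\mathfrak f$. Let $G^0$ be the group over $F$ given by $(\mathrm{Res}_{E_2/F}\mathrm{GL}_2\times\mathrm{Res}_{E_4/F}\mathrm{GL}_1)\cap\mathrm{SL}_8$ (embedded in $\mathrm{GL}_8$ via $F$-bases of $E_2$ and $E_4$), so $G^0(F)=\{(g_2,g_4)\in\mathrm{GL}_2(E_2)\times E_4^\times: N_{E_2/F}(\det g_2)N_{E_4/F}(g_4)=1\}$. Let $M^0\subset G^0$ be the maximal torus for which $g_2$ is diagonal; write its $F$-points as $(x,y,z)\in E_2^\times\times E_2^\times\times E_4^\times$, meaning $(\mathrm{diag}(x,y),z)$. Let $I_2=\{\begin{pmatrix}a&b\\c&d\end{pmatrix}\in\mathrm{GL}_2(E_2): a,d\in\mathcal O_{E_2}^\times,\ b\in\mathcal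 O_{E_2},\ c\in\mathfrak p_{E_2}\}$. Put $K^0_{\mathrm{st}}=(I_2\times\mathcal O_{E_4}^\times)\cap G^0(F)$ (the stabilizer of a point $x_0$ of the enlarged Bruhat–Tits building) and $K^0_{\mathrm{par}}=\{(g_2,g_4)\in K^0_{\mathrm{st}}: (\det g_2\bmod\mathfrak p_{E_2})\cdot(g_4\bmod\mathfrak p_{E_4})^2=1 \text{ in }\mathfrak f^\times\}$ (the corresponding parahoric subgroup). For $K^0$ one of these, $K_{M^0}=K^0\cap M^0(F)$. Let $\rho_{M^0}$ be the character $(x,y,z)\mapsto\eta(N_{E_2/F}(y))$ of $K_{M^0}$, and $\rho^0$ the character $(\begin{pmatrix}a&b\\c&d\end{pmatrix},g_4)\mapsto\eta(N_{E_2/F}(d))$ of $K^0$. Notation: ${}^nK=nKn^{-1}$ and ${}^n\rho(x)=\rho(n^{-1}xn)$. Put $N(\rho_{M^0})=\{n\in N_{G^0}(M^0)(F): {}^nK_{M^0}=K_{M^0},\ {}^n\rho_{M^0}=\rho_{M^0}\}$, where $N_{G^0}(M^0)$ is the normalizer, and $W(\rho_{M^0})=N(\rho_{M^0})/K_{M^0}$. $\mathcal H(G^0(F),(K^0,\rho^0))$ is the $\mathbb C$-algebra of compactly supported functions $\varphi\colon G^0(F)\to\mathbb C$ with $\varphi(k_1gk_2)=\rho^0(k_1)\varphi(g)\rho^0(k_2)$ for $k_1,k_2\in K^0$, with convolution $(\varphi*\psi)(g)=\sum_{h\in G^0(F)/K^0}\varphi(h)\psi(h^{-1}g)$. The family $\mathcal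 T$: non-zero elements $T_n\in\mathrm{Hom}_{K_{M^0}}({}^n\rho_{M^0},\rho_{M^0})=\mathbb C$ (i.e. $T_n\in\mathbb C^\times$) for $n\in N(\rho_{M^0})$, such that $T_{nk}=T_n\,\rho_{M^0}(k)$ for all $n\in N(\rho_{M^0})$, $k\in K_{M^0}$. The $2$-cocycle $\mu^{\mathcal T}$ is defined by $T_mT_n=\mu^{\mathcal T}(mK_{M^0},nK_{M^0})\,T_{mn}$ for $m,n\in N(\rho_{M^0})$ (well defined on $W(\rho_{M^0})$). The twisted group algebra $\mathbb C[W,\mu]$ has basis $\{b_w\}_{w\in W}$ with $b_vb_w=\mu(v,w)b_{vw}$. *)

theory Defs
  imports
    "HOL-Analysis.Product_Topology"
    "HOL-Algebra.Left_Coset"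
    "HOL-Algebra.QuotRing"
    "HOL-Algebra.Algebraic_Closure_Type"
    "Jordan_Normal_Form.Determinant"
begin

section \<open>Local fields\<close>

definition unit_elems :: "'a::field set \<Rightarrow> 'a set" where
  "unit_elems R = {x \<in> R. x \<noteq> 0 \<and> inverse x \<in> R}"

text \<open>The maximal ideal when the subring \<open>R\<close> of a field is local.\<close>

definition nonunits :: "'a::field set \<Rightarrow> 'a set" where
  "nonunits R = R - unit_elems R"

text \<open>A valuation is a map to the integers of which the value at \<open>0\<close> is irrelevant (it stands
  for \<open>\<infinity>\<close>).\<close>

definition val_ge :: "('f::field \<Rightarrow> int) \<Rightarrow> 'f \<Rightarrow> int \<Rightarrow> bool" where
  "val_ge v x n \<longleftrightarrow> x = 0 \<or> n \<le> v x"

definition valuation_ring :: "('f::field \<Rightarrow> int) \<Rightarrow> 'f set" where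
  "valuation_ring v = {x. val_ge v x 0}"

definition residue_field :: "('f::field \<Rightarrow> int) \<Rightarrow> 'f set ring" where
  "residue_field v =
     \<lparr>carrier = valuation_ring v, monoid.mult = (*), one = 1, zero = 0, add = (+)\<rparr>
       Quot nonunits (valuation_ring v)"

definition nonarch_local_field :: "('f::field \<Rightarrow> int) \<Rightarrow> bool" where
  "nonarch_local_field v \<longleftrightarrow>
     (\<forall>x y. x \<noteq> 0 \<longrightarrow> y \<noteq> 0 \<longrightarrow> v (x * y) = v x + v y) \<and>
     (\<forall>x y. x \<noteq> 0 \<longrightarrow> y \<noteq> 0 \<longrightarrow> x + y \<noteq> 0 \<longrightarrow> min (v x) (v y) \<le> v (x + y)) \<and>
     (\<exists>x. x \<noteq> 0 \<and> v x = 1) \<and>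
     (\<forall>s :: nat \<Rightarrow> 'f. (\<forall>n. \<exists>k. \<forall>i\<ge>k. \<forall>j\<ge>k. val_ge v (s i - s j) n) \<longrightarrow>
        (\<exists>l. \<forall>n. \<exists>k. \<forall>i\<ge>k. val_ge v (s i - l) n)) \<and>
     finite (carrier (residue_field v))"

section \<open>Extensions, given by an embedding \<open>\<iota>\<close> of the base field\<close>

definition is_splitting_field :: "('f::field \<Rightarrow> 'e::field) \<Rightarrow> 'f poly \<Rightarrow> bool" where
  "is_splitting_field \<iota> f \<longleftrightarrow> field_hom \<iota> \<and>
     (\<exists>rs. map_poly \<iota> f = Polynomial.smult (\<iota> (lead_coeff f)) (\<Prod>r\<leftarrow>rs. [:- r, 1:])) \<and>
     (\<forall>L. range \<iota> \<subseteq> L \<longrightarrow> {r. poly (map_poly \<iota> f) r = 0} \<subseteq> L \<longrightarrow>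
        (\<forall>x\<in>L. \<forall>y\<in>L. x - y \<in> L \<and> x * y \<in> L \<and> inverse x \<in> L) \<longrightarrow> L = UNIV)"

definition integral_closure :: "('f::field \<Rightarrow> 'e::field) \<Rightarrow> 'f set \<Rightarrow> 'e set" where
  "integral_closure \<iota> R =
     {x. \<exists>f. lead_coeff f = 1 \<and> set (coeffs f) \<subseteq> R \<and> poly (map_poly \<iota> f) x = 0}"

definition is_ext_basis :: "('f::field \<Rightarrow> 'e::field) \<Rightarrow> 'e list \<Rightarrow> bool" where
  "is_ext_basis \<iota> bs \<longleftrightarrow>
     (\<forall>x. \<exists>!c. c \<in> carrier_vec (length bs) \<and> x = (\<Sum>i<length bs. \<iota> (c $ i) * bs ! i))"

text \<open>A fixed basis; another choice conjugates the regular representation below.\<close>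

definition ext_basis :: "('f::field \<Rightarrow> 'e::field) \<Rightarrow> 'e list" where
  "ext_basis \<iota> = (SOME bs. is_ext_basis \<iota> bs)"

definition ext_degree :: "('f::field \<Rightarrow> 'e::field) \<Rightarrow> nat" where
  "ext_degree \<iota> = length (ext_basis \<iota>)"

definition ext_coords :: "('f::field \<Rightarrow> 'e::field) \<Rightarrow> 'e \<Rightarrow> 'f vec" where
  "ext_coords \<iota> x = (THE c. c \<in> carrier_vec (ext_degree \<iota>) \<and>
     x = (\<Sum>i<ext_degree \<iota>. \<iota> (c $ i) * ext_basis \<iota> ! i))"

text \<open>The matrix of multiplication by \<open>x\<close>.\<close>

definition regular_rep :: "('f::field \<Rightarrow> 'e::field) \<Rightarrow> 'e \<Rightarrow> 'f mat" where
  "regular_rep \<iota> x = mat (ext_degree \<iota>) (ext_degree \<iota>)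
     (\<lambda>(i, j). ext_coords \<iota> (x * ext_basis \<iota> ! j) $ i)"

definition ext_norm :: "('f::field \<Rightarrow> 'e::field) \<Rightarrow> 'e \<Rightarrow> 'f" where
  "ext_norm \<iota> x = det (regular_rep \<iota> x)"

text \<open>The residue class of an integer \<open>x\<close> of a totally ramified extension, as an element of the
  residue field of the base: the coset of those \<open>u\<close> whose image is congruent to \<open>x\<close>.\<close>

definition residue :: "('f::field \<Rightarrow> int) \<Rightarrow> ('f \<Rightarrow> 'e::field) \<Rightarrow> 'e \<Rightarrow> 'f set" where
  "residue v \<iota> x = {u \<in> valuation_ring v.
     x - \<iota> u \<in> nonunits (integral_closure \<iota> (valuation_ring v))}"

text \<open>The valuation topology: the sets \<open>\<iota> c * \<O>\<close> with \<open>c\<close> non-zero in the base field form a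
  neighbourhood basis of \<open>0\<close>.\<close>

definition ext_topology :: "('f::field \<Rightarrow> int) \<Rightarrow> ('f \<Rightarrow> 'e::field) \<Rightarrow> 'e topology" where
  "ext_topology v \<iota> = topology (\<lambda>U. \<forall>x\<in>U. \<exists>c. c \<noteq> 0 \<and>
     (\<forall>y \<in> integral_closure \<iota> (valuation_ring v). x + \<iota> c * y \<in> U))"

section \<open>The group and its torus\<close>

definition G0 :: "('f::field \<Rightarrow> 'e2::field) \<Rightarrow> ('f \<Rightarrow> 'e4::field) \<Rightarrow> ('e2 mat \<times> 'e4) monoid" where
  "G0 \<iota>2 \<iota>4 =
     \<lparr>carrier = {(g2, g4). g2 \<in> carrier_mat 2 2 \<and> det g2 \<noteq> 0 \<and> g4 \<noteq> 0 \<and>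
        ext_norm \<iota>2 (det g2) * ext_norm \<iota>4 g4 = 1},
      monoid.mult = (\<lambda>(g2, g4) (h2, h4). (g2 * h2, g4 * h4)),
      one = (1\<^sub>m 2, 1)\<rparr>"

text \<open>The topology induced from the affine space \<open>M\<^sub>2(E\<^sub>2) \<times> E\<^sub>4\<close>.\<close>

definition G0_topology ::
  "('f::field \<Rightarrow> int) \<Rightarrow> ('f \<Rightarrow> 'e2::field) \<Rightarrow> ('f \<Rightarrow> 'e4::field) \<Rightarrow> ('e2 mat \<times> 'e4) topology" where
  "G0_topology v \<iota>2 \<iota>4 = pullback_topology (carrier (G0 \<iota>2 \<iota>4))
     (\<lambda>(g2, g4). (g2 $$ (0,0), g2 $$ (0,1), g2 $$ (1,0), g2 $$ (1,1), g4))
     (prod_topology (ext_topology v \<iota>2) (prod_topology (ext_topology v \<iota>2)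
       (prod_topology (ext_topology v \<iota>2) (prod_topology (ext_topology v \<iota>2)
         (ext_topology v \<iota>4)))))"

definition M0 :: "('f::field \<Rightarrow> 'e2::field) \<Rightarrow> ('f \<Rightarrow> 'e4::field) \<Rightarrow> ('e2 mat \<times> 'e4) set" where
  "M0 \<iota>2 \<iota>4 = {g \<in> carrier (G0 \<iota>2 \<iota>4). diagonal_mat (fst g)}"

text \<open>The normalizer of the torus is that of the algebraic group, so it is taken with respect to
  the points over an algebraic closure \<open>F\<^sup>a\<close> (the torus is smooth). These are described inside
  \<open>GL\<^sub>8(F\<^sup>a)\<close>, where \<open>G\<^sup>0\<close> is embedded by means of the chosen bases. First, the image of
  \<open>F\<^sup>a \<otimes>\<^sub>F E\<close> under the regular representation.\<close>

definition ext_closure_points :: "('f::field \<Rightarrow> 'e::field) \<Rightarrow> 'f alg_closure mat set" where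
  "ext_closure_points \<iota> =
     {mat (ext_degree \<iota>) (ext_degree \<iota>)
        (\<lambda>(i, j). \<Sum>k<ext_degree \<iota>. c k * to_ac (regular_rep \<iota> (ext_basis \<iota> ! k) $$ (i, j)))
      | c. True}"

definition block_diag_mat :: "'a::zero mat \<Rightarrow> 'a mat \<Rightarrow> 'a mat" where
  "block_diag_mat A B =
     four_block_mat A (0\<^sub>m (dim_row A) (dim_col B)) (0\<^sub>m (dim_row B) (dim_col A)) B"

definition M0_closure_points ::
  "('f::field \<Rightarrow> 'e2::field) \<Rightarrow> ('f \<Rightarrow> 'e4::field) \<Rightarrow> 'f alg_closure mat set" where
  "M0_closure_points \<iota>2 \<iota>4 =
     {A. \<exists>x \<in> ext_closure_points \<iota>2. \<exists>y \<in> ext_closure_points \<iota>2. \<exists>z \<in> ext_closure_points \<iota>4.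
        A = block_diag_mat (block_diag_mat x y) z \<and> det A = 1}"

definition GL8_embedding ::
  "('f::field \<Rightarrow> 'e2::field) \<Rightarrow> ('f \<Rightarrow> 'e4::field) \<Rightarrow> 'e2 mat \<times> 'e4 \<Rightarrow> 'f mat" where
  "GL8_embedding \<iota>2 \<iota>4 = (\<lambda>(g2, g4). block_diag_mat
     (four_block_mat (regular_rep \<iota>2 (g2 $$ (0,0))) (regular_rep \<iota>2 (g2 $$ (0,1)))
                     (regular_rep \<iota>2 (g2 $$ (1,0))) (regular_rep \<iota>2 (g2 $$ (1,1))))
     (regular_rep \<iota>4 g4))"

definition normalizer_M0 ::
  "('f::field \<Rightarrow> 'e2::field) \<Rightarrow> ('f \<Rightarrow> 'e4::field) \<Rightarrow> ('e2 mat \<times> 'e4) set" where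
  "normalizer_M0 \<iota>2 \<iota>4 = {g \<in> carrier (G0 \<iota>2 \<iota>4).
     (\<lambda>A. map_mat to_ac (GL8_embedding \<iota>2 \<iota>4 g) * A *
          map_mat to_ac (GL8_embedding \<iota>2 \<iota>4 (inv\<^bsub>G0 \<iota>2 \<iota>4\<^esub> g)))
       ` M0_closure_points \<iota>2 \<iota>4 = M0_closure_points \<iota>2 \<iota>4}"

section \<open>Compact open subgroups and characters\<close>

definition iwahori :: "'e::field set \<Rightarrow> 'e mat set" where
  "iwahori R = {g \<in> carrier_mat 2 2.
     g $$ (0,0) \<in> unit_elems R \<and> g $$ (0,1) \<in> R \<and>
     g $$ (1,0) \<in> nonunits R \<and> g $$ (1,1) \<in> unit_elems R}"

definition K_st ::
  "('f::field \<Rightarrow> int) \<Rightarrow> ('f \<Rightarrow> 'e2::field) \<Rightarrow> ('f \<Rightarrow> 'e4::field) \<Rightarrow> ('e2 mat \<times> 'e4) set" where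
  "K_st v \<iota>2 \<iota>4 =
     (iwahori (integral_closure \<iota>2 (valuation_ring v)) \<times>
      unit_elems (integral_closure \<iota>4 (valuation_ring v))) \<inter> carrier (G0 \<iota>2 \<iota>4)"

definition K_par ::
  "('f::field \<Rightarrow> int) \<Rightarrow> ('f \<Rightarrow> 'e2::field) \<Rightarrow> ('f \<Rightarrow> 'e4::field) \<Rightarrow> ('e2 mat \<times> 'e4) set" where
  "K_par v \<iota>2 \<iota>4 = {(g2, g4) \<in> K_st v \<iota>2 \<iota>4.
     residue v \<iota>2 (det g2) \<otimes>\<^bsub>residue_field v\<^esub> (residue v \<iota>4 g4 [^]\<^bsub>residue_field v\<^esub> (2::nat))
       = \<one>\<^bsub>residue_field v\<^esub>}"

definition rho0 :: "('f::field \<Rightarrow> complex) \<Rightarrow> ('f \<Rightarrow> 'e2::field) \<Rightarrow> 'e2 mat \<times> 'e4 \<Rightarrow> complex" where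
  "rho0 \<eta> \<iota>2 = (\<lambda>(g2, g4). \<eta> (ext_norm \<iota>2 (g2 $$ (1,1))))"

text \<open>On the torus, \<open>y\<close> is the lower right entry of \<open>diag(x, y)\<close>.\<close>

definition rhoM :: "('f::field \<Rightarrow> complex) \<Rightarrow> ('f \<Rightarrow> 'e2::field) \<Rightarrow> 'e2 mat \<times> 'e4 \<Rightarrow> complex" where
  "rhoM \<eta> \<iota>2 = (\<lambda>(g2, z). let y = g2 $$ (1,1) in \<eta> (ext_norm \<iota>2 y))"

text \<open>\<open>Nm\<close> is the set of rational points of the normalizer of the torus, \<open>KM\<close> a subgroup of the
  torus and \<open>\<rho>\<close> a character of \<open>KM\<close>.\<close>

definition stabilizer_rho :: "'g monoid \<Rightarrow> 'g set \<Rightarrow> 'g set \<Rightarrow> ('g \<Rightarrow> complex) \<Rightarrow> 'g set" where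
  "stabilizer_rho G Nm KM \<rho> = {n \<in> Nm.
     (\<lambda>k. n \<otimes>\<^bsub>G\<^esub> k \<otimes>\<^bsub>G\<^esub> inv\<^bsub>G\<^esub> n) ` KM = KM \<and>
     (\<forall>x\<in>KM. \<rho> (inv\<^bsub>G\<^esub> n \<otimes>\<^bsub>G\<^esub> x \<otimes>\<^bsub>G\<^esub> n) = \<rho> x)}"

section \<open>Hecke algebras, cocycles and twisted group algebras\<close>

text \<open>Functions on the group or on a quotient are extended by \<open>0\<close> outside its carrier. Algebras
  over the complex numbers are elements of the record type of modules, which has a multiplication.

  In the convolution, the summand does not depend on the representative \<open>h\<close> of the coset; only the finitely many
  cosets on which \<open>\<phi>\<close> does not vanish are summed over, because \<open>sum\<close> is \<open>0\<close> on infinite sets.\<close>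

definition hecke_conv ::
  "'g monoid \<Rightarrow> 'g set \<Rightarrow> ('g \<Rightarrow> complex) \<Rightarrow> ('g \<Rightarrow> complex) \<Rightarrow> 'g \<Rightarrow> complex" where
  "hecke_conv G K \<phi> \<psi> g = (if g \<in> carrier G
     then \<Sum>C \<in> {C \<in> lcosets\<^bsub>G\<^esub> K. \<exists>h\<in>C. \<phi> h \<noteq> 0}.
            let h = (SOME h. h \<in> C) in \<phi> h * \<psi> (inv\<^bsub>G\<^esub> h \<otimes>\<^bsub>G\<^esub> g)
     else 0)"

definition hecke_algebra ::
  "'g monoid \<Rightarrow> 'g topology \<Rightarrow> 'g set \<Rightarrow> ('g \<Rightarrow> complex) \<Rightarrow> (complex, 'g \<Rightarrow> complex) module" where
  "hecke_algebra G T K \<rho> =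
     \<lparr>carrier = {\<phi>. (\<forall>g. g \<notin> carrier G \<longrightarrow> \<phi> g = 0) \<and>
        compactin T (T closure_of {g. \<phi> g \<noteq> 0}) \<and>
        (\<forall>g\<in>carrier G. \<forall>k1\<in>K. \<forall>k2\<in>K. \<phi> (k1 \<otimes>\<^bsub>G\<^esub> g \<otimes>\<^bsub>G\<^esub> k2) = \<rho> k1 * \<phi> g * \<rho> k2)},
      monoid.mult = hecke_conv G K,
      one = (\<lambda>g. if g \<in> K then \<rho> g else 0),
      zero = (\<lambda>_. 0),
      add = (\<lambda>\<phi> \<psi> g. \<phi> g + \<psi> g),
      module.smult = (\<lambda>c \<phi> g. c * \<phi> g)\<rparr>"

text \<open>Elements of \<open>W = N / KM\<close> are the cosets themselves: \<open>m \<in> v\<close> means \<open>v = m KM\<close>.\<close>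

definition cocycle_of :: "'g monoid \<Rightarrow> ('g \<Rightarrow> complex) \<Rightarrow> 'g set \<Rightarrow> 'g set \<Rightarrow> complex" where
  "cocycle_of G T v w = (THE c. \<forall>m\<in>v. \<forall>n\<in>w. T m * T n = c * T (m \<otimes>\<^bsub>G\<^esub> n))"

definition two_cocycle :: "'w monoid \<Rightarrow> ('w \<Rightarrow> 'w \<Rightarrow> complex) \<Rightarrow> bool" where
  "two_cocycle W \<mu> \<longleftrightarrow>
     (\<forall>u\<in>carrier W. \<forall>v\<in>carrier W. \<mu> u v \<noteq> 0) \<and>
     (\<forall>u\<in>carrier W. \<forall>v\<in>carrier W. \<forall>w\<in>carrier W.
        \<mu> u v * \<mu> (u \<otimes>\<^bsub>W\<^esub> v) w = \<mu> u (v \<otimes>\<^bsub>W\<^esub> w) * \<mu> v w)"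

definition two_coboundary :: "'w monoid \<Rightarrow> ('w \<Rightarrow> 'w \<Rightarrow> complex) \<Rightarrow> bool" where
  "two_coboundary W \<mu> \<longleftrightarrow> (\<exists>f. (\<forall>w\<in>carrier W. f w \<noteq> 0) \<and>
     (\<forall>u\<in>carrier W. \<forall>v\<in>carrier W. \<mu> u v = f u * f v / f (u \<otimes>\<^bsub>W\<^esub> v)))"

text \<open>An element is its family of coefficients on the basis \<open>b\<^sub>w\<close>. As \<open>\<mu>\<close> need not be
  normalized, the unit is \<open>\<mu>(1,1)\<^sup>-\<^sup>1 b\<^sub>1\<close>.\<close>

definition twisted_group_algebra ::
  "'w monoid \<Rightarrow> ('w \<Rightarrow> 'w \<Rightarrow> complex) \<Rightarrow> (complex, 'w \<Rightarrow> complex) module" where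
  "twisted_group_algebra W \<mu> =
     \<lparr>carrier = {a. finite {w. a w \<noteq> 0} \<and> {w. a w \<noteq> 0} \<subseteq> carrier W},
      monoid.mult = (\<lambda>a b w. \<Sum>u \<in> {u. a u \<noteq> 0}. \<Sum>v \<in> {v. b v \<noteq> 0}.
                if u \<otimes>\<^bsub>W\<^esub> v = w then a u * b v * \<mu> u v else 0),
      one = (\<lambda>w. if w = \<one>\<^bsub>W\<^esub> then inverse (\<mu> \<one>\<^bsub>W\<^esub> \<one>\<^bsub>W\<^esub>) else 0),
      zero = (\<lambda>_. 0),
      add = (\<lambda>a b w. a w + b w),
      module.smult = (\<lambda>c a w. c * a w)\<rparr>"

definition algebra_iso :: "(complex, 'a) module \<Rightarrow> (complex, 'b) module \<Rightarrow> ('a \<Rightarrow> 'b) set" where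
  "algebra_iso A B = {\<Phi> \<in> ring_iso A B.
     \<forall>c. \<forall>x\<in>carrier A. \<Phi> (c \<odot>\<^bsub>A\<^esub> x) = c \<odot>\<^bsub>B\<^esub> \<Phi> x}"

end

theory Submission
  imports Defs "Jordan_Normal_Form.Char_Poly"
begin

text \<open>Each of the two extensions is generated by a root \<open>\<theta>\<close> of \<open>X\<^sup>n - D\<close> with \<open>v D = 1\<close>, and is totally
  ramified: the valuation of the norm is a valuation \<open>w\<close>, whose ring consists of the combinations of
  powers of \<open>\<theta>\<close> with integral coefficients, and \<open>N(x) \<equiv> a\<^sup>n\<close> if \<open>x \<equiv> a\<close> with \<open>a\<close> in the base field.
  Hence \<open>\<eta> \<circ> N\<close> takes the values \<open>\<plusminus>1\<close> on the units of \<open>E\<^sub>2\<close> and is trivial on those of \<open>E\<^sub>4\<close>, so that \<open>\<rho>\<close>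
  does not change if the two diagonal entries are exchanged, and \<open>N(\<rho>)\<close> is the group of all monomial
  elements.

  By the Bruhat decomposition \<open>G = K N K\<close>, a function in the Hecke algebra is determined by its values on
  \<open>N\<close>. Write \<open>X(s)\<close> for the elements of a root subgroup. The left cosets in \<open>K m K\<close> are represented by
  elements \<open>X(s) m\<close>, so that the convolution at \<open>n\<close> is a sum of values \<open>\<psi>(m\<^sup>-\<^sup>1 X(-s) n)\<close>. Either \<open>X(-s)\<close> can be
  absorbed on the right, and the value is \<open>\<psi>(m\<^sup>-\<^sup>1 n)\<close>, or by a computation in \<open>SL\<^sub>2\<close> it can be replaced by a
  monomial matrix with entries \<open>-s\<close> and \<open>s\<^sup>-\<^sup>1\<close>. In the second case multiplication of \<open>s\<close> by \<open>\<zeta>\<close> multiplies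
  the value by \<open>\<eta>(\<zeta>\<^sup>-\<^sup>2) = -1\<close>, and these values cancel. After normalization by the square root of the number
  of cosets, the restriction of functions to \<open>N\<close>, divided by \<open>T\<close>, is therefore an isomorphism onto the
  twisted group algebra.

  The elements with matrices \<open>(0, 1; -1, 0)\<close> and \<open>diag(\<zeta>\<theta>\<^sub>2, \<theta>\<^sub>2)\<close>, and second components \<open>1\<close> and \<open>\<theta>\<^sub>4\<^sup>-\<^sup>2\<close>, commute
  in \<open>W\<close>, but \<open>\<rho>\<close> is \<open>-1\<close> on their commutator. A coboundary is symmetric on commuting pairs, so the
  cocycle is not a coboundary.\<close>

section \<open>The base field\<close>

text \<open>Everything rests on one number, \<open>\<eta> (\<zeta> ^ 2) = -1\<close>. Because of it
  the affine reflections satisfy quadratic relations without a linear term, so that no affine Hecke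
  algebra appears and, after rescaling, only the projective multiplication of W remains. The same
  number is the value of \<rho> on the commutator that detects the cocycle. The obstacle there is
  the norm equation. Norms of units of E4 are congruent to fourth powers, so diag(\<theta>2,
  \<theta>2) has no partner of the form unit times \<open>\<theta>4 powi (-2)\<close>: since
  N(\<theta>2) = \<pi> but N(\<theta>4) = \<zeta> \<pi>, the quotient of the two diagonal entries is
  forced to be a nonsquare in the residue field (-1 is a square because 4 divides q - 1, so \<zeta>
  and -\<zeta> are both nonsquares). This is where the factor \<zeta> in the equation of E4 matters.
  Divisibility of q - 1 by 4 also puts all roots of that equation into the field generated by one of
  them.\<close>

definition val_ring :: "('f::field \<Rightarrow> int) \<Rightarrow> 'f ring" where
  "val_ring v = \<lparr>carrier = valuation_ring v, monoid.mult = (*), one = 1, zero = 0, add = (+)\<rparr>"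

lemma val_ring_simps [simp]:
  "carrier (val_ring v) = valuation_ring v" "x \<otimes>\<^bsub>val_ring v\<^esub> y = x * y" "\<one>\<^bsub>val_ring v\<^esub> = 1"
  "\<zero>\<^bsub>val_ring v\<^esub> = 0" "x \<oplus>\<^bsub>val_ring v\<^esub> y = x + y"
  by (simp_all add: val_ring_def)

text \<open>No uniformizer and no completeness are demanded, so that the same facts serve
  \<open>v\<close> on the base field and, once it is known to be a valuation, \<open>w\<close> on
  each extension.\<close>

locale valued_field =
  fixes v :: "'f::field \<Rightarrow> int"
  assumes v_mult: "x \<noteq> 0 \<Longrightarrow> y \<noteq> 0 \<Longrightarrow> v (x * y) = v x + v y"
    and v_add: "x \<noteq> 0 \<Longrightarrow> y \<noteq> 0 \<Longrightarrow> x + y \<noteq> 0 \<Longrightarrow> min (v x) (v y) \<le> v (x + y)"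
begin

lemma v_1 [simp]: "v 1 = 0"
  using v_mult[of 1 1] by simp

lemma v_uminus [simp]: "v (- x) = v x"
proof (cases "x = 0")
  case False
  have "v (-1) = 0" using v_mult[of "-1" "-1"] by simp
  then show ?thesis using v_mult[of "-1" x] False by simp
qed simp

lemma v_inverse: "x \<noteq> 0 \<Longrightarrow> v (inverse x) = - v x"
  using v_mult[of x "inverse x"] by simp

lemma v_divide: "x \<noteq> 0 \<Longrightarrow> y \<noteq> 0 \<Longrightarrow> v (x / y) = v x - v y"
  by (simp add: divide_inverse v_mult v_inverse)

lemma v_power: "x \<noteq> 0 \<Longrightarrow> v (x ^ n) = int n * v x"
  by (induction n) (auto simp: v_mult algebra_simps)

lemma v_powi: "x \<noteq> 0 \<Longrightarrow> v (x powi n) = n * v x"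
  by (cases "n \<ge> 0") (auto simp: power_int_def v_power v_inverse)

lemma val_ge_0 [simp]: "val_ge v 0 k"
  by (simp add: val_ge_def)

lemma val_ge_add: "val_ge v x k \<Longrightarrow> val_ge v y k \<Longrightarrow> val_ge v (x + y) k"
  using v_add[of x y] by (cases "x = 0"; cases "y = 0"; cases "x + y = 0") (auto simp: val_ge_def)

lemma val_ge_uminus [simp]: "val_ge v (- x) k = val_ge v x k"
  by (auto simp: val_ge_def)

lemma val_ge_diff: "val_ge v x k \<Longrightarrow> val_ge v y k \<Longrightarrow> val_ge v (x - y) k"
  using val_ge_add[of x k "- y"] by simp

lemma val_ge_minus_commute: "val_ge v (x - y) k \<longleftrightarrow> val_ge v (y - x) k"
  using val_ge_uminus[of "x - y" k] by simp

lemma val_ge_mult: "val_ge v x k \<Longrightarrow> val_ge v y l \<Longrightarrow> val_ge v (x * y) (k + l)"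
  by (cases "x = 0"; cases "y = 0") (auto simp: val_ge_def v_mult)

lemma val_ge_mono: "val_ge v x k \<Longrightarrow> l \<le> k \<Longrightarrow> val_ge v x l"
  by (auto simp: val_ge_def)

lemma val_ge_mult_0: "val_ge v x 0 \<Longrightarrow> val_ge v y l \<Longrightarrow> val_ge v (x * y) l"
  using val_ge_mult[of x 0 y l] by simp

lemma val_ge_divide_unit: "y \<noteq> 0 \<Longrightarrow> v y = 0 \<Longrightarrow> val_ge v (x / y) k \<longleftrightarrow> val_ge v x k"
  by (cases "x = 0") (auto simp: val_ge_def v_divide)

lemma val_ge_sum: "(\<And>i. i \<in> I \<Longrightarrow> val_ge v (f i) k) \<Longrightarrow> val_ge v (sum f I) k"
  by (induction I rule: infinite_finite_induct) (auto intro: val_ge_add)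

lemma val_ge_prod: "(\<And>i. i \<in> I \<Longrightarrow> val_ge v (f i) 0) \<Longrightarrow> val_ge v (prod f I) 0"
  by (induction I rule: infinite_finite_induct) (auto intro: val_ge_mult_0 simp: val_ge_def[of _ 1])

lemma val_ge_1: "val_ge v 1 k \<longleftrightarrow> k \<le> 0"
  by (simp add: val_ge_def)

lemma val_ge_power: "val_ge v x 0 \<Longrightarrow> val_ge v (x ^ n) 0"
  by (induction n) (auto intro: val_ge_mult_0 simp: val_ge_1)

lemma val_ge_of_nat: "val_ge v (of_nat n) 0"
  by (induction n) (auto intro: val_ge_add simp: val_ge_1)

lemma unit_elems_valuation_ring: "unit_elems (valuation_ring v) = {x. x \<noteq> 0 \<and> v x = 0}"
  by (auto simp: unit_elems_def valuation_ring_def val_ge_def v_inverse)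

lemma nonunits_valuation_ring: "nonunits (valuation_ring v) = {x. val_ge v x 1}"
  unfolding nonunits_def unit_elems_valuation_ring by (auto simp: valuation_ring_def val_ge_def)

text \<open>In an ultrametric field a perturbation smaller than \<open>x\<close> cannot change its
  size. This is how units are recognized from their residues.\<close>

lemma val_eq_of_close: "x \<noteq> 0 \<Longrightarrow> val_ge v (x - y) (v x + 1) \<Longrightarrow> y \<noteq> 0 \<and> v y = v x"
proof -
  assume x: "x \<noteq> 0" and c: "val_ge v (x - y) (v x + 1)"
  have y: "y \<noteq> 0" using c x by (auto simp: val_ge_def)
  have "v y \<ge> v x"
  proof -
    have "val_ge v (x - (x - y)) (v x)" using c by (rule_tac val_ge_diff) (auto simp: val_ge_def)
    then show ?thesis using y by (simp add: val_ge_def)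
  qed
  moreover have "v y \<le> v x"
  proof (rule ccontr)
    assume "\<not> v y \<le> v x"
    then have "val_ge v (y + (x - y)) (v x + 1)" using c
      by (intro val_ge_add) (simp_all add: val_ge_def y)
    then show False using x by (simp add: val_ge_def)
  qed
  ultimately show ?thesis using y by simp
qed

lemma val_ring_cring: "cring (val_ring v)"
proof (rule cringI)
  show "abelian_group (val_ring v)"
    by (rule abelian_groupI)
       (auto simp: valuation_ring_def val_ge_add add.commute add.left_commute
             intro!: exI[of _ "- _"] bexI[of _ "- _"])
  show "comm_monoid (val_ring v)"
    by (rule comm_monoidI) (auto simp: valuation_ring_def val_ge_mult_0 val_ge_1 ac_simps)
qed (auto simp: algebra_simps)

lemma val_ring_a_inv: "x \<in> valuation_ring v \<Longrightarrow> \<ominus>\<^bsub>val_ring v\<^esub> x = - x"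
proof -
  interpret cring "val_ring v" by (rule val_ring_cring)
  assume "x \<in> valuation_ring v"
  then show ?thesis by (intro minus_equality) (auto simp: valuation_ring_def)
qed

lemma nonunits_ideal: "ideal (nonunits (valuation_ring v)) (val_ring v)"
proof -
  interpret cring "val_ring v" by (rule val_ring_cring)
  show ?thesis
  proof (rule idealI)
    show "ring (val_ring v)" by (rule ring_axioms)
    show "subgroup (nonunits (valuation_ring v)) (add_monoid (val_ring v))"
    proof (rule add.subgroupI)
      show "nonunits (valuation_ring v) \<subseteq> carrier (val_ring v)"
        by (auto simp: nonunits_def)
      show "nonunits (valuation_ring v) \<noteq> {}"
        by (auto simp: nonunits_valuation_ring intro: exI[of _ 0])
    next
      fix a assume a: "a \<in> nonunits (valuation_ring v)"
      then have "a \<in> valuation_ring v" by (auto simp: nonunits_def)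
      with a show "\<ominus>\<^bsub>val_ring v\<^esub> a \<in> nonunits (valuation_ring v)"
        by (simp only: val_ring_a_inv nonunits_valuation_ring mem_Collect_eq val_ge_uminus)
    qed (auto simp: nonunits_valuation_ring val_ge_add)
  next
    fix a x assume "a \<in> nonunits (valuation_ring v)" "x \<in> carrier (val_ring v)"
    then have *: "val_ge v a 1" "val_ge v x 0"
      by (simp_all only: nonunits_valuation_ring val_ring_simps mem_Collect_eq) (simp add: valuation_ring_def)
    show "x \<otimes>\<^bsub>val_ring v\<^esub> a \<in> nonunits (valuation_ring v)"
      using val_ge_mult[OF *(2) *(1)] by (simp add: nonunits_valuation_ring)
    show "a \<otimes>\<^bsub>val_ring v\<^esub> x \<in> nonunits (valuation_ring v)"
      using val_ge_mult[OF *(1) *(2)] by (simp add: nonunits_valuation_ring)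
  qed
qed

text \<open>No integrality is demanded of \<open>u\<close>: when \<open>a\<close> is integral, every
  \<open>u\<close> congruent to it is integral too, so this is its coset of the maximal
  ideal.\<close>

definition res_class :: "'f \<Rightarrow> 'f set" where
  "res_class a = {u. val_ge v (a - u) 1}"

lemma res_class_coset: "nonunits (valuation_ring v) +>\<^bsub>val_ring v\<^esub> a = res_class a"
proof -
  have "u \<in> (\<Union>h\<in>nonunits (valuation_ring v). {h + a}) \<longleftrightarrow> u \<in> res_class a" for u
    by (auto simp: nonunits_valuation_ring res_class_def val_ge_minus_commute[of a] intro: bexI[of _ "u - a"])
  then show ?thesis by (auto simp: a_r_coset_def' )
qed

lemma res_class_eq_iff: "res_class a = res_class b \<longleftrightarrow> val_ge v (a - b) 1"
proof
  assume "res_class a = res_class b"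
  moreover have "b \<in> res_class b" by (simp add: res_class_def)
  ultimately have "b \<in> res_class a" by simp
  then show "val_ge v (a - b) 1" by (simp add: res_class_def)
next
  assume *: "val_ge v (a - b) 1"
  have "val_ge v (a - u) 1 \<longleftrightarrow> val_ge v (b - u) 1" for u
    using val_ge_diff[of "a - u" 1 "a - b"] val_ge_add[of "b - u" 1 "a - b"] * by auto
  then show "res_class a = res_class b" by (simp add: res_class_def)
qed

lemma residue_field_eq: "residue_field v = val_ring v Quot nonunits (valuation_ring v)"
  by (simp add: residue_field_def val_ring_def)

lemma carrier_residue_field: "carrier (residue_field v) = res_class ` valuation_ring v"
  by (auto simp: residue_field_eq FactRing_def A_RCOSETS_def' res_class_coset)

lemma residue_field_ring: "ring (residue_field v)"
  unfolding residue_field_eq by (rule ideal.quotient_is_ring[OF nonunits_ideal])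

lemma one_residue_field: "\<one>\<^bsub>residue_field v\<^esub> = res_class 1"
  by (simp add: residue_field_eq FactRing_def res_class_coset)

lemma zero_residue_field: "\<zero>\<^bsub>residue_field v\<^esub> = res_class 0"
  by (auto simp: residue_field_eq FactRing_def nonunits_valuation_ring res_class_def)

lemma mult_residue_field:
  assumes "a \<in> valuation_ring v" "b \<in> valuation_ring v"
  shows "res_class a \<otimes>\<^bsub>residue_field v\<^esub> res_class b = res_class (a * b)"
  using ideal.rcoset_mult_add[OF nonunits_ideal, of a b] assms
  by (simp add: residue_field_eq FactRing_def res_class_coset)

lemma add_residue_field:
  assumes "a \<in> valuation_ring v" "b \<in> valuation_ring v"
  shows "res_class a \<oplus>\<^bsub>residue_field v\<^esub> res_class b = res_class (a + b)"
proof -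
  interpret cring "val_ring v" by (rule val_ring_cring)
  interpret abelian_subgroup "nonunits (valuation_ring v)" "val_ring v"
    by (rule abelian_subgroupI3[OF ideal.axioms(1)[OF nonunits_ideal] abelian_group_axioms])
  show ?thesis using a_rcos_sum[of a b] assms
    by (simp add: residue_field_eq FactRing_def res_class_coset)
qed

lemma pow_residue_field:
  assumes "a \<in> valuation_ring v"
  shows "res_class a [^]\<^bsub>residue_field v\<^esub> (k::nat) = res_class (a ^ k)"
proof (induction k)
  case 0
  then show ?case by (simp add: one_residue_field)
next
  case (Suc k)
  have "a ^ k \<in> valuation_ring v" using assms by (auto simp: valuation_ring_def val_ge_power)
  then show ?case using Suc assms by (simp add: mult_residue_field mult.commute)
qed

text \<open>Lagrange's theorem in the additive group of the residue field: \<open>q\<close> times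
  the class of 1 is zero. It serves to separate roots of unity in
  \<open>root_of_unity_near_1\<close>.\<close>

lemma card_residue_field_in_nonunits: "val_ge v (of_nat (card (carrier (residue_field v)))) 1"
proof -
  interpret R: ring "residue_field v" by (rule residue_field_ring)
  have 1: "res_class 1 \<in> carrier (residue_field v)"
    by (auto simp: carrier_residue_field valuation_ring_def val_ge_1)
  have *: "[k] \<cdot>\<^bsub>residue_field v\<^esub> res_class 1 = res_class (of_nat k)" for k :: nat
  proof (induction k)
    case 0
    then show ?case by (simp add: zero_residue_field)
  next
    case (Suc k)
    then show ?case
      by (simp add: add_residue_field valuation_ring_def val_ge_of_nat val_ge_1 add.commute)
  qed
  have "[card (carrier (residue_field v))] \<cdot>\<^bsub>residue_field v\<^esub> res_class 1 = \<zero>\<^bsub>residue_field v\<^esub>"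
    using R.add.pow_order_eq_1[of "res_class 1"] 1 by (simp add: Coset.order_def add_pow_def)
  then show ?thesis by (simp add: * zero_residue_field res_class_eq_iff)
qed

end

section \<open>Congruences between products and between determinants over the valuation ring\<close>

lemma (in valued_field) prod_cong_val:
  assumes "finite I" "\<And>i. i \<in> I \<Longrightarrow> val_ge v (f i) 0" "\<And>i. i \<in> I \<Longrightarrow> val_ge v (g i) 0"
    and "\<And>i. i \<in> I \<Longrightarrow> val_ge v (f i - g i) k"
  shows "val_ge v (prod f I - prod g I) k"
  using assms
proof (induction I rule: finite_induct)
  case (insert i I)
  have "prod f (insert i I) - prod g (insert i I) = (f i - g i) * prod f I + g i * (prod f I - prod g I)"
    using insert.hyps by (simp add: algebra_simps)
  moreover have "val_ge v ((f i - g i) * prod f I) k"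
    using val_ge_mult_0[OF val_ge_prod[of I f], of "f i - g i" k] insert.prems by (simp add: mult.commute)
  moreover have "val_ge v (g i * (prod f I - prod g I)) k"
    using val_ge_mult_0[of "g i" "prod f I - prod g I" k] insert by simp
  ultimately show ?case by (simp add: val_ge_add)
qed simp

text \<open>By the Leibniz formula a determinant is a signed sum of products of integral entries,
  and congruent factors give congruent products. The congruences for norms come from here.\<close>

lemma (in valued_field) det_cong_val:
  assumes A: "A \<in> carrier_mat n n" and B: "B \<in> carrier_mat n n"
    and "\<And>i j. i < n \<Longrightarrow> j < n \<Longrightarrow> val_ge v (A $$ (i,j)) 0"
    and "\<And>i j. i < n \<Longrightarrow> j < n \<Longrightarrow> val_ge v (B $$ (i,j)) 0"
    and "\<And>i j. i < n \<Longrightarrow> j < n \<Longrightarrow> val_ge v (A $$ (i,j) - B $$ (i,j)) k"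
  shows "val_ge v (det A - det B) k"
proof -
  have "det A - det B = (\<Sum>p\<in>{p. p permutes {0..<n}}. signof p *
      ((\<Prod>i = 0..<n. A $$ (i, p i)) - (\<Prod>i = 0..<n. B $$ (i, p i))))"
    by (simp add: det_def'[OF A] det_def'[OF B] sum_subtractf right_diff_distrib)
  moreover have "val_ge v (signof p *
      ((\<Prod>i = 0..<n. A $$ (i, p i)) - (\<Prod>i = 0..<n. B $$ (i, p i)))) k"
    if "p permutes {0..<n}" for p
  proof -
    have "val_ge v ((\<Prod>i = 0..<n. A $$ (i, p i)) - (\<Prod>i = 0..<n. B $$ (i, p i))) k"
      using that assms by (intro prod_cong_val) (auto simp: permutes_in_image[of p "{0..<n}", simplified])
    then show ?thesis by (simp add: sign_def val_ge_minus_commute)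
  qed
  ultimately show ?thesis by (auto intro: val_ge_sum)
qed

lemma (in valued_field) det_integral:
  assumes A: "A \<in> carrier_mat n n" and "\<And>i j. i < n \<Longrightarrow> j < n \<Longrightarrow> val_ge v (A $$ (i,j)) 0"
  shows "val_ge v (det A) 0"
\<comment> \<open>The empty matrix is separated because its determinant is 1; for positive
  \<open>n\<close> the comparison is with the zero matrix.\<close>
proof (cases "n = 0")
  case True
  then show ?thesis using A by (simp add: det_def val_ge_1)
next
  case False
  then show ?thesis using det_cong_val[OF A, of "0\<^sub>m n n" 0] assms by simp
qed

section \<open>Bases, the regular representation and the norm\<close>

locale field_embedding =
  fixes \<iota> :: "'f::field \<Rightarrow> 'e::field"
  assumes hom: "field_hom \<iota>"
begin

sublocale field_hom \<iota> by (rule hom)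

text \<open>Columns are read as coordinate vectors. Since \<open>A\<close> may be rectangular,
  transition matrices between lists of a priori different lengths and multiplication matrices obey
  the same rule \<open>comb_mult\<close>.\<close>

definition comb :: "'e list \<Rightarrow> 'f mat \<Rightarrow> nat \<Rightarrow> 'e" where
  "comb bs A j = (\<Sum>i<length bs. \<iota> (A $$ (i,j)) * bs ! i)"

definition mat_rep :: "'e list \<Rightarrow> 'e \<Rightarrow> 'f mat \<Rightarrow> bool" where
  "mat_rep bs x A \<longleftrightarrow> A \<in> carrier_mat (length bs) (length bs) \<and>
     (\<forall>j<length bs. x * bs ! j = comb bs A j)"

lemma hom_simps [simp]:
  "\<iota> 0 = 0" "\<iota> 1 = 1" "\<iota> (x + y) = \<iota> x + \<iota> y" "\<iota> (x * y) = \<iota> x * \<iota> y" "\<iota> (x - y) = \<iota> x - \<iota> y"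
  "\<iota> (- x) = - \<iota> x" "\<iota> (inverse x) = inverse (\<iota> x)" "\<iota> (x / y) = \<iota> x / \<iota> y" "\<iota> (x ^ n) = \<iota> x ^ n"
  "\<iota> x = \<iota> y \<longleftrightarrow> x = y" "\<iota> x = 0 \<longleftrightarrow> x = 0" "\<iota> (sum f I) = (\<Sum>i\<in>I. \<iota> (f i))"
  by (auto simp: hom_distribs)

lemma comb_mult:
  assumes "A \<in> carrier_mat (length bs) m" "B \<in> carrier_mat m k" "j < k"
  shows "comb bs (A * B) j = (\<Sum>l<m. \<iota> (B $$ (l,j)) * comb bs A l)"
proof -
  have "comb bs (A * B) j = (\<Sum>i<length bs. \<Sum>l<m. \<iota> (A $$ (i,l)) * \<iota> (B $$ (l,j)) * bs ! i)"
    using assms by (auto simp: comb_def scalar_prod_def sum_distrib_right atLeast0LessThan intro!: sum.cong)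
  also have "\<dots> = (\<Sum>l<m. \<Sum>i<length bs. \<iota> (A $$ (i,l)) * \<iota> (B $$ (l,j)) * bs ! i)"
    by (rule sum.swap)
  finally show ?thesis by (simp add: comb_def sum_distrib_left mult_ac)
qed

lemma comb_one: "j < length bs \<Longrightarrow> comb bs (1\<^sub>m (length bs)) j = bs ! j"
  by (simp add: comb_def if_distrib[of \<iota>] if_distrib[of "\<lambda>x. x * _"] sum.delta cong: if_cong)

lemma comb_eqD:
  assumes bs: "is_ext_basis \<iota> bs" and A: "A \<in> carrier_mat (length bs) m" and B: "B \<in> carrier_mat (length bs) m"
    and eq: "\<And>j. j < m \<Longrightarrow> comb bs A j = comb bs B j"
  shows "A = B"
proof (rule eq_matI)
  fix i j assume "i < dim_row B" "j < dim_col B"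
  with B have ij: "i < length bs" "j < m" by auto
  have "col A j \<in> carrier_vec (length bs)" "col B j \<in> carrier_vec (length bs)"
    using A B by (simp_all add: carrier_vecI)
  moreover have "comb bs A j = (\<Sum>i<length bs. \<iota> (col A j $ i) * bs ! i)"
    "comb bs A j = (\<Sum>i<length bs. \<iota> (col B j $ i) * bs ! i)"
    unfolding eq[OF ij(2)] using A B ij by (auto simp: comb_def eq[OF ij(2), unfolded comb_def] intro!: sum.cong)
  ultimately have "col A j = col B j" using bs unfolding is_ext_basis_def by blast
  then show "A $$ (i,j) = B $$ (i,j)" using A B ij by (metis carrier_matD index_col)
qed (use A B in auto)

lemma ex_comb:
  assumes bs: "is_ext_basis \<iota> bs"
  obtains P where "P \<in> carrier_mat (length bs) m" "\<And>j. j < m \<Longrightarrow> comb bs P j = c j"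
proof -
  have "\<exists>u. u \<in> carrier_vec (length bs) \<and> x = (\<Sum>i<length bs. \<iota> (u $ i) * bs ! i)" for x
    using bs unfolding is_ext_basis_def by blast
  then obtain u where u: "\<And>x. u x \<in> carrier_vec (length bs)"
    "\<And>x. x = (\<Sum>i<length bs. \<iota> (vec_index (u x) i) * bs ! i)" by metis
  show ?thesis
  proof (rule that[of "mat (length bs) m (\<lambda>(i,j). vec_index (u (c j)) i)"])
    fix j assume "j < m"
    then show "comb bs (mat (length bs) m (\<lambda>(i,j). vec_index (u (c j)) i)) j = c j"
      using u(2)[of "c j", symmetric] by (simp add: comb_def)
  qed auto
qed

lemma mat_rep_unique: "is_ext_basis \<iota> bs \<Longrightarrow> mat_rep bs x A \<Longrightarrow> mat_rep bs x B \<Longrightarrow> A = B"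
  by (rule comb_eqD) (auto simp: mat_rep_def)

lemma mat_rep_mult:
  assumes "mat_rep bs x A" "mat_rep bs y B"
  shows "mat_rep bs (x * y) (A * B)"
  unfolding mat_rep_def
proof (intro conjI allI impI)
  fix j assume j: "j < length bs"
  have "comb bs (A * B) j = (\<Sum>l<length bs. \<iota> (B $$ (l,j)) * comb bs A l)"
    using assms j by (intro comb_mult) (auto simp: mat_rep_def)
  also have "\<dots> = (\<Sum>l<length bs. \<iota> (B $$ (l,j)) * (x * bs ! l))"
    using assms by (auto simp: mat_rep_def intro!: sum.cong)
  also have "\<dots> = x * comb bs B j"
    by (simp add: comb_def sum_distrib_left mult_ac)
  also have "\<dots> = x * y * bs ! j" using assms j by (simp add: mat_rep_def flip: mult.assoc)
  finally show "x * y * bs ! j = comb bs (A * B) j" by simp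
qed (use assms in \<open>auto simp: mat_rep_def\<close>)

lemma mat_rep_add:
  assumes "mat_rep bs x A" "mat_rep bs y B"
  shows "mat_rep bs (x + y) (A + B)"
  using assms by (auto simp: mat_rep_def comb_def distrib_right sum.distrib[symmetric] intro!: sum.cong)

lemma mat_rep_smult:
  assumes "mat_rep bs x A"
  shows "mat_rep bs (\<iota> a * x) (a \<cdot>\<^sub>m A)"
  using assms by (auto simp: mat_rep_def comb_def sum_distrib_left mult.assoc intro!: sum.cong)

lemma mat_rep_one: "mat_rep bs 1 (1\<^sub>m (length bs))"
  by (simp add: mat_rep_def comb_one)

lemma mat_rep_zero: "mat_rep bs 0 (0\<^sub>m (length bs) (length bs))"
  by (simp add: mat_rep_def comb_def)

end

text \<open>Padding both factors with zeros to square matrices does not change the product. If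
  \<open>m < n\<close>, the padded \<open>B\<close> has a zero row and so determinant 0, which
  cannot divide 1.\<close>

lemma rectangular_inverse_square:
  fixes A :: "'a::field mat"
  assumes A: "A \<in> carrier_mat n m" and B: "B \<in> carrier_mat m n" and AB: "A * B = 1\<^sub>m n"
  shows "n \<le> m"
proof (rule ccontr)
  assume "\<not> n \<le> m"
  then have m: "m < n" by simp
  define A' where "A' = mat n n (\<lambda>(i,j). if j < m then A $$ (i,j) else 0)"
  define B' where "B' = mat n n (\<lambda>(i,j). if i < m then B $$ (i,j) else 0)"
  have c: "A' \<in> carrier_mat n n" "B' \<in> carrier_mat n n" by (auto simp: A'_def B'_def)
  have "A' * B' = 1\<^sub>m n"
  proof (rule eq_matI)
    fix i j assume "i < dim_row (1\<^sub>m n :: 'a mat)" "j < dim_col (1\<^sub>m n :: 'a mat)"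
    then have ij: "i < n" "j < n" by auto
    have "(A' * B') $$ (i,j) = (\<Sum>k<n. A' $$ (i,k) * B' $$ (k,j))"
      using ij c by (simp add: scalar_prod_def atLeast0LessThan)
    also have "\<dots> = (\<Sum>k<m. A' $$ (i,k) * B' $$ (k,j))"
      using m ij by (intro sum.mono_neutral_right) (auto simp: A'_def)
    also have "\<dots> = (\<Sum>k<m. A $$ (i,k) * B $$ (k,j))"
      using m ij by (intro sum.cong) (auto simp: A'_def B'_def)
    also have "\<dots> = (A * B) $$ (i,j)" using ij A B by (simp add: scalar_prod_def atLeast0LessThan)
    finally show "(A' * B') $$ (i,j) = 1\<^sub>m n $$ (i,j)" using AB by simp
  qed (use c in auto)
  then have "det A' * det B' = 1" using det_mult[OF c] by simp
  moreover have "det B' = 0"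
  proof -
    have "(\<Prod>i = 0..<n. B' $$ (i, p i)) = 0" if "p permutes {0..<n}" for p
      using m permutes_in_image[OF that, of m] by (intro prod_zero bexI[of _ m]) (auto simp: B'_def)
    then show ?thesis unfolding det_def'[OF c(2)] by (intro sum.neutral) simp
  qed
  ultimately show False by simp
qed

text \<open>\<open>ext_basis\<close> is an arbitrary choice, but norms have to be computed in the
  basis of powers of \<open>\<theta>\<close>. The transition matrix \<open>P\<close> is invertible
  by uniqueness of coordinates and satisfies \<open>A * P = P * B\<close>.\<close>

lemma (in field_embedding) mat_rep_change_basis:
  assumes bs: "is_ext_basis \<iota> bs" and cs: "is_ext_basis \<iota> cs"
    and A: "mat_rep bs x A" and B: "mat_rep cs x B"
  shows "det A = det B" "length bs = length cs"
proof -
  obtain P where P: "P \<in> carrier_mat (length bs) (length cs)" "\<And>j. j < length cs \<Longrightarrow> comb bs P j = cs ! j"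
    using ex_comb[OF bs] by metis
  obtain Q where Q: "Q \<in> carrier_mat (length cs) (length bs)" "\<And>j. j < length bs \<Longrightarrow> comb cs Q j = bs ! j"
    using ex_comb[OF cs] by metis
  have "comb bs (P * Q) j = comb bs (1\<^sub>m (length bs)) j" if j: "j < length bs" for j
    using j Q(2)[OF j] by (simp add: comb_mult[OF P(1) Q(1) j] P(2) comb_one) (simp add: comb_def)
  then have PQ: "P * Q = 1\<^sub>m (length bs)" by (intro comb_eqD[OF bs]) (use P Q in auto)
  have "comb cs (Q * P) j = comb cs (1\<^sub>m (length cs)) j" if j: "j < length cs" for j
    using j P(2)[OF j] by (simp add: comb_mult[OF Q(1) P(1) j] Q(2) comb_one) (simp add: comb_def)
  then have QP: "Q * P = 1\<^sub>m (length cs)" by (intro comb_eqD[OF cs]) (use P Q in auto)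
  show len: "length bs = length cs"
    using rectangular_inverse_square[OF P(1) Q(1) PQ] rectangular_inverse_square[OF Q(1) P(1) QP] by simp
  have Ac: "A \<in> carrier_mat (length bs) (length bs)" and Bc: "B \<in> carrier_mat (length cs) (length cs)"
    using A B by (auto simp: mat_rep_def)
  have "comb bs (A * P) j = comb bs (P * B) j" if j: "j < length cs" for j
  proof -
    have "comb bs (A * P) j = (\<Sum>l<length bs. \<iota> (P $$ (l,j)) * (x * bs ! l))"
      unfolding comb_mult[OF Ac P(1) j] using A by (auto simp: mat_rep_def intro!: sum.cong)
    also have "\<dots> = x * comb bs P j" by (simp add: comb_def sum_distrib_left mult_ac)
    also have "\<dots> = comb bs (P * B) j"
    proof -
      have "comb bs (P * B) j = (\<Sum>l<length cs. \<iota> (B $$ (l,j)) * cs ! l)"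
        unfolding comb_mult[OF P(1) Bc j] by (simp add: P(2))
      then show ?thesis using B j P(2)[OF j] by (simp add: mat_rep_def comb_def[of cs])
    qed
    finally show ?thesis .
  qed
  then have "A * P = P * B" by (intro comb_eqD[OF bs]) (use P Ac Bc in auto)
  then have "A * P * Q = P * B * Q" by simp
  then have "A = P * B * Q" using assoc_mult_mat[OF Ac P(1) Q(1)] Ac by (simp add: PQ)
  then have "det A = det P * det B * det Q" using P Q Bc len by (simp add: det_mult[of _ "length cs"])
  moreover have "det P * det Q = 1"
    using det_mult[of P "length cs" Q] P Q len PQ by simp
  ultimately show "det A = det B" by (simp add: mult_ac)
qed

locale finite_extension = field_embedding \<iota> for \<iota> :: "'f::field \<Rightarrow> 'e::field" +
  assumes has_basis: "\<exists>bs. is_ext_basis \<iota> bs"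
begin

lemma ext_basis: "is_ext_basis \<iota> (ext_basis \<iota>)"
  unfolding ext_basis_def using has_basis by (rule someI_ex)

lemma ext_coords:
  "ext_coords \<iota> x \<in> carrier_vec (ext_degree \<iota>)"
  "(\<Sum>i<ext_degree \<iota>. \<iota> (ext_coords \<iota> x $ i) * ext_basis \<iota> ! i) = x"
proof -
  have "\<exists>!c. c \<in> carrier_vec (ext_degree \<iota>) \<and> x = (\<Sum>i<ext_degree \<iota>. \<iota> (c $ i) * ext_basis \<iota> ! i)"
    using ext_basis by (simp add: is_ext_basis_def ext_degree_def)
  from theI'[OF this] show "ext_coords \<iota> x \<in> carrier_vec (ext_degree \<iota>)"
    "(\<Sum>i<ext_degree \<iota>. \<iota> (ext_coords \<iota> x $ i) * ext_basis \<iota> ! i) = x"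
    by (simp_all add: ext_coords_def)
qed

lemma regular_rep: "mat_rep (ext_basis \<iota>) x (regular_rep \<iota> x)"
  using ext_coords(2) by (simp add: mat_rep_def regular_rep_def comb_def ext_degree_def)

lemma regular_rep_eqI: "mat_rep (ext_basis \<iota>) x A \<Longrightarrow> regular_rep \<iota> x = A"
  by (rule mat_rep_unique[OF ext_basis regular_rep])

lemma regular_rep_carrier [simp]: "regular_rep \<iota> x \<in> carrier_mat (ext_degree \<iota>) (ext_degree \<iota>)"
  by (simp add: regular_rep_def)

lemma regular_rep_dim [simp]:
  "dim_row (regular_rep \<iota> x) = ext_degree \<iota>" "dim_col (regular_rep \<iota> x) = ext_degree \<iota>"
  by (simp_all add: regular_rep_def)

lemma regular_rep_mult: "regular_rep \<iota> (x * y) = regular_rep \<iota> x * regular_rep \<iota> y"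
  by (intro regular_rep_eqI mat_rep_mult regular_rep)

lemma regular_rep_add: "regular_rep \<iota> (x + y) = regular_rep \<iota> x + regular_rep \<iota> y"
  by (intro regular_rep_eqI mat_rep_add regular_rep)

lemma regular_rep_smult: "regular_rep \<iota> (\<iota> a * x) = a \<cdot>\<^sub>m regular_rep \<iota> x"
  by (intro regular_rep_eqI mat_rep_smult regular_rep)

lemma regular_rep_one: "regular_rep \<iota> 1 = 1\<^sub>m (ext_degree \<iota>)"
  unfolding ext_degree_def by (intro regular_rep_eqI mat_rep_one)

lemma regular_rep_zero: "regular_rep \<iota> 0 = 0\<^sub>m (ext_degree \<iota>) (ext_degree \<iota>)"
  unfolding ext_degree_def by (intro regular_rep_eqI mat_rep_zero)

lemma regular_rep_eq_zero_iff: "regular_rep \<iota> x = 0\<^sub>m (ext_degree \<iota>) (ext_degree \<iota>) \<longleftrightarrow> x = 0"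
proof
  assume *: "regular_rep \<iota> x = 0\<^sub>m (ext_degree \<iota>) (ext_degree \<iota>)"
  have "x * b = 0" if b: "b \<in> set (ext_basis \<iota>)" for b
  proof -
    obtain j where "j < length (ext_basis \<iota>)" "b = ext_basis \<iota> ! j"
      using b by (auto simp: in_set_conv_nth)
    then show ?thesis using regular_rep[of x] unfolding * by (auto simp: mat_rep_def comb_def ext_degree_def)
  qed
  moreover have "\<exists>b\<in>set (ext_basis \<iota>). b \<noteq> 0"
  proof (rule ccontr)
    assume "\<not> ?thesis"
    then have "(\<Sum>i<ext_degree \<iota>. \<iota> (ext_coords \<iota> 1 $ i) * ext_basis \<iota> ! i) = 0"
      by (auto intro!: sum.neutral simp: ext_degree_def)
    then show False using ext_coords(2)[of 1] by simp
  qed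
  ultimately show "x = 0" by auto
qed (simp add: regular_rep_zero)

lemma ext_norm_eqI: "is_ext_basis \<iota> bs \<Longrightarrow> mat_rep bs x A \<Longrightarrow> ext_norm \<iota> x = det A"
  unfolding ext_norm_def by (rule mat_rep_change_basis[OF ext_basis _ regular_rep])

lemma ext_norm_mult: "ext_norm \<iota> (x * y) = ext_norm \<iota> x * ext_norm \<iota> y"
  by (simp add: ext_norm_def regular_rep_mult det_mult[of _ "ext_degree \<iota>"])

lemma ext_norm_one [simp]: "ext_norm \<iota> 1 = 1"
  by (simp add: ext_norm_def regular_rep_one)

lemma ext_norm_nonzero: "x \<noteq> 0 \<Longrightarrow> ext_norm \<iota> x \<noteq> 0"
  using ext_norm_mult[of x "inverse x"] by auto

lemma ext_norm_inverse: "x \<noteq> 0 \<Longrightarrow> ext_norm \<iota> (inverse x) = inverse (ext_norm \<iota> x)"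
  using ext_norm_mult[of x "inverse x"] ext_norm_nonzero[of x] by (simp add: field_simps)

lemma ext_norm_power: "ext_norm \<iota> (x ^ k) = ext_norm \<iota> x ^ k"
  by (induction k) (simp_all add: ext_norm_mult)

end

section \<open>Totally ramified extensions generated by a radical\<close>

text \<open>The Eisenstein situation. Generation is stated in the form that a splitting field
  supplies; independence of the powers of \<open>\<theta>\<close> is derived from
  \<open>v D = 1\<close> in \<open>ev_eq_0_iff\<close>.\<close>

locale radical_extension = valued_field v + field_embedding \<iota>
  for v :: "'f::field \<Rightarrow> int" and \<iota> :: "'f \<Rightarrow> 'e::field" +
  fixes n :: nat and D :: 'f and \<theta> :: 'e
  assumes n_pos: "0 < n" and D_nonzero: "D \<noteq> 0" and v_D: "v D = 1" and \<theta>_power: "\<theta> ^ n = \<iota> D"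
    and generates: "\<And>L. range \<iota> \<subseteq> L \<Longrightarrow> \<theta> \<in> L \<Longrightarrow>
        (\<forall>x\<in>L. \<forall>y\<in>L. x - y \<in> L \<and> x * y \<in> L \<and> inverse x \<in> L) \<Longrightarrow> L = UNIV"
begin

definition ev :: "(nat \<Rightarrow> 'f) \<Rightarrow> 'e" where
  "ev c = (\<Sum>i<n. \<iota> (c i) * \<theta> ^ i)"

text \<open>The matrix of multiplication by \<open>ev c\<close> in the basis of powers of
  \<open>\<theta>\<close>: entries that wrap around past \<open>\<theta> ^ (n - 1)\<close> pick up a
  factor \<open>D\<close> from \<open>\<theta> ^ n = \<iota> D\<close>.\<close>

definition tm :: "(nat \<Rightarrow> 'f) \<Rightarrow> 'f mat" where
  "tm c = mat n n (\<lambda>(i,j). if j \<le> i then c (i - j) else D * c (n + i - j))"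

definition \<theta>s :: "'e list" where
  "\<theta>s = map (\<lambda>i. \<theta> ^ i) [0..<n]"

abbreviation integral :: "(nat \<Rightarrow> 'f) \<Rightarrow> bool" where
  "integral c \<equiv> \<forall>i<n. val_ge v (c i) 0"

lemma \<theta>_nonzero [simp]: "\<theta> \<noteq> 0"
  using \<theta>_power n_pos D_nonzero by (auto simp: power_0_left)

lemma length_\<theta>s [simp]: "length \<theta>s = n"
  by (simp add: \<theta>s_def)

lemma nth_\<theta>s [simp]: "i < n \<Longrightarrow> \<theta>s ! i = \<theta> ^ i"
  by (simp add: \<theta>s_def)

lemma tm_carrier [simp]: "tm c \<in> carrier_mat n n"
  by (simp add: tm_def)

lemma tm_dim [simp]: "dim_row (tm c) = n" "dim_col (tm c) = n"
  by (simp_all add: tm_def)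

lemma comb_\<theta>s: "comb \<theta>s A j = ev (\<lambda>i. A $$ (i,j))"
  by (simp add: comb_def ev_def)

lemma tm_rep: "mat_rep \<theta>s (ev c) (tm c)"
  unfolding mat_rep_def
proof (intro conjI allI impI)
  fix j assume "j < length \<theta>s"
  then have j: "j < n" by simp
  have "(\<Sum>k<n. \<iota> (c k) * \<theta> ^ k * \<theta> ^ j) = (\<Sum>i<n. \<iota> (tm c $$ (i,j)) * \<theta> ^ i)"
  proof (rule sum.reindex_bij_witness[where
        j = "\<lambda>k. if k + j < n then k + j else k + j - n" and i = "\<lambda>i. if j \<le> i then i - j else n + i - j"])
    fix k assume k: "k \<in> {..<n}"
    show "\<iota> (tm c $$ (if k + j < n then k + j else k + j - n, j)) * \<theta> ^ (if k + j < n then k + j else k + j - n)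
        = \<iota> (c k) * \<theta> ^ k * \<theta> ^ j"
    proof (cases "k + j < n")
      case True
      then show ?thesis using k j by (simp add: tm_def power_add)
    next
      case False
      have "\<theta> ^ k * \<theta> ^ j = \<theta> ^ n * \<theta> ^ (k + j - n)"
        using False by (simp flip: power_add)
      moreover have "\<iota> (tm c $$ (k + j - n, j)) = \<iota> D * \<iota> (c k)"
        using False k j by (auto simp: tm_def)
      ultimately show ?thesis using False by (simp add: \<theta>_power mult_ac)
    qed
  qed (use j in auto)
  then show "ev c * \<theta>s ! j = comb \<theta>s (tm c) j"
    using j unfolding comb_\<theta>s by (simp add: ev_def sum_distrib_right)
qed simp

text \<open>Every entry above the diagonal contains the factor \<open>D\<close> of value 1. Modulo
  the maximal ideal the matrix is therefore lower triangular with constant diagonal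
  \<open>c 0\<close>.\<close>

lemma det_tm: "integral c \<Longrightarrow> val_ge v (det (tm c) - c 0 ^ n) 1"
proof -
  assume c: "integral c"
  define B where "B = mat n n (\<lambda>(i,j). if j \<le> i then c (i - j) else 0)"
  have "det B = prod_list (diag_mat B)"
    by (rule det_lower_triangular[of n]) (auto simp: B_def)
  also have "\<dots> = c 0 ^ n"
    by (simp add: prod_list_diag_prod B_def)
  finally have "det B = c 0 ^ n" .
  moreover have "val_ge v (det (tm c) - det B) 1"
  proof (rule det_cong_val)
    fix i j assume "i < n" "j < n"
    then show "val_ge v (tm c $$ (i, j) - B $$ (i, j)) 1"
      using c val_ge_mult[of D 1 "c (n + i - j)" 0] by (auto simp: tm_def B_def val_ge_def[of _ D] v_D)
    show "val_ge v (tm c $$ (i, j)) 0"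
      using c \<open>i < n\<close> \<open>j < n\<close> val_ge_mult_0[of D "c (n + i - j)" 0] by (auto simp: tm_def val_ge_def[of _ D] v_D)
    show "val_ge v (B $$ (i, j)) 0"
      using c \<open>i < n\<close> \<open>j < n\<close> by (auto simp: B_def)
  qed (auto simp: B_def)
  ultimately show ?thesis by simp
qed

text \<open>Coordinates after division by \<open>\<theta>\<close>: the constant term moves to the
  top position because the inverse of \<open>\<theta>\<close> is \<open>\<theta> ^ (n - 1)\<close>
  divided by the image of \<open>D\<close>.\<close>

definition shift :: "(nat \<Rightarrow> 'f) \<Rightarrow> nat \<Rightarrow> 'f" where
  "shift c i = (if Suc i < n then c (Suc i) else c 0 / D)"

lemma ev_shift: "ev c = \<theta> * ev (shift c)"
proof -
  define m where "m = n - 1"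
  have m: "Suc m = n" using n_pos by (simp add: m_def)
  have split: "(\<Sum>i<n. f i) = (\<Sum>i<m. f i) + f m" "(\<Sum>i<n. f i) = f 0 + (\<Sum>i<m. f (Suc i))"
    for f :: "nat \<Rightarrow> 'e"
    using sum.lessThan_Suc[of f m] sum.lessThan_Suc_shift[of f m] m by simp_all
  have "\<theta> * ev (shift c) = \<theta> * ((\<Sum>i<m. \<iota> (shift c i) * \<theta> ^ i) + \<iota> (shift c m) * \<theta> ^ m)"
    unfolding ev_def split(1) ..
  also have "\<dots> = \<theta> * ((\<Sum>i<m. \<iota> (c (Suc i)) * \<theta> ^ i) + \<iota> (c 0 / D) * \<theta> ^ m)"
    using m by (auto simp: shift_def intro!: sum.cong)
  also have "\<dots> = (\<Sum>i<m. \<iota> (c (Suc i)) * \<theta> ^ Suc i) + \<iota> (c 0 / D) * \<theta> ^ Suc m"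
    by (simp add: distrib_left sum_distrib_left mult_ac)
  also have "\<theta> ^ Suc m = \<iota> D" unfolding m by (rule \<theta>_power)
  also have "\<iota> (c 0 / D) * \<iota> D = \<iota> (c 0)" using D_nonzero by simp
  also have "(\<Sum>i<m. \<iota> (c (Suc i)) * \<theta> ^ Suc i) + \<iota> (c 0) = ev c"
    unfolding ev_def split(2) by simp
  finally show ?thesis by simp
qed

lemma integral_shift: "integral c \<Longrightarrow> val_ge v (c 0) 1 \<Longrightarrow> integral (shift c)"
  using D_nonzero v_D by (cases "c 0 = 0") (auto simp: shift_def val_ge_def v_divide)

text \<open>Division by \<open>\<theta>\<close> is repeated as long as the constant coefficient is
  not a unit; the coefficients stay integral meanwhile.\<close>

lemma integral_decomp:
  assumes "integral c" "i < n" "c i \<noteq> 0"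
  shows "\<exists>m u. integral u \<and> u 0 \<noteq> 0 \<and> v (u 0) = 0 \<and> ev c = \<theta> ^ m * ev u"
  using assms
\<comment> \<open>The measure is the order of the term \<open>c i * \<theta> ^ i\<close> in powers
  of \<open>\<theta>\<close>. One \<open>shift\<close> lowers it by 1; for \<open>i = 0\<close> the
  coefficient loses value 1 and reappears at position \<open>n - 1\<close>.\<close>
proof (induction "nat (int n * v (c i)) + i" arbitrary: c i rule: less_induct)
  case less
  show ?case
  proof (cases "c 0 \<noteq> 0 \<and> v (c 0) = 0")
    case True
    then show ?thesis using less.prems(1) by (intro exI[of _ 0] exI[of _ c]) simp
  next
    case False
    then have c0: "val_ge v (c 0) 1" using less.prems(1) n_pos by (force simp: val_ge_def)
    have vi: "v (c i) \<ge> 0" using less.prems by (auto simp: val_ge_def)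
    have "\<exists>m u. integral u \<and> u 0 \<noteq> 0 \<and> v (u 0) = 0 \<and> ev (shift c) = \<theta> ^ m * ev u"
    proof (cases i)
      case (Suc k)
      show ?thesis
        by (rule less.hyps[of "shift c" k]) (use Suc less.prems integral_shift[of c, OF _ c0] in \<open>auto simp: shift_def\<close>)
    next
      case 0
      have v0: "v (c 0) \<ge> 1" using c0 less.prems(3) 0 by (auto simp: val_ge_def)
      have v': "v (c 0 / D) = v (c 0) - 1" using D_nonzero less.prems(3) 0 v_D by (simp add: v_divide)
      have "int n * v (c 0) = int n * (v (c 0) - 1) + int n" by (simp add: algebra_simps)
      then have *: "nat (int n * v (c 0)) = nat (int n * (v (c 0) - 1)) + n"
        using v0 by (simp add: nat_add_distrib)
      show ?thesis
        by (rule less.hyps[of "shift c" "n - 1"])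
           (use 0 less.prems integral_shift[of c, OF _ c0] n_pos * v' D_nonzero in \<open>auto simp: shift_def\<close>)
    qed
    then obtain m u where "integral u" "u 0 \<noteq> 0" "v (u 0) = 0" "ev (shift c) = \<theta> ^ m * ev u" by blast
    then show ?thesis by (intro exI[of _ "Suc m"] exI[of _ u]) (simp add: ev_shift[of c])
  qed
qed

lemma ev_smult: "ev (\<lambda>i. a * c i) = \<iota> a * ev c"
  by (simp add: ev_def sum_distrib_left mult.assoc)

lemma ev_add: "ev (\<lambda>i. c i + d i) = ev c + ev d"
  by (simp add: ev_def sum.distrib algebra_simps)

lemma ev_diff: "ev (\<lambda>i. c i - d i) = ev c - ev d"
  by (simp add: ev_def sum_subtractf algebra_simps)

lemma ev_const: "ev (\<lambda>i. if i = 0 then a else 0) = \<iota> a"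
  using n_pos by (simp add: ev_def if_distrib[of \<iota>] if_distrib[of "\<lambda>x. x * _"] sum.delta cong: if_cong)

lemma ev_decomp:
  assumes "i < n" "c i \<noteq> 0"
  shows "\<exists>m u. integral u \<and> u 0 \<noteq> 0 \<and> v (u 0) = 0 \<and> ev c = \<theta> powi m * ev u"
proof -
  \<comment> \<open>\<open>N\<close> dominates all negative values of coefficients, so
    \<open>D ^ N\<close> clears denominators. Its image is \<open>\<theta> ^ (n * N)\<close>, which
    is divided out again at the end.\<close>
  define N where "N = (\<Sum>i<n. nat \<bar>v (c i)\<bar>)"
  have N: "- v (c i) \<le> int N" if "i < n" for i
    using member_le_sum[of i "{..<n}" "\<lambda>i. nat \<bar>v (c i)\<bar>"] that
    unfolding N_def[symmetric] by simp
  have "integral (\<lambda>i. D ^ N * c i)"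
  proof (intro allI impI)
    fix i assume "i < n"
    then show "val_ge v (D ^ N * c i) 0"
      using N[of i] D_nonzero v_D by (cases "c i = 0") (simp_all add: val_ge_def v_mult v_power)
  qed
  from integral_decomp[OF this, of i] assms D_nonzero
  obtain m u where u: "integral u" "u 0 \<noteq> 0" "v (u 0) = 0" "ev (\<lambda>i. D ^ N * c i) = \<theta> ^ m * ev u"
    by auto
  have "\<theta> powi (int m - int (n * N)) * ev u = \<theta> ^ m * ev u / (\<theta> ^ n) ^ N"
    by (subst power_int_diff) (simp_all only: power_int_of_nat power_mult \<theta>_nonzero times_divide_eq_left simp_thms)
  also have "\<dots> = ev c"
    using D_nonzero unfolding u(4)[symmetric] ev_smult by (simp add: \<theta>_power)
  finally show ?thesis using u by (intro exI[of _ "int m - int (n * N)"] exI[of _ u]) simp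
qed

lemma ev_mult: "ev c * ev d = ev (\<lambda>i. \<Sum>j<n. tm c $$ (i,j) * d j)"
proof -
  have "ev c * ev d = (\<Sum>j<n. \<iota> (d j) * (ev c * \<theta> ^ j))"
    by (simp add: ev_def[of d] sum_distrib_left mult_ac)
  also have "\<dots> = (\<Sum>j<n. \<iota> (d j) * ev (\<lambda>i. tm c $$ (i,j)))"
    using tm_rep[of c] by (intro sum.cong) (auto simp: mat_rep_def comb_\<theta>s)
  also have "\<dots> = (\<Sum>j<n. \<Sum>i<n. \<iota> (tm c $$ (i,j) * d j) * \<theta> ^ i)"
    by (simp add: ev_def sum_distrib_left mult_ac)
  also have "\<dots> = (\<Sum>i<n. \<Sum>j<n. \<iota> (tm c $$ (i,j) * d j) * \<theta> ^ i)"
    by (rule sum.swap)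
  finally show ?thesis by (simp add: ev_def sum_distrib_right)
qed

text \<open>The first column of the adjugate matrix gives the complementary factor. It provides
  inverses before anything is known about irreducibility of \<open>X ^ n - D\<close>.\<close>

lemma ev_dvd_det: "\<exists>d. ev c * ev d = \<iota> (det (tm c))"
proof (intro exI)
  let ?A = "adj_mat (tm c)"
  have A: "?A \<in> carrier_mat n n" "tm c * ?A = det (tm c) \<cdot>\<^sub>m 1\<^sub>m n" using adj_mat[of "tm c" n] by auto
  have "ev c * ev (\<lambda>i. ?A $$ (i,0)) = ev (\<lambda>i. \<Sum>j<n. tm c $$ (i,j) * ?A $$ (j,0))"
    by (rule ev_mult)
  also have "\<dots> = ev (\<lambda>i. (tm c * ?A) $$ (i,0))"
    unfolding ev_def using A(1) n_pos tm_carrier[of c]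
    by (intro sum.cong) (auto simp: scalar_prod_def atLeast0LessThan intro!: arg_cong[of _ _ \<iota>] sum.cong
        simp del: hom_simps)
  also have "\<dots> = ev (\<lambda>i. if i = 0 then det (tm c) else 0)"
    unfolding A(2) ev_def using n_pos by (intro sum.cong) auto
  finally show "ev c * ev (\<lambda>i. ?A $$ (i,0)) = \<iota> (det (tm c))" by (simp add: ev_const)
qed

lemma unit_det_tm:
  assumes "integral u" "u 0 \<noteq> 0" "v (u 0) = 0"
  shows "det (tm u) \<noteq> 0" "v (det (tm u)) = 0"
  using val_eq_of_close[of "u 0 ^ n" "det (tm u)"] det_tm[OF assms(1)] assms
  by (auto simp: v_power val_ge_minus_commute)

text \<open>A nonzero coefficient vector splits off a power of \<open>\<theta>\<close> and leaves a
  factor whose multiplication matrix has unit determinant; by \<open>ev_dvd_det\<close> such a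
  factor is not zero.\<close>

lemma ev_eq_0_iff: "ev c = 0 \<longleftrightarrow> (\<forall>i<n. c i = 0)"
proof
  assume *: "ev c = 0"
  show "\<forall>i<n. c i = 0"
  proof (rule ccontr)
    assume "\<not> ?thesis"
    then obtain i where "i < n" "c i \<noteq> 0" by blast
    from ev_decomp[of i c, OF this] obtain m u where u: "integral u" "u 0 \<noteq> 0" "v (u 0) = 0" "ev c = \<theta> powi m * ev u" by blast
    then have "ev u = 0" using * by simp
    with ev_dvd_det[of u] unit_det_tm(1)[OF u(1-3)] show False by simp
  qed
qed (simp add: ev_def)

text \<open>The range is shown to be a field containing \<open>\<theta>\<close>. Only inverses are
  delicate: the power of \<open>\<theta>\<close> is inverted by shifting, the remaining unit by its
  adjugate.\<close>

lemma ev_surj: "range ev = UNIV"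
proof (rule generates)
  show "range \<iota> \<subseteq> range ev" using ev_const by (metis image_subsetI rangeI)
  have 0: "ev (\<lambda>i. 0) = 0" by (simp add: ev_def)
  have shift_inv: "\<exists>c. \<theta> * ev d = ev c" for d
  proof -
    define c where "c i = (case i of 0 \<Rightarrow> D * d (n - 1) | Suc j \<Rightarrow> d j)" for i
    have "ev d = ev (shift c)" unfolding ev_def
      using D_nonzero by (intro sum.cong) (auto simp: shift_def c_def less_Suc_eq intro!: arg_cong[of _ _ d])
    then show ?thesis using ev_shift[of c] by metis
  qed
  show "\<theta> \<in> range ev" using shift_inv[of "\<lambda>i. if i = 0 then 1 else 0"] unfolding ev_const by auto
  have \<theta>m: "\<exists>c. \<theta> ^ m * ev d = ev c" for m d
  proof (induction m)
    case (Suc m)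
    then show ?case using shift_inv by (metis mult.assoc power_Suc)
  qed auto
  have \<theta>mi: "\<exists>c. inverse \<theta> ^ m * ev d = ev c" for m d
  proof (induction m)
    case (Suc m)
    then obtain c where "inverse \<theta> ^ m * ev d = ev c" by blast
    then have "inverse \<theta> ^ Suc m * ev d = ev (shift c)"
      using ev_shift[of c] by (simp add: mult.assoc)
    then show ?case by blast
  qed auto
  have \<theta>powi: "\<exists>c. \<theta> powi m * ev d = ev c" for m d
    using \<theta>m \<theta>mi by (auto simp: power_int_def)
  show "\<forall>x\<in>range ev. \<forall>y\<in>range ev. x - y \<in> range ev \<and> x * y \<in> range ev \<and> inverse x \<in> range ev"
  proof (intro ballI conjI)
    fix x y assume "x \<in> range ev" "y \<in> range ev"
    then obtain c d where cd: "x = ev c" "y = ev d" by blast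
    show "x - y \<in> range ev" unfolding cd ev_diff[symmetric] by (rule rangeI)
    show "x * y \<in> range ev" unfolding cd ev_mult by (rule rangeI)
    show "inverse x \<in> range ev"
    proof (cases "x = 0")
      case True
      then show ?thesis using 0 by (auto intro!: range_eqI[OF sym])
    next
      case False
      then obtain i where "i < n" "c i \<noteq> 0" using cd ev_eq_0_iff by blast
      from ev_decomp[of i c, OF this] obtain m u where u: "integral u" "u 0 \<noteq> 0" "v (u 0) = 0" "ev c = \<theta> powi m * ev u" by blast
      obtain e where e: "ev u * ev e = \<iota> (det (tm u))" using ev_dvd_det by blast
      have "inverse (ev u) = ev (\<lambda>i. inverse (det (tm u)) * e i)"
        unfolding ev_smult using e unit_det_tm(1)[OF u(1-3)] by (intro inverse_unique) (simp add: field_simps)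
      moreover have "inverse x = \<theta> powi (- m) * inverse (ev u)"
        using cd u(4) by (simp add: power_int_minus)
      ultimately have "inverse x = \<theta> powi (- m) * ev (\<lambda>i. inverse (det (tm u)) * e i)" by simp
      then show ?thesis using \<theta>powi[of "- m" "\<lambda>i. inverse (det (tm u)) * e i"] by auto
    qed
  qed
qed

lemma \<theta>s_basis: "is_ext_basis \<iota> \<theta>s"
  unfolding is_ext_basis_def
proof (intro allI ex_ex1I)
  fix x :: 'e
  obtain c where "x = ev c" using ev_surj by blast
  then show "\<exists>u. u \<in> carrier_vec (length \<theta>s) \<and> x = (\<Sum>i<length \<theta>s. \<iota> (vec_index u i) * \<theta>s ! i)"
    by (intro exI[of _ "vec n c"]) (auto simp: ev_def)
next
  fix x u u'
  assume u: "u \<in> carrier_vec (length \<theta>s) \<and> x = (\<Sum>i<length \<theta>s. \<iota> (vec_index u i) * \<theta>s ! i)"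
    and u': "u' \<in> carrier_vec (length \<theta>s) \<and> x = (\<Sum>i<length \<theta>s. \<iota> (vec_index u' i) * \<theta>s ! i)"
  then have "ev (vec_index u) = ev (vec_index u')" by (simp add: ev_def)
  then have "ev (\<lambda>i. vec_index u i - vec_index u' i) = 0" by (simp add: ev_diff)
  then show "u = u'" using u u' by (intro eq_vecI) (auto simp: ev_eq_0_iff)
qed

sublocale finite_extension \<iota>
  by unfold_locales (use \<theta>s_basis in blast)

lemma ext_norm_ev: "ext_norm \<iota> (ev c) = det (tm c)"
  by (rule ext_norm_eqI[OF \<theta>s_basis tm_rep])

lemma ext_norm_\<iota>: "ext_norm \<iota> (\<iota> a) = a ^ n"
proof -
  have "mat_rep \<theta>s (\<iota> a * 1) (a \<cdot>\<^sub>m 1\<^sub>m (length \<theta>s))" by (intro mat_rep_smult mat_rep_one)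
  then show ?thesis using ext_norm_eqI[OF \<theta>s_basis, of "\<iota> a"] by simp
qed

text \<open>For \<open>c\<close> representing \<open>\<theta>\<close>, the only nonzero entry of the
  first row is the last one, \<open>D\<close>, and the matrix left after deleting its row and column
  is an identity.\<close>

lemma ext_norm_\<theta>: "ext_norm \<iota> \<theta> = (- 1) ^ (n - 1) * D"
proof -
  \<comment> \<open>For \<open>n = 1\<close> the element \<open>\<theta>\<close> is the constant
    \<open>D\<close>; otherwise it is the basis vector at position 1.\<close>
  define c where "c i = (case i of 0 \<Rightarrow> D * (if n = 1 then 1 else 0) | Suc j \<Rightarrow> if j = 0 then 1 else 0)" for i :: nat
  have "ev (\<lambda>i. if i = 0 then 1 else 0) = ev (shift c)" unfolding ev_def
    using D_nonzero n_pos by (intro sum.cong) (auto simp: shift_def c_def)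
  then have "ev c = \<theta>" using ev_shift[of c] by (simp add: ev_const)
  then have "ext_norm \<iota> \<theta> = det (tm c)" using ext_norm_ev[of c] by simp
  also have "\<dots> = (\<Sum>j<n. tm c $$ (0,j) * cofactor (tm c) 0 j)"
    using n_pos by (intro laplace_expansion_row[of _ n]) auto
  also have "\<dots> = (\<Sum>j\<in>{n - 1}. tm c $$ (0,j) * cofactor (tm c) 0 j)"
    using n_pos by (intro sum.mono_neutral_right) (auto simp: tm_def c_def split: nat.splits)
  also have "\<dots> = D * cofactor (tm c) 0 (n - 1)"
    using n_pos by (auto simp: tm_def c_def split: nat.splits)
  also have "mat_delete (tm c) 0 (n - 1) = 1\<^sub>m (n - 1)"
    by (rule eq_matI) (auto simp: mat_delete_def tm_def c_def split: nat.splits)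
  then have "cofactor (tm c) 0 (n - 1) = (- 1) ^ (n - 1)"
    by (simp add: cofactor_def)
  finally show ?thesis by (simp add: mult.commute)
qed

end

section \<open>The valuation of the extension\<close>

context radical_extension
begin

text \<open>No rescaling of the norm is needed: total ramification gives
  \<open>w \<theta> = 1\<close>, while on the base field \<open>w\<close> is \<open>n\<close> times
  \<open>v\<close>.\<close>

definition w :: "'e \<Rightarrow> int" where
  "w x = v (ext_norm \<iota> x)"

lemma w_\<theta>: "w \<theta> = 1"
  using D_nonzero by (cases "even (n - 1)") (simp_all add: w_def ext_norm_\<theta> v_D)

lemma w_mult: "x \<noteq> 0 \<Longrightarrow> y \<noteq> 0 \<Longrightarrow> w (x * y) = w x + w y"
  by (simp add: w_def ext_norm_mult v_mult ext_norm_nonzero)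

lemma w_inverse: "x \<noteq> 0 \<Longrightarrow> w (inverse x) = - w x"
  by (simp add: w_def ext_norm_inverse v_inverse ext_norm_nonzero)

lemma w_power: "x \<noteq> 0 \<Longrightarrow> w (x ^ k) = int k * w x"
  by (simp add: w_def ext_norm_power v_power ext_norm_nonzero)

lemma w_powi: "x \<noteq> 0 \<Longrightarrow> w (x powi k) = k * w x"
  by (cases "k \<ge> 0") (auto simp: power_int_def w_power w_inverse)

lemma ext_decomp:
  assumes "x \<noteq> 0"
  obtains u where "integral u" "u 0 \<noteq> 0" "v (u 0) = 0" "x = \<theta> powi (w x) * ev u"
proof -
  obtain c where c: "x = ev c" using ev_surj by blast
  with assms obtain i where "i < n" "c i \<noteq> 0" using ev_eq_0_iff by blast
  from ev_decomp[of i c, OF this] obtain m u where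
    u: "integral u" "u 0 \<noteq> 0" "v (u 0) = 0" "x = \<theta> powi m * ev u" using c by blast
  have "ev u \<noteq> 0" using u(4) assms by auto
  then have "w x = m + w (ev u)" using u(4) by (simp add: w_mult w_powi w_\<theta>)
  also have "w (ev u) = 0" using unit_det_tm(2)[OF u(1-3)] by (simp add: w_def ext_norm_ev)
  finally have "w x = m" by simp
  then show ?thesis using that u by blast
qed

lemma integral_unshift:
  assumes "integral d"
  shows "\<exists>c. integral c \<and> \<theta> * ev d = ev c"
proof -
  define c where "c i = (case i of 0 \<Rightarrow> D * d (n - 1) | Suc j \<Rightarrow> d j)" for i
  have "ev d = ev (shift c)" unfolding ev_def
    using D_nonzero by (intro sum.cong) (auto simp: shift_def c_def less_Suc_eq intro!: arg_cong[of _ _ d])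
  moreover have "integral c"
    using assms val_ge_mult_0[of D "d (n - 1)" 0] n_pos
    by (auto simp: c_def val_ge_def[of _ D] v_D split: nat.split)
  ultimately show ?thesis using ev_shift[of c] by metis
qed

text \<open>Integral coordinates give an integral multiplication matrix and so an integral norm.
  Conversely, \<open>x\<close> is a nonnegative power of \<open>\<theta>\<close> times an integral
  combination, and multiplication by \<open>\<theta>\<close> keeps coordinates integral.\<close>

lemma val_ge_w_0_iff: "val_ge w x 0 \<longleftrightarrow> (\<exists>c. integral c \<and> x = ev c)"
proof
  assume "\<exists>c. integral c \<and> x = ev c"
  then obtain c where c: "integral c" "x = ev c" by blast
  have "val_ge v (det (tm c)) 0"
    using c(1) val_ge_mult_0[of D _ 0] by (intro det_integral[of _ n]) (auto simp: tm_def val_ge_def[of _ D] v_D)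
  then show "val_ge w x 0"
    using ext_norm_nonzero[of x] c by (auto simp: val_ge_def w_def ext_norm_ev)
next
  assume x: "val_ge w x 0"
  show "\<exists>c. integral c \<and> x = ev c"
  proof (cases "x = 0")
    case True
    then show ?thesis by (intro exI[of _ "\<lambda>_. 0"]) (simp add: ev_def)
  next
    case False
    with x have "w x \<ge> 0" by (simp add: val_ge_def)
    obtain u where u: "integral u" "x = \<theta> powi (w x) * ev u" using ext_decomp[OF False] by metis
    have "\<exists>c. integral c \<and> \<theta> ^ m * ev u = ev c" for m
    proof (induction m)
      case 0
      then show ?case using u by auto
    next
      case (Suc m)
      then obtain c where "integral c" "\<theta> ^ m * ev u = ev c" by blast
      then show ?case using integral_unshift[of c] by (simp add: mult.assoc)
    qed
    then show ?thesis using u(2) \<open>w x \<ge> 0\<close> by (metis power_int_def)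
  qed
qed

lemma val_ge_w_ev: "integral c \<Longrightarrow> val_ge w (ev c) 0"
  unfolding val_ge_w_0_iff by blast

text \<open>The ultrametric inequality for \<open>w x \<le> w y\<close> reduces, after division by
  \<open>x\<close>, to the integrality of \<open>1 + y / x\<close>, which is visible on
  coordinates.\<close>

sublocale w: valued_field w
proof
  fix x y :: 'e assume xy: "x \<noteq> 0" "y \<noteq> 0"
  show "w (x * y) = w x + w y" using xy by (rule w_mult)
  assume s: "x + y \<noteq> 0"
  have *: "w x \<le> w (x + y)" if "w x \<le> w y" "x \<noteq> 0" "y \<noteq> 0" "x + y \<noteq> 0" for x y :: 'e
  proof -
    have "val_ge w (y / x) 0" using that by (simp add: val_ge_def divide_inverse w_mult w_inverse)
    then obtain c where c: "integral c" "y / x = ev c" using val_ge_w_0_iff by blast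
    have i: "integral (\<lambda>i. (if i = 0 then 1 else 0) + c i)"
      using c(1) val_ge_add by (auto simp: val_ge_1)
    have "1 + y / x = ev (\<lambda>i. (if i = 0 then 1 else 0) + c i)"
      by (simp only: ev_add ev_const c(2) hom_simps)
    then have "val_ge w (1 + y / x) 0" using val_ge_w_ev[OF i] by simp
    moreover have "x * (1 + y / x) = x + y" using that by (simp add: field_simps)
    moreover from this have "1 + y / x \<noteq> 0" using that by auto
    ultimately show ?thesis using w_mult[of x "1 + y / x"] that by (simp add: val_ge_def)
  qed
  show "min (w x) (w y) \<le> w (x + y)"
    using *[of x y] *[of y x] xy s by (auto simp: min_def add.commute)
qed

lemma w_\<iota>: "a \<noteq> 0 \<Longrightarrow> w (\<iota> a) = int n * v a"
  by (simp add: w_def ext_norm_\<iota> v_power)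

lemma val_ge_w_\<iota>: "val_ge w (\<iota> a) (int n * k) \<longleftrightarrow> val_ge v a k"
  using n_pos by (cases "a = 0") (auto simp: val_ge_def w_\<iota>)

lemma val_ge_w_\<iota>_0: "val_ge w (\<iota> a) 0 \<longleftrightarrow> val_ge v a 0"
  using val_ge_w_\<iota>[of a 0] by simp

lemma val_ge_w_\<iota>_1: "val_ge w (\<iota> a) 1 \<longleftrightarrow> val_ge v a 1"
  using n_pos by (cases "a = 0") (auto simp: val_ge_def w_\<iota> mult_le_0_iff zero_less_mult_iff int_one_le_iff_zero_less)

lemma reduction_coeff:
  assumes c: "integral c"
  shows "val_ge w (ev c - \<iota> (c 0)) 1"
proof -
  define d where "d i = c i - (if i = 0 then c 0 else 0)" for i
  have d: "integral d" "d 0 = 0" using c by (auto simp: d_def)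
  have "d = (\<lambda>i. c i - (if i = 0 then c 0 else 0))" by (rule ext) (rule d_def)
  then have "ev d = ev c - \<iota> (c 0)" by (simp only: ev_diff ev_const)
  then have *: "ev c - \<iota> (c 0) = \<theta> * ev (shift d)" using ev_shift[of d] by (rule subst)
  have "val_ge w \<theta> 1" by (simp add: val_ge_def w_\<theta>)
  moreover have "val_ge w (ev (shift d)) 0"
    using d by (intro val_ge_w_ev integral_shift) auto
  ultimately show ?thesis unfolding * using w.val_ge_mult[of \<theta> 1 "ev (shift d)" 0] by simp
qed

lemma ex_reduction:
  assumes "val_ge w x 0"
  obtains a where "val_ge v a 0" "val_ge w (x - \<iota> a) 1"
proof -
  obtain c where c: "integral c" "x = ev c" using assms val_ge_w_0_iff by blast
  then show ?thesis using that reduction_coeff[of c] n_pos by blast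
qed

text \<open>The constant coordinate of \<open>x\<close> represents its residue, so \<open>a\<close>
  is congruent to it and \<open>det_tm\<close> applies.\<close>

lemma ext_norm_reduction:
  assumes a: "val_ge v a 0" and x: "val_ge w (x - \<iota> a) 1"
  shows "val_ge v (ext_norm \<iota> x - a ^ n) 1"
proof -
  have "val_ge w (x - \<iota> a + \<iota> a) 0"
    using a by (intro w.val_ge_add w.val_ge_mono[OF x]) (auto simp: val_ge_w_\<iota>_0)
  then obtain c where c: "integral c" "x = ev c" using val_ge_w_0_iff by auto
  have N: "val_ge v (ext_norm \<iota> x - c 0 ^ n) 1" using det_tm[OF c(1)] c(2) ext_norm_ev by simp
  have "val_ge w (x - \<iota> (c 0)) 1" using reduction_coeff[OF c(1)] c(2) by simp
  from w.val_ge_diff[OF x this] have "val_ge w (\<iota> (c 0 - a)) 1" by simp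
  then have ca: "val_ge v (c 0 - a) 1" by (simp only: val_ge_w_\<iota>_1)
  have "val_ge v (c 0 ^ n - a ^ n) 1"
    using prod_cong_val[of "{..<n}" "\<lambda>_. c 0" "\<lambda>_. a" 1] ca a c(1) n_pos by simp
  from val_ge_add[OF N this] show ?thesis by simp
qed

text \<open>Such a \<open>y\<close> is \<open>D ^ k\<close> times an integral element, so the matrix
  of \<open>1 + y\<close> is congruent to the identity modulo \<open>D ^ k\<close>. This continuity
  of the norm makes the norm equation a closed condition.\<close>

lemma ext_norm_close_1:
  assumes y: "val_ge w y (int n * k)" and k: "0 \<le> k"
  shows "val_ge v (ext_norm \<iota> (1 + y) - 1) k"
proof -
  define y' where "y' = y / \<iota> (D ^ nat k)"
  have D: "\<iota> (D ^ nat k) \<noteq> 0" using D_nonzero by simp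
  have "val_ge w y' 0"
    using y D k unfolding y'_def by (cases "y = 0") (auto simp: val_ge_def w.v_divide w_\<iota> D_nonzero v_power v_D simp del: hom_simps)
  then obtain c where c: "integral c" "y' = ev c" using val_ge_w_0_iff by blast
  have y: "y = \<iota> (D ^ nat k) * ev c" unfolding c(2)[symmetric] y'_def using D by (simp del: hom_simps)
  have dc: "val_ge v (D ^ nat k * c i) k" if "i < n" for i
    using val_ge_mult[of "D ^ nat k" k "c i" 0] c(1) that k D_nonzero by (simp add: val_ge_def[of _ "D ^ _"] v_power v_D)
  define d where "d i = (if i = 0 then 1 else 0) + D ^ nat k * c i" for i
  have "1 + y = ev d" unfolding y d_def[abs_def] ev_add ev_const ev_smult by simp
  then have "ext_norm \<iota> (1 + y) = det (tm d)" using ext_norm_ev by simp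
  moreover have "val_ge v (det (tm d) - det (1\<^sub>m n)) k"
  proof (rule det_cong_val)
    fix i j assume ij: "i < n" "j < n"
    have Ddc: "val_ge v (D * (D ^ nat k * c l)) k" if "l < n" for l
      using val_ge_mult_0[of D "D ^ nat k * c l" k] dc[OF that] by (simp add: val_ge_def[of _ D] v_D)
    show 1: "val_ge v (tm d $$ (i, j) - 1\<^sub>m n $$ (i, j)) k"
      using ij dc Ddc by (auto simp: tm_def d_def)
    show 2: "val_ge v (1\<^sub>m n $$ (i, j)) 0" using ij by (auto simp: val_ge_1)
    from val_ge_add[OF val_ge_mono[OF 1 k] 2] show "val_ge v (tm d $$ (i, j)) 0" by simp
  qed auto
  ultimately show ?thesis by simp
qed

text \<open>After division by \<open>D powi k\<close> the element is integral, and uniqueness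
  identifies its coordinates with integral ones. Thus coordinates are continuous, and completeness
  can be checked on them.\<close>

lemma ev_coord_bound:
  assumes "val_ge w (ev c) (int n * k)" "i < n"
  shows "val_ge v (c i) k"
proof -
  have Dk: "D powi k \<noteq> 0" using D_nonzero by simp
  have "val_ge w (\<iota> (inverse (D powi k)) * ev c) 0"
    using w.val_ge_mult[OF _ assms(1), of "\<iota> (inverse (D powi k))" "- (int n * k)"] Dk
    by (simp add: val_ge_def[of _ "inverse _"] w.v_inverse w_\<iota> v_powi D_nonzero v_D)
  then obtain d where d: "integral d" "ev (\<lambda>i. inverse (D powi k) * c i) = ev d"
    unfolding val_ge_w_0_iff ev_smult by blast
  then have "ev (\<lambda>i. inverse (D powi k) * c i - d i) = 0" unfolding ev_diff by simp
  then have "inverse (D powi k) * c i = d i" using assms(2) ev_eq_0_iff[of "\<lambda>i. inverse (D powi k) * c i - d i"] by auto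
  then have "c i = D powi k * d i" using Dk by (auto simp: field_simps)
  then show ?thesis using val_ge_mult[of "D powi k" k "d i" 0] d(1) assms(2) D_nonzero
    by (simp add: val_ge_def[of _ "D powi k"] v_powi v_D)
qed

lemma w_complete:
  fixes s :: "nat \<Rightarrow> 'e"
  assumes complete: "\<And>s :: nat \<Rightarrow> 'f. (\<forall>n. \<exists>k. \<forall>i\<ge>k. \<forall>j\<ge>k. val_ge v (s i - s j) n) \<Longrightarrow>
        (\<exists>l. \<forall>n. \<exists>k. \<forall>i\<ge>k. val_ge v (s i - l) n)"
    and cauchy: "\<And>m. \<exists>k. \<forall>i\<ge>k. \<forall>j\<ge>k. val_ge w (s i - s j) m"
  shows "\<exists>l. \<forall>m. \<exists>k. \<forall>i\<ge>k. val_ge w (s i - l) m"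
proof -
  have "\<exists>c. s i = ev c" for i using ev_surj by blast
  then obtain c where c: "\<And>i. s i = ev (c i)" by metis
  have "\<exists>l. \<forall>m. \<exists>k. \<forall>i\<ge>k. val_ge v (c i r - l) m" if r: "r < n" for r
  proof (rule complete, rule allI)
    fix m
    from cauchy[of "int n * m"] obtain k where k: "\<forall>i\<ge>k. \<forall>j\<ge>k. val_ge w (s i - s j) (int n * m)" ..
    have "val_ge v (c i r - c j r) m" if "i \<ge> k" "j \<ge> k" for i j
      using ev_coord_bound[of "\<lambda>r. c i r - c j r" m r] k that r by (simp add: c ev_diff)
    then show "\<exists>k. \<forall>i\<ge>k. \<forall>j\<ge>k. val_ge v (c i r - c j r) m" by blast
  qed
  then obtain l where l: "\<And>r m. r < n \<Longrightarrow> \<exists>k. \<forall>i\<ge>k. val_ge v (c i r - l r) m" by metis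
  show ?thesis
  proof (intro exI[of _ "ev l"] allI)
    fix m :: int
    \<comment> \<open>The absolute value makes \<open>m \<le> int n * m'\<close> true for negative
      \<open>m\<close> too.\<close>
    define m' where "m' = \<bar>m\<bar>"
    have m': "m \<le> int n * m'" "0 \<le> m'" using n_pos mult_right_mono[of 1 "int n" "\<bar>m\<bar>"]
      by (auto simp: m'_def)
    have "\<forall>r. \<exists>k. r < n \<longrightarrow> (\<forall>i\<ge>k. val_ge v (c i r - l r) m')" using l[of _ m'] by blast
    from choice[OF this] obtain K where K: "\<And>r. r < n \<Longrightarrow> \<forall>i\<ge>K r. val_ge v (c i r - l r) m'" by blast
    have "val_ge w (s i - ev l) m" if "i \<ge> Max (K ` {..<n})" for i
    proof -
      have "val_ge w (ev (\<lambda>r. c i r - l r)) m" unfolding ev_def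
      proof (rule w.val_ge_sum)
        fix r assume r: "r \<in> {..<n}"
        then have "K r \<le> Max (K ` {..<n})" by (intro Max_ge) auto
        with that have "K r \<le> i" by simp
        then have "val_ge w (\<iota> (c i r - l r)) (int n * m')" using K r by (simp only: val_ge_w_\<iota>) auto
        from w.val_ge_mult[OF this, of "\<theta> ^ r" 0] show "val_ge w (\<iota> (c i r - l r) * \<theta> ^ r) m"
          using m' by (auto simp: val_ge_def[of _ "\<theta> ^ r"] w_power w_\<theta> simp del: hom_simps intro: w.val_ge_mono)
      qed
      then show ?thesis by (simp only: ev_diff c)
    qed
    then show "\<exists>k. \<forall>i\<ge>k. val_ge w (s i - ev l) m" by blast
  qed
qed

section \<open>Integral closure and residues\<close>

lemma poly_integral_det:
  fixes P :: "'f poly mat"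
  assumes P: "P \<in> carrier_mat n n" and "\<And>i j k. i < n \<Longrightarrow> j < n \<Longrightarrow> val_ge v (coeff (P $$ (i,j)) k) 0"
  shows "val_ge v (coeff (det P) k) 0"
proof -
  have prod: "\<forall>k. val_ge v (coeff (prod f I) k) 0"
    if "\<And>i k. i \<in> I \<Longrightarrow> val_ge v (coeff (f i) k) 0" "finite I" for f :: "nat \<Rightarrow> 'f poly" and I
    using that(2,1)
  proof (induction I)
    case (insert i I)
    then show ?case by (auto simp: coeff_mult intro!: val_ge_sum val_ge_mult_0)
  qed (simp add: val_ge_1)
  have "val_ge v (coeff (signof p * (\<Prod>i = 0..<n. P $$ (i, p i))) k) 0" if p: "p permutes {0..<n}" for p
  proof -
    have "val_ge v (coeff (\<Prod>i = 0..<n. P $$ (i, p i)) k) 0"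
      using permutes_in_image[OF p] assms(2) by (intro prod[rule_format]) auto
    then show ?thesis by (simp add: sign_def)
  qed
  then show ?thesis unfolding det_def'[OF P] coeff_sum by (intro val_ge_sum) auto
qed

text \<open>For \<open>w x < 0\<close> a monic integral equation is impossible, since its leading
  term would dominate. Conversely, an element with integral coordinates is a root of the
  characteristic polynomial of its multiplication matrix.\<close>

lemma integral_closure_eq: "integral_closure \<iota> (valuation_ring v) = valuation_ring w"
proof (intro equalityI subsetI)
  fix x assume "x \<in> integral_closure \<iota> (valuation_ring v)"
  then obtain f where f: "lead_coeff f = 1" "set (coeffs f) \<subseteq> valuation_ring v" "poly (map_poly \<iota> f) x = 0"
    by (auto simp: integral_closure_def)
  show "x \<in> valuation_ring w"
  proof (rule ccontr)
    assume "x \<notin> valuation_ring w"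
    then have x: "x \<noteq> 0" "w x < 0" by (auto simp: valuation_ring_def val_ge_def)
    define d where "d = degree f"
    have co: "val_ge v (coeff f i) 0" for i
    proof (cases "coeff f i = 0")
      case False
      then have "coeff f i \<in> set (coeffs f)" by (intro coeff_in_coeffs le_degree) auto
      then show ?thesis using f(2) by (auto simp: valuation_ring_def)
    qed simp
    have "poly (map_poly \<iota> f) x = (\<Sum>i\<le>d. \<iota> (coeff f i) * x ^ i)"
      by (simp add: poly_altdef coeff_map_poly d_def)
    also have "\<dots> = (\<Sum>i<d. \<iota> (coeff f i) * x ^ i) + x ^ d"
      using f(1) by (simp add: d_def flip: lessThan_Suc_atMost)
    finally have "x ^ d = - (\<Sum>i<d. \<iota> (coeff f i) * x ^ i)" using f(3) by (simp add: eq_neg_iff_add_eq_0 add.commute)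
    \<comment> \<open>All lower terms have value at least \<open>(int d - 1) * w x\<close>, which
      exceeds the value \<open>int d * w x\<close> of the leading term because
      \<open>w x < 0\<close>.\<close>
    moreover have "val_ge w (- (\<Sum>i<d. \<iota> (coeff f i) * x ^ i)) ((int d - 1) * w x)"
      unfolding w.val_ge_uminus
    proof (rule w.val_ge_sum)
      fix i assume i: "i \<in> {..<d}"
      have "(int d - 1) * w x \<le> int i * w x" using i x by (intro mult_right_mono_neg) auto
      then have "val_ge w (x ^ i) ((int d - 1) * w x)" using x by (simp add: val_ge_def w_power)
      then show "val_ge w (\<iota> (coeff f i) * x ^ i) ((int d - 1) * w x)"
        using co by (intro w.val_ge_mult_0) (simp_all only: val_ge_w_\<iota>_0)
    qed
    ultimately have "val_ge w (x ^ d) ((int d - 1) * w x)" by simp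
    then show False using x by (simp add: val_ge_def w_power algebra_simps)
  qed
next
  fix x assume "x \<in> valuation_ring w"
  then obtain c where c: "integral c" "x = ev c" using val_ge_w_0_iff by (auto simp: valuation_ring_def)
  define f where "f = char_poly (tm c)"
  have "lead_coeff f = 1" using degree_monic_char_poly[of "tm c" n] by (simp add: f_def)
  moreover have "set (coeffs f) \<subseteq> valuation_ring v"
  proof -
    have tc: "val_ge v (tm c $$ (i, j)) 0" if "i < n" "j < n" for i j
      using c that val_ge_mult_0[of D "c (n + i - j)" 0] by (auto simp: tm_def val_ge_def[of _ D] v_D)
    have "val_ge v (coeff f k) 0" for k
      unfolding f_def char_poly_def
      by (intro poly_integral_det)
         (auto simp: char_poly_matrix_def tc coeff_pCons val_ge_1 split: nat.splits)
    then show ?thesis by (auto simp: valuation_ring_def coeffs_def)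
  qed
  moreover have "poly (map_poly \<iota> f) x = 0"
  proof -
    have "mat_rep \<theta>s x (tm c)" using tm_rep c by simp
    interpret p: map_poly_comm_ring_hom \<iota> ..
    interpret h: comm_ring_hom "\<lambda>p. poly (map_poly \<iota> p) x"
      by unfold_locales (simp_all add: p.hom_add p.hom_mult)
    have eval_const: "poly (map_poly \<iota> [:a:]) x = \<iota> a" for a
      by (cases "a = 0") (simp_all add: map_poly_pCons)
    have "poly (map_poly \<iota> f) x = det (map_mat (\<lambda>p. poly (map_poly \<iota> p) x) (char_poly_matrix (tm c)))"
      unfolding f_def char_poly_def by (rule h.hom_det[symmetric])
    also have "map_mat (\<lambda>p. poly (map_poly \<iota> p) x) (char_poly_matrix (tm c)) =
        mat n n (\<lambda>(i,j). (if i = j then x else 0) - \<iota> (tm c $$ (i,j)))" (is "_ = ?M")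
      by (rule eq_matI) (auto simp: char_poly_matrix_def eval_const)
    \<comment> \<open>Column \<open>j\<close> of \<open>tm c\<close> holds the coordinates of
      \<open>x * \<theta> ^ j\<close>, so the vector of powers of \<open>\<theta>\<close> is
      annihilated by the transposed matrix.\<close>
    also have "det ?M = 0"
    proof -
      have M: "?M\<^sup>T \<in> carrier_mat n n" by simp
      have "?M\<^sup>T *\<^sub>v vec n (\<lambda>i. \<theta> ^ i) = 0\<^sub>v n"
      proof (rule eq_vecI)
        fix j assume "j < dim_vec (0\<^sub>v n :: 'e vec)"
        then have j: "j < n" by simp
        have "vec_index (?M\<^sup>T *\<^sub>v vec n (\<lambda>i. \<theta> ^ i)) j = (\<Sum>i<n. ((if i = j then x else 0) - \<iota> (tm c $$ (i,j))) * \<theta> ^ i)"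
          using j by (auto simp: scalar_prod_def atLeast0LessThan intro!: sum.cong)
        also have "\<dots> = x * \<theta> ^ j - ev (\<lambda>i. tm c $$ (i,j))"
          using j by (simp add: left_diff_distrib sum_subtractf ev_def if_distrib[of "\<lambda>y. y * _"] sum.delta cong: if_cong)
        also have "\<dots> = 0" using tm_rep[of c] c j by (simp add: mat_rep_def comb_\<theta>s)
        finally show "vec_index (?M\<^sup>T *\<^sub>v vec n (\<lambda>i. \<theta> ^ i)) j = vec_index (0\<^sub>v n) j" using j by simp
      qed simp
      moreover have "vec n (\<lambda>i. \<theta> ^ i) \<noteq> 0\<^sub>v n"
        using n_pos by (auto simp: vec_eq_iff intro: exI[of _ 0])
      ultimately have "det ?M\<^sup>T = 0"
        using det_0_iff_vec_prod_zero[OF M] by (intro iffD2[OF det_0_iff_vec_prod_zero[OF M]] bexI[of _ "vec n (\<lambda>i. \<theta> ^ i)"] exI[of _ "vec n (\<lambda>i. \<theta> ^ i)"]) auto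
      then show ?thesis using det_transpose[of ?M n] by simp
    qed
    finally show ?thesis .
  qed
  ultimately show "x \<in> integral_closure \<iota> (valuation_ring v)" by (auto simp: integral_closure_def)
qed

lemma residue_eq:
  assumes "val_ge w (x - \<iota> a) 1"
  shows "residue v \<iota> x = {u \<in> valuation_ring v. val_ge v (a - u) 1}"
proof -
  have "val_ge w (x - \<iota> u) 1 \<longleftrightarrow> val_ge v (a - u) 1" for u
  proof -
    have "val_ge w (x - \<iota> u) 1 \<longleftrightarrow> val_ge w (\<iota> (a - u)) 1"
      using w.val_ge_diff[of "x - \<iota> u" 1 "x - \<iota> a"] w.val_ge_add[of "\<iota> (a - u)" 1 "x - \<iota> a"] assms by auto
    then show ?thesis by (simp only: val_ge_w_\<iota>_1)
  qed
  then show ?thesis by (simp add: residue_def integral_closure_eq w.nonunits_valuation_ring)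
qed

lemma residue_res_class:
  assumes "val_ge v a 0" "val_ge w (x - \<iota> a) 1"
  shows "residue v \<iota> x = res_class a"
proof -
  have "val_ge v u 0" if "val_ge v (a - u) 1" for u
    using val_ge_diff[OF assms(1) val_ge_mono[OF that, of 0]] by simp
  then show ?thesis unfolding residue_eq[OF assms(2)] by (auto simp: res_class_def valuation_ring_def)
qed

end

section \<open>Digit expansions\<close>

text \<open>In the application \<open>S\<close> consists of the images of 0 and of the powers of
  \<open>\<zeta>\<close>, and \<open>t\<close> is the image of \<open>\<zeta>\<close>. Closure of
  the digits under \<open>t\<close> makes truncated expansions stable under \<open>t\<close>, as the
  sign cancellation requires.\<close>

locale digit_system = valued_field w for w :: "'e::field \<Rightarrow> int" +
  fixes \<theta> :: 'e and S :: "'e set" and t :: 'e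
  assumes \<theta>: "\<theta> \<noteq> 0" "w \<theta> = 1"
    and S: "finite S" "0 \<in> S" "\<And>s. s \<in> S \<Longrightarrow> val_ge w s 0"
    and digit_ex: "\<And>x. val_ge w x 0 \<Longrightarrow> \<exists>s\<in>S. val_ge w (x - s) 1"
    and digit_unique: "\<And>s s'. s \<in> S \<Longrightarrow> s' \<in> S \<Longrightarrow> val_ge w (s - s') 1 \<Longrightarrow> s = s'"
    and t: "t \<noteq> 0" "w t = 0" "\<And>s. s \<in> S \<Longrightarrow> t * s \<in> S"
begin

text \<open>Truncated expansions with digits at positions \<open>a\<close> to
  \<open>a + l - 1\<close>: representatives of the elements of value at least \<open>a\<close>
  modulo those of value at least \<open>a + l\<close>.\<close>

primrec reps :: "nat \<Rightarrow> int \<Rightarrow> 'e set" where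
  "reps 0 a = {0}"
| "reps (Suc l) a = (\<lambda>(s, y). s * \<theta> powi a + y) ` (S \<times> reps l (a + 1))"

lemma val_ge_\<theta>_powi_mult: "val_ge w (x * \<theta> powi a) (k + a) \<longleftrightarrow> val_ge w x k"
  using \<theta> by (cases "x = 0") (auto simp: val_ge_def v_mult v_powi)

lemma finite_reps: "finite (reps l a)"
  by (induction l arbitrary: a) (auto simp: S)

lemma reps_ge: "y \<in> reps l a \<Longrightarrow> val_ge w y a"
proof (induction l arbitrary: a y)
  case (Suc l)
  then obtain s z where sz: "s \<in> S" "z \<in> reps l (a + 1)" "y = s * \<theta> powi a + z" by auto
  have "val_ge w (s * \<theta> powi a) a" using val_ge_\<theta>_powi_mult[of s a 0] S(3)[OF sz(1)] by simp
  then show ?case unfolding sz(3) by (intro val_ge_add val_ge_mono[OF Suc.IH[OF sz(2)]]) auto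
qed simp

lemma reps_ex: "val_ge w x a \<Longrightarrow> \<exists>r\<in>reps l a. val_ge w (x - r) (a + int l)"
proof (induction l arbitrary: a x)
  case (Suc l)
  define x' where "x' = x * \<theta> powi (- a)"
  have "val_ge w x' 0"
    using val_ge_\<theta>_powi_mult[of x "- a" a] Suc.prems by (simp add: x'_def)
  then obtain s where s: "s \<in> S" "val_ge w (x' - s) 1" using digit_ex by blast
  have "x' * \<theta> powi a = x"
    using \<theta> by (simp add: x'_def power_int_minus)
  then have "val_ge w (x - s * \<theta> powi a) (a + 1)"
    using val_ge_\<theta>_powi_mult[of "x' - s" a 1] s(2) by (simp add: left_diff_distrib add.commute)
  from Suc.IH[OF this] obtain r where "r \<in> reps l (a + 1)" "val_ge w (x - s * \<theta> powi a - r) (a + 1 + int l)" by blast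
  then show ?case using s by (intro bexI[of _ "s * \<theta> powi a + r"]) (auto simp: algebra_simps)
qed auto

lemma reps_head_unique:
  assumes "s \<in> S" "s' \<in> S" "val_ge w y (a + 1)" "val_ge w y' (a + 1)"
    and "val_ge w (s * \<theta> powi a + y - (s' * \<theta> powi a + y')) (a + 1)"
  shows "s = s'"
proof -
  have "val_ge w ((s * \<theta> powi a + y - (s' * \<theta> powi a + y')) - (y - y')) (a + 1)"
    using assms by (intro val_ge_diff[OF assms(5)] val_ge_diff) auto
  then have "val_ge w ((s - s') * \<theta> powi a) (1 + a)" by (simp add: algebra_simps)
  then show ?thesis using digit_unique assms val_ge_\<theta>_powi_mult by blast
qed

lemma reps_unique: "r \<in> reps l a \<Longrightarrow> r' \<in> reps l a \<Longrightarrow> val_ge w (r - r') (a + int l) \<Longrightarrow> r = r'"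
proof (induction l arbitrary: a r r')
  case (Suc l)
  then obtain s y s' y' where *: "s \<in> S" "y \<in> reps l (a + 1)" "r = s * \<theta> powi a + y"
    "s' \<in> S" "y' \<in> reps l (a + 1)" "r' = s' * \<theta> powi a + y'" by auto
  have "val_ge w (r - r') (a + 1)" by (rule val_ge_mono[OF Suc.prems(3)]) simp
  then have "s = s'" using * reps_head_unique[of s s' y a y'] reps_ge by blast
  moreover have "y = y'"
    using Suc.prems(3) * \<open>s = s'\<close> by (intro Suc.IH[of y "a + 1" y']) (auto simp: algebra_simps)
  ultimately show ?case using * by simp
qed simp

lemma card_reps: "card (reps l a) = card S ^ l"
proof (induction l arbitrary: a)
  case (Suc l)
  have "inj_on (\<lambda>(s, y). s * \<theta> powi a + y) (S \<times> reps l (a + 1))"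
  proof (rule inj_onI, clarify)
    fix s y s' y'
    assume *: "s \<in> S" "y \<in> reps l (a + 1)" "s' \<in> S" "y' \<in> reps l (a + 1)"
      "s * \<theta> powi a + y = s' * \<theta> powi a + y'"
    then have "s = s'" using reps_head_unique[of s s' y a y'] reps_ge by simp
    then show "s = s' \<and> y = y'" using * by simp
  qed
  then show ?case using Suc by (simp add: card_image card_cartesian_product)
qed simp

text \<open>By uniqueness of the leading digit, an expansion of value at least \<open>c\<close> has
  zero digits below position \<open>c\<close>.\<close>

lemma reps_filter:
  "a \<le> c \<Longrightarrow> c \<le> a + int l \<Longrightarrow> {r \<in> reps l a. val_ge w r c} = reps (nat (a + int l - c)) c"
proof (induction l arbitrary: a)
  case (Suc l)
  show ?case
  proof (cases "c = a")
    case True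
    moreover have "nat (a + int (Suc l) - a) = Suc l" by simp
    ultimately show ?thesis using reps_ge[of _ "Suc l" a] by (auto simp del: reps.simps)
  next
    case False
    have "{r \<in> reps (Suc l) a. val_ge w r c} = {r \<in> reps l (a + 1). val_ge w r c}"
    proof (intro equalityI subsetI)
      fix r assume "r \<in> {r \<in> reps (Suc l) a. val_ge w r c}"
      then obtain s y where *: "s \<in> S" "y \<in> reps l (a + 1)" "r = s * \<theta> powi a + y" "val_ge w r c" by auto
      have "val_ge w (r - 0) (a + 1)" using val_ge_mono[OF *(4), of "a + 1"] Suc.prems False by simp
      then have "s = 0" using reps_head_unique[of s 0 y a 0] * reps_ge[OF *(2)] S by simp
      then show "r \<in> {r \<in> reps l (a + 1). val_ge w r c}" using * by simp
    next
      fix r assume "r \<in> {r \<in> reps l (a + 1). val_ge w r c}"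
      then show "r \<in> {r \<in> reps (Suc l) a. val_ge w r c}"
        using S(2) by (auto intro!: image_eqI[of _ _ "(0, r)"])
    qed
    also have "\<dots> = reps (nat (a + 1 + int l - c)) c"
      using Suc.prems False by (intro Suc.IH) auto
    finally show ?thesis by (simp add: algebra_simps)
  qed
qed auto

lemma t_mult_reps: "y \<in> reps l a \<Longrightarrow> t * y \<in> reps l a"
proof (induction l arbitrary: a y)
  case (Suc l)
  then obtain s z where "s \<in> S" "z \<in> reps l (a + 1)" "y = s * \<theta> powi a + z" by auto
  then have "t * y = (t * s) * \<theta> powi a + t * z" "t * s \<in> S" "t * z \<in> reps l (a + 1)"
    using Suc.IH t(3) by (simp_all add: distrib_left mult.assoc)
  then show ?case by force
qed simp

text \<open>Multiplication by the unit \<open>t\<close> permutes the index set, so the sum equals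
  its own negative.\<close>

lemma sum_reps_cancel:
  fixes f :: "'e \<Rightarrow> 'c::field_char_0"
  assumes "\<And>y. y \<in> reps l a \<Longrightarrow> \<not> val_ge w y c \<Longrightarrow> f (t * y) = - f y"
  shows "sum f {y \<in> reps l a. \<not> val_ge w y c} = 0"
proof -
  let ?R = "{y \<in> reps l a. \<not> val_ge w y c}"
  have fin: "finite ?R" using finite_reps by simp
  have inj: "inj_on ((*) t) ?R" using t by (auto simp: inj_on_def)
  have "val_ge w (t * y) c \<longleftrightarrow> val_ge w y c" for y
    using t by (cases "y = 0") (auto simp: val_ge_def v_mult)
  then have "(*) t ` ?R \<subseteq> ?R" using t_mult_reps by auto
  then have im: "(*) t ` ?R = ?R" by (rule endo_inj_surj[OF fin _ inj])
  have "sum f ?R = sum f ((*) t ` ?R)" by (simp only: im)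
  also have "\<dots> = (\<Sum>y\<in>?R. f (t * y))" using inj by (simp add: sum.reindex)
  also have "\<dots> = (\<Sum>y\<in>?R. - f y)" using assms by (intro sum.cong) auto
  finally have "sum f ?R = - sum f ?R" by (simp add: sum_negf)
  then show ?thesis by (simp add: eq_neg_iff_add_eq_0 flip: mult_2)
qed

end

section \<open>Roots of unity in the base field and the character \<open>\<eta>\<close>\<close>

locale local_field_char = valued_field v for v :: "'f::field \<Rightarrow> int" +
  fixes q :: nat and \<pi> \<zeta> :: 'f and i1 :: complex and \<eta> :: "'f \<Rightarrow> complex"
  assumes complete: "\<And>s :: nat \<Rightarrow> 'f. (\<forall>n. \<exists>k. \<forall>i\<ge>k. \<forall>j\<ge>k. val_ge v (s i - s j) n) \<Longrightarrow>
        (\<exists>l. \<forall>n. \<exists>k. \<forall>i\<ge>k. val_ge v (s i - l) n)"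
    and finite_residue: "finite (carrier (residue_field v))"
    and q: "q = card (carrier (residue_field v))" "4 dvd q - 1"
    and \<pi>: "\<pi> \<noteq> 0" "v \<pi> = 1"
    and \<zeta>: "\<zeta> ^ (q - 1) = 1" "\<And>k. 0 < k \<Longrightarrow> k < q - 1 \<Longrightarrow> \<zeta> ^ k \<noteq> 1"
    and i1: "i1 ^ 2 = -1"
    and \<eta>_nonzero: "\<And>x. x \<noteq> 0 \<Longrightarrow> \<eta> x \<noteq> 0"
    and \<eta>_mult: "\<And>x y. x \<noteq> 0 \<Longrightarrow> y \<noteq> 0 \<Longrightarrow> \<eta> (x * y) = \<eta> x * \<eta> y"
    and \<eta>_one_units: "\<And>x. val_ge v x 1 \<Longrightarrow> \<eta> (1 + x) = 1" and \<eta>_\<zeta>: "\<eta> \<zeta> = i1"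
begin

text \<open>The subtraction in \<open>q - 1\<close> is that of natural numbers, so
  \<open>4 dvd q - 1\<close> alone would allow \<open>q \<le> 1\<close>; the distinct classes of 0
  and 1 exclude this.\<close>

lemma q_ge: "5 \<le> q"
proof -
  have "res_class 0 \<noteq> res_class 1" by (simp add: res_class_eq_iff val_ge_1)
  moreover have "res_class 0 \<in> carrier (residue_field v)" "res_class 1 \<in> carrier (residue_field v)"
    by (auto simp: carrier_residue_field valuation_ring_def val_ge_1)
  ultimately have "2 \<le> q" unfolding q(1)
    using card_mono[OF finite_residue, of "{res_class 0, res_class 1}"] by simp
  then show ?thesis using dvd_imp_le[OF q(2)] by simp
qed

lemma \<zeta>_nonzero [simp]: "\<zeta> \<noteq> 0"
  using \<zeta>(1) q_ge by (auto simp: power_0_left)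

lemma v_\<zeta>: "v \<zeta> = 0"
  using v_power[of \<zeta> "q - 1"] \<zeta>(1) q_ge by simp

lemma \<zeta>_square: "\<zeta> ^ 2 \<noteq> 1"
  using \<zeta>(2)[of 2] q_ge by simp

text \<open>A primitive fourth root of unity. With it, one root of
  \<open>X ^ 4 + \<zeta> * \<pi>\<close> generates the other three.\<close>

definition i0 :: 'f where "i0 = \<zeta> ^ ((q - 1) div 4)"

lemma i0_square: "i0 ^ 2 = -1"
proof -
  have *: "(q - 1) div 4 * 4 = q - 1" using q(2) by simp
  have "(i0 ^ 2) ^ 2 = 1" using \<zeta>(1) * by (simp only: i0_def mult.commute[of _ 2] flip: power_mult) (simp add: mult.commute)
  moreover have "i0 ^ 2 \<noteq> 1"
    unfolding i0_def using \<zeta>(2)[of "(q - 1) div 4 * 2"] * q_ge by (simp flip: power_mult)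
  ultimately show ?thesis using square_eq_1_iff[of "i0 ^ 2"] by (simp add: power2_eq_square)
qed

text \<open>Otherwise the geometric sum of the \<open>x ^ i\<close> over \<open>i < q - 1\<close>
  vanishes, although each term is congruent to 1 and the sum therefore to \<open>q - 1\<close>, that
  is, to -1.\<close>

lemma root_of_unity_near_1:
  assumes "x ^ (q - 1) = 1" "val_ge v (x - 1) 1"
  shows "x = 1"
proof (rule ccontr)
  assume "x \<noteq> 1"
  have x0: "val_ge v x 0" using val_ge_add[OF val_ge_mono[OF assms(2), of 0], of 1] by (simp add: val_ge_1)
  have "(x - 1) * (\<Sum>i<q - 1. x ^ i) = 0" using assms(1) by (simp flip: power_diff_1_eq)
  then have 0: "(\<Sum>i<q - 1. x ^ i) = 0" using \<open>x \<noteq> 1\<close> by simp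
  have p1: "val_ge v (x ^ i - 1) 1" for i
    using prod_cong_val[of "{..<i}" "\<lambda>_. x" "\<lambda>_. 1" 1] assms(2) x0 by (simp add: val_ge_1)
  have "val_ge v (\<Sum>i<q - 1. x ^ i - 1) 1" using p1 by (intro val_ge_sum)
  then have "val_ge v (- of_nat (q - 1)) 1" unfolding sum_subtractf 0 by simp
  moreover have "val_ge v (of_nat q) 1" unfolding q(1) by (rule card_residue_field_in_nonunits)
  ultimately have "val_ge v (- of_nat (q - 1) + of_nat q) 1" by (rule val_ge_add)
  moreover have "(of_nat q :: 'f) = of_nat (q - 1) + 1" using q_ge by (simp add: of_nat_diff)
  ultimately show False by (simp add: val_ge_1)
qed

text \<open>The Teichmueller representatives of the residue field.\<close>

definition digits :: "'f set" where "digits = insert 0 ((\<lambda>k. \<zeta> ^ k) ` {..<q - 1})"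

lemma digits_integral: "s \<in> digits \<Longrightarrow> val_ge v s 0"
  using v_\<zeta> by (auto simp: digits_def val_ge_def v_power)

lemma \<zeta>_power_unique: "i < q - 1 \<Longrightarrow> j < q - 1 \<Longrightarrow> val_ge v (\<zeta> ^ i - \<zeta> ^ j) 1 \<Longrightarrow> i = j"
proof (induction i j rule: linorder_wlog)
  case (le i j)
  have "val_ge v (inverse (\<zeta> ^ i) * (\<zeta> ^ j - \<zeta> ^ i)) 1"
    using le v_\<zeta> by (intro val_ge_mult_0) (auto simp: val_ge_def[of _ "inverse _"] v_inverse v_power val_ge_minus_commute)
  moreover have "inverse (\<zeta> ^ i) * (\<zeta> ^ j - \<zeta> ^ i) = \<zeta> ^ (j - i) - 1"
    using le by (simp add: right_diff_distrib power_diff divide_inverse mult.commute)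
  moreover have "(\<zeta> ^ (j - i)) ^ (q - 1) = 1"
    using \<zeta>(1) by (metis mult.commute power_mult power_one)
  ultimately have "\<zeta> ^ (j - i) = 1" using root_of_unity_near_1 by simp
  then show ?case using \<zeta>(2)[of "j - i"] le by (cases "i = j") auto
next
  case (sym i j)
  then show ?case by (metis val_ge_minus_commute)
qed

lemma digits_unique:
  assumes "s \<in> digits" "s' \<in> digits" "val_ge v (s - s') 1"
  shows "s = s'"
proof -
  have *: "\<not> val_ge v (\<zeta> ^ k) 1" for k using v_\<zeta> by (simp add: val_ge_def v_power)
  show ?thesis using assms *  \<zeta>_power_unique by (auto simp: digits_def)
qed

lemma card_digits: "card digits = q"
proof -
  have "inj_on (\<lambda>k. \<zeta> ^ k) {..<q - 1}" using \<zeta>_power_unique by (auto simp: inj_on_def)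
  then have "card ((\<lambda>k. \<zeta> ^ k) ` {..<q - 1}) = q - 1" by (simp add: card_image)
  moreover have "0 \<notin> (\<lambda>k. \<zeta> ^ k) ` {..<q - 1}" by auto
  ultimately show ?thesis using q_ge by (simp add: digits_def)
qed

text \<open>A counting argument in place of Hensel's lemma: the \<open>q\<close> digits are pairwise
  incongruent, and the residue field has \<open>q\<close> elements.\<close>

lemma digits_ex:
  assumes "val_ge v a 0"
  shows "\<exists>s\<in>digits. val_ge v (a - s) 1"
proof -
  have "inj_on res_class digits" using digits_unique by (auto simp: inj_on_def res_class_eq_iff)
  then have "card (res_class ` digits) = card (carrier (residue_field v))"
    using card_digits q(1) by (simp add: card_image)
  moreover have "res_class ` digits \<subseteq> carrier (residue_field v)"
    using digits_integral by (auto simp: carrier_residue_field valuation_ring_def)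
  ultimately have "res_class ` digits = carrier (residue_field v)"
    using finite_residue by (intro card_subset_eq) auto
  moreover have "res_class a \<in> carrier (residue_field v)"
    using assms by (auto simp: carrier_residue_field valuation_ring_def)
  ultimately have "res_class a \<in> res_class ` digits" by simp
  then show ?thesis by (auto simp: res_class_eq_iff)
qed

lemma digits_\<zeta>: "s \<in> digits \<Longrightarrow> \<zeta> * s \<in> digits"
proof -
  assume "s \<in> digits"
  moreover have "\<zeta> * \<zeta> ^ k \<in> digits" if "k < q - 1" for k
  proof (cases "Suc k = q - 1")
    case True
    then have "\<zeta> * \<zeta> ^ k = \<zeta> ^ 0" using \<zeta>(1) by (simp flip: power_Suc)
    moreover have "\<zeta> ^ 0 \<in> digits" unfolding digits_def using q_ge by (intro insertI2 imageI) auto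
    ultimately show ?thesis by simp
  next
    case False
    then have "\<zeta> ^ Suc k \<in> digits" unfolding digits_def using that by (intro insertI2 imageI) auto
    then show ?thesis by simp
  qed
  ultimately show ?thesis by (auto simp: digits_def)
qed

lemma unit_cases:
  assumes "a \<noteq> 0" "v a = 0"
  obtains k where "val_ge v (a - \<zeta> ^ k) 1"
proof -
  obtain s where s: "s \<in> digits" "val_ge v (a - s) 1" using digits_ex[of a] assms by (auto simp: val_ge_def)
  then have "s \<noteq> 0" using assms by (auto simp: val_ge_def)
  then show ?thesis using that s by (auto simp: digits_def)
qed

lemma \<eta>_1 [simp]: "\<eta> 1 = 1"
  using \<eta>_one_units[of 0] by simp

lemma \<eta>_power: "x \<noteq> 0 \<Longrightarrow> \<eta> (x ^ k) = \<eta> x ^ k"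
  by (induction k) (simp_all add: \<eta>_mult)

lemma \<eta>_close:
  assumes "b \<noteq> 0" "v b = 0" "val_ge v (a - b) 1"
  shows "\<eta> a = \<eta> b"
proof -
  have "a \<noteq> 0" using assms by (auto simp: val_ge_def)
  have "val_ge v (inverse b * (a - b)) 1"
    using assms by (intro val_ge_mult_0) (auto simp: val_ge_def[of _ "inverse b"] v_inverse)
  from \<eta>_one_units[OF this] have "\<eta> (a / b) = 1" using assms by (simp add: field_simps)
  moreover have "a = a / b * b" using assms by simp
  ultimately show ?thesis using \<eta>_mult[of "a / b" b] \<open>a \<noteq> 0\<close> assms by (metis divide_eq_0_iff mult_1)
qed

text \<open>Modulo the maximal ideal a unit is a power \<open>\<zeta> ^ k\<close>, so that
  \<open>\<eta>\<close> takes the value \<open>i1 ^ k\<close> on it, a fourth root of unity.\<close>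

lemma \<eta>_unit_power4:
  assumes "a \<noteq> 0" "v a = 0"
  shows "\<eta> (a ^ 4) = 1"
proof -
  obtain k where "val_ge v (a - \<zeta> ^ k) 1" using unit_cases assms by blast
  then have "\<eta> a = i1 ^ k" using \<eta>_close[of "\<zeta> ^ k" a] v_\<zeta> by (simp add: v_power \<eta>_power \<eta>_\<zeta>)
  moreover have "i1 ^ 4 = 1" using i1 power_mult[of i1 2 2] by simp
  ultimately show ?thesis using assms by (simp add: \<eta>_power) (metis mult.commute power_mult power_one)
qed

end

section \<open>Two by two matrices\<close>

definition mk :: "'a \<Rightarrow> 'a \<Rightarrow> 'a \<Rightarrow> 'a \<Rightarrow> 'a mat" where
  "mk a b c d = mat 2 2 (\<lambda>(i,j). if i = 0 then if j = 0 then a else b else if j = 0 then c else d)"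

lemma mk_carrier [simp]: "mk a b c d \<in> carrier_mat 2 2"
  by (simp add: mk_def)

lemma mk_dim [simp]: "dim_row (mk a b c d) = 2" "dim_col (mk a b c d) = 2"
  by (simp_all add: mk_def)

lemma mk_index [simp]: "mk a b c d $$ (0,0) = a" "mk a b c d $$ (0,Suc 0) = b"
  "mk a b c d $$ (Suc 0,0) = c" "mk a b c d $$ (Suc 0,Suc 0) = d"
  by (simp_all add: mk_def)

lemma mk_eq_iff [simp]: "mk a b c d = mk a' b' c' d' \<longleftrightarrow> a = a' \<and> b = b' \<and> c = c' \<and> d = d'"
  by (metis mk_index)

lemma mat2_cases:
  assumes "A \<in> carrier_mat 2 2"
  obtains a b c d where "A = mk a b c d"
proof -
  have "A = mk (A $$ (0,0)) (A $$ (0,1)) (A $$ (1,0)) (A $$ (1,1))"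
    using assms by (intro eq_matI) (auto simp: mk_def less_2_cases_iff)
  then show ?thesis using that by blast
qed

lemma mk_mult [simp]: "mk a b c d * mk a' b' c' d' =
    mk (a * a' + b * c') (a * b' + b * d') (c * a' + d * c') (c * b' + d * d' :: 'a :: comm_ring_1)"
  by (rule eq_matI) (auto simp: less_2_cases_iff scalar_prod_def mk_def numeral_2_eq_2)

lemma one_mat_2: "1\<^sub>m 2 = mk 1 0 0 (1 :: 'a :: comm_ring_1)"
  by (rule eq_matI) (auto simp: less_2_cases_iff mk_def)

lemma det_mk [simp]: "det (mk a b c d) = a * d - b * (c :: 'a :: comm_ring_1)"
proof -
  have *: "mat_delete (mk a b c d) 0 0 \<in> carrier_mat 1 1" "mat_delete (mk a b c d) 0 1 \<in> carrier_mat 1 1"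
    by (auto simp: mat_delete_def)
  have "det (mk a b c d) = (\<Sum>j<2. mk a b c d $$ (0,j) * cofactor (mk a b c d) 0 j)"
    by (rule laplace_expansion_row[of _ 2]) auto
  also have "\<dots> = a * cofactor (mk a b c d) 0 0 + b * cofactor (mk a b c d) 0 1"
    by (simp add: numeral_2_eq_2)
  also have "\<dots> = a * d - b * c"
    using det_single[OF *(1)] det_single[OF *(2)] by (simp add: cofactor_def mat_delete_def)
  finally show ?thesis .
qed

lemma diagonal_mk: "diagonal_mat (mk a b c d) \<longleftrightarrow> b = 0 \<and> c = 0"
  by (auto simp: diagonal_mat_def mk_def numeral_2_eq_2 less_Suc_eq)

context local_field_char
begin

lemma digit_system_radical:
  assumes "radical_extension v \<iota> n D \<theta>"
  shows "digit_system (radical_extension.w v \<iota>) \<theta> (\<iota> ` digits) (\<iota> \<zeta>)"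
proof -
  interpret E: radical_extension v \<iota> n D \<theta> by (rule assms)
  show ?thesis
  proof
  show "finite (\<iota> ` digits)" by (simp add: digits_def)
  show "0 \<in> \<iota> ` digits" by (rule image_eqI[of _ _ 0]) (simp_all add: digits_def)
  show "val_ge E.w s 0" if "s \<in> \<iota> ` digits" for s
    using that digits_integral by (auto simp: E.val_ge_w_\<iota>_0)
  show "\<exists>s\<in>\<iota> ` digits. val_ge E.w (x - s) 1" if x: "val_ge E.w x 0" for x
  proof -
    obtain a where a: "val_ge v a 0" "val_ge E.w (x - \<iota> a) 1" using E.ex_reduction[OF x] by blast
    obtain s where s: "s \<in> digits" "val_ge v (a - s) 1" using digits_ex a by blast
    then have "val_ge E.w (\<iota> (a - s)) 1" by (simp only: E.val_ge_w_\<iota>_1)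
    from E.w.val_ge_add[OF a(2) this] have "val_ge E.w (x - \<iota> s) 1" by simp
    then show ?thesis using s by blast
  qed
  show "s = s'" if s: "s \<in> \<iota> ` digits" "s' \<in> \<iota> ` digits" "val_ge E.w (s - s') 1" for s s'
  proof -
    obtain a a' where a: "a \<in> digits" "a' \<in> digits" "s = \<iota> a" "s' = \<iota> a'" using s(1,2) by blast
    then have "val_ge E.w (\<iota> (a - a')) 1" using s(3) by simp
    then have "a = a'" using digits_unique a by (simp only: E.val_ge_w_\<iota>_1)
    then show ?thesis using a by simp
  qed
  show "\<iota> \<zeta> * s \<in> \<iota> ` digits" if "s \<in> \<iota> ` digits" for s
    using that digits_\<zeta> by (metis (no_types, lifting) E.hom_mult image_iff)
qed (simp_all add: E.w_\<theta> E.w_\<iota> v_\<zeta>)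
qed

end

section \<open>The group\<close>

text \<open>The predicate \<open>P\<close>, applied to the determinant of the first component and to the second component,
  singles out \<open>K\<close> inside \<open>K_st\<close>: it is trivial for \<open>K_st\<close> itself and a condition on residues for \<open>K_par\<close>.\<close>

locale hecke_setup = local_field_char v q \<pi> \<zeta> i1 \<eta> +
    E2: radical_extension v \<iota>2 2 "- \<pi>" \<theta>2 + E4: radical_extension v \<iota>4 4 "- (\<zeta> * \<pi>)" \<theta>4
  for v :: "'f::field \<Rightarrow> int" and q :: nat and \<pi> \<zeta> :: 'f and i1 :: complex and \<eta> :: "'f \<Rightarrow> complex"
    and \<iota>2 :: "'f \<Rightarrow> 'e2::field" and \<theta>2 :: 'e2 and \<iota>4 :: "'f \<Rightarrow> 'e4::field" and \<theta>4 :: 'e4 +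
  fixes P :: "'e2 \<Rightarrow> 'e4 \<Rightarrow> bool"
  assumes P_mult: "\<And>x y x' y'. x \<noteq> 0 \<Longrightarrow> E2.w x = 0 \<Longrightarrow> x' \<noteq> 0 \<Longrightarrow> E2.w x' = 0 \<Longrightarrow>
        y \<noteq> 0 \<Longrightarrow> E4.w y = 0 \<Longrightarrow> y' \<noteq> 0 \<Longrightarrow> E4.w y' = 0 \<Longrightarrow> P x y \<Longrightarrow> P x' y' \<Longrightarrow> P (x * x') (y * y')"
    and P_inverse: "\<And>x y. x \<noteq> 0 \<Longrightarrow> E2.w x = 0 \<Longrightarrow> y \<noteq> 0 \<Longrightarrow> E4.w y = 0 \<Longrightarrow> P x y \<Longrightarrow> P (inverse x) (inverse y)"
    and P_near_1: "\<And>x y. val_ge E2.w (x - 1) 1 \<Longrightarrow> val_ge E4.w (y - 1) 1 \<Longrightarrow> P x y"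
begin

abbreviation G where "G \<equiv> G0 \<iota>2 \<iota>4"
abbreviation N2 where "N2 \<equiv> ext_norm \<iota>2"
abbreviation N4 where "N4 \<equiv> ext_norm \<iota>4"
abbreviation \<rho> where "\<rho> \<equiv> rho0 \<eta> \<iota>2"

definition \<rho>2 :: "'e2 \<Rightarrow> complex" where "\<rho>2 x = \<eta> (N2 x)"

lemma \<rho>2_mult: "x \<noteq> 0 \<Longrightarrow> y \<noteq> 0 \<Longrightarrow> \<rho>2 (x * y) = \<rho>2 x * \<rho>2 y"
  by (simp add: \<rho>2_def E2.ext_norm_mult \<eta>_mult E2.ext_norm_nonzero)

lemma \<rho>2_1 [simp]: "\<rho>2 1 = 1"
  by (simp add: \<rho>2_def)

lemma \<rho>2_nonzero: "x \<noteq> 0 \<Longrightarrow> \<rho>2 x \<noteq> 0"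
  by (simp add: \<rho>2_def \<eta>_nonzero E2.ext_norm_nonzero)

lemma unit_reduction2:
  assumes "x \<noteq> 0" "E2.w x = 0"
  obtains a where "a \<noteq> 0" "v a = 0" "val_ge E2.w (x - \<iota>2 a) 1"
proof -
  obtain a where a: "val_ge v a 0" "val_ge E2.w (x - \<iota>2 a) 1"
    using E2.ex_reduction[of x] assms by (auto simp: val_ge_def)
  then have "\<iota>2 a \<noteq> 0 \<and> E2.w (\<iota>2 a) = 0" using E2.w.val_eq_of_close[of x "\<iota>2 a"] assms by simp
  then show ?thesis using that a by (auto simp: E2.w_\<iota>)
qed

lemma \<rho>2_reduction:
  assumes "a \<noteq> 0" "v a = 0" "val_ge E2.w (x - \<iota>2 a) 1"
  shows "\<rho>2 x = \<eta> (a ^ 2)"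
  unfolding \<rho>2_def using E2.ext_norm_reduction[of a x] assms
  by (intro \<eta>_close) (auto simp: val_ge_def[of _ a] v_power)

lemma \<rho>2_close:
  assumes "x \<noteq> 0" "E2.w x = 0" "val_ge E2.w (x - y) 1"
  shows "\<rho>2 x = \<rho>2 y"
proof -
  obtain a where a: "a \<noteq> 0" "v a = 0" "val_ge E2.w (x - \<iota>2 a) 1" using unit_reduction2[OF assms(1,2)] by blast
  have "val_ge E2.w (y - \<iota>2 a) 1" using E2.w.val_ge_diff[OF a(3) assms(3)] by simp
  then show ?thesis using \<rho>2_reduction a by simp
qed

lemma \<rho>2_square:
  assumes "x \<noteq> 0" "E2.w x = 0"
  shows "\<rho>2 x * \<rho>2 x = 1"
proof -
  obtain a where a: "a \<noteq> 0" "v a = 0" "val_ge E2.w (x - \<iota>2 a) 1" using unit_reduction2[OF assms] by blast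
  have "\<rho>2 x * \<rho>2 x = \<eta> (a ^ 2 * a ^ 2)" using \<rho>2_reduction[OF a] a \<eta>_mult[of "a ^ 2" "a ^ 2"] by simp
  also have "a ^ 2 * a ^ 2 = a ^ 4" by (simp flip: power_add)
  also have "\<eta> (a ^ 4) = 1" by (rule \<eta>_unit_power4[OF a(1,2)])
  finally show ?thesis .
qed

text \<open>\<open>\<zeta>\<close> has norm \<open>\<zeta> ^ 2\<close> from the quadratic extension,
  and \<open>\<eta>\<close> maps this to \<open>i1 ^ 2\<close>. This sign drives both the
  cancellation in convolutions and the non-triviality of the cocycle.\<close>

lemma \<rho>2_\<zeta>: "\<rho>2 (\<iota>2 \<zeta>) = - 1" "\<rho>2 (inverse (\<iota>2 \<zeta>)) = - 1"
proof -
  show 1: "\<rho>2 (\<iota>2 \<zeta>) = - 1"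
    using i1 by (simp add: \<rho>2_def E2.ext_norm_\<iota> \<eta>_power \<eta>_\<zeta>)
  show "\<rho>2 (inverse (\<iota>2 \<zeta>)) = - 1"
    using \<rho>2_mult[of "\<iota>2 \<zeta>" "inverse (\<iota>2 \<zeta>)"] by (simp add: 1 minus_equation_iff[of _ 1])
qed

lemma \<eta>_N4_unit:
  assumes "z \<noteq> 0" "E4.w z = 0"
  shows "\<eta> (N4 z) = 1"
proof -
  obtain a where a: "val_ge v a 0" "val_ge E4.w (z - \<iota>4 a) 1"
    using E4.ex_reduction[of z] assms by (auto simp: val_ge_def)
  then have "\<iota>4 a \<noteq> 0 \<and> E4.w (\<iota>4 a) = 0" using E4.w.val_eq_of_close[of z "\<iota>4 a"] assms by simp
  then have a0: "a \<noteq> 0" "v a = 0" by (auto simp: E4.w_\<iota>)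
  have "\<eta> (N4 z) = \<eta> (a ^ 4)"
    using E4.ext_norm_reduction[OF a] a0 by (intro \<eta>_close) (auto simp: v_power)
  then show ?thesis using \<eta>_unit_power4[OF a0] by simp
qed

lemma w_\<zeta>: "E2.w (\<iota>2 \<zeta>) = 0"
  by (simp add: E2.w_\<iota> v_\<zeta>)

lemma G_iff [simp]: "(mk a b c d, z) \<in> carrier G \<longleftrightarrow>
    a * d - b * c \<noteq> 0 \<and> z \<noteq> 0 \<and> N2 (a * d - b * c) * N4 z = 1"
  by (simp add: G0_def)

lemma G_cases:
  assumes "g \<in> carrier G"
  obtains a b c d z where "g = (mk a b c d, z)"
  using assms by (auto simp: G0_def elim: mat2_cases)

lemma G_mult [simp]: "(A, z) \<otimes>\<^bsub>G\<^esub> (B, u) = (A * B, z * u)"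
  by (simp add: G0_def)

lemma G_one [simp]: "\<one>\<^bsub>G\<^esub> = (mk 1 0 0 1, 1)"
  by (simp add: G0_def one_mat_2)

lemma inverse_det_2:
  fixes a b c d :: "'x::field"
  assumes "a * d - b * c \<noteq> 0"
  shows "d / (a * d - b * c) * (a / (a * d - b * c)) - (- b / (a * d - b * c)) * (- c / (a * d - b * c))
      = inverse (a * d - b * c)"
proof -
  define \<Delta> where "\<Delta> = a * d - b * c"
  have "d / \<Delta> * (a / \<Delta>) - (- b / \<Delta>) * (- c / \<Delta>) = (a * d - b * c) / (\<Delta> * \<Delta>)"
    by (simp add: diff_divide_distrib mult.commute)
  then show ?thesis using assms by (simp add: \<Delta>_def divide_inverse)
qed

lemma left_inverse_mk:
  assumes "(mk a b c d, z) \<in> carrier G"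
  shows "(mk (d / (a * d - b * c)) (- b / (a * d - b * c))
    (- c / (a * d - b * c)) (a / (a * d - b * c)), inverse z) \<in> carrier G" (is ?A)
   "(mk (d / (a * d - b * c)) (- b / (a * d - b * c))
    (- c / (a * d - b * c)) (a / (a * d - b * c)), inverse z) \<otimes>\<^bsub>G\<^esub> (mk a b c d, z) = \<one>\<^bsub>G\<^esub>" (is ?B)
proof -
  have u: "a * d - b * c \<noteq> 0" "z \<noteq> 0" "N2 (a * d - b * c) * N4 z = 1" using assms by auto
  have "inverse (N2 (a * d - b * c)) * inverse (N4 z) = 1"
    using u(3) by (metis inverse_1 inverse_mult_distrib)
  then show ?A unfolding G_iff inverse_det_2[OF u(1)] using u by (simp add: E2.ext_norm_inverse E4.ext_norm_inverse)
  show ?B using u by (simp add: diff_divide_distrib[symmetric] add_divide_distrib[symmetric] mult.commute)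
qed

lemma group_G: "group G"
proof (rule groupI)
  fix g h assume g: "g \<in> carrier G" and h: "h \<in> carrier G"
  obtain a b c d z where g': "g = (mk a b c d, z)" using g by (rule G_cases)
  obtain a' b' c' d' z' where h': "h = (mk a' b' c' d', z')" using h by (rule G_cases)
  have det: "(a * a' + b * c') * (c * b' + d * d') - (a * b' + b * d') * (c * a' + d * c') =
      (a * d - b * c) * (a' * d' - b' * c')" by (simp add: algebra_simps)
  have "N2 (a * d - b * c) * N2 (a' * d' - b' * c') * (N4 z * N4 z') =
      (N2 (a * d - b * c) * N4 z) * (N2 (a' * d' - b' * c') * N4 z')" by (simp only: mult_ac)
  also have "\<dots> = 1" using g h unfolding g' h' by simp
  finally have "N2 (a * d - b * c) * N2 (a' * d' - b' * c') * (N4 z * N4 z') = 1" .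
  then show "g \<otimes>\<^bsub>G\<^esub> h \<in> carrier G"
    using g h unfolding g' h' by (simp add: det E2.ext_norm_mult E4.ext_norm_mult)
next
  fix g h k assume "g \<in> carrier G" "h \<in> carrier G" "k \<in> carrier G"
  then show "g \<otimes>\<^bsub>G\<^esub> h \<otimes>\<^bsub>G\<^esub> k = g \<otimes>\<^bsub>G\<^esub> (h \<otimes>\<^bsub>G\<^esub> k)"
    by (elim G_cases) (simp add: algebra_simps)
next
  fix g assume g: "g \<in> carrier G"
  then show "\<one>\<^bsub>G\<^esub> \<otimes>\<^bsub>G\<^esub> g = g" by (elim G_cases) simp
  obtain a b c d z where g': "g = (mk a b c d, z)" using g by (rule G_cases)
  show "\<exists>h\<in>carrier G. h \<otimes>\<^bsub>G\<^esub> g = \<one>\<^bsub>G\<^esub>"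
    using left_inverse_mk[of a b c d z] g unfolding g' by blast
qed (simp)

sublocale G: group G by (rule group_G)

lemma inv_mk: "(mk a b c d, z) \<in> carrier G \<Longrightarrow> inv\<^bsub>G\<^esub> (mk a b c d, z) = (mk (d / (a * d - b * c)) (- b / (a * d - b * c))
    (- c / (a * d - b * c)) (a / (a * d - b * c)), inverse z)"
  by (rule G.inv_equality) (use left_inverse_mk in blast)+

section \<open>The compact open subgroup and its character\<close>

definition K :: "('e2 mat \<times> 'e4) set" where
  "K = {(A, z) \<in> K_st v \<iota>2 \<iota>4. P (det A) z}"

lemma K_iff: "(mk a b c d, z) \<in> K \<longleftrightarrow> (mk a b c d, z) \<in> carrier G \<and> a \<noteq> 0 \<and> E2.w a = 0 \<and> d \<noteq> 0 \<and> E2.w d = 0 \<and>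
    val_ge E2.w b 0 \<and> val_ge E2.w c 1 \<and> z \<noteq> 0 \<and> E4.w z = 0 \<and> P (a * d - b * c) z"
  unfolding K_def K_st_def iwahori_def E2.integral_closure_eq E4.integral_closure_eq
    E2.w.unit_elems_valuation_ring E4.w.unit_elems_valuation_ring E2.w.nonunits_valuation_ring
  by (auto simp: valuation_ring_def)

lemma K_subset_G: "K \<subseteq> carrier G"
  by (auto simp: K_def K_st_def)

lemma K_G: "k \<in> K \<Longrightarrow> k \<in> carrier G"
  using K_subset_G by blast

lemma K_cases:
  assumes "k \<in> K"
  obtains a b c d z where "k = (mk a b c d, z)"
  using assms K_subset_G G_cases by (metis subsetD)

lemma unit_add:
  assumes "x \<noteq> 0" "E2.w x = 0" "val_ge E2.w y 1"
  shows "x + y \<noteq> 0 \<and> E2.w (x + y) = 0"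
  using E2.w.val_eq_of_close[of x "x + y"] assms by (simp add: E2.w.val_ge_uminus)

lemma K_det_unit:
  assumes "a \<noteq> 0" "E2.w a = 0" "d \<noteq> 0" "E2.w d = 0" "val_ge E2.w b 0" "val_ge E2.w c 1"
  shows "a * d - b * c \<noteq> 0 \<and> E2.w (a * d - b * c) = 0" "val_ge E2.w (b * c) 1"
proof -
  show bc: "val_ge E2.w (b * c) 1" using E2.w.val_ge_mult_0 assms by blast
  then show "a * d - b * c \<noteq> 0 \<and> E2.w (a * d - b * c) = 0"
    using unit_add[of "a * d" "- (b * c)"] assms by (simp add: E2.w.v_mult)
qed

lemma K_subgroup: "subgroup K G"
proof (rule G.subgroupI)
  show "K \<subseteq> carrier G" by (rule K_subset_G)
  show "K \<noteq> {}" using K_iff[of 1 0 0 1 1] P_near_1[of 1 1] by auto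
next
  fix k assume k: "k \<in> K"
  obtain a b c d z where k': "k = (mk a b c d, z)" using k by (rule K_cases)
  have G: "(mk a b c d, z) \<in> carrier G" using k K_G k' by blast
  define \<Delta> where "\<Delta> = a * d - b * c"
  have u: "a \<noteq> 0" "E2.w a = 0" "d \<noteq> 0" "E2.w d = 0" "val_ge E2.w b 0" "val_ge E2.w c 1" "z \<noteq> 0" "E4.w z = 0" "P \<Delta> z"
    using k unfolding k' K_iff \<Delta>_def by auto
  have \<Delta>: "\<Delta> \<noteq> 0" "E2.w \<Delta> = 0" using K_det_unit(1)[OF u(1-6)] by (auto simp: \<Delta>_def)
  have i: "inv\<^bsub>G\<^esub> k = (mk (d / \<Delta>) (- b / \<Delta>) (- c / \<Delta>) (a / \<Delta>), inverse z)"
    unfolding k' using inv_mk[OF G] by (simp add: \<Delta>_def)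
  have det: "d / \<Delta> * (a / \<Delta>) - (- b / \<Delta>) * (- c / \<Delta>) = inverse \<Delta>"
    using \<Delta> inverse_det_2[of a d b c] by (simp add: \<Delta>_def)
  have "inv\<^bsub>G\<^esub> k \<in> carrier G" using k K_G by simp
  moreover have "val_ge E2.w (- b / \<Delta>) 0" "val_ge E2.w (- c / \<Delta>) 1"
    using u \<Delta> by (cases "b = 0"; cases "c = 0"; simp add: val_ge_def E2.w.v_divide)+
  ultimately show "inv\<^bsub>G\<^esub> k \<in> K"
    unfolding i K_iff det using u \<Delta> P_inverse[of \<Delta> z] by (simp add: E2.w.v_divide E4.w.v_inverse)
next
  fix k k' assume k: "k \<in> K" and k': "k' \<in> K"
  obtain a b c d z where e: "k = (mk a b c d, z)" using k by (rule K_cases)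
  obtain a' b' c' d' z' where e': "k' = (mk a' b' c' d', z')" using k' by (rule K_cases)
  have u: "a \<noteq> 0" "E2.w a = 0" "d \<noteq> 0" "E2.w d = 0" "val_ge E2.w b 0" "val_ge E2.w c 1" "z \<noteq> 0" "E4.w z = 0" "P (a * d - b * c) z"
    using k unfolding e K_iff by auto
  have u': "a' \<noteq> 0" "E2.w a' = 0" "d' \<noteq> 0" "E2.w d' = 0" "val_ge E2.w b' 0" "val_ge E2.w c' 1" "z' \<noteq> 0" "E4.w z' = 0" "P (a' * d' - b' * c') z'"
    using k' unfolding e' K_iff by auto
  have det: "(a * a' + b * c') * (c * b' + d * d') - (a * b' + b * d') * (c * a' + d * c') =
      (a * d - b * c) * (a' * d' - b' * c')" by (simp add: algebra_simps)
  have aa: "a * a' + b * c' \<noteq> 0 \<and> E2.w (a * a' + b * c') = 0"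
    using u u' by (intro unit_add E2.w.val_ge_mult_0) (auto simp: E2.w.v_mult)
  have "d * d' + c * b' \<noteq> 0 \<and> E2.w (d * d' + c * b') = 0"
    using u u' E2.w.val_ge_mult[of c 1 b' 0] by (intro unit_add) (auto simp: E2.w.v_mult)
  then have dd: "c * b' + d * d' \<noteq> 0 \<and> E2.w (c * b' + d * d') = 0" by (simp add: add.commute)
  have "val_ge E2.w a 0" "val_ge E2.w d 0" "val_ge E2.w a' 0" "val_ge E2.w d' 0" using u u' by (auto simp: val_ge_def)
  then have b: "val_ge E2.w (a * b' + b * d') 0" and c: "val_ge E2.w (c * a' + d * c') 1"
    using u u' E2.w.val_ge_mult[of c 1 a' 0] by (auto intro!: E2.w.val_ge_add E2.w.val_ge_mult_0)
  have "k \<otimes>\<^bsub>G\<^esub> k' \<in> carrier G" using k k' K_G by simp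
  then show "k \<otimes>\<^bsub>G\<^esub> k' \<in> K"
    using aa dd b c u u' K_det_unit(1)[OF u(1-6)] K_det_unit(1)[OF u'(1-6)]
    unfolding e e' G_mult mk_mult K_iff det
    by (auto simp: E4.w.v_mult intro!: P_mult)
qed

lemma \<rho>_mk: "\<rho> (mk a b c d, z) = \<rho>2 d"
  by (simp add: rho0_def \<rho>2_def)

text \<open>Since the lower left entry lies in the maximal ideal, the lower right entry is
  multiplicative up to congruence, and on units \<open>\<rho>2\<close> depends only on the
  residue.\<close>

lemma \<rho>_mult:
  assumes k: "k \<in> K" and k': "k' \<in> K"
  shows "\<rho> (k \<otimes>\<^bsub>G\<^esub> k') = \<rho> k * \<rho> k'"
proof -
  obtain a b c d z where e: "k = (mk a b c d, z)" using k by (rule K_cases)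
  obtain a' b' c' d' z' where e': "k' = (mk a' b' c' d', z')" using k' by (rule K_cases)
  have u: "d \<noteq> 0" "E2.w d = 0" "val_ge E2.w c 1" using k unfolding e K_iff by auto
  have u': "d' \<noteq> 0" "E2.w d' = 0" "val_ge E2.w b' 0" using k' unfolding e' K_iff by auto
  have "\<rho>2 (d * d') = \<rho>2 (c * b' + d * d')"
    using u u' E2.w.val_ge_mult[of c 1 b' 0] by (intro \<rho>2_close) (auto simp: E2.w.v_mult)
  then show ?thesis unfolding e e' using u u' by (simp add: \<rho>_mk \<rho>2_mult)
qed

lemma \<rho>_nonzero: "k \<in> K \<Longrightarrow> \<rho> k \<noteq> 0"
  using K_cases[of k] by (force simp: \<rho>_mk K_iff \<rho>2_nonzero)

lemma \<rho>_one: "\<rho> \<one>\<^bsub>G\<^esub> = 1"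
  by (simp add: \<rho>_mk)

text \<open>The determinant is congruent to \<open>a * d\<close>, and \<open>\<rho>2\<close> is
  trivial on it, because its norm is inverse to that of a unit of the degree-4 extension. As
  \<open>\<rho>2\<close> is quadratic on units, the two values agree.\<close>

lemma K_\<rho>2_diag:
  assumes "(mk a b c d, z) \<in> K"
  shows "\<rho>2 a = \<rho>2 d"
proof -
  have u: "a \<noteq> 0" "E2.w a = 0" "d \<noteq> 0" "E2.w d = 0" "val_ge E2.w b 0" "val_ge E2.w c 1" "z \<noteq> 0" "E4.w z = 0"
    "N2 (a * d - b * c) * N4 z = 1"
    using assms unfolding K_iff by auto
  note \<Delta> = K_det_unit[OF u(1-6)]
  have "\<rho>2 (a * d - b * c) * \<eta> (N4 z) = \<eta> 1"
    unfolding \<rho>2_def u(9)[symmetric] using \<Delta> u E2.ext_norm_nonzero E4.ext_norm_nonzero by (intro \<eta>_mult[symmetric]) blast+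
  then have "\<rho>2 (a * d - b * c) = 1" using \<eta>_N4_unit u by simp
  moreover have "\<rho>2 (a * d - b * c) = \<rho>2 (a * d)" using \<Delta> by (intro \<rho>2_close) auto
  ultimately have "\<rho>2 a * \<rho>2 d = 1" using u by (simp add: \<rho>2_mult)
  then have "\<rho>2 a * \<rho>2 d = \<rho>2 d * \<rho>2 d" using \<rho>2_square u by simp
  then show ?thesis using \<rho>2_nonzero u by simp
qed

subsection \<open>Monomial elements\<close>

text \<open>The expected rational points of the normalizer of the torus; the identification is
  \<open>normalizer_M0_eq\<close>.\<close>

definition Nm :: "('e2 mat \<times> 'e4) set" where
  "Nm = {g \<in> carrier G. \<exists>x y z. g = (mk x 0 0 y, z) \<or> g = (mk 0 x y 0, z)}"

lemma Nm_cases: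
  assumes "n \<in> Nm"
  obtains (diag) x y z where "n = (mk x 0 0 y, z)" "x \<noteq> 0" "y \<noteq> 0" "z \<noteq> 0" "N2 (x * y) * N4 z = 1"
    | (anti) x y z where "n = (mk 0 x y 0, z)" "x \<noteq> 0" "y \<noteq> 0" "z \<noteq> 0" "N2 (- (x * y)) * N4 z = 1"
  using assms by (auto simp: Nm_def)

lemma Nm_G: "n \<in> Nm \<Longrightarrow> n \<in> carrier G"
  by (simp add: Nm_def)

lemma inv_diag: "(mk x 0 0 y, z) \<in> carrier G \<Longrightarrow> inv\<^bsub>G\<^esub> (mk x 0 0 y, z) = (mk (inverse x) 0 0 (inverse y), inverse z)"
  by (subst inv_mk) (auto simp: field_simps)

lemma inv_anti: "(mk 0 x y 0, z) \<in> carrier G \<Longrightarrow> inv\<^bsub>G\<^esub> (mk 0 x y 0, z) = (mk 0 (inverse y) (inverse x) 0, inverse z)"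
  by (subst inv_mk) (auto simp: field_simps)

lemma Nm_iff: "(mk a b c d, z) \<in> Nm \<longleftrightarrow> (mk a b c d, z) \<in> carrier G \<and> (b = 0 \<and> c = 0 \<or> a = 0 \<and> d = 0)"
  by (auto simp: Nm_def)

lemma Nm_subgroup: "subgroup Nm G"
proof (rule G.subgroupI)
  show "Nm \<subseteq> carrier G" using Nm_G by blast
  show "Nm \<noteq> {}" using Nm_iff[of 1 0 0 1 1] by auto
next
  fix n assume n: "n \<in> Nm"
  then have i: "inv\<^bsub>G\<^esub> n \<in> carrier G" and nG: "n \<in> carrier G" using Nm_G by simp_all
  from n show "inv\<^bsub>G\<^esub> n \<in> Nm"
    using i nG by (cases rule: Nm_cases) (simp_all add: Nm_iff inv_diag inv_anti del: G_iff)
next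
  fix n n' assume n: "n \<in> Nm" "n' \<in> Nm"
  have "n \<otimes>\<^bsub>G\<^esub> n' \<in> carrier G" using n Nm_G by simp
  then show "n \<otimes>\<^bsub>G\<^esub> n' \<in> Nm" using n
    by (elim Nm_cases) (auto simp: Nm_iff simp del: G_iff)
qed

lemma K_Nm_eq_M0: "K \<inter> Nm = K \<inter> M0 \<iota>2 \<iota>4"
proof -
  have "k \<in> Nm \<longleftrightarrow> k \<in> M0 \<iota>2 \<iota>4" if k: "k \<in> K" for k
  proof -
    obtain a b c d z where e: "k = (mk a b c d, z)" using k by (rule K_cases)
    show ?thesis using k unfolding e by (auto simp: K_iff Nm_iff M0_def diagonal_mk)
  qed
  then show ?thesis by blast
qed

text \<open>Diagonal elements keep the lower right entry, antidiagonal ones replace it by the upper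
  left one, where \<open>\<rho>2\<close> has the same value. That \<open>k\<close> ranges over
  \<open>K\<close>, not only over the torus, makes functions on double cosets well defined.\<close>

lemma conj_KNm:
  assumes n: "n \<in> Nm" and k: "k \<in> K" and c: "inv\<^bsub>G\<^esub> n \<otimes>\<^bsub>G\<^esub> k \<otimes>\<^bsub>G\<^esub> n \<in> K"
  shows "\<rho> (inv\<^bsub>G\<^esub> n \<otimes>\<^bsub>G\<^esub> k \<otimes>\<^bsub>G\<^esub> n) = \<rho> k"
proof -
  obtain a b c d z where e: "k = (mk a b c d, z)" using k by (rule K_cases)
  have "\<rho>2 a = \<rho>2 d" using K_\<rho>2_diag k e by simp
  from n show ?thesis
  proof (cases rule: Nm_cases)
    case (diag x y u)
    then have "inv\<^bsub>G\<^esub> n = (mk (inverse x) 0 0 (inverse y), inverse u)" using inv_diag Nm_G[OF n] by simp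
    then show ?thesis using diag by (auto simp: e \<rho>_mk intro!: arg_cong[of _ _ \<rho>2])
  next
    case (anti x y u)
    then have "inv\<^bsub>G\<^esub> n = (mk 0 (inverse y) (inverse x) 0, inverse u)" using inv_anti Nm_G[OF n] by simp
    then show ?thesis using anti
      by (auto simp: e \<rho>_mk \<open>\<rho>2 a = \<rho>2 d\<close>[symmetric] intro!: arg_cong[of _ _ \<rho>2])
  qed
qed

lemma conj_KM:
  assumes n: "n \<in> Nm" and k: "k \<in> K \<inter> Nm"
  shows "n \<otimes>\<^bsub>G\<^esub> k \<otimes>\<^bsub>G\<^esub> inv\<^bsub>G\<^esub> n \<in> K \<inter> Nm"
proof -
  obtain a b c d z where e: "k = (mk a b c d, z)" using k K_cases by blast
  have u: "b = 0" "c = 0" "a \<noteq> 0" "E2.w a = 0" "d \<noteq> 0" "E2.w d = 0" "z \<noteq> 0" "E4.w z = 0" "P (a * d) z" "P (d * a) z"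
    using k unfolding e by (auto simp: K_iff Nm_iff mult.commute)
  have nG: "n \<otimes>\<^bsub>G\<^esub> k \<otimes>\<^bsub>G\<^esub> inv\<^bsub>G\<^esub> n \<in> carrier G" using n k Nm_G by simp
  from n show ?thesis
  proof (cases rule: Nm_cases)
    case (diag x y u)
    then have "inv\<^bsub>G\<^esub> n = (mk (inverse x) 0 0 (inverse y), inverse u)" using inv_diag Nm_G[OF n] by simp
    then have "n \<otimes>\<^bsub>G\<^esub> k \<otimes>\<^bsub>G\<^esub> inv\<^bsub>G\<^esub> n = (mk a 0 0 d, z)" using diag by (simp add: e u)
    then show ?thesis using nG u by (simp add: K_iff Nm_iff)
  next
    case (anti x y u)
    then have "inv\<^bsub>G\<^esub> n = (mk 0 (inverse y) (inverse x) 0, inverse u)" using inv_anti Nm_G[OF n] by simp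
    then have "n \<otimes>\<^bsub>G\<^esub> k \<otimes>\<^bsub>G\<^esub> inv\<^bsub>G\<^esub> n = (mk d 0 0 a, z)" using anti by (simp add: e u)
    then show ?thesis using nG u by (simp add: K_iff Nm_iff)
  qed
qed

text \<open>If \<open>m\<close> and \<open>m'\<close> are both diagonal or both antidiagonal, the
  diagonal entries of the given element of \<open>K\<close> show that
  \<open>m\<^sup>-\<^sup>1 m'\<close> has unit entries. Mixed types are impossible.\<close>

lemma double_coset_unique:
  assumes k: "k \<in> K" and m: "m \<in> Nm" and m': "m' \<in> Nm" and c: "inv\<^bsub>G\<^esub> m \<otimes>\<^bsub>G\<^esub> k \<otimes>\<^bsub>G\<^esub> m' \<in> K"
  shows "inv\<^bsub>G\<^esub> m \<otimes>\<^bsub>G\<^esub> m' \<in> K \<inter> Nm"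
proof -
  obtain a b c d z where e: "k = (mk a b c d, z)" using k by (rule K_cases)
  have u: "a \<noteq> 0" "E2.w a = 0" "d \<noteq> 0" "E2.w d = 0" "val_ge E2.w b 0" "val_ge E2.w c 1" "z \<noteq> 0" "E4.w z = 0"
    "P (a * d - b * c) z"
    using k unfolding e by (auto simp: K_iff)
  note \<Delta> = K_det_unit(1)[OF u(1-6)]
  have mem: "inv\<^bsub>G\<^esub> m \<otimes>\<^bsub>G\<^esub> m' \<in> Nm"
    using m m' Nm_subgroup by (simp add: subgroup.m_closed subgroup.m_inv_closed)
  have inG: "inv\<^bsub>G\<^esub> m \<otimes>\<^bsub>G\<^esub> m' \<in> carrier G" using mem Nm_G by blast
  text \<open>The element \<open>m\<^sup>-\<^sup>1 m'\<close> satisfies \<open>P\<close> because it differs from \<open>m\<^sup>-\<^sup>1 k m'\<close> by \<open>k\<close> only,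
    as far as determinants are concerned.\<close>
  have P_quot: "P \<Delta>' z'" if "P (\<Delta>' * (a * d - b * c)) (z' * z)"
    "\<Delta>' \<noteq> 0" "E2.w \<Delta>' = 0" "z' \<noteq> 0" "E4.w z' = 0" for \<Delta>' z'
    using P_mult[of "\<Delta>' * (a * d - b * c)" "inverse (a * d - b * c)" "z' * z" "inverse z"]
      P_inverse[of "a * d - b * c" z] that u \<Delta>
    by (simp add: E2.w.v_mult E2.w.v_inverse E4.w.v_mult E4.w.v_inverse mult.assoc)
  have w_z: "E4.w (inverse z2 * z1) = 0" if "E4.w (inverse z2 * z * z1) = 0" "z1 \<noteq> 0" "z2 \<noteq> 0" for z1 z2
    using that u by (simp add: E4.w.v_mult E4.w.v_inverse)
  from m show ?thesis
  proof (cases rule: Nm_cases)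
    case d: (diag x y z2)
    then have im: "inv\<^bsub>G\<^esub> m = (mk (inverse x) 0 0 (inverse y), inverse z2)" using inv_diag Nm_G[OF m] by simp
    from m' show ?thesis
    proof (cases rule: Nm_cases)
      case d': (diag x' y' z1)
      have wx: "E2.w (inverse x * x') = 0" "E2.w (inverse y * y') = 0" "E4.w (inverse z2 * z1) = 0"
        using c d d' u w_z[of z2 z1] unfolding im e d'(1)
        by (auto simp: K_iff E2.w.v_mult E2.w.v_inverse simp del: G_iff)
      have "inverse x * a * x' * (inverse y * d * y') - inverse x * b * y' * (inverse y * c * x') =
         inverse x * x' * (inverse y * y') * (a * d - b * c)" by (simp add: algebra_simps)
      then have "P (inverse x * x' * (inverse y * y') * (a * d - b * c)) (inverse z2 * z1 * z)"
        using c unfolding im e d'(1) by (simp add: K_iff mult_ac del: G_iff)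
      then have "P (inverse x * x' * (inverse y * y')) (inverse z2 * z1)"
        using P_quot wx d d' by (simp add: E2.w.v_mult)
      then show ?thesis using mem inG wx d d' unfolding im d'(1) by (auto simp: K_iff simp del: G_iff)
    next
      case a': (anti x' y' z1)
      have 1: "val_ge E2.w (inverse x * a * x') 0" "val_ge E2.w (inverse y * d * y') 1"
        "inverse x * b * y' \<noteq> 0" "E2.w (inverse x * b * y') = 0" "inverse y * c * x' \<noteq> 0" "E2.w (inverse y * c * x') = 0"
        using c unfolding im e a'(1) by (auto simp: K_iff simp del: G_iff)
      have "b \<noteq> 0" "c \<noteq> 0" using 1 by auto
      \<comment> \<open>The unit conditions on the diagonal and the bounds off it give
        \<open>E2.w b + E2.w c \<le> - 1\<close>, while \<open>b\<close> is integral and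
        \<open>c\<close> lies in the maximal ideal.\<close>
      then have False using 1 u d a' by (auto simp: val_ge_def E2.w.v_mult E2.w.v_inverse)
      then show ?thesis ..
    qed
  next
    case an: (anti x y z2)
    then have im: "inv\<^bsub>G\<^esub> m = (mk 0 (inverse y) (inverse x) 0, inverse z2)" using inv_anti Nm_G[OF m] by simp
    from m' show ?thesis
    proof (cases rule: Nm_cases)
      case d': (diag x' y' z1)
      have 1: "val_ge E2.w (inverse y * d * y') 0" "val_ge E2.w (inverse x * a * x') 1"
        "inverse x * b * y' \<noteq> 0" "E2.w (inverse x * b * y') = 0" "inverse y * c * x' \<noteq> 0" "E2.w (inverse y * c * x') = 0"
        using c unfolding im e d'(1) by (auto simp: K_iff simp del: G_iff)
      have "b \<noteq> 0" "c \<noteq> 0" using 1 by auto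
      then have False using 1 u an d' by (auto simp: val_ge_def E2.w.v_mult E2.w.v_inverse)
      then show ?thesis ..
    next
      case a': (anti x' y' z1)
      have wx: "E2.w (inverse x * x') = 0" "E2.w (inverse y * y') = 0" "E4.w (inverse z2 * z1) = 0"
        using c an a' u w_z[of z2 z1] unfolding im e a'(1)
        by (auto simp: K_iff E2.w.v_mult E2.w.v_inverse simp del: G_iff)
      have "inverse y * d * y' * (inverse x * a * x') - inverse y * c * x' * (inverse x * b * y') =
         inverse y * y' * (inverse x * x') * (a * d - b * c)" by (simp add: algebra_simps)
      then have "P (inverse y * y' * (inverse x * x') * (a * d - b * c)) (inverse z2 * z1 * z)"
        using c unfolding im e a'(1) by (simp add: K_iff mult_ac del: G_iff)
      then have "P (inverse y * y' * (inverse x * x')) (inverse z2 * z1)"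
        using P_quot wx an a' by (simp add: E2.w.v_mult)
      then show ?thesis using mem inG wx an a' unfolding im a'(1) by (auto simp: K_iff simp del: G_iff)
    qed
  qed
qed

end

context hecke_setup
begin

declare G_one [simp del]

lemma G_inv_cancel: "x \<in> carrier G \<Longrightarrow> y \<in> carrier G \<Longrightarrow> inv\<^bsub>G\<^esub> x \<otimes>\<^bsub>G\<^esub> (x \<otimes>\<^bsub>G\<^esub> y) = y"
  "x \<in> carrier G \<Longrightarrow> y \<in> carrier G \<Longrightarrow> x \<otimes>\<^bsub>G\<^esub> (inv\<^bsub>G\<^esub> x \<otimes>\<^bsub>G\<^esub> y) = y"
  by (simp_all add: G.m_assoc[symmetric])

lemmas G_simps = G.m_assoc G_inv_cancel G.inv_mult_group

subsection \<open>Root elements\<close>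

definition xr :: "bool \<Rightarrow> 'e2 \<Rightarrow> 'e2 mat \<times> 'e4" where
  "xr \<sigma> s = (if \<sigma> then mk 1 s 0 1 else mk 1 0 s 1, 1)"

text \<open>The least value of a parameter for which the root element lies in the Iwahori subgroup;
  \<open>True\<close> stands for the upper triangular root.\<close>

definition lev :: "bool \<Rightarrow> int" where
  "lev \<sigma> = (if \<sigma> then 0 else 1)"

lemma xr_G [simp]: "xr \<sigma> s \<in> carrier G"
  by (simp add: xr_def)

lemma xr_add: "xr \<sigma> s \<otimes>\<^bsub>G\<^esub> xr \<sigma> s' = xr \<sigma> (s + s')"
  by (simp add: xr_def add.commute)

lemma xr_0: "xr \<sigma> 0 = \<one>\<^bsub>G\<^esub>"
  by (simp add: xr_def G_one)

lemma inv_xr: "inv\<^bsub>G\<^esub> (xr \<sigma> s) = xr \<sigma> (- s)"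
  by (rule G.inv_equality) (simp_all add: xr_add xr_0)

lemma xr_K: "xr \<sigma> s \<in> K \<longleftrightarrow> val_ge E2.w s (lev \<sigma>)"
  by (auto simp: xr_def lev_def K_iff P_near_1)

lemma \<rho>_xr: "\<rho> (xr \<sigma> s) = 1"
  by (simp add: xr_def \<rho>_mk)

text \<open>\<open>\<beta> n\<close> is the shift of levels under conjugation by a monomial element \<open>n\<close>.\<close>

definition \<beta> :: "'e2 mat \<times> 'e4 \<Rightarrow> int" where
  "\<beta> n = (let A = fst n in if A $$ (0,1) = 0 then E2.w (A $$ (1,1)) - E2.w (A $$ (0,0))
     else E2.w (A $$ (1,0)) - E2.w (A $$ (0,1)) - 1)"

definition \<beta>s :: "'e2 mat \<times> 'e4 \<Rightarrow> bool \<Rightarrow> int" where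
  "\<beta>s n \<sigma> = (if \<sigma> then \<beta> n else - \<beta> n)"

lemma \<beta>_diag [simp]: "\<beta> (mk x 0 0 y, z) = E2.w y - E2.w x"
  by (simp add: \<beta>_def)

text \<open>An antidiagonal element exchanges the two root subgroups, whose levels differ by 1; this
  is the source of the \<open>- 1\<close>.\<close>

lemma \<beta>_anti [simp]: "x \<noteq> 0 \<Longrightarrow> \<beta> (mk 0 x y 0, z) = E2.w y - E2.w x - 1"
  by (simp add: \<beta>_def)

lemma inv_Nm:
  "(mk x 0 0 y, z) \<in> Nm \<Longrightarrow> inv\<^bsub>G\<^esub> (mk x 0 0 y, z) = (mk (inverse x) 0 0 (inverse y), inverse z)"
  "(mk 0 x y 0, z) \<in> Nm \<Longrightarrow> inv\<^bsub>G\<^esub> (mk 0 x y 0, z) = (mk 0 (inverse y) (inverse x) 0, inverse z)"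
  using inv_diag inv_anti Nm_G by blast+

text \<open>A monomial element permutes the root subgroups and shifts their filtrations; measured
  relative to \<open>lev\<close>, the shift is \<open>\<beta>s n \<sigma>\<close> whatever the type
  of \<open>n\<close>.\<close>

lemma conj_xr:
  assumes n: "n \<in> Nm"
  obtains \<tau> s' where "inv\<^bsub>G\<^esub> n \<otimes>\<^bsub>G\<^esub> xr \<sigma> s \<otimes>\<^bsub>G\<^esub> n = xr \<tau> s'"
    "\<And>k. val_ge E2.w s' (lev \<tau>) \<longleftrightarrow> val_ge E2.w s (lev \<sigma> - \<beta>s n \<sigma>)"
  using n
proof (cases rule: Nm_cases)
  case (diag x y z)
  define s' where "s' = (if \<sigma> then s * y / x else s * x / y)"
  have "inv\<^bsub>G\<^esub> n = (mk (inverse x) 0 0 (inverse y), inverse z)" using n diag inv_Nm by simp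
  then have "inv\<^bsub>G\<^esub> n \<otimes>\<^bsub>G\<^esub> xr \<sigma> s \<otimes>\<^bsub>G\<^esub> n = xr \<sigma> s'"
    using diag by (simp add: xr_def s'_def field_simps)
  moreover have "val_ge E2.w s' (lev \<sigma>) \<longleftrightarrow> val_ge E2.w s (lev \<sigma> - \<beta>s n \<sigma>)"
    using diag by (cases "s = 0") (auto simp: s'_def val_ge_def \<beta>s_def E2.w.v_divide E2.w.v_mult)
  ultimately show ?thesis using that by blast
next
  case (anti x y z)
  define s' where "s' = (if \<sigma> then s * y / x else s * x / y)"
  have "inv\<^bsub>G\<^esub> n = (mk 0 (inverse y) (inverse x) 0, inverse z)" using n anti inv_Nm by simp
  then have "inv\<^bsub>G\<^esub> n \<otimes>\<^bsub>G\<^esub> xr \<sigma> s \<otimes>\<^bsub>G\<^esub> n = xr (\<not> \<sigma>) s'"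
    using anti by (simp add: xr_def s'_def field_simps)
  moreover have "val_ge E2.w s' (lev (\<not> \<sigma>)) \<longleftrightarrow> val_ge E2.w s (lev \<sigma> - \<beta>s n \<sigma>)"
    using anti by (cases "s = 0") (auto simp: s'_def val_ge_def lev_def \<beta>s_def E2.w.v_divide E2.w.v_mult)
  ultimately show ?thesis using that by blast
qed

lemma conj_xr_K: "n \<in> Nm \<Longrightarrow> inv\<^bsub>G\<^esub> n \<otimes>\<^bsub>G\<^esub> xr \<sigma> s \<otimes>\<^bsub>G\<^esub> n \<in> K \<longleftrightarrow> val_ge E2.w s (lev \<sigma> - \<beta>s n \<sigma>)"
  using conj_xr[of n \<sigma> s] xr_K by metis

lemma \<rho>_conj_xr: "n \<in> Nm \<Longrightarrow> \<rho> (inv\<^bsub>G\<^esub> n \<otimes>\<^bsub>G\<^esub> xr \<sigma> s \<otimes>\<^bsub>G\<^esub> n) = 1"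
  using conj_xr[of n \<sigma> s] \<rho>_xr by metis

text \<open>\<open>Nm\<close> acts on the apartment, a line, by translations and reflections, and
  \<open>\<beta> n\<close> labels the alcove to which \<open>n\<close> moves the base alcove. Both
  sides are the distance between the alcoves of \<open>m\<close> and \<open>n\<close>.\<close>

lemma \<beta>_quotient:
  assumes m: "m \<in> Nm" and n: "n \<in> Nm"
  shows "\<bar>\<beta> (inv\<^bsub>G\<^esub> m \<otimes>\<^bsub>G\<^esub> n)\<bar> = \<bar>\<beta> m - \<beta> n\<bar>"
  using m n inv_Nm
  by (elim Nm_cases; simp add: E2.w.v_mult E2.w.v_inverse)

definition J :: "bool \<Rightarrow> 'e2 \<Rightarrow> 'e2 mat \<times> 'e4" where
  "J \<sigma> s = (if \<sigma> then mk 0 s (- inverse s) 0 else mk 0 (- inverse s) s 0, 1)"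

definition tor :: "bool \<Rightarrow> 'e2 \<Rightarrow> 'e2 mat \<times> 'e4" where
  "tor \<sigma> u = (if \<sigma> then mk u 0 0 (inverse u) else mk (inverse u) 0 0 u, 1)"

lemma J_G [simp]: "s \<noteq> 0 \<Longrightarrow> J \<sigma> s \<in> carrier G"
  by (simp add: J_def)

lemma tor_Nm: "u \<noteq> 0 \<Longrightarrow> tor \<sigma> u \<in> Nm"
  by (simp add: tor_def Nm_iff)

text \<open>The rank-one relation in \<open>SL\<^sub>2\<close>: a large parameter in one root
  subgroup is traded for its small inverse in the opposite one, at the cost of a monomial
  element.\<close>

lemma xr_rank_one: "s \<noteq> 0 \<Longrightarrow> xr \<sigma> s = xr (\<not> \<sigma>) (inverse s) \<otimes>\<^bsub>G\<^esub> J \<sigma> s \<otimes>\<^bsub>G\<^esub> xr (\<not> \<sigma>) (inverse s)"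
  by (simp add: xr_def J_def)

lemma J_scale: "u \<noteq> 0 \<Longrightarrow> J \<sigma> (u * s) = tor \<sigma> u \<otimes>\<^bsub>G\<^esub> J \<sigma> s"
  by (simp add: J_def tor_def)

lemma tor_\<zeta>: "tor \<sigma> (\<iota>2 \<zeta>) \<in> K" "\<rho> (tor \<sigma> (\<iota>2 \<zeta>)) = - 1"
proof -
  define u where "u = \<iota>2 \<zeta>"
  have "u \<noteq> 0" by (simp add: u_def)
  moreover have "E2.w u = 0" "\<rho>2 u = - 1" "\<rho>2 (inverse u) = - 1"
    using w_\<zeta> \<rho>2_\<zeta> by (simp_all only: u_def)
  ultimately show "tor \<sigma> (\<iota>2 \<zeta>) \<in> K" "\<rho> (tor \<sigma> (\<iota>2 \<zeta>)) = - 1"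
    unfolding u_def[symmetric] by (simp_all add: tor_def K_iff P_near_1 \<rho>_mk E2.w.v_inverse)
qed

subsection \<open>Decompositions\<close>

text \<open>Gaussian elimination with a unit diagonal entry as pivot. Both orders of the root
  factors are needed because the relevant root \<open>sg m\<close> depends on
  \<open>m\<close>.\<close>

lemma iwahori_factorization:
  assumes k: "k \<in> K"
  obtains s s' t where "xr \<sigma> s \<in> K" "xr (\<not> \<sigma>) s' \<in> K" "t \<in> K \<inter> Nm" "k = xr \<sigma> s \<otimes>\<^bsub>G\<^esub> (xr (\<not> \<sigma>) s' \<otimes>\<^bsub>G\<^esub> t)"
proof -
  obtain a b c d z where e: "k = (mk a b c d, z)" using k by (rule K_cases)
  have u: "a \<noteq> 0" "E2.w a = 0" "d \<noteq> 0" "E2.w d = 0" "val_ge E2.w b 0" "val_ge E2.w c 1" "z \<noteq> 0" "E4.w z = 0"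
    "P (a * d - b * c) z" "k \<in> carrier G"
    using k unfolding e by (auto simp: K_iff)
  note \<Delta> = K_det_unit[OF u(1-6)]
  show ?thesis
  proof (cases \<sigma>)
    case True
    define a' where "a' = a - b * c / d"
    have a': "a' \<noteq> 0" "E2.w a' = 0" "a' * d = a * d - b * c"
    proof -
      show 1: "a' * d = a * d - b * c" using u by (simp add: a'_def field_simps)
      then show 2: "a' \<noteq> 0" using \<Delta> by auto
      show "E2.w a' = 0" using \<Delta> 1 2 u E2.w.v_mult[of a' d] by simp
    qed
    have 1: "xr True (b / d) \<in> K" "xr False (c / a') \<in> K"
      using u a' by (simp_all add: xr_K lev_def E2.w.val_ge_divide_unit)
    have 2: "(mk a' 0 0 d, z) \<in> K \<inter> Nm"
      using u a' e by (auto simp: K_iff Nm_iff)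
    have "a' + b / d * c = a" using u by (simp add: a'_def)
    moreover have "c / a' * a' = c" "b / d * d = b" using a' u by auto
    ultimately have 3: "k = xr True (b / d) \<otimes>\<^bsub>G\<^esub> (xr False (c / a') \<otimes>\<^bsub>G\<^esub> (mk a' 0 0 d, z))"
      by (simp add: xr_def e)
    show ?thesis using that 1 2 3 True by simp
  next
    case False
    define d' where "d' = d - c * b / a"
    have d': "d' \<noteq> 0" "E2.w d' = 0" "a * d' = a * d - b * c"
    proof -
      show 1: "a * d' = a * d - b * c" using u by (simp add: d'_def field_simps)
      then show 2: "d' \<noteq> 0" using \<Delta> by auto
      show "E2.w d' = 0" using \<Delta> 1 2 u E2.w.v_mult[of a d'] by simp
    qed
    have 1: "xr False (c / a) \<in> K" "xr True (b / d') \<in> K"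
      using u d' by (simp_all add: xr_K lev_def E2.w.val_ge_divide_unit)
    have 2: "(mk a 0 0 d', z) \<in> K \<inter> Nm"
      using u d' e by (auto simp: K_iff Nm_iff)
    have "d' + c / a * b = d" using u by (simp add: d'_def)
    moreover have "b / d' * d' = b" "c / a * a = c" using d' u by auto
    ultimately have 3: "k = xr False (c / a) \<otimes>\<^bsub>G\<^esub> (xr True (b / d') \<otimes>\<^bsub>G\<^esub> (mk a 0 0 d', z))"
      by (simp add: xr_def e add.commute)
    show ?thesis using that 1 2 3 False by simp
  qed
qed

text \<open>Gaussian elimination with the operations that the Iwahori subgroup allows. An entry may
  serve as pivot if it divides its two neighbours, strictly where the elimination uses the lower
  root subgroup.\<close>

lemma bruhat_decomposition:
  assumes g: "g \<in> carrier G"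
  obtains k n k' where "k \<in> K" "n \<in> Nm" "k' \<in> K" "g = k \<otimes>\<^bsub>G\<^esub> n \<otimes>\<^bsub>G\<^esub> k'"
proof -
  note goal = that
  obtain a b c d z where e: "g = (mk a b c d, z)" using g by (rule G_cases)
  \<comment> \<open>Divisibility by an integral factor, and next by a factor in the maximal ideal.
    Zero is a multiple of every element in both senses.\<close>
  define le where "le x y \<longleftrightarrow> (\<exists>s. val_ge E2.w s 0 \<and> y = s * x)" for x y
  define lt where "lt x y \<longleftrightarrow> (\<exists>s. val_ge E2.w s 1 \<and> y = s * x)" for x y
  have total: "lt x y \<or> le y x" for x y
  proof (cases "x = 0 \<or> y = 0")
    case True
    then show ?thesis by (auto simp: lt_def le_def intro: exI[of _ 0])
  next
    case False
    then show ?thesis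
      using exI[of "\<lambda>s. val_ge E2.w s 1 \<and> y = s * x" "y / x"] exI[of "\<lambda>s. val_ge E2.w s 0 \<and> x = s * y" "x / y"]
      by (cases "E2.w x < E2.w y") (auto simp: lt_def le_def val_ge_def E2.w.v_divide)
  qed
  have lt_le: "le x y" if "lt x y" for x y
    using that E2.w.val_ge_mono[of _ 1 0] by (auto simp: lt_def le_def)
  have lt_le_trans: "lt x z" if "lt x y" "le y z" for x y z
    using that E2.w.val_ge_mult_0 by (force simp: lt_def le_def simp flip: mult.assoc)
  have le_trans: "le x z" if "le x y" "le y z" for x y z
    using that E2.w.val_ge_mult_0 by (force simp: lt_def le_def simp flip: mult.assoc)
  \<comment> \<open>Root elements have determinant 1 and trivial second component, so the middle
    factor inherits the norm equation from \<open>g\<close>.\<close>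
  have fin: thesis if "xr \<sigma> s \<in> K" "xr \<tau> r \<in> K" "g = xr \<sigma> s \<otimes>\<^bsub>G\<^esub> n \<otimes>\<^bsub>G\<^esub> xr \<tau> r"
    "n = (mk x 0 0 y, u) \<or> n = (mk 0 x y 0, u)" for \<sigma> s \<tau> r n x y u
  proof -
    have "n \<in> carrier G"
    proof -
      have "det (fst g) = det (fst n)" "snd g = snd n"
        using that(3,4) by (auto simp: xr_def algebra_simps)
      then show ?thesis using g that(4) unfolding e by auto
    qed
    then have "n \<in> Nm" using that(4) by (auto simp: Nm_iff simp del: G_iff)
    then show thesis using that(1-3) goal by blast
  qed
  \<comment> \<open>The four cases take the pivot \<open>a\<close>, \<open>d\<close>,
    \<open>b\<close> and \<open>c\<close> respectively.\<close>
  consider "le a b" "lt a c" | "le d b" "lt d c" | "lt b a" "lt b d" | "le c a" "le c d"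
    using total lt_le lt_le_trans le_trans by metis
  then show thesis
  proof cases
    case 1
    then obtain s r where "val_ge E2.w s 0" "b = s * a" "val_ge E2.w r 1" "c = r * a" by (auto simp: le_def lt_def)
    then show thesis
      by (intro fin[of False r True s "(mk a 0 0 (d - r * a * s), z)" a "d - r * a * s" z])
         (auto simp: xr_K lev_def e, simp_all add: xr_def algebra_simps)
  next
    case 2
    then obtain s r where "val_ge E2.w s 0" "b = s * d" "val_ge E2.w r 1" "c = r * d" by (auto simp: le_def lt_def)
    then show thesis
      by (intro fin[of True s False r "(mk (a - s * d * r) 0 0 d, z)" "a - s * d * r" d z])
         (auto simp: xr_K lev_def e, simp_all add: xr_def algebra_simps)
  next
    case 3
    then obtain s r where "val_ge E2.w r 1" "a = r * b" "val_ge E2.w s 1" "d = s * b" by (auto simp: le_def lt_def)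
    then show thesis
      by (intro fin[of False s False r "(mk 0 b (c - s * b * r) 0, z)" b "c - s * b * r" z])
         (auto simp: xr_K lev_def e, simp_all add: xr_def algebra_simps)
  next
    case 4
    then obtain s r where "val_ge E2.w s 0" "a = s * c" "val_ge E2.w r 0" "d = r * c" by (auto simp: le_def lt_def)
    then show thesis
      by (intro fin[of True s True r "(mk 0 (b - s * c * r) c 0, z)" "b - s * c * r" c z])
         (auto simp: xr_K lev_def e, simp_all add: xr_def algebra_simps)
  qed
qed

subsection \<open>Cosets in a double coset\<close>

sublocale D: digit_system E2.w \<theta>2 "\<iota>2 ` digits" "\<iota>2 \<zeta>"
  by (rule digit_system_radical) unfold_locales

sublocale D4: digit_system E4.w \<theta>4 "\<iota>4 ` digits" "\<iota>4 \<zeta>"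
  by (rule digit_system_radical) unfold_locales

lemma card_reps: "card (D.reps l a) = q ^ l"
proof -
  have "inj_on \<iota>2 digits" by (simp add: inj_on_def)
  then show ?thesis by (simp add: D.card_reps card_image card_digits)
qed

text \<open>The sign of the root subgroup that acts non-trivially on the cosets in \<open>K m K\<close>.\<close>

definition sg :: "'e2 mat \<times> 'e4 \<Rightarrow> bool" where
  "sg m \<longleftrightarrow> \<beta> m \<le> 0"

definition len :: "'e2 mat \<times> 'e4 \<Rightarrow> nat" where
  "len m = nat \<bar>\<beta> m\<bar>"

text \<open>Representatives of the root parameters in \<open>K\<close> modulo those that stay in
  \<open>K\<close> under conjugation by \<open>m\<^sup>-\<^sup>1\<close>: the latter have level
  higher by \<open>len m\<close>.\<close>

definition Y :: "'e2 mat \<times> 'e4 \<Rightarrow> 'e2 set" where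
  "Y m = D.reps (len m) (lev (sg m))"

lemma \<beta>s_sg: "\<beta>s m (sg m) = - int (len m)" "\<beta>s m (\<not> sg m) = int (len m)"
  by (auto simp: \<beta>s_def sg_def len_def)

lemma Y_K: "s \<in> Y m \<Longrightarrow> xr (sg m) s \<in> K"
  using D.reps_ge by (simp add: Y_def xr_K)

lemma finite_Y: "finite (Y m)"
  by (simp add: Y_def D.finite_reps)

text \<open>In the factorization of \<open>k\<close> with the root \<open>sg m\<close> in front, the
  opposite root factor and the torus factor are absorbed by \<open>K\<close> after passing
  \<open>m\<close>. Only the first parameter matters, and only up to the precision of
  \<open>Y m\<close>.\<close>

lemma coset_ex:
  assumes m: "m \<in> Nm" and k: "k \<in> K"
  shows "\<exists>s\<in>Y m. inv\<^bsub>G\<^esub> (xr (sg m) s \<otimes>\<^bsub>G\<^esub> m) \<otimes>\<^bsub>G\<^esub> (k \<otimes>\<^bsub>G\<^esub> m) \<in> K"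
proof -
  let ?\<sigma> = "sg m"
  obtain s0 s' t where k': "xr ?\<sigma> s0 \<in> K" "xr (\<not> ?\<sigma>) s' \<in> K" "t \<in> K \<inter> Nm" "k = xr ?\<sigma> s0 \<otimes>\<^bsub>G\<^esub> (xr (\<not> ?\<sigma>) s' \<otimes>\<^bsub>G\<^esub> t)"
    using iwahori_factorization[OF k, of ?\<sigma>] by blast
  have "val_ge E2.w s0 (lev ?\<sigma>)" using k'(1) by (simp add: xr_K)
  from D.reps_ex[OF this, of "len m"] obtain s where
    s: "s \<in> Y m" "val_ge E2.w (s0 - s) (lev ?\<sigma> + int (len m))" unfolding Y_def by blast
  have mG: "m \<in> carrier G" and tG: "t \<in> carrier G" using m k' Nm_G by auto
  have 1: "inv\<^bsub>G\<^esub> m \<otimes>\<^bsub>G\<^esub> xr ?\<sigma> (s0 - s) \<otimes>\<^bsub>G\<^esub> m \<in> K"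
    using conj_xr_K[OF m] s by (simp add: \<beta>s_sg)
  have "val_ge E2.w s' (lev (\<not> ?\<sigma>))" using k'(2) by (simp add: xr_K)
  then have 2: "inv\<^bsub>G\<^esub> m \<otimes>\<^bsub>G\<^esub> xr (\<not> ?\<sigma>) s' \<otimes>\<^bsub>G\<^esub> m \<in> K"
    unfolding conj_xr_K[OF m] \<beta>s_sg by (rule E2.w.val_ge_mono) simp
  have "inv\<^bsub>G\<^esub> m \<in> Nm" using m Nm_subgroup by (simp add: subgroup.m_inv_closed)
  from conj_KM[OF this k'(3)] have 3: "inv\<^bsub>G\<^esub> m \<otimes>\<^bsub>G\<^esub> t \<otimes>\<^bsub>G\<^esub> m \<in> K" using mG by simp
  have "inv\<^bsub>G\<^esub> (xr ?\<sigma> s \<otimes>\<^bsub>G\<^esub> m) \<otimes>\<^bsub>G\<^esub> (k \<otimes>\<^bsub>G\<^esub> m)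
    = inv\<^bsub>G\<^esub> m \<otimes>\<^bsub>G\<^esub> (inv\<^bsub>G\<^esub> (xr ?\<sigma> s) \<otimes>\<^bsub>G\<^esub> xr ?\<sigma> s0) \<otimes>\<^bsub>G\<^esub> (xr (\<not> ?\<sigma>) s' \<otimes>\<^bsub>G\<^esub> t \<otimes>\<^bsub>G\<^esub> m)"
    unfolding k'(4) using mG tG by (simp add: G_simps)
  also have "inv\<^bsub>G\<^esub> (xr ?\<sigma> s) \<otimes>\<^bsub>G\<^esub> xr ?\<sigma> s0 = xr ?\<sigma> (s0 - s)" by (simp add: inv_xr xr_add)
  also have "inv\<^bsub>G\<^esub> m \<otimes>\<^bsub>G\<^esub> xr ?\<sigma> (s0 - s) \<otimes>\<^bsub>G\<^esub> (xr (\<not> ?\<sigma>) s' \<otimes>\<^bsub>G\<^esub> t \<otimes>\<^bsub>G\<^esub> m) =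
     (inv\<^bsub>G\<^esub> m \<otimes>\<^bsub>G\<^esub> xr ?\<sigma> (s0 - s) \<otimes>\<^bsub>G\<^esub> m) \<otimes>\<^bsub>G\<^esub> ((inv\<^bsub>G\<^esub> m \<otimes>\<^bsub>G\<^esub> xr (\<not> ?\<sigma>) s' \<otimes>\<^bsub>G\<^esub> m) \<otimes>\<^bsub>G\<^esub> (inv\<^bsub>G\<^esub> m \<otimes>\<^bsub>G\<^esub> t \<otimes>\<^bsub>G\<^esub> m))"
    using mG tG by (simp add: G_simps)
  also have "\<dots> \<in> K" using 1 2 3 K_subgroup by (simp add: subgroup.m_closed)
  finally show ?thesis using s by blast
qed

lemma coset_unique:
  assumes m: "m \<in> Nm" and s: "s \<in> Y m" "s' \<in> Y m"
    and c: "inv\<^bsub>G\<^esub> (xr (sg m) s \<otimes>\<^bsub>G\<^esub> m) \<otimes>\<^bsub>G\<^esub> (xr (sg m) s' \<otimes>\<^bsub>G\<^esub> m) \<in> K"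
  shows "s = s'"
proof -
  have mG: "m \<in> carrier G" using m Nm_G by auto
  have "inv\<^bsub>G\<^esub> (xr (sg m) s \<otimes>\<^bsub>G\<^esub> m) \<otimes>\<^bsub>G\<^esub> (xr (sg m) s' \<otimes>\<^bsub>G\<^esub> m) =
     inv\<^bsub>G\<^esub> m \<otimes>\<^bsub>G\<^esub> (inv\<^bsub>G\<^esub> (xr (sg m) s) \<otimes>\<^bsub>G\<^esub> xr (sg m) s') \<otimes>\<^bsub>G\<^esub> m"
    using mG by (simp add: G_simps)
  also have "inv\<^bsub>G\<^esub> (xr (sg m) s) \<otimes>\<^bsub>G\<^esub> xr (sg m) s' = xr (sg m) (s' - s)" by (simp add: inv_xr xr_add)
  finally have "val_ge E2.w (s' - s) (lev (sg m) + int (len m))"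
    using c conj_xr_K[OF m] by (simp add: \<beta>s_sg)
  then show ?thesis using D.reps_unique[of s' "len m" "lev (sg m)" s] s by (simp add: Y_def)
qed

definition L :: "'e2 mat \<times> 'e4 \<Rightarrow> complex" where
  "L n = of_real (sqrt (real q)) ^ len n"

lemma L_nonzero: "L n \<noteq> 0"
  using q_ge by (simp add: L_def)

text \<open>The cardinality is \<open>q ^ e\<close> with
  \<open>2 * e = len m + len (m\<^sup>-\<^sup>1 n) - len n\<close>, the defect of the triangle
  inequality on the line of alcoves. The position of \<open>n\<close> relative to the segment from
  the base alcove to that of \<open>m\<close> gives three cases.\<close>

lemma card_Y_filter:
  assumes m: "m \<in> Nm" and n: "n \<in> Nm"
  shows "of_nat (card {s \<in> Y m. val_ge E2.w s (lev (sg m) - \<beta>s n (sg m))}) * L n = L m * L (inv\<^bsub>G\<^esub> m \<otimes>\<^bsub>G\<^esub> n)"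
proof -
  \<comment> \<open>\<open>B\<close> is the signed position of \<open>n\<close>, oriented so that
    \<open>m\<close> sits at \<open>l\<close>.\<close>
  define B where "B = - \<beta>s n (sg m)"
  define l where "l = len m"
  define r :: complex where "r = of_real (sqrt (real q))"
  have r2: "r ^ (2 * k) = of_nat (q ^ k)" for k
    by (simp add: r_def power_mult flip: of_real_power)
  have "len n = nat \<bar>B\<bar>" by (simp add: len_def B_def \<beta>s_def)
  moreover have "len (inv\<^bsub>G\<^esub> m \<otimes>\<^bsub>G\<^esub> n) = nat \<bar>B - int l\<bar>"
    unfolding len_def \<beta>_quotient[OF m n] B_def l_def by (auto simp: sg_def \<beta>s_def)
  ultimately have LL: "L n = r ^ nat \<bar>B\<bar>" "L (inv\<^bsub>G\<^esub> m \<otimes>\<^bsub>G\<^esub> n) = r ^ nat \<bar>B - int l\<bar>" "L m = r ^ l"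
    by (simp_all add: L_def r_def l_def)
  have set_eq: "{s \<in> Y m. val_ge E2.w s (lev (sg m) - \<beta>s n (sg m))} = {s \<in> D.reps l (lev (sg m)). val_ge E2.w s (lev (sg m) + B)}"
    by (simp add: Y_def l_def B_def)
  consider "B \<le> 0" | "0 \<le> B" "B \<le> int l" | "int l < B" by linarith
  then show ?thesis
  proof cases
    case 1
    have "{s \<in> D.reps l (lev (sg m)). val_ge E2.w s (lev (sg m) + B)} = D.reps l (lev (sg m))"
      using D.reps_ge E2.w.val_ge_mono 1 by fastforce
    then have "card {s \<in> Y m. val_ge E2.w s (lev (sg m) - \<beta>s n (sg m))} = q ^ l"
      unfolding set_eq by (simp add: card_reps)
    moreover have "2 * l + nat \<bar>B\<bar> = l + nat \<bar>B - int l\<bar>" using 1 by simp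
    ultimately show ?thesis unfolding LL by (simp only: r2[symmetric] flip: power_add)
  next
    case 2
    have "{s \<in> D.reps l (lev (sg m)). val_ge E2.w s (lev (sg m) + B)} = D.reps (nat (int l - B)) (lev (sg m) + B)"
      using D.reps_filter[of "lev (sg m)" "lev (sg m) + B" l] 2 by simp
    then have "card {s \<in> Y m. val_ge E2.w s (lev (sg m) - \<beta>s n (sg m))} = q ^ nat (int l - B)"
      unfolding set_eq by (simp add: card_reps)
    moreover have "2 * nat (int l - B) + nat \<bar>B\<bar> = l + nat \<bar>B - int l\<bar>" using 2 by simp
    ultimately show ?thesis unfolding LL by (simp only: r2[symmetric] flip: power_add)
  next
    case 3
    have "{s \<in> D.reps l (lev (sg m)). val_ge E2.w s (lev (sg m) + int l)} = {0}"
      using D.reps_filter[of "lev (sg m)" "lev (sg m) + int l" l] by simp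
    then have "s \<in> D.reps l (lev (sg m)) \<and> val_ge E2.w s (lev (sg m) + int l) \<longleftrightarrow> s = 0" for s by blast
    then have "{s \<in> D.reps l (lev (sg m)). val_ge E2.w s (lev (sg m) + B)} = {0}"
      using E2.w.val_ge_mono[of _ "lev (sg m) + B" "lev (sg m) + int l"] 3 by auto
    then have "card {s \<in> Y m. val_ge E2.w s (lev (sg m) - \<beta>s n (sg m))} = q ^ 0"
      unfolding set_eq by simp
    moreover have "2 * 0 + nat \<bar>B\<bar> = l + nat \<bar>B - int l\<bar>" using 3 by simp
    ultimately show ?thesis unfolding LL by (simp only: r2[symmetric] flip: power_add)
  qed
qed

lemma Y_bound:
  assumes "s \<in> Y m" "s \<noteq> 0"
  shows "E2.w s < lev (sg m) + int (len m)"
proof (rule ccontr)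
  assume "\<not> ?thesis"
  then have "s \<in> {s \<in> Y m. val_ge E2.w s (lev (sg m) + int (len m))}" using assms by (simp add: val_ge_def)
  also have "\<dots> = {0}"
    using D.reps_filter[of "lev (sg m)" "lev (sg m) + int (len m)" "len m"] by (simp add: Y_def)
  finally show False using assms by simp
qed

text \<open>The cosets that do not fix \<open>n\<close> up to \<open>K\<close> contribute zero in total, since multiplication
  of the parameter by \<open>\<zeta>\<close> changes the sign of the summand.\<close>

lemma coset_sum:
  fixes \<psi> :: "'e2 mat \<times> 'e4 \<Rightarrow> complex"
  assumes m: "m \<in> Nm" and n: "n \<in> Nm"
    and \<psi>: "\<And>g k k'. g \<in> carrier G \<Longrightarrow> k \<in> K \<Longrightarrow> k' \<in> K \<Longrightarrow> \<psi> (k \<otimes>\<^bsub>G\<^esub> g \<otimes>\<^bsub>G\<^esub> k') = \<rho> k * \<psi> g * \<rho> k'"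
  shows "(\<Sum>s\<in>Y m. \<psi> (inv\<^bsub>G\<^esub> (xr (sg m) s \<otimes>\<^bsub>G\<^esub> m) \<otimes>\<^bsub>G\<^esub> n)) * L n = L m * (L (inv\<^bsub>G\<^esub> m \<otimes>\<^bsub>G\<^esub> n) * \<psi> (inv\<^bsub>G\<^esub> m \<otimes>\<^bsub>G\<^esub> n))"
proof -
  let ?\<sigma> = "sg m"
  define f where "f s = \<psi> (inv\<^bsub>G\<^esub> m \<otimes>\<^bsub>G\<^esub> (xr ?\<sigma> (- s) \<otimes>\<^bsub>G\<^esub> n))" for s
  define c where "c = lev ?\<sigma> - \<beta>s n ?\<sigma>"
  have mG: "m \<in> carrier G" and nG: "n \<in> carrier G" using m n Nm_G by auto
  have oneK: "\<one>\<^bsub>G\<^esub> \<in> K" using K_subgroup by (rule subgroup.one_closed)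
  have f_eq: "\<psi> (inv\<^bsub>G\<^esub> (xr ?\<sigma> s \<otimes>\<^bsub>G\<^esub> m) \<otimes>\<^bsub>G\<^esub> n) = f s" for s
    unfolding f_def inv_xr[symmetric] using mG nG by (simp add: G_simps)
  have good: "f s = \<psi> (inv\<^bsub>G\<^esub> m \<otimes>\<^bsub>G\<^esub> n)" if "val_ge E2.w s c" for s
  proof -
    have "inv\<^bsub>G\<^esub> n \<otimes>\<^bsub>G\<^esub> xr ?\<sigma> (- s) \<otimes>\<^bsub>G\<^esub> n \<in> K" using conj_xr_K[OF n] that by (simp add: c_def)
    then have "\<psi> (\<one>\<^bsub>G\<^esub> \<otimes>\<^bsub>G\<^esub> (inv\<^bsub>G\<^esub> m \<otimes>\<^bsub>G\<^esub> n) \<otimes>\<^bsub>G\<^esub> (inv\<^bsub>G\<^esub> n \<otimes>\<^bsub>G\<^esub> xr ?\<sigma> (- s) \<otimes>\<^bsub>G\<^esub> n)) = \<psi> (inv\<^bsub>G\<^esub> m \<otimes>\<^bsub>G\<^esub> n)"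
      using \<psi>[of "inv\<^bsub>G\<^esub> m \<otimes>\<^bsub>G\<^esub> n" "\<one>\<^bsub>G\<^esub>"] oneK mG nG by (simp add: \<rho>_conj_xr[OF n] \<rho>_one)
    then show ?thesis using mG nG by (simp add: f_def G_simps)
  qed
  have bad: "f s = \<psi> (inv\<^bsub>G\<^esub> m \<otimes>\<^bsub>G\<^esub> (J ?\<sigma> (- s) \<otimes>\<^bsub>G\<^esub> n))" if s: "s \<in> Y m" "\<not> val_ge E2.w s c" for s
  proof -
    have s0: "s \<noteq> 0" "E2.w s < c" using s by (auto simp: val_ge_def)
    have flip: "\<beta>s n (\<not> ?\<sigma>) = - \<beta>s n ?\<sigma>" "lev (\<not> ?\<sigma>) = 1 - lev ?\<sigma>" by (auto simp: \<beta>s_def lev_def)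
    \<comment> \<open>In \<open>xr_rank_one\<close> the right factor \<open>x\<close> is absorbed
      past \<open>n\<close> since \<open>E2.w s < c\<close>, the left one past \<open>m\<close> by
      \<open>Y_bound\<close>: inversion of \<open>s\<close> turns upper bounds on its value into
      lower ones.\<close>
    define x where "x = xr (\<not> ?\<sigma>) (inverse (- s))"
    have xn: "inv\<^bsub>G\<^esub> n \<otimes>\<^bsub>G\<^esub> x \<otimes>\<^bsub>G\<^esub> n \<in> K"
      unfolding x_def conj_xr_K[OF n] flip using s0 by (simp add: val_ge_def E2.w.v_inverse c_def)
    have xm: "inv\<^bsub>G\<^esub> m \<otimes>\<^bsub>G\<^esub> x \<otimes>\<^bsub>G\<^esub> m \<in> K"
      unfolding x_def conj_xr_K[OF m] flip(2) \<beta>s_sg using s0 Y_bound[OF s(1) s0(1)]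
      by (simp add: val_ge_def E2.w.v_inverse)
    have JG: "J ?\<sigma> (- s) \<in> carrier G" using s0 by simp
    have xG: "x \<in> carrier G" by (simp add: x_def)
    have "\<psi> ((inv\<^bsub>G\<^esub> m \<otimes>\<^bsub>G\<^esub> x \<otimes>\<^bsub>G\<^esub> m) \<otimes>\<^bsub>G\<^esub> (inv\<^bsub>G\<^esub> m \<otimes>\<^bsub>G\<^esub> (J ?\<sigma> (- s) \<otimes>\<^bsub>G\<^esub> n)) \<otimes>\<^bsub>G\<^esub> (inv\<^bsub>G\<^esub> n \<otimes>\<^bsub>G\<^esub> x \<otimes>\<^bsub>G\<^esub> n))
       = \<psi> (inv\<^bsub>G\<^esub> m \<otimes>\<^bsub>G\<^esub> (J ?\<sigma> (- s) \<otimes>\<^bsub>G\<^esub> n))"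
      using \<psi>[OF _ xm xn, of "inv\<^bsub>G\<^esub> m \<otimes>\<^bsub>G\<^esub> (J ?\<sigma> (- s) \<otimes>\<^bsub>G\<^esub> n)"] JG mG nG
      by (simp add: x_def \<rho>_conj_xr[OF n] \<rho>_conj_xr[OF m])
    moreover have "xr ?\<sigma> (- s) = x \<otimes>\<^bsub>G\<^esub> J ?\<sigma> (- s) \<otimes>\<^bsub>G\<^esub> x"
      unfolding x_def using s0 by (intro xr_rank_one) simp
    ultimately show ?thesis using mG nG JG xG by (simp add: f_def G_simps)
  qed
  have "f (\<iota>2 \<zeta> * s) = - f s" if s: "s \<in> Y m" "\<not> val_ge E2.w s c" for s
  proof -
    let ?t = "tor ?\<sigma> (\<iota>2 \<zeta>)"
    have \<zeta>0: "\<iota>2 \<zeta> \<noteq> 0" by simp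
    have tKM: "?t \<in> K \<inter> Nm" using tor_\<zeta> tor_Nm[OF \<zeta>0] by blast
    have tG: "?t \<in> carrier G" using tKM Nm_G by blast
    have s0: "s \<noteq> 0" using s by (auto simp: val_ge_def)
    have JG: "J ?\<sigma> (- s) \<in> carrier G" using s0 by simp
    have s': "\<iota>2 \<zeta> * s \<in> Y m" using s D.t_mult_reps by (simp add: Y_def)
    have "\<not> val_ge E2.w (\<iota>2 \<zeta> * s) c" using s s0 w_\<zeta> by (simp add: val_ge_def E2.w.v_mult)
    then have "f (\<iota>2 \<zeta> * s) = \<psi> (inv\<^bsub>G\<^esub> m \<otimes>\<^bsub>G\<^esub> (J ?\<sigma> (- (\<iota>2 \<zeta> * s)) \<otimes>\<^bsub>G\<^esub> n))" by (rule bad[OF s'])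
    also have "J ?\<sigma> (- (\<iota>2 \<zeta> * s)) = ?t \<otimes>\<^bsub>G\<^esub> J ?\<sigma> (- s)"
      using J_scale[OF \<zeta>0, of ?\<sigma> "- s"] by simp
    also have "\<psi> (inv\<^bsub>G\<^esub> m \<otimes>\<^bsub>G\<^esub> (?t \<otimes>\<^bsub>G\<^esub> J ?\<sigma> (- s) \<otimes>\<^bsub>G\<^esub> n)) =
      \<psi> ((inv\<^bsub>G\<^esub> m \<otimes>\<^bsub>G\<^esub> ?t \<otimes>\<^bsub>G\<^esub> m) \<otimes>\<^bsub>G\<^esub> (inv\<^bsub>G\<^esub> m \<otimes>\<^bsub>G\<^esub> (J ?\<sigma> (- s) \<otimes>\<^bsub>G\<^esub> n)) \<otimes>\<^bsub>G\<^esub> \<one>\<^bsub>G\<^esub>)"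
      using mG nG JG tG by (simp add: G_simps)
    also have "\<dots> = - \<psi> (inv\<^bsub>G\<^esub> m \<otimes>\<^bsub>G\<^esub> (J ?\<sigma> (- s) \<otimes>\<^bsub>G\<^esub> n))"
    proof -
      have "inv\<^bsub>G\<^esub> m \<in> Nm" using m Nm_subgroup by (simp add: subgroup.m_inv_closed)
      from conj_KM[OF this tKM] have tK: "inv\<^bsub>G\<^esub> m \<otimes>\<^bsub>G\<^esub> ?t \<otimes>\<^bsub>G\<^esub> m \<in> K" using mG by simp
      have "\<rho> (inv\<^bsub>G\<^esub> m \<otimes>\<^bsub>G\<^esub> ?t \<otimes>\<^bsub>G\<^esub> m) = - 1" using conj_KNm[OF m _ tK] tor_\<zeta> by simp
      then show ?thesis
        using \<psi>[OF _ tK oneK, of "inv\<^bsub>G\<^esub> m \<otimes>\<^bsub>G\<^esub> (J ?\<sigma> (- s) \<otimes>\<^bsub>G\<^esub> n)"] JG mG nG by (simp add: \<rho>_one)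
    qed
    also have "\<dots> = - f s" using bad[OF s] by simp
    finally show ?thesis .
  qed
  then have cancel: "sum f {s \<in> Y m. \<not> val_ge E2.w s c} = 0"
    unfolding Y_def by (intro D.sum_reps_cancel)
  have "sum f (Y m) = sum f ({s \<in> Y m. val_ge E2.w s c} \<union> {s \<in> Y m. \<not> val_ge E2.w s c})"
    by (rule arg_cong[of _ _ "sum f"]) blast
  also have "\<dots> = sum f {s \<in> Y m. val_ge E2.w s c}"
    using finite_Y by (subst sum.union_disjoint) (auto simp: cancel)
  also have "\<dots> = (\<Sum>s\<in>{s \<in> Y m. val_ge E2.w s c}. \<psi> (inv\<^bsub>G\<^esub> m \<otimes>\<^bsub>G\<^esub> n))" using good by (intro sum.cong) auto
  finally have "sum f (Y m) = of_nat (card {s \<in> Y m. val_ge E2.w s c}) * \<psi> (inv\<^bsub>G\<^esub> m \<otimes>\<^bsub>G\<^esub> n)" by simp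
  then have "sum f (Y m) * L n = (of_nat (card {s \<in> Y m. val_ge E2.w s c}) * L n) * \<psi> (inv\<^bsub>G\<^esub> m \<otimes>\<^bsub>G\<^esub> n)"
    by (simp only: mult_ac)
  then show ?thesis unfolding f_eq using card_Y_filter[OF m n] by (simp add: c_def mult.assoc)
qed

end

section \<open>The normalizer of the torus\<close>

lemma comm_ring_hom_to_ac: "comm_ring_hom (to_ac :: 'a::field \<Rightarrow> _)"
  by unfold_locales simp_all

context finite_extension
begin

definition rac :: "'e \<Rightarrow> 'f alg_closure mat" where
  "rac x = map_mat to_ac (regular_rep \<iota> x)"

lemma rac_carrier [simp]: "rac x \<in> carrier_mat (ext_degree \<iota>) (ext_degree \<iota>)"
  by (simp add: rac_def)

lemma rac_mult: "rac (x * y) = rac x * rac y"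
proof -
  interpret h: comm_ring_hom "to_ac :: 'f \<Rightarrow> _" by (rule comm_ring_hom_to_ac)
  show ?thesis unfolding rac_def regular_rep_mult by (rule h.mat_hom_mult) auto
qed

lemma rac_add: "rac (x + y) = rac x + rac y"
  unfolding rac_def regular_rep_add by (rule eq_matI) auto

lemma rac_one: "rac 1 = 1\<^sub>m (ext_degree \<iota>)"
  unfolding rac_def regular_rep_one by (rule eq_matI) auto

lemma rac_zero: "rac 0 = 0\<^sub>m (ext_degree \<iota>) (ext_degree \<iota>)"
  unfolding rac_def regular_rep_zero by (rule eq_matI) auto

lemma rac_inverse: "x \<noteq> 0 \<Longrightarrow> rac x * rac (inverse x) = 1\<^sub>m (ext_degree \<iota>)"
  by (simp add: rac_one flip: rac_mult)

lemma rac_eq_zeroD: "rac x = 0\<^sub>m (ext_degree \<iota>) (ext_degree \<iota>) \<Longrightarrow> x = 0"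
proof -
  assume *: "rac x = 0\<^sub>m (ext_degree \<iota>) (ext_degree \<iota>)"
  have "regular_rep \<iota> x = 0\<^sub>m (ext_degree \<iota>) (ext_degree \<iota>)"
  proof (rule eq_matI)
    fix i j assume ij: "i < dim_row (0\<^sub>m (ext_degree \<iota>) (ext_degree \<iota>) :: 'f mat)" "j < dim_col (0\<^sub>m (ext_degree \<iota>) (ext_degree \<iota>) :: 'f mat)"
    then have "to_ac (regular_rep \<iota> x $$ (i,j)) = rac x $$ (i,j)" by (simp add: rac_def)
    then show "regular_rep \<iota> x $$ (i,j) = 0\<^sub>m (ext_degree \<iota>) (ext_degree \<iota>) $$ (i,j)" using ij by (simp add: *)
  qed auto
  then show "x = 0" by (simp add: regular_rep_eq_zero_iff)
qed

lemma det_rac: "det (rac x) = to_ac (ext_norm \<iota> x)"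
proof -
  interpret h: comm_ring_hom "to_ac :: 'f \<Rightarrow> _" by (rule comm_ring_hom_to_ac)
  show ?thesis unfolding rac_def ext_norm_def by (rule h.hom_det)
qed

lemma closure_points_carrier: "x \<in> ext_closure_points \<iota> \<Longrightarrow> x \<in> carrier_mat (ext_degree \<iota>) (ext_degree \<iota>)"
  by (auto simp: ext_closure_points_def)

lemma regular_rep_expand:
  assumes "i < ext_degree \<iota>" "j < ext_degree \<iota>"
  shows "regular_rep \<iota> x $$ (i,j) = (\<Sum>k<ext_degree \<iota>. vec_index (ext_coords \<iota> x) k * regular_rep \<iota> (ext_basis \<iota> ! k) $$ (i,j))"
proof -
  have *: "regular_rep \<iota> (\<Sum>k\<in>S. \<iota> (c k) * b k) $$ (i,j) = (\<Sum>k\<in>S. c k * regular_rep \<iota> (b k) $$ (i,j))"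
    if "finite S" for S :: "nat set" and c b
    using that
  proof (induction S)
    case empty
    then show ?case using assms by (simp add: regular_rep_zero)
  next
    case (insert k S)
    then show ?case using assms by (simp add: regular_rep_add regular_rep_smult)
  qed
  show ?thesis by (subst ext_coords(2)[of x, symmetric]) (simp add: *)
qed

lemma rac_closure_points: "rac x \<in> ext_closure_points \<iota>"
  unfolding ext_closure_points_def
proof (intro CollectI exI conjI)
  show "rac x = mat (ext_degree \<iota>) (ext_degree \<iota>)
        (\<lambda>(i, j). \<Sum>k<ext_degree \<iota>. to_ac (vec_index (ext_coords \<iota> x) k) * to_ac (regular_rep \<iota> (ext_basis \<iota> ! k) $$ (i, j)))"
    by (rule eq_matI) (auto simp: rac_def regular_rep_expand[of _ _ x] to_ac_sum)
qed simp

text \<open>Points over the closure are linear combinations of multiplication matrices, which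
  commute because the field is commutative. Hence conjugation by diagonal elements is trivial on the
  torus over the closure.\<close>

lemma rac_commute:
  assumes "x \<in> ext_closure_points \<iota>"
  shows "rac y * x = x * rac y"
proof -
  let ?n = "ext_degree \<iota>"
  obtain c where x: "x = mat ?n ?n (\<lambda>(i, j). \<Sum>k<?n. c k * to_ac (regular_rep \<iota> (ext_basis \<iota> ! k) $$ (i, j)))"
    using assms by (auto simp: ext_closure_points_def)
  have xe: "x $$ (i,j) = (\<Sum>k<?n. c k * rac (ext_basis \<iota> ! k) $$ (i,j))" if "i < ?n" "j < ?n" for i j
    using that by (simp add: x rac_def)
  have rc: "dim_row (rac u) = ?n" "dim_col (rac u) = ?n" for u by (simp_all add: rac_def)
  show ?thesis
  proof (rule eq_matI)
    fix i j assume "i < dim_row (x * rac y)" "j < dim_col (x * rac y)"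
    then have ij: "i < ?n" "j < ?n" by (auto simp: x rc)
    have "(rac y * x) $$ (i,j) = (\<Sum>l<?n. \<Sum>k<?n. c k * (rac y $$ (i,l) * rac (ext_basis \<iota> ! k) $$ (l,j)))"
      using ij by (auto simp: scalar_prod_def atLeast0LessThan x rac_def sum_distrib_left mult.left_commute intro!: sum.cong)
    also have "\<dots> = (\<Sum>k<?n. c k * (rac y * rac (ext_basis \<iota> ! k)) $$ (i,j))"
      using ij by (subst sum.swap) (auto simp: scalar_prod_def atLeast0LessThan rc sum_distrib_left intro!: sum.cong)
    also have "\<dots> = (\<Sum>k<?n. c k * (rac (ext_basis \<iota> ! k) * rac y) $$ (i,j))"
      by (simp add: mult.commute flip: rac_mult)
    also have "\<dots> = (\<Sum>l<?n. \<Sum>k<?n. c k * (rac (ext_basis \<iota> ! k) $$ (i,l) * rac y $$ (l,j)))"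
      using ij by (subst sum.swap) (auto simp: scalar_prod_def atLeast0LessThan rc sum_distrib_left intro!: sum.cong)
    also have "\<dots> = (x * rac y) $$ (i,j)"
      using ij by (auto simp: scalar_prod_def atLeast0LessThan x rac_def sum_distrib_right mult.assoc intro!: sum.cong)
    finally show "(rac y * x) $$ (i,j) = (x * rac y) $$ (i,j)" .
  qed (auto simp: x rc)
qed

lemma rac_conj:
  assumes x: "x \<in> ext_closure_points \<iota>" and y: "y \<noteq> 0"
  shows "rac y * x * rac (inverse y) = x"
proof -
  have xc: "x \<in> carrier_mat (ext_degree \<iota>) (ext_degree \<iota>)" using x by (rule closure_points_carrier)
  have "rac y * x * rac (inverse y) = x * (rac y * rac (inverse y))"
    unfolding rac_commute[OF x] by (rule assoc_mult_mat[OF xc rac_carrier rac_carrier])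
  then show ?thesis using xc y by (simp add: rac_inverse)
qed

end

definition blk :: "'a::zero mat \<Rightarrow> 'a mat \<Rightarrow> 'a mat \<Rightarrow> 'a mat \<Rightarrow> 'a mat \<Rightarrow> 'a mat" where
  "blk A B C D Z = block_diag_mat (four_block_mat A B C D) Z"

lemma blk_mult:
  fixes A :: "'a::comm_ring_1 mat"
  assumes "A \<in> carrier_mat n n" "B \<in> carrier_mat n n" "C \<in> carrier_mat n n" "D \<in> carrier_mat n n" "Z \<in> carrier_mat m m"
    "A' \<in> carrier_mat n n" "B' \<in> carrier_mat n n" "C' \<in> carrier_mat n n" "D' \<in> carrier_mat n n" "Z' \<in> carrier_mat m m"
  shows "blk A B C D Z * blk A' B' C' D' Z' =
    blk (A * A' + B * C') (A * B' + B * D') (C * A' + D * C') (C * B' + D * D') (Z * Z')"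
proof -
  let ?M = "four_block_mat A B C D" and ?M' = "four_block_mat A' B' C' D'"
  have M: "?M \<in> carrier_mat (n + n) (n + n)" "?M' \<in> carrier_mat (n + n) (n + n)" using assms by auto
  have MM': "?M * ?M' = four_block_mat (A * A' + B * C') (A * B' + B * D') (C * A' + D * C') (C * B' + D * D')"
    by (rule mult_four_block_mat) (use assms in auto)
  have d: "dim_row ?M = n + n" "dim_col ?M = n + n" "dim_row ?M' = n + n" "dim_col ?M' = n + n"
    "dim_row Z = m" "dim_col Z = m" "dim_row Z' = m" "dim_col Z' = m" using M assms by auto
  have "blk A B C D Z * blk A' B' C' D' Z' =
    four_block_mat (?M * ?M' + 0\<^sub>m (n + n) m * 0\<^sub>m m (n + n)) (?M * 0\<^sub>m (n + n) m + 0\<^sub>m (n + n) m * Z')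
      (0\<^sub>m m (n + n) * ?M' + Z * 0\<^sub>m m (n + n)) (0\<^sub>m m (n + n) * 0\<^sub>m (n + n) m + Z * Z')"
    unfolding blk_def block_diag_mat_def d by (rule mult_four_block_mat) (use M assms in auto)
  also have "\<dots> = four_block_mat (?M * ?M') (0\<^sub>m (n + n) m) (0\<^sub>m m (n + n)) (Z * Z')"
    using M assms by (simp add: right_add_zero_mat[OF mult_carrier_mat[OF M]])
  also have "\<dots> = block_diag_mat (?M * ?M') (Z * Z')"
    using d by (simp add: block_diag_mat_def)
  finally show ?thesis by (simp add: MM' blk_def)
qed

lemma det_blk_diag:
  fixes A :: "'a::idom mat"
  assumes "A \<in> carrier_mat n n" "D \<in> carrier_mat n n" "Z \<in> carrier_mat m m"
  shows "det (blk A (0\<^sub>m n n) (0\<^sub>m n n) D Z) = det A * det D * det Z"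
proof -
  have M: "four_block_mat A (0\<^sub>m n n) (0\<^sub>m n n) D \<in> carrier_mat (n + n) (n + n)" using assms by auto
  have "det (blk A (0\<^sub>m n n) (0\<^sub>m n n) D Z) = det (four_block_mat A (0\<^sub>m n n) (0\<^sub>m n n) D) * det Z"
    unfolding blk_def block_diag_mat_def using M assms
    by (intro det_four_block_mat_upper_right_zero[of _ "n + n" _ m]) auto
  also have "det (four_block_mat A (0\<^sub>m n n) (0\<^sub>m n n) D) = det A * det D"
    using assms by (intro det_four_block_mat_upper_right_zero[of _ n _ n]) auto
  finally show ?thesis .
qed

lemma blk_off_diagonal:
  assumes c: "A \<in> carrier_mat n n" "B \<in> carrier_mat n n" "C \<in> carrier_mat n n" "D \<in> carrier_mat n n" "Z \<in> carrier_mat m m"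
    "A' \<in> carrier_mat n n" "D' \<in> carrier_mat n n" "Z' \<in> carrier_mat m m"
    and eq: "blk A B C D Z = blk A' (0\<^sub>m n n) (0\<^sub>m n n) D' Z'"
  shows "B = 0\<^sub>m n n" "C = 0\<^sub>m n n"
proof -
  have entry: "blk A B C D Z $$ (i, n + j) = B $$ (i,j)" "blk A B C D Z $$ (n + i, j) = C $$ (i,j)"
    if "i < n" "j < n" "A \<in> carrier_mat n n" "B \<in> carrier_mat n n" "C \<in> carrier_mat n n" "D \<in> carrier_mat n n" "Z \<in> carrier_mat m m"
    for i j and A B C D Z :: "'a mat"
    using that by (auto simp: blk_def block_diag_mat_def)
  show "B = 0\<^sub>m n n"
  proof (rule eq_matI)
    fix i j assume "i < dim_row (0\<^sub>m n n :: 'a mat)" "j < dim_col (0\<^sub>m n n :: 'a mat)"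
    then show "B $$ (i,j) = 0\<^sub>m n n $$ (i,j)"
      using entry(1)[of i j A B C D Z] entry(1)[of i j A' "0\<^sub>m n n" "0\<^sub>m n n" D' Z'] eq c by simp
  qed (use c in auto)
  show "C = 0\<^sub>m n n"
  proof (rule eq_matI)
    fix i j assume "i < dim_row (0\<^sub>m n n :: 'a mat)" "j < dim_col (0\<^sub>m n n :: 'a mat)"
    then show "C $$ (i,j) = 0\<^sub>m n n $$ (i,j)"
      using entry(2)[of i j A B C D Z] entry(2)[of i j A' "0\<^sub>m n n" "0\<^sub>m n n" D' Z'] eq c by simp
  qed (use c in auto)
qed

context hecke_setup
begin

abbreviation d2 where "d2 \<equiv> ext_degree \<iota>2"
abbreviation d4 where "d4 \<equiv> ext_degree \<iota>4"

definition emb :: "'e2 mat \<times> 'e4 \<Rightarrow> 'f alg_closure mat" where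
  "emb g = map_mat to_ac (GL8_embedding \<iota>2 \<iota>4 g)"

lemma emb_mk: "emb (mk a b c d, z) = blk (E2.rac a) (E2.rac b) (E2.rac c) (E2.rac d) (E4.rac z)"
proof -
  let ?M = "four_block_mat (regular_rep \<iota>2 a) (regular_rep \<iota>2 b) (regular_rep \<iota>2 c) (regular_rep \<iota>2 d)"
  have M: "?M \<in> carrier_mat (d2 + d2) (d2 + d2)" by auto
  have 1: "map_mat to_ac ?M = four_block_mat (E2.rac a) (E2.rac b) (E2.rac c) (E2.rac d)"
    unfolding E2.rac_def by (rule map_four_block_mat) auto
  have z: "map_mat to_ac (0\<^sub>m i j :: 'f mat) = 0\<^sub>m i j" for i j by (rule eq_matI) auto
  have "emb (mk a b c d, z) = map_mat to_ac (four_block_mat ?M (0\<^sub>m (d2 + d2) d4) (0\<^sub>m d4 (d2 + d2)) (regular_rep \<iota>4 z))"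
    using M by (simp add: emb_def GL8_embedding_def block_diag_mat_def)
  also have "\<dots> = four_block_mat (map_mat to_ac ?M) (map_mat to_ac (0\<^sub>m (d2 + d2) d4)) (map_mat to_ac (0\<^sub>m d4 (d2 + d2))) (E4.rac z)"
    unfolding E4.rac_def by (rule map_four_block_mat[OF M]) auto
  also have "\<dots> = blk (E2.rac a) (E2.rac b) (E2.rac c) (E2.rac d) (E4.rac z)"
    unfolding 1 z by (simp add: blk_def block_diag_mat_def E2.rac_def E4.rac_def)
  finally show ?thesis .
qed

lemma emb_mult: "g \<in> carrier G \<Longrightarrow> h \<in> carrier G \<Longrightarrow> emb (g \<otimes>\<^bsub>G\<^esub> h) = emb g * emb h"
  by (elim G_cases)
     (simp add: emb_mk blk_mult[of _ d2 _ _ _ _ d4] E2.rac_mult E2.rac_add E4.rac_mult)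

lemma M0_closure_points_eq: "M0_closure_points \<iota>2 \<iota>4 =
   {blk x (0\<^sub>m d2 d2) (0\<^sub>m d2 d2) y z | x y z. x \<in> ext_closure_points \<iota>2 \<and> y \<in> ext_closure_points \<iota>2 \<and>
      z \<in> ext_closure_points \<iota>4 \<and> det x * det y * det z = 1}"
proof -
  have "block_diag_mat (block_diag_mat x y) z = blk x (0\<^sub>m d2 d2) (0\<^sub>m d2 d2) y z"
    if "x \<in> ext_closure_points \<iota>2" "y \<in> ext_closure_points \<iota>2" for x y :: "'f alg_closure mat" and z
    using E2.closure_points_carrier[OF that(1)] E2.closure_points_carrier[OF that(2)]
    by (simp add: blk_def block_diag_mat_def)
  moreover have "det (blk x (0\<^sub>m d2 d2) (0\<^sub>m d2 d2) y z) = det x * det y * det z"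
    if "x \<in> ext_closure_points \<iota>2" "y \<in> ext_closure_points \<iota>2" "z \<in> ext_closure_points \<iota>4" for x y z
    using that E2.closure_points_carrier E4.closure_points_carrier by (intro det_blk_diag) auto
  ultimately show ?thesis unfolding M0_closure_points_def by (auto; metis)
qed

lemma emb_conj_diag:
  assumes n: "(mk a 0 0 b, u) \<in> carrier G"
    and x: "x \<in> ext_closure_points \<iota>2" "y \<in> ext_closure_points \<iota>2" "z \<in> ext_closure_points \<iota>4"
  shows "emb (mk a 0 0 b, u) * blk x (0\<^sub>m d2 d2) (0\<^sub>m d2 d2) y z * emb (inv\<^bsub>G\<^esub> (mk a 0 0 b, u))
    = blk x (0\<^sub>m d2 d2) (0\<^sub>m d2 d2) y z"
proof -
  have nz: "a \<noteq> 0" "b \<noteq> 0" "u \<noteq> 0" using n by auto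
  have c: "x \<in> carrier_mat d2 d2" "y \<in> carrier_mat d2 d2" "z \<in> carrier_mat d4 d4"
    using x E2.closure_points_carrier E4.closure_points_carrier by auto
  note pc = mult_carrier_mat[OF E2.rac_carrier[of a] c(1)] mult_carrier_mat[OF E2.rac_carrier[of b] c(2)]
    mult_carrier_mat[OF E4.rac_carrier[of u] c(3)]
  show ?thesis unfolding inv_diag[OF n] emb_mk E2.rac_zero
    using c pc by (simp add: blk_mult[of _ d2 _ _ _ _ d4] E2.rac_conj E4.rac_conj x nz
        right_mult_zero_mat[OF E2.rac_carrier] left_mult_zero_mat[OF E2.rac_carrier]
        right_mult_zero_mat[OF pc(1)] right_mult_zero_mat[OF pc(2)])
qed

lemma emb_conj_anti:
  assumes n: "(mk 0 a b 0, u) \<in> carrier G"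
    and x: "x \<in> ext_closure_points \<iota>2" "y \<in> ext_closure_points \<iota>2" "z \<in> ext_closure_points \<iota>4"
  shows "emb (mk 0 a b 0, u) * blk x (0\<^sub>m d2 d2) (0\<^sub>m d2 d2) y z * emb (inv\<^bsub>G\<^esub> (mk 0 a b 0, u))
    = blk y (0\<^sub>m d2 d2) (0\<^sub>m d2 d2) x z"
proof -
  have nz: "a \<noteq> 0" "b \<noteq> 0" "u \<noteq> 0" using n by auto
  have c: "x \<in> carrier_mat d2 d2" "y \<in> carrier_mat d2 d2" "z \<in> carrier_mat d4 d4"
    using x E2.closure_points_carrier E4.closure_points_carrier by auto
  note pc = mult_carrier_mat[OF E2.rac_carrier[of a] c(2)] mult_carrier_mat[OF E2.rac_carrier[of b] c(1)]
    mult_carrier_mat[OF E4.rac_carrier[of u] c(3)]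
  show ?thesis unfolding inv_anti[OF n] emb_mk E2.rac_zero
    using c pc by (simp add: blk_mult[of _ d2 _ _ _ _ d4] E2.rac_conj E4.rac_conj x nz
        right_mult_zero_mat[OF E2.rac_carrier] left_mult_zero_mat[OF E2.rac_carrier]
        right_mult_zero_mat[OF pc(1)] right_mult_zero_mat[OF pc(2)])
qed

text \<open>Monomial elements fix or exchange the first two blocks. For the converse it suffices to
  conjugate a single rational torus element.\<close>

lemma normalizer_M0_eq: "normalizer_M0 \<iota>2 \<iota>4 = Nm"
proof -
  have N: "normalizer_M0 \<iota>2 \<iota>4 = {g \<in> carrier G. (\<lambda>A. emb g * A * emb (inv\<^bsub>G\<^esub> g)) ` M0_closure_points \<iota>2 \<iota>4 = M0_closure_points \<iota>2 \<iota>4}"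
    by (simp add: normalizer_M0_def emb_def)
  have "(\<lambda>A. emb n * A * emb (inv\<^bsub>G\<^esub> n)) ` M0_closure_points \<iota>2 \<iota>4 = M0_closure_points \<iota>2 \<iota>4" if n: "n \<in> Nm" for n
    using n
  proof (cases rule: Nm_cases)
    case (diag a b u)
    have "emb n * A * emb (inv\<^bsub>G\<^esub> n) = A" if "A \<in> M0_closure_points \<iota>2 \<iota>4" for A
      using that emb_conj_diag Nm_G[OF n] unfolding diag(1) M0_closure_points_eq by blast
    then show ?thesis by simp
  next
    case (anti a b u)
    note conj = emb_conj_anti[OF Nm_G[OF n, unfolded anti(1)], folded anti(1)]
    show ?thesis
    proof (intro equalityI subsetI)
      fix A assume "A \<in> (\<lambda>A. emb n * A * emb (inv\<^bsub>G\<^esub> n)) ` M0_closure_points \<iota>2 \<iota>4"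
      then obtain x y z where x: "x \<in> ext_closure_points \<iota>2" "y \<in> ext_closure_points \<iota>2"
        "z \<in> ext_closure_points \<iota>4" "det x * det y * det z = 1"
        "A = emb n * blk x (0\<^sub>m d2 d2) (0\<^sub>m d2 d2) y z * emb (inv\<^bsub>G\<^esub> n)" unfolding M0_closure_points_eq by blast
      then have "A = blk y (0\<^sub>m d2 d2) (0\<^sub>m d2 d2) x z" "det y * det x * det z = 1" by (simp_all add: conj mult.commute)
      then show "A \<in> M0_closure_points \<iota>2 \<iota>4" using x unfolding M0_closure_points_eq by blast
    next
      fix A assume "A \<in> M0_closure_points \<iota>2 \<iota>4"
      then obtain x y z where x: "x \<in> ext_closure_points \<iota>2" "y \<in> ext_closure_points \<iota>2"
        "z \<in> ext_closure_points \<iota>4" "det x * det y * det z = 1"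
        "A = blk x (0\<^sub>m d2 d2) (0\<^sub>m d2 d2) y z" unfolding M0_closure_points_eq by blast
      then have "det y * det x * det z = 1" by (simp add: mult.commute)
      then have "blk y (0\<^sub>m d2 d2) (0\<^sub>m d2 d2) x z \<in> M0_closure_points \<iota>2 \<iota>4"
        using x unfolding M0_closure_points_eq by blast
      moreover have "A = emb n * blk y (0\<^sub>m d2 d2) (0\<^sub>m d2 d2) x z * emb (inv\<^bsub>G\<^esub> n)"
        using conj x by simp
      ultimately show "A \<in> (\<lambda>A. emb n * A * emb (inv\<^bsub>G\<^esub> n)) ` M0_closure_points \<iota>2 \<iota>4" by blast
    qed
  qed
  moreover have "g \<in> Nm" if g: "g \<in> carrier G"
    and eq: "(\<lambda>A. emb g * A * emb (inv\<^bsub>G\<^esub> g)) ` M0_closure_points \<iota>2 \<iota>4 = M0_closure_points \<iota>2 \<iota>4" for g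
  proof -
    \<comment> \<open>The test element \<open>diag(s, inverse s)\<close> has
      \<open>s * s \<noteq> 1\<close> because \<open>\<zeta>\<close> has order at least 4; vanishing
      of the off-diagonal blocks of its conjugate gives \<open>a * b = 0\<close> and
      \<open>c * d = 0\<close>.\<close>
    define s where "s = \<iota>2 \<zeta>"
    have s: "s \<noteq> 0" "s * s \<noteq> 1"
      using \<zeta>_square by (auto simp: s_def power2_eq_square simp flip: E2.hom_simps(4) E2.hom_simps(2))
    let ?t = "(mk s 0 0 (inverse s), 1) :: 'e2 mat \<times> 'e4"
    obtain a b c d z where e: "g = (mk a b c d, z)" using g by (rule G_cases)
    define \<Delta> where "\<Delta> = a * d - b * c"
    have \<Delta>: "\<Delta> \<noteq> 0" "z \<noteq> 0" using g by (auto simp: e \<Delta>_def)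
    have t: "?t \<in> carrier G" using s by simp
    have "emb ?t \<in> M0_closure_points \<iota>2 \<iota>4"
    proof -
      have "E2.rac s \<in> ext_closure_points \<iota>2" "E2.rac (inverse s) \<in> ext_closure_points \<iota>2" "E4.rac 1 \<in> ext_closure_points \<iota>4"
        by (rule E2.rac_closure_points E4.rac_closure_points)+
      moreover have "det (E2.rac s) * det (E2.rac (inverse s)) * det (E4.rac 1) = 1"
        using s E2.ext_norm_nonzero[of s] by (simp add: E2.det_rac E4.det_rac E2.ext_norm_inverse)
      ultimately show ?thesis unfolding M0_closure_points_eq emb_mk E2.rac_zero by blast
    qed
    then have "emb g * emb ?t * emb (inv\<^bsub>G\<^esub> g) \<in> M0_closure_points \<iota>2 \<iota>4" using eq by blast
    then have "emb (g \<otimes>\<^bsub>G\<^esub> ?t \<otimes>\<^bsub>G\<^esub> inv\<^bsub>G\<^esub> g) \<in> M0_closure_points \<iota>2 \<iota>4"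
      using g t by (simp add: emb_mult del: G_mult G_iff)
    moreover have "g \<otimes>\<^bsub>G\<^esub> ?t \<otimes>\<^bsub>G\<^esub> inv\<^bsub>G\<^esub> g = (mk (a * s * (d / \<Delta>) + b * inverse s * (- c / \<Delta>))
       (a * s * (- b / \<Delta>) + b * inverse s * (a / \<Delta>)) (c * s * (d / \<Delta>) + d * inverse s * (- c / \<Delta>))
       (c * s * (- b / \<Delta>) + d * inverse s * (a / \<Delta>)), 1)"
      using g \<Delta> unfolding e by (simp add: inv_mk flip: \<Delta>_def)
    ultimately obtain x y w where xyw: "x \<in> ext_closure_points \<iota>2" "y \<in> ext_closure_points \<iota>2" "w \<in> ext_closure_points \<iota>4"
      "blk (E2.rac (a * s * (d / \<Delta>) + b * inverse s * (- c / \<Delta>)))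
       (E2.rac (a * s * (- b / \<Delta>) + b * inverse s * (a / \<Delta>))) (E2.rac (c * s * (d / \<Delta>) + d * inverse s * (- c / \<Delta>)))
       (E2.rac (c * s * (- b / \<Delta>) + d * inverse s * (a / \<Delta>))) (E4.rac 1) = blk x (0\<^sub>m d2 d2) (0\<^sub>m d2 d2) y w"
      unfolding M0_closure_points_eq by (auto simp: emb_mk)
    have "E2.rac (a * s * (- b / \<Delta>) + b * inverse s * (a / \<Delta>)) = 0\<^sub>m d2 d2"
      "E2.rac (c * s * (d / \<Delta>) + d * inverse s * (- c / \<Delta>)) = 0\<^sub>m d2 d2"
      using blk_off_diagonal[where n = d2 and m = d4, OF _ _ _ _ _ _ _ _ xyw(4)] xyw(1-3)
        E2.closure_points_carrier E4.closure_points_carrier by auto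
    then have "a * s * (- b / \<Delta>) + b * inverse s * (a / \<Delta>) = 0" "c * s * (d / \<Delta>) + d * inverse s * (- c / \<Delta>) = 0"
      using E2.rac_eq_zeroD by blast+
    then have "a * b * (1 - s * s) = 0" "c * d * (1 - s * s) = 0"
      using s \<Delta> by (simp_all add: field_simps)
    then have "a * b = 0" "c * d = 0" using s by auto
    then have "b = 0 \<and> c = 0 \<or> a = 0 \<and> d = 0" using \<Delta> by (auto simp: \<Delta>_def)
    then show ?thesis using g by (simp add: e Nm_iff del: G_iff)
  qed
  ultimately show ?thesis unfolding N using Nm_G by blast
qed

end

section \<open>Hecke algebras and twisted group algebras\<close>

text \<open>A pair \<open>(K, \<rho>)\<close> all of whose double cosets \<open>K n K\<close>, for \<open>n\<close> in a group \<open>N\<close> of representatives,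
  support a function of the Hecke algebra. The set \<open>Y n\<close> represents the left cosets in \<open>K n K\<close>, and
  \<open>L n\<close> is the square root of their number.\<close>

locale hecke_pair = group G for G :: "'g monoid" (structure) +
  fixes T :: "'g topology" and K N :: "'g set" and \<rho> L t :: "'g \<Rightarrow> complex" and Y :: "'g \<Rightarrow> 'g set"
  assumes K: "subgroup K G" and N: "subgroup N G"
    and \<rho>_mult: "\<And>k l. k \<in> K \<Longrightarrow> l \<in> K \<Longrightarrow> \<rho> (k \<otimes> l) = \<rho> k * \<rho> l"
    and \<rho>_nonzero: "\<And>k. k \<in> K \<Longrightarrow> \<rho> k \<noteq> 0"
    and conj_KN: "\<And>n k. n \<in> N \<Longrightarrow> k \<in> K \<inter> N \<Longrightarrow> n \<otimes> k \<otimes> inv n \<in> K \<inter> N"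
    and decomp: "\<And>g. g \<in> carrier G \<Longrightarrow> \<exists>k\<in>K. \<exists>n\<in>N. \<exists>k'\<in>K. g = k \<otimes> n \<otimes> k'"
    and decomp_unique: "\<And>k m n. k \<in> K \<Longrightarrow> m \<in> N \<Longrightarrow> n \<in> N \<Longrightarrow> inv m \<otimes> k \<otimes> n \<in> K \<Longrightarrow> inv m \<otimes> n \<in> K"
    and conj_\<rho>: "\<And>n k. n \<in> N \<Longrightarrow> k \<in> K \<Longrightarrow> inv n \<otimes> k \<otimes> n \<in> K \<Longrightarrow> \<rho> (inv n \<otimes> k \<otimes> n) = \<rho> k"
    and Y: "\<And>m. m \<in> N \<Longrightarrow> finite (Y m)" "\<And>m. m \<in> N \<Longrightarrow> Y m \<subseteq> K" "\<And>m x. m \<in> N \<Longrightarrow> x \<in> Y m \<Longrightarrow> \<rho> x = 1"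
    and Y_ex: "\<And>m k. m \<in> N \<Longrightarrow> k \<in> K \<Longrightarrow> \<exists>x\<in>Y m. inv (x \<otimes> m) \<otimes> (k \<otimes> m) \<in> K"
    and Y_unique: "\<And>m x y. m \<in> N \<Longrightarrow> x \<in> Y m \<Longrightarrow> y \<in> Y m \<Longrightarrow> inv (x \<otimes> m) \<otimes> (y \<otimes> m) \<in> K \<Longrightarrow> x = y"
    and L_nonzero: "\<And>n. L n \<noteq> 0" and L_one: "L \<one> = 1"
    and L_mult: "\<And>n k. n \<in> N \<Longrightarrow> k \<in> K \<inter> N \<Longrightarrow> L (n \<otimes> k) = L n"
    and sum_Y: "\<And>m n \<psi>. m \<in> N \<Longrightarrow> n \<in> N \<Longrightarrow>
        (\<And>g k k'. g \<in> carrier G \<Longrightarrow> k \<in> K \<Longrightarrow> k' \<in> K \<Longrightarrow> \<psi> (k \<otimes> g \<otimes> k') = \<rho> k * \<psi> g * \<rho> k') \<Longrightarrow>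
        (\<Sum>x\<in>Y m. \<psi> (inv (x \<otimes> m) \<otimes> n)) * L n = L m * (L (inv m \<otimes> n) * \<psi> (inv m \<otimes> n))"
    and compact_iff: "\<And>S. S \<subseteq> carrier G \<Longrightarrow> (\<And>g k. g \<in> S \<Longrightarrow> k \<in> K \<Longrightarrow> g \<otimes> k \<in> S) \<Longrightarrow>
        compactin T (T closure_of S) \<longleftrightarrow> (\<exists>F. finite F \<and> F \<subseteq> carrier G \<and> (\<forall>g\<in>S. \<exists>f\<in>F. inv f \<otimes> g \<in> K))"
    and t_nonzero: "\<And>n. n \<in> N \<Longrightarrow> t n \<noteq> 0"
    and t_mult: "\<And>n k. n \<in> N \<Longrightarrow> k \<in> K \<inter> N \<Longrightarrow> t (n \<otimes> k) = t n * \<rho> k"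
begin

abbreviation KN where "KN \<equiv> K \<inter> N"
abbreviation GN where "GN \<equiv> G\<lparr>carrier := N\<rparr>"
abbreviation W where "W \<equiv> GN Mod KN"
abbreviation \<mu> where "\<mu> \<equiv> cocycle_of G t"
abbreviation H where "H \<equiv> hecke_algebra G T K \<rho>"

lemma K_carrier [simp]: "k \<in> K \<Longrightarrow> k \<in> carrier G"
  and N_carrier [simp]: "n \<in> N \<Longrightarrow> n \<in> carrier G"
  using K N by (auto dest: subgroup.subset)

lemma K_closed [simp]: "k \<in> K \<Longrightarrow> l \<in> K \<Longrightarrow> k \<otimes> l \<in> K" "k \<in> K \<Longrightarrow> inv k \<in> K" "\<one> \<in> K"
  using K by (auto simp: subgroup.m_closed subgroup.m_inv_closed subgroup.one_closed)

lemma N_closed [simp]: "m \<in> N \<Longrightarrow> n \<in> N \<Longrightarrow> m \<otimes> n \<in> N" "n \<in> N \<Longrightarrow> inv n \<in> N" "\<one> \<in> N"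
  using N by (auto simp: subgroup.m_closed subgroup.m_inv_closed subgroup.one_closed)

lemma cancel [simp]: "x \<in> carrier G \<Longrightarrow> y \<in> carrier G \<Longrightarrow> inv x \<otimes> (x \<otimes> y) = y"
  "x \<in> carrier G \<Longrightarrow> y \<in> carrier G \<Longrightarrow> x \<otimes> (inv x \<otimes> y) = y"
  by (simp_all add: m_assoc[symmetric])

lemma \<rho>_one: "\<rho> \<one> = 1"
  using \<rho>_mult[of \<one> \<one>] \<rho>_nonzero[of \<one>] by simp

lemma \<rho>_inv: "k \<in> K \<Longrightarrow> \<rho> (inv k) = inverse (\<rho> k)"
  using \<rho>_mult[of k "inv k"] \<rho>_one by (intro inverse_unique[symmetric]) simp

lemma conj_KN': "n \<in> N \<Longrightarrow> k \<in> KN \<Longrightarrow> inv n \<otimes> k \<otimes> n \<in> KN"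
  using conj_KN[of "inv n" k] by simp

subsection \<open>The group \<open>W\<close> and the cocycle\<close>

lemma group_GN: "group GN"
  by (rule subgroup.subgroup_is_group[OF N is_group])

lemma inv_GN: "n \<in> N \<Longrightarrow> inv\<^bsub>GN\<^esub> n = inv n"
  by (rule m_inv_consistent[OF N])

lemma normal_KN: "KN \<lhd> GN"
proof (rule group.normal_invI[OF group_GN])
  show "subgroup KN GN"
    using subgroup_incl[OF _ N, of KN] subgroups_Inter_pair[OF K N] by simp
qed (use conj_KN in \<open>auto simp: inv_GN\<close>)

definition cl :: "'g \<Rightarrow> 'g set" where
  "cl n = KN #>\<^bsub>GN\<^esub> n"

text \<open>By normality the right cosets of the library's quotient are also left cosets, the form
  suited to the equivariance of \<open>t\<close> under right multiplication.\<close>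

lemma mem_cl: "n \<in> N \<Longrightarrow> x \<in> cl n \<longleftrightarrow> x \<in> N \<and> inv n \<otimes> x \<in> K"
proof -
  assume n: "n \<in> N"
  have "x \<in> cl n \<longleftrightarrow> (\<exists>k\<in>KN. x = k \<otimes> n)" by (auto simp: cl_def r_coset_def)
  also have "\<dots> \<longleftrightarrow> x \<in> N \<and> inv n \<otimes> x \<in> K"
  proof
    assume "\<exists>k\<in>KN. x = k \<otimes> n"
    then obtain k where k: "k \<in> KN" "x = k \<otimes> n" by blast
    then have "inv n \<otimes> x = inv n \<otimes> k \<otimes> n" using n by (simp add: m_assoc)
    then show "x \<in> N \<and> inv n \<otimes> x \<in> K" using conj_KN'[OF n k(1)] k n by simp
  next
    assume x: "x \<in> N \<and> inv n \<otimes> x \<in> K"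
    then have "inv n \<otimes> x \<in> KN" using n by simp
    from conj_KN[OF n this] have "x \<otimes> inv n \<in> KN" using n x by (simp add: m_assoc[symmetric])
    moreover have "x = x \<otimes> inv n \<otimes> n" using n x by (simp add: m_assoc)
    ultimately show "\<exists>k\<in>KN. x = k \<otimes> n" by blast
  qed
  finally show ?thesis .
qed

lemma self_cl: "n \<in> N \<Longrightarrow> n \<in> cl n"
  by (simp add: mem_cl)

lemma cl_eq_iff: "m \<in> N \<Longrightarrow> n \<in> N \<Longrightarrow> cl m = cl n \<longleftrightarrow> inv m \<otimes> n \<in> K"
proof
  assume mn: "m \<in> N" "n \<in> N"
  show "inv m \<otimes> n \<in> K" if "cl m = cl n" using self_cl[OF mn(2)] that mem_cl[OF mn(1)] by simp
  show "cl m = cl n" if c: "inv m \<otimes> n \<in> K"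
  proof -
    have "inv m \<otimes> x \<in> K \<longleftrightarrow> inv n \<otimes> x \<in> K" if x: "x \<in> N" for x
    proof
      assume "inv m \<otimes> x \<in> K"
      then have "inv (inv m \<otimes> n) \<otimes> (inv m \<otimes> x) \<in> K" using c by simp
      then show "inv n \<otimes> x \<in> K" using mn x by (simp add: inv_mult_group m_assoc)
    next
      assume "inv n \<otimes> x \<in> K"
      then have "(inv m \<otimes> n) \<otimes> (inv n \<otimes> x) \<in> K" using c by simp
      then show "inv m \<otimes> x \<in> K" using mn x by (simp add: m_assoc)
    qed
    then show ?thesis using mem_cl mn by blast
  qed
qed

lemma carrier_W: "carrier W = cl ` N"
  by (auto simp: FactGroup_def RCOSETS_def cl_def)

lemma W_one: "\<one>\<^bsub>W\<^esub> = cl \<one>"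
proof -
  have "x \<in> KN \<longleftrightarrow> x \<in> cl \<one>" for x by (auto simp: mem_cl)
  then show ?thesis by (auto simp: FactGroup_def)
qed

lemma W_mult: "m \<in> N \<Longrightarrow> n \<in> N \<Longrightarrow> cl m \<otimes>\<^bsub>W\<^esub> cl n = cl (m \<otimes> n)"
  using normal.rcos_sum[OF normal_KN, of m n] by (simp add: FactGroup_def cl_def)

definition rp :: "'g set \<Rightarrow> 'g" where
  "rp u = (SOME n. n \<in> u)"

lemma rp: "u \<in> carrier W \<Longrightarrow> rp u \<in> N" "u \<in> carrier W \<Longrightarrow> cl (rp u) = u"
proof -
  assume "u \<in> carrier W"
  then obtain n where n: "n \<in> N" "u = cl n" by (auto simp: carrier_W)
  then have "rp u \<in> u" unfolding rp_def by (intro someI[of "\<lambda>n. n \<in> u" n]) (simp add: self_cl)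
  then show "rp u \<in> N" "cl (rp u) = u" using n mem_cl[of n "rp u"] cl_eq_iff[of n "rp u"] by auto
qed

text \<open>New representatives multiply both sides by the same values of \<open>\<rho>\<close>:
  moving \<open>k\<close> past \<open>n\<close> conjugates it by \<open>n\<close>, which does not
  change \<open>\<rho> k\<close>. So the description in \<open>cocycle_of\<close> has a unique
  solution.\<close>

lemma mu_cl:
  assumes m: "m \<in> N" and n: "n \<in> N"
  shows "\<mu> (cl m) (cl n) = t m * t n / t (m \<otimes> n)"
proof -
  have *: "t m' * t n' = t m * t n / t (m \<otimes> n) * t (m' \<otimes> n')" if "m' \<in> cl m" "n' \<in> cl n" for m' n'
  proof -
    define k l where "k = inv m \<otimes> m'" and "l = inv n \<otimes> n'"
    have kl: "k \<in> KN" "l \<in> KN" using that m n by (auto simp: k_def l_def mem_cl)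
    have e: "m' = m \<otimes> k" "n' = n \<otimes> l" using that m n by (auto simp: k_def l_def mem_cl)
    have c: "inv n \<otimes> k \<otimes> n \<in> KN" using conj_KN' n kl by blast
    have "m' \<otimes> n' = (m \<otimes> n) \<otimes> ((inv n \<otimes> k \<otimes> n) \<otimes> l)"
      unfolding e using m n kl by (simp add: m_assoc)
    then have "t (m' \<otimes> n') = t (m \<otimes> n) * (\<rho> (inv n \<otimes> k \<otimes> n) * \<rho> l)"
      using t_mult[of "m \<otimes> n" "(inv n \<otimes> k \<otimes> n) \<otimes> l"] m n kl c by (simp add: \<rho>_mult)
    also have "\<rho> (inv n \<otimes> k \<otimes> n) = \<rho> k" using conj_\<rho> n kl c by blast
    finally show ?thesis unfolding e using m n kl t_nonzero[of "m \<otimes> n"] by (simp add: t_mult)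
  qed
  show ?thesis unfolding cocycle_of_def
  proof (rule the_equality)
    show "\<forall>m'\<in>cl m. \<forall>n'\<in>cl n. t m' * t n' = t m * t n / t (m \<otimes> n) * t (m' \<otimes> n')" using * by blast
    fix c assume "\<forall>m'\<in>cl m. \<forall>n'\<in>cl n. t m' * t n' = c * t (m' \<otimes> n')"
    then have "t m * t n = c * t (m \<otimes> n)" using self_cl m n by blast
    then show "c = t m * t n / t (m \<otimes> n)" using t_nonzero[of "m \<otimes> n"] m n by simp
  qed
qed

lemma two_cocycle_W: "two_cocycle W \<mu>"
  unfolding two_cocycle_def carrier_W
proof (intro conjI ballI)
  fix u v assume "u \<in> cl ` N" "v \<in> cl ` N"
  then show "\<mu> u v \<noteq> 0" using t_nonzero by (auto simp: mu_cl)
next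
  fix u v w assume "u \<in> cl ` N" "v \<in> cl ` N" "w \<in> cl ` N"
  then show "\<mu> u v * \<mu> (u \<otimes>\<^bsub>W\<^esub> v) w = \<mu> u (v \<otimes>\<^bsub>W\<^esub> w) * \<mu> v w"
    using t_nonzero by (auto simp: mu_cl W_mult m_assoc simp del: mult_FactGroup)
qed

text \<open>A coboundary is symmetric on commuting pairs, but \<open>\<mu>\<close> detects the value of \<open>\<rho>\<close> on a commutator.\<close>

lemma not_coboundary:
  assumes a: "a \<in> N" and b: "b \<in> N" and c: "c \<in> K \<inter> N" "a \<otimes> b = b \<otimes> a \<otimes> c" "\<rho> c \<noteq> 1"
  shows "\<not> two_coboundary W \<mu>"
proof
  assume "two_coboundary W \<mu>"
  then obtain f where f: "\<And>w. w \<in> carrier W \<Longrightarrow> f w \<noteq> 0"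
    "\<And>u v. u \<in> carrier W \<Longrightarrow> v \<in> carrier W \<Longrightarrow> \<mu> u v = f u * f v / f (u \<otimes>\<^bsub>W\<^esub> v)"
    unfolding two_coboundary_def by blast
  have "cl (b \<otimes> a) = cl (a \<otimes> b)" unfolding c(2) using a b c(1) by (subst cl_eq_iff) (auto simp: m_assoc inv_mult_group)
  then have "\<mu> (cl a) (cl b) = \<mu> (cl b) (cl a)"
    using a b f(2)[of "cl a" "cl b"] f(2)[of "cl b" "cl a"] by (simp add: carrier_W W_mult mult.commute del: mult_FactGroup)
  then have "t a * t b / t (a \<otimes> b) = t a * t b / t (b \<otimes> a)" using a b by (simp add: mu_cl mult.commute)
  then have "t (a \<otimes> b) = t (b \<otimes> a)" using a b t_nonzero by (simp add: field_simps)
  then have "t (b \<otimes> a) * \<rho> c = t (b \<otimes> a)" using t_mult[of "b \<otimes> a" c] a b c by simp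
  then show False using t_nonzero[of "b \<otimes> a"] a b c(3) by simp
qed

subsection \<open>The isomorphism\<close>

lemma H_D:
  assumes "\<phi> \<in> carrier H"
  shows "g \<notin> carrier G \<Longrightarrow> \<phi> g = 0" "compactin T (T closure_of {g. \<phi> g \<noteq> 0})"
    "g \<in> carrier G \<Longrightarrow> k \<in> K \<Longrightarrow> k' \<in> K \<Longrightarrow> \<phi> (k \<otimes> g \<otimes> k') = \<rho> k * \<phi> g * \<rho> k'"
  using assms by (auto simp: hecke_algebra_def)

lemma H_right: "\<phi> \<in> carrier H \<Longrightarrow> g \<in> carrier G \<Longrightarrow> k \<in> K \<Longrightarrow> \<phi> (g \<otimes> k) = \<phi> g * \<rho> k"
  using H_D(3)[of \<phi> g \<one> k] by (simp add: \<rho>_one)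

lemma H_left: "\<phi> \<in> carrier H \<Longrightarrow> g \<in> carrier G \<Longrightarrow> k \<in> K \<Longrightarrow> \<phi> (k \<otimes> g) = \<rho> k * \<phi> g"
  using H_D(3)[of \<phi> g k \<one>] by (simp add: \<rho>_one)

lemma H_finite_cosets:
  assumes \<phi>: "\<phi> \<in> carrier H"
  obtains F where "finite F" "F \<subseteq> carrier G" "\<And>g. \<phi> g \<noteq> 0 \<Longrightarrow> \<exists>f\<in>F. inv f \<otimes> g \<in> K"
proof -
  have 1: "{g. \<phi> g \<noteq> 0} \<subseteq> carrier G" using H_D(1)[OF \<phi>] by blast
  have 2: "g \<otimes> k \<in> {g. \<phi> g \<noteq> 0}" if "g \<in> {g. \<phi> g \<noteq> 0}" "k \<in> K" for g k
    using H_right[OF \<phi>, of g k] that 1 \<rho>_nonzero by auto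
  show ?thesis using that compact_iff[OF 1 2] H_D(2)[OF \<phi>] by blast
qed

definition iso :: "('g \<Rightarrow> complex) \<Rightarrow> 'g set \<Rightarrow> complex" where
  "iso \<phi> u = (if u \<in> carrier W then \<phi> (rp u) * L (rp u) / t (rp u) else 0)"

text \<open>The factor \<open>\<rho> k\<close> of \<open>\<phi>\<close> and that of \<open>t\<close>
  cancel, so the chosen representative does not matter.\<close>

lemma iso_cl:
  assumes \<phi>: "\<phi> \<in> carrier H" and n: "n \<in> N"
  shows "iso \<phi> (cl n) = \<phi> n * L n / t n"
proof -
  define m where "m = rp (cl n)"
  have "cl n \<in> carrier W" using n by (simp add: carrier_W)
  then have m: "m \<in> N" "cl m = cl n" using rp by (auto simp: m_def)
  define k where "k = inv n \<otimes> m"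
  have k: "k \<in> KN" "m = n \<otimes> k" using m n cl_eq_iff[of n m] by (auto simp: k_def)
  have "\<phi> m * L m / t m = \<phi> n * L n / t n"
    unfolding k(2) using k(1) n \<rho>_nonzero[of k] by (simp add: H_right[OF \<phi>] L_mult t_mult)
  then show ?thesis using \<open>cl n \<in> carrier W\<close> by (simp add: iso_def m_def)
qed

lemma iso_eq_0_iff: "u \<in> carrier W \<Longrightarrow> iso \<phi> u = 0 \<longleftrightarrow> \<phi> (rp u) = 0"
  using L_nonzero t_nonzero rp(1) by (simp add: iso_def)

text \<open>Representatives of different classes lie in different left cosets of \<open>K\<close>,
  and only finitely many cosets meet the support of \<open>\<phi>\<close>.\<close>

lemma finite_iso_support:
  assumes \<phi>: "\<phi> \<in> carrier H"
  shows "finite {u. iso \<phi> u \<noteq> 0}"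
proof -
  obtain F where F: "finite F" "F \<subseteq> carrier G" "\<And>g. \<phi> g \<noteq> 0 \<Longrightarrow> \<exists>f\<in>F. inv f \<otimes> g \<in> K"
    using H_finite_cosets[OF \<phi>] by blast
  define c where "c u = (SOME f. f \<in> F \<and> inv f \<otimes> rp u \<in> K)" for u
  have u: "u \<in> carrier W \<and> c u \<in> F \<and> inv (c u) \<otimes> rp u \<in> K" if "iso \<phi> u \<noteq> 0" for u
  proof -
    have 1: "u \<in> carrier W" using that by (auto simp: iso_def split: if_splits)
    then have "\<exists>f. f \<in> F \<and> inv f \<otimes> rp u \<in> K" using F(3)[of "rp u"] that iso_eq_0_iff by blast
    then have "c u \<in> F \<and> inv (c u) \<otimes> rp u \<in> K" unfolding c_def by (rule someI_ex)
    then show ?thesis using 1 by blast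
  qed
  have "inj_on c {u. iso \<phi> u \<noteq> 0}"
  proof (rule inj_onI)
    fix x y assume xy: "x \<in> {u. iso \<phi> u \<noteq> 0}" "y \<in> {u. iso \<phi> u \<noteq> 0}" and e: "c x = c y"
    have x: "x \<in> carrier W" "c x \<in> F" "inv (c x) \<otimes> rp x \<in> K" and y: "y \<in> carrier W" "inv (c x) \<otimes> rp y \<in> K"
      using u[of x] u[of y, folded e] xy by auto
    have c: "c x \<in> carrier G" using x F by blast
    have "inv (inv (c x) \<otimes> rp x) \<otimes> (inv (c x) \<otimes> rp y) \<in> K" using x y by simp
    then have "inv (rp x) \<otimes> rp y \<in> K" using c x y rp(1) by (simp add: inv_mult_group m_assoc)
    then show "x = y" using cl_eq_iff[of "rp x" "rp y"] rp x y by simp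
  qed
  moreover have "c ` {u. iso \<phi> u \<noteq> 0} \<subseteq> F" using u by blast
  ultimately show ?thesis using F(1) inj_on_finite by blast
qed

text \<open>The left cosets on which \<open>\<phi>\<close> is nonzero are indexed by a class
  \<open>u\<close> in the support of \<open>iso \<phi>\<close> and an element of
  \<open>Y (rp u)\<close>; the inner sums are then evaluated by \<open>sum_Y\<close>.\<close>

lemma hecke_conv_eq:
  assumes \<phi>: "\<phi> \<in> carrier H" and \<psi>: "\<psi> \<in> carrier H" and n: "n \<in> N"
  shows "hecke_conv G K \<phi> \<psi> n * L n =
    (\<Sum>u | iso \<phi> u \<noteq> 0. \<phi> (rp u) * L (rp u) * (L (inv (rp u) \<otimes> n) * \<psi> (inv (rp u) \<otimes> n)))"
proof -
  define U where "U = {u. iso \<phi> u \<noteq> 0}"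
  have U: "u \<in> carrier W" "rp u \<in> N" "\<phi> (rp u) \<noteq> 0" if "u \<in> U" for u
  proof -
    show 1: "u \<in> carrier W" using that by (auto simp: U_def iso_def split: if_splits)
    then show "rp u \<in> N" "\<phi> (rp u) \<noteq> 0" using that rp(1) iso_eq_0_iff[OF 1] by (auto simp: U_def)
  qed
  have finU: "finite U" unfolding U_def by (rule finite_iso_support[OF \<phi>])
  define CC where "CC = {C \<in> lcosets K. \<exists>h\<in>C. \<phi> h \<noteq> 0}"
  define F where "F C = (let h = (SOME h. h \<in> C) in \<phi> h * \<psi> (inv h \<otimes> n))" for C
  define S where "S = Sigma U (\<lambda>u. Y (rp u))"
  define co where "co = (\<lambda>(u, x). (x \<otimes> rp u) <# K)"
  have mem: "h \<in> g <# K \<longleftrightarrow> h \<in> carrier G \<and> inv g \<otimes> h \<in> K" if "g \<in> carrier G" for g h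
    using that by (auto simp: l_coset_def intro!: bexI[of _ "inv g \<otimes> h"])
  have coset_eqI: "g <# K = (g' <# K)" if "g \<in> carrier G" "g' \<in> carrier G" "inv g \<otimes> g' \<in> K" for g g'
    using l_repr_independence[of g' g K] that K mem by simp
  \<comment> \<open>The summand is independent of the representative: \<open>\<phi>\<close>
    contributes \<open>\<rho> k\<close> and \<open>\<psi>\<close> its inverse.\<close>
  have F_eq: "F C = \<phi> h * \<psi> (inv h \<otimes> n)" if h: "h \<in> carrier G" "C = h <# K" for C h
  proof -
    define h' where "h' = (SOME h. h \<in> C)"
    have "h \<in> C" using h mem by simp
    then have "h' \<in> C" unfolding h'_def by (rule someI)
    define k where "k = inv h \<otimes> h'"
    have k: "k \<in> K" "h' = h \<otimes> k" using \<open>h' \<in> C\<close> h mem by (auto simp: k_def)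
    have "inv h' \<otimes> n = inv k \<otimes> (inv h \<otimes> n)" using k h n by (simp add: inv_mult_group m_assoc)
    then have "\<psi> (inv h' \<otimes> n) = inverse (\<rho> k) * \<psi> (inv h \<otimes> n)"
      using H_left[OF \<psi>, of "inv h \<otimes> n" "inv k"] k h n by (simp add: \<rho>_inv)
    moreover have "\<phi> h' = \<phi> h * \<rho> k" using H_right[OF \<phi>] k h by simp
    ultimately show ?thesis using \<rho>_nonzero[OF k(1)] by (simp add: F_def flip: h'_def)
  qed
  have YK: "x \<in> K" if "u \<in> U" "x \<in> Y (rp u)" for u x using Y(2) U(2) that by blast
  have inj: "inj_on co S"
  proof (rule inj_onI)
    fix p p' assume "p \<in> S" "p' \<in> S" and e: "co p = co p'"
    then obtain u x u' x' where p: "p = (u, x)" "u \<in> U" "x \<in> Y (rp u)" "p' = (u', x')" "u' \<in> U" "x' \<in> Y (rp u')"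
      by (auto simp: S_def)
    have x: "x \<in> K" "x' \<in> K" "rp u \<in> N" "rp u' \<in> N" using YK p U by auto
    have "x' \<otimes> rp u' \<in> (x' \<otimes> rp u') <# K" using x mem by simp
    then have "x' \<otimes> rp u' \<in> (x \<otimes> rp u) <# K" using e p by (simp add: co_def)
    then have c: "inv (x \<otimes> rp u) \<otimes> (x' \<otimes> rp u') \<in> K" using x mem by simp
    then have "inv (rp u) \<otimes> (inv x \<otimes> x') \<otimes> rp u' \<in> K" using x by (simp add: inv_mult_group m_assoc)
    then have "inv (rp u) \<otimes> rp u' \<in> K" using decomp_unique[of "inv x \<otimes> x'" "rp u" "rp u'"] x by simp
    then have uu: "u = u'" using cl_eq_iff[of "rp u" "rp u'"] x rp(2) U(1) p by simp
    then have "x = x'" using Y_unique[of "rp u" x x'] c p x by simp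
    then show "p = p'" using uu p by simp
  qed
  have im: "co ` S = CC"
  proof (intro equalityI subsetI)
    fix C assume "C \<in> co ` S"
    then obtain u x where ux: "u \<in> U" "x \<in> Y (rp u)" "C = (x \<otimes> rp u) <# K" by (auto simp: S_def co_def)
    have x: "x \<in> K" "rp u \<in> N" using YK U ux by auto
    have "\<phi> (x \<otimes> rp u) \<noteq> 0" using H_left[OF \<phi>, of "rp u" x] x \<rho>_nonzero U(3) ux by simp
    moreover have "x \<otimes> rp u \<in> C" using ux x mem by simp
    moreover have "C \<in> lcosets K" unfolding ux(3) LCOSETS_def using x by auto
    ultimately show "C \<in> CC" by (auto simp: CC_def)
  next
    fix C assume "C \<in> CC"
    then obtain g h where g: "g \<in> carrier G" "C = g <# K" "h \<in> C" "\<phi> h \<noteq> 0" by (auto simp: CC_def LCOSETS_def)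
    have h: "h \<in> carrier G" using g(3) mem[OF g(1)] unfolding g(2) by blast
    have hC: "C = h <# K" unfolding g(2) using g(3) mem[OF g(1)] h unfolding g(2) by (intro coset_eqI[OF g(1)]) blast+
    obtain k m' k' where k: "k \<in> K" "m' \<in> N" "k' \<in> K" "h = k \<otimes> m' \<otimes> k'" using decomp[OF h] by blast
    define u where "u = cl m'"
    have uW: "u \<in> carrier W" using k by (simp add: u_def carrier_W)
    define m where "m = rp u"
    have m: "m \<in> N" "cl m = cl m'" using rp[OF uW] by (auto simp: m_def u_def)
    have \<phi>m': "\<phi> m' \<noteq> 0" using H_D(3)[OF \<phi>, of m' k k'] k g by auto
    have "iso \<phi> u \<noteq> 0" unfolding u_def iso_cl[OF \<phi> k(2)] using \<phi>m' L_nonzero t_nonzero k by simp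
    then have uU: "u \<in> U" by (simp add: U_def)
    obtain x where x: "x \<in> Y m" "inv (x \<otimes> m) \<otimes> (k \<otimes> m) \<in> K" using Y_ex[OF m(1) k(1)] by blast
    have xK: "x \<in> K" using x Y(2) m by blast
    define l where "l = inv m \<otimes> m'"
    have l: "l \<in> K" "m' = m \<otimes> l" using m k cl_eq_iff by (auto simp: l_def)
    have "inv (x \<otimes> m) \<otimes> h = inv (x \<otimes> m) \<otimes> (k \<otimes> m) \<otimes> (l \<otimes> k')"
      unfolding k(4) l(2) using k l m xK by (simp add: m_assoc inv_mult_group)
    also have "\<dots> \<in> K" using x l k by simp
    finally have "(x \<otimes> m) <# K = (h <# K)" using coset_eqI[of "x \<otimes> m" h] xK m h by simp
    then have "co (u, x) = C" by (simp add: co_def hC flip: m_def)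
    moreover have "(u, x) \<in> S" using uU x(1) by (simp add: S_def m_def)
    ultimately show "C \<in> co ` S" by blast
  qed
  have "hecke_conv G K \<phi> \<psi> n = sum F CC" using n by (simp add: hecke_conv_def CC_def F_def)
  also have "\<dots> = sum (F \<circ> co) S" using sum.reindex[OF inj, of F] im by simp
  also have "\<dots> = (\<Sum>u\<in>U. \<Sum>x\<in>Y (rp u). F (co (u, x)))"
    unfolding S_def using finU Y(1) U(2) by (subst sum.Sigma) (auto intro!: sum.cong)
  also have "\<dots> = (\<Sum>u\<in>U. \<phi> (rp u) * (\<Sum>x\<in>Y (rp u). \<psi> (inv (x \<otimes> rp u) \<otimes> n)))"
    unfolding sum_distrib_left
  proof (intro sum.cong refl)
    fix u x assume ux: "u \<in> U" "x \<in> Y (rp u)"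
    have x: "x \<in> K" "rp u \<in> N" using YK U ux by auto
    have "\<phi> (x \<otimes> rp u) = \<phi> (rp u)" using H_left[OF \<phi>, of "rp u" x] x Y(3) ux by simp
    then show "F (co (u, x)) = \<phi> (rp u) * \<psi> (inv (x \<otimes> rp u) \<otimes> n)"
      using F_eq[of "x \<otimes> rp u"] x by (simp add: co_def)
  qed
  finally have "hecke_conv G K \<phi> \<psi> n * L n =
     (\<Sum>u\<in>U. \<phi> (rp u) * ((\<Sum>x\<in>Y (rp u). \<psi> (inv (x \<otimes> rp u) \<otimes> n)) * L n))"
    by (simp add: sum_distrib_right mult.assoc)
  also have "\<dots> = (\<Sum>u\<in>U. \<phi> (rp u) * L (rp u) * (L (inv (rp u) \<otimes> n) * \<psi> (inv (rp u) \<otimes> n)))"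
    using sum_Y[OF U(2) n H_D(3)[OF \<psi>]] by (intro sum.cong) (simp_all add: mult.assoc)
  finally show ?thesis by (simp add: U_def)
qed

text \<open>For each \<open>u\<close> only \<open>v = u\<^sup>-\<^sup>1 w\<close> can contribute,
  and the cocycle value \<open>t m * t (m\<^sup>-\<^sup>1 n) / t n\<close> converts the
  normalizations of the two factors into that of the convolution at \<open>n\<close>.\<close>

lemma iso_mult:
  assumes \<phi>: "\<phi> \<in> carrier H" and \<psi>: "\<psi> \<in> carrier H"
  shows "iso (\<phi> \<otimes>\<^bsub>H\<^esub> \<psi>) = iso \<phi> \<otimes>\<^bsub>twisted_group_algebra W \<mu>\<^esub> iso \<psi>"
proof
  fix w
  interpret W: group W by (rule normal.factorgroup_is_group[OF normal_KN])
  have supp: "u \<in> carrier W" if "iso \<phi> u \<noteq> 0" for u \<phi> using that by (auto simp: iso_def split: if_splits)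
  have rhs: "(iso \<phi> \<otimes>\<^bsub>twisted_group_algebra W \<mu>\<^esub> iso \<psi>) w =
    (\<Sum>u | iso \<phi> u \<noteq> 0. \<Sum>v | iso \<psi> v \<noteq> 0. if u \<otimes>\<^bsub>W\<^esub> v = w then iso \<phi> u * iso \<psi> v * \<mu> u v else 0)"
    by (simp add: twisted_group_algebra_def)
  show "iso (\<phi> \<otimes>\<^bsub>H\<^esub> \<psi>) w = (iso \<phi> \<otimes>\<^bsub>twisted_group_algebra W \<mu>\<^esub> iso \<psi>) w"
  proof (cases "w \<in> carrier W")
    case False
    then have "(if u \<otimes>\<^bsub>W\<^esub> v = w then iso \<phi> u * iso \<psi> v * \<mu> u v else 0) = 0"
      if "iso \<phi> u \<noteq> 0" "iso \<psi> v \<noteq> 0" for u v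
      using W.m_closed[OF supp[OF that(1)] supp[OF that(2)]] by auto
    then have "(iso \<phi> \<otimes>\<^bsub>twisted_group_algebra W \<mu>\<^esub> iso \<psi>) w = 0"
      unfolding rhs by (intro sum.neutral ballI) simp
    then show ?thesis using False by (simp add: iso_def)
  next
    case True
    define n where "n = rp w"
    have n: "n \<in> N" "cl n = w" using rp[OF True] by (auto simp: n_def)
    have inner: "(\<Sum>v | iso \<psi> v \<noteq> 0. if u \<otimes>\<^bsub>W\<^esub> v = w then iso \<phi> u * iso \<psi> v * \<mu> u v else 0) =
       \<phi> (rp u) * L (rp u) * (L (inv (rp u) \<otimes> n) * \<psi> (inv (rp u) \<otimes> n)) / t n" if u: "iso \<phi> u \<noteq> 0" for u
    proof -
      define m where "m = rp u"
      have m: "m \<in> N" "cl m = u" using rp[OF supp[OF u]] by (auto simp: m_def)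
      define v0 where "v0 = cl (inv m \<otimes> n)"
      have uv0: "u \<otimes>\<^bsub>W\<^esub> v0 = w" unfolding v0_def m(2)[symmetric] n(2)[symmetric] using m n by (subst W_mult) auto
      have v0W: "v0 \<in> carrier W" using m n by (simp add: v0_def carrier_W)
      have "u \<otimes>\<^bsub>W\<^esub> v = w \<longleftrightarrow> v = v0" if "iso \<psi> v \<noteq> 0" for v
        using uv0 W.l_cancel[of u v v0] supp[OF u] supp[OF that] v0W by metis
      then have "(\<Sum>v | iso \<psi> v \<noteq> 0. if u \<otimes>\<^bsub>W\<^esub> v = w then iso \<phi> u * iso \<psi> v * \<mu> u v else 0) =
        (\<Sum>v | iso \<psi> v \<noteq> 0. if v = v0 then iso \<phi> u * iso \<psi> v0 * \<mu> u v0 else 0)"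
        by (intro sum.cong) auto
      also have "\<dots> = iso \<phi> u * iso \<psi> v0 * \<mu> u v0"
        using finite_iso_support[OF \<psi>] by (simp add: sum.delta)
      also have "\<dots> = \<phi> m * L m * (L (inv m \<otimes> n) * \<psi> (inv m \<otimes> n)) / t n"
      proof -
        have 1: "iso \<phi> u = \<phi> m * L m / t m" using iso_cl[OF \<phi> m(1)] m(2) by simp
        have 2: "iso \<psi> v0 = \<psi> (inv m \<otimes> n) * L (inv m \<otimes> n) / t (inv m \<otimes> n)"
          unfolding v0_def using iso_cl[OF \<psi>, of "inv m \<otimes> n"] m n by simp
        have 3: "\<mu> u v0 = t m * t (inv m \<otimes> n) / t n"
          unfolding v0_def m(2)[symmetric] using mu_cl[of m "inv m \<otimes> n"] m n by simp
        show ?thesis unfolding 1 2 3 using t_nonzero[of m] t_nonzero[of "inv m \<otimes> n"] m n by simp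
      qed
      finally show ?thesis by (simp add: m_def)
    qed
    have "iso (\<phi> \<otimes>\<^bsub>H\<^esub> \<psi>) w = hecke_conv G K \<phi> \<psi> n * L n / t n"
      using True by (simp add: iso_def n_def hecke_algebra_def)
    also have "\<dots> = (\<Sum>u | iso \<phi> u \<noteq> 0. \<phi> (rp u) * L (rp u) * (L (inv (rp u) \<otimes> n) * \<psi> (inv (rp u) \<otimes> n)) / t n)"
      unfolding hecke_conv_eq[OF \<phi> \<psi> n(1)] by (simp add: sum_divide_distrib)
    also have "\<dots> = (iso \<phi> \<otimes>\<^bsub>twisted_group_algebra W \<mu>\<^esub> iso \<psi>) w"
      unfolding rhs using inner by (intro sum.cong) auto
    finally show ?thesis .
  qed
qed

text \<open>The function is prescribed on \<open>k n k'\<close> by equivariance; the point is that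
  two factorizations of one element yield the same value.\<close>

lemma iso_surj:
  assumes a: "finite {w. a w \<noteq> 0}" "{w. a w \<noteq> 0} \<subseteq> carrier W"
  shows "\<exists>\<phi>\<in>carrier H. iso \<phi> = a"
proof -
  define val where "val k n k' = \<rho> k * (a (cl n) * t n / L n) * \<rho> k'" for k n k'
  \<comment> \<open>The middle factors differ by \<open>c\<close> in \<open>KN\<close>. Then
    \<open>c l' k'\<^sup>-\<^sup>1\<close> is the conjugate of \<open>l\<^sup>-\<^sup>1 k\<close> by
    \<open>n\<^sup>-\<^sup>1\<close>, so \<open>conj_\<rho>\<close> relates the outer factors, and
    the equivariance of \<open>t\<close> accounts for \<open>\<rho> c\<close>.\<close>
  have val_unique: "val k n k' = val l m l'"
    if k: "k \<in> K" "n \<in> N" "k' \<in> K" and l: "l \<in> K" "m \<in> N" "l' \<in> K" and e: "k \<otimes> n \<otimes> k' = l \<otimes> m \<otimes> l'" for k n k' l m l'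
  proof -
    have "inv n \<otimes> (inv k \<otimes> l) \<otimes> m = inv n \<otimes> inv k \<otimes> (l \<otimes> m \<otimes> l') \<otimes> inv l'"
      using k l by (simp add: m_assoc)
    also have "\<dots> = k' \<otimes> inv l'" unfolding e[symmetric] using k l by (simp add: m_assoc)
    finally have "inv n \<otimes> m \<in> K" using decomp_unique[of "inv k \<otimes> l" n m] k l by simp
    define c where "c = inv n \<otimes> m"
    have c: "c \<in> KN" "m = n \<otimes> c" using \<open>inv n \<otimes> m \<in> K\<close> k l by (auto simp: c_def)
    have "inv n \<otimes> (inv l \<otimes> k) \<otimes> n = inv n \<otimes> inv l \<otimes> (k \<otimes> n \<otimes> k') \<otimes> inv k'"
      using k l by (simp add: m_assoc)
    also have "\<dots> = c \<otimes> l' \<otimes> inv k'" unfolding e c(2) using k l c(1) by (simp add: m_assoc)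
    finally have *: "inv n \<otimes> (inv l \<otimes> k) \<otimes> n = c \<otimes> l' \<otimes> inv k'" .
    then have "\<rho> (inv l \<otimes> k) = \<rho> (c \<otimes> l' \<otimes> inv k')"
      using conj_\<rho>[of n "inv l \<otimes> k"] k l c(1) by simp
    then have "\<rho> k * \<rho> k' = \<rho> l * \<rho> c * \<rho> l'"
      using k l c(1) \<rho>_nonzero by (simp add: \<rho>_mult \<rho>_inv field_simps)
    moreover have "cl m = cl n" using \<open>inv n \<otimes> m \<in> K\<close> k l cl_eq_iff[of n m] by simp
    moreover have "t m = t n * \<rho> c" "L m = L n" unfolding c(2) using t_mult L_mult c(1) k by auto
    ultimately show ?thesis by (simp add: val_def mult_ac)
  qed
  define \<phi> where "\<phi> g = (if g \<in> carrier G then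
      (THE y. \<exists>k\<in>K. \<exists>n\<in>N. \<exists>k'\<in>K. g = k \<otimes> n \<otimes> k' \<and> y = val k n k') else 0)" for g
  have \<phi>_eq: "\<phi> (k \<otimes> n \<otimes> k') = val k n k'" if "k \<in> K" "n \<in> N" "k' \<in> K" for k n k'
  proof -
    have "(THE y. \<exists>l\<in>K. \<exists>m\<in>N. \<exists>l'\<in>K. k \<otimes> n \<otimes> k' = l \<otimes> m \<otimes> l' \<and> y = val l m l') = val k n k'"
    proof (rule the_equality)
      show "\<exists>l\<in>K. \<exists>m\<in>N. \<exists>l'\<in>K. k \<otimes> n \<otimes> k' = l \<otimes> m \<otimes> l' \<and> val k n k' = val l m l'"
        using that by (intro bexI[of _ k] bexI[of _ n] bexI[of _ k']) simp_all
      fix y assume "\<exists>l\<in>K. \<exists>m\<in>N. \<exists>l'\<in>K. k \<otimes> n \<otimes> k' = l \<otimes> m \<otimes> l' \<and> y = val l m l'"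
      then obtain l m l' where "l \<in> K" "m \<in> N" "l' \<in> K" "k \<otimes> n \<otimes> k' = l \<otimes> m \<otimes> l'" "y = val l m l'" by auto
      then show "y = val k n k'" using val_unique[OF that] by simp
    qed
    then show ?thesis using that by (simp add: \<phi>_def)
  qed
  have \<phi>N: "\<phi> n = a (cl n) * t n / L n" if "n \<in> N" for n
    using \<phi>_eq[of \<one> n \<one>] that by (simp add: val_def \<rho>_one)
  have equi: "\<phi> (k \<otimes> g \<otimes> k') = \<rho> k * \<phi> g * \<rho> k'" if g: "g \<in> carrier G" and k: "k \<in> K" "k' \<in> K" for g k k'
  proof -
    obtain l n l' where l: "l \<in> K" "n \<in> N" "l' \<in> K" "g = l \<otimes> n \<otimes> l'" using decomp[OF g] by blast
    have "k \<otimes> g \<otimes> k' = (k \<otimes> l) \<otimes> n \<otimes> (l' \<otimes> k')" using l k by (simp add: m_assoc)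
    then have "\<phi> (k \<otimes> g \<otimes> k') = val (k \<otimes> l) n (l' \<otimes> k')" using \<phi>_eq l k by simp
    then show ?thesis using \<phi>_eq[OF l(1-3)] l k by (simp add: val_def \<rho>_mult mult_ac)
  qed
  have compact: "compactin T (T closure_of {g. \<phi> g \<noteq> 0})"
  proof -
    have 1: "{g. \<phi> g \<noteq> 0} \<subseteq> carrier G" by (auto simp: \<phi>_def)
    have 2: "g \<otimes> k \<in> {g. \<phi> g \<noteq> 0}" if "g \<in> {g. \<phi> g \<noteq> 0}" "k \<in> K" for g k
      using equi[of g \<one> k] that 1 \<rho>_nonzero by (auto simp: \<rho>_one)
    define F where "F = (\<Union>u\<in>{u. a u \<noteq> 0}. (\<lambda>x. x \<otimes> rp u) ` Y (rp u))"
    have rpN: "rp u \<in> N" if "a u \<noteq> 0" for u using that a(2) rp(1) by blast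
    have "finite F" unfolding F_def using a(1) Y(1) rpN by auto
    moreover have "F \<subseteq> carrier G"
    proof
      fix f assume "f \<in> F"
      then obtain u x where "a u \<noteq> 0" "x \<in> Y (rp u)" "f = x \<otimes> rp u" by (auto simp: F_def)
      then show "f \<in> carrier G" using rpN[of u] Y(2)[of "rp u"] by auto
    qed
    moreover have "\<exists>f\<in>F. inv f \<otimes> g \<in> K" if "\<phi> g \<noteq> 0" for g
    proof -
      have "g \<in> carrier G" using that 1 by blast
      then obtain k n k' where k: "k \<in> K" "n \<in> N" "k' \<in> K" "g = k \<otimes> n \<otimes> k'" using decomp by blast
      then have au: "a (cl n) \<noteq> 0" using that \<phi>_eq by (auto simp: val_def)
      define m where "m = rp (cl n)"
      have m: "m \<in> N" "cl m = cl n" using rp[of "cl n"] k by (auto simp: m_def carrier_W)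
      obtain x where x: "x \<in> Y m" "inv (x \<otimes> m) \<otimes> (k \<otimes> m) \<in> K" using Y_ex[OF m(1) k(1)] by blast
      have xK: "x \<in> K" using x Y(2) m by blast
      define l where "l = inv m \<otimes> n"
      have l: "l \<in> K" "n = m \<otimes> l" using m k cl_eq_iff by (auto simp: l_def)
      have "inv (x \<otimes> m) \<otimes> g = inv (x \<otimes> m) \<otimes> (k \<otimes> m) \<otimes> (l \<otimes> k')"
        unfolding k(4) l(2) using k l m xK by (simp add: m_assoc inv_mult_group)
      also have "\<dots> \<in> K" using x l k by simp
      finally show ?thesis using x au by (auto simp: F_def m_def)
    qed
    ultimately show ?thesis using compact_iff[OF 1 2] by blast
  qed
  have \<phi>H: "\<phi> \<in> carrier H"
    using equi compact by (simp add: hecke_algebra_def) (simp add: \<phi>_def)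
  moreover have "iso \<phi> = a"
  proof
    fix u
    show "iso \<phi> u = a u"
    proof (cases "u \<in> carrier W")
      case True
      then obtain n where n: "n \<in> N" "u = cl n" by (auto simp: carrier_W)
      then show ?thesis using iso_cl[OF \<phi>H n(1)] \<phi>N[OF n(1)] L_nonzero t_nonzero by simp
    next
      case False
      then show ?thesis using a(2) by (auto simp: iso_def)
    qed
  qed
  ultimately show ?thesis by blast
qed

theorem hecke_algebra_iso: "iso \<in> algebra_iso H (twisted_group_algebra W \<mu>)"
proof -
  let ?B = "twisted_group_algebra W \<mu>"
  have carrier: "iso \<phi> \<in> carrier ?B" if "\<phi> \<in> carrier H" for \<phi>
    using finite_iso_support[OF that] by (auto simp: twisted_group_algebra_def iso_def split: if_splits)
  have one: "iso \<one>\<^bsub>H\<^esub> = \<one>\<^bsub>?B\<^esub>"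
  proof
    fix u
    show "iso \<one>\<^bsub>H\<^esub> u = \<one>\<^bsub>?B\<^esub> u"
    proof (cases "u \<in> carrier W")
      case True
      define n where "n = rp u"
      have n: "n \<in> N" "cl n = u" using rp[OF True] by (auto simp: n_def)
      have "cl n = cl \<one> \<longleftrightarrow> n \<in> K" using cl_eq_iff[of \<one> n] n(1) by auto
      then have "u = \<one>\<^bsub>W\<^esub> \<longleftrightarrow> n \<in> K" unfolding W_one n(2) .
      \<comment> \<open>On \<open>KN\<close> one has \<open>t n = t \<one> * \<rho> n\<close>, and
        \<open>\<mu>\<close> at the identity equals \<open>t \<one>\<close>; this matches the
        inverse in the unit of the twisted algebra.\<close>
      moreover have "\<rho> n * L n / t n = inverse (\<mu> \<one>\<^bsub>W\<^esub> \<one>\<^bsub>W\<^esub>)" if "n \<in> K"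
        using t_mult[of \<one> n] L_mult[of \<one> n] that n t_nonzero[of \<one>] \<rho>_nonzero[of n]
        unfolding W_one by (simp add: mu_cl L_one inverse_eq_divide)
      ultimately show ?thesis using True
        by (simp add: iso_def hecke_algebra_def twisted_group_algebra_def n_def[symmetric] del: one_FactGroup)
    next
      case False
      moreover have "\<one>\<^bsub>W\<^esub> \<in> carrier W" unfolding W_one carrier_W by simp
      ultimately show ?thesis by (auto simp: iso_def twisted_group_algebra_def simp del: one_FactGroup)
    qed
  qed
  have "iso \<in> Ring.ring_hom H ?B"
  proof (rule ring_hom_memI)
    show "iso (\<phi> \<oplus>\<^bsub>H\<^esub> \<psi>) = iso \<phi> \<oplus>\<^bsub>?B\<^esub> iso \<psi>" for \<phi> \<psi>
      by (auto simp: hecke_algebra_def twisted_group_algebra_def iso_def add_divide_distrib distrib_right)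
  qed (use carrier one iso_mult in auto)
  moreover have "inj_on iso (carrier H)"
  proof (rule inj_onI)
    fix \<phi> \<psi> assume \<phi>: "\<phi> \<in> carrier H" and \<psi>: "\<psi> \<in> carrier H" and e: "iso \<phi> = iso \<psi>"
    have N: "\<phi> n = \<psi> n" if "n \<in> N" for n
      using iso_cl[OF \<phi> that] iso_cl[OF \<psi> that] e L_nonzero t_nonzero[OF that] by simp
    show "\<phi> = \<psi>"
    proof
      fix g
      show "\<phi> g = \<psi> g"
      proof (cases "g \<in> carrier G")
        case True
        obtain k n k' where "k \<in> K" "n \<in> N" "k' \<in> K" "g = k \<otimes> n \<otimes> k'" using decomp[OF True] by blast
        then show ?thesis using H_D(3)[OF \<phi>, of n k k'] H_D(3)[OF \<psi>, of n k k'] N by simp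
      next
        case False
        then show ?thesis using H_D(1)[OF \<phi>] H_D(1)[OF \<psi>] by metis
      qed
    qed
  qed
  moreover have "iso ` carrier H = carrier ?B"
  proof
    show "carrier ?B \<subseteq> iso ` carrier H" using iso_surj by (force simp: twisted_group_algebra_def)
  qed (use carrier in blast)
  moreover have "iso (c \<odot>\<^bsub>H\<^esub> \<phi>) = c \<odot>\<^bsub>?B\<^esub> iso \<phi>" for c \<phi>
    by (auto simp: hecke_algebra_def twisted_group_algebra_def iso_def)
  ultimately show ?thesis by (auto simp: algebra_iso_def ring_iso_def bij_betw_def)
qed

end

section \<open>The topology\<close>

text \<open>If a subset has no finite subcover, then neither has one of its finitely many classes. A limit of
  nested classes without finite subcover contradicts the openness of the set that covers it.\<close>

lemma compactin_ultrametric: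
  fixes R :: "nat \<Rightarrow> 'a \<Rightarrow> 'a \<Rightarrow> bool"
  assumes sub: "C \<subseteq> topspace T"
    and sym: "\<And>k x y. R k x y \<Longrightarrow> R k y x"
    and trans: "\<And>k x y z. R k x y \<Longrightarrow> R k y z \<Longrightarrow> R k x z"
    and opn: "\<And>U g. openin T U \<Longrightarrow> g \<in> U \<Longrightarrow> g \<in> C \<Longrightarrow> \<exists>k. \<forall>h\<in>C. R k g h \<longrightarrow> h \<in> U"
    and fin: "\<And>k. \<exists>F. finite F \<and> F \<subseteq> C \<and> (\<forall>h\<in>C. \<exists>f\<in>F. R k f h)"
    and complete: "\<And>s. (\<And>i. s i \<in> C) \<Longrightarrow> (\<And>i j. i < j \<Longrightarrow> R i (s i) (s j)) \<Longrightarrow> \<exists>g\<in>C. \<forall>i. R i (s i) g"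
  shows "compactin T C"
  unfolding compactin_def
proof (intro conjI sub allI impI, rule ccontr)
  fix \<U> assume \<U>: "Ball \<U> (openin T) \<and> C \<subseteq> \<Union> \<U>" and nofin: "\<not> (\<exists>\<F>. finite \<F> \<and> \<F> \<subseteq> \<U> \<and> C \<subseteq> \<Union> \<F>)"
  define bad where "bad B \<longleftrightarrow> B \<subseteq> C \<and> \<not> (\<exists>\<F>. finite \<F> \<and> \<F> \<subseteq> \<U> \<and> B \<subseteq> \<Union> \<F>)" for B
  have step: "\<exists>f\<in>B. bad {h \<in> B. R k f h}" if B: "bad B" for B k
  proof -
    obtain F where F: "finite F" "F \<subseteq> C" "\<forall>h\<in>C. \<exists>f\<in>F. R k f h" using fin by blast
    have "\<exists>f\<in>F. bad {h \<in> B. R k f h}"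
    proof (rule ccontr)
      assume *: "\<not> ?thesis"
      have "\<exists>\<F>. finite \<F> \<and> \<F> \<subseteq> \<U> \<and> {h \<in> B. R k f h} \<subseteq> \<Union> \<F>" if "f \<in> F" for f
      proof -
        have "{h \<in> B. R k f h} \<subseteq> C" using B unfolding bad_def by blast
        moreover have "\<not> bad {h \<in> B. R k f h}" using * that by blast
        ultimately show ?thesis unfolding bad_def by (simp only: simp_thms)
      qed
      then obtain \<F> where \<F>: "\<And>f. f \<in> F \<Longrightarrow> finite (\<F> f) \<and> \<F> f \<subseteq> \<U> \<and> {h \<in> B. R k f h} \<subseteq> \<Union> (\<F> f)"
        by metis
      define \<V> where "\<V> = (\<Union>f\<in>F. \<F> f)"
      have "finite \<V>" "\<V> \<subseteq> \<U>" using F(1) \<F> by (auto simp: \<V>_def)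
      moreover have "B \<subseteq> \<Union> \<V>"
      proof
        fix h assume h: "h \<in> B"
        then have "h \<in> C" using B unfolding bad_def by blast
        then obtain f where f: "f \<in> F" "R k f h" using F(3) by blast
        then have "h \<in> \<Union> (\<F> f)" using \<F>[of f] h by blast
        then show "h \<in> \<Union> \<V>" using f by (auto simp: \<V>_def)
      qed
      ultimately show False using B unfolding bad_def by blast
    qed
    then obtain f where f: "f \<in> F" "bad {h \<in> B. R k f h}" by blast
    \<comment> \<open>The centre \<open>f\<close> need not lie in \<open>B\<close>. A bad class is
      nonempty, since the empty set has an empty subcover, and each of its points is an equally good
      centre.\<close>
    then have "{h \<in> B. R k f h} \<noteq> {}" by (auto simp: bad_def)
    then obtain f' where f': "f' \<in> B" "R k f f'" by blast
    then have "{h \<in> B. R k f h} = {h \<in> B. R k f' h}" using sym trans by blast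
    then show ?thesis using f f' by auto
  qed
  define pick where "pick k B = (SOME f. f \<in> B \<and> bad {h \<in> B. R k f h})" for k B
  define B where "B = rec_nat C (\<lambda>k B. {h \<in> B. R k (pick k B) h})"
  have B_0: "B 0 = C" and B_Suc: "B (Suc k) = {h \<in> B k. R k (pick k (B k)) h}" for k
    by (simp_all add: B_def)
  have pick: "pick k A \<in> A \<and> bad {h \<in> A. R k (pick k A) h}" if "bad A" for k A
    using step[OF that, of k] unfolding pick_def by (intro someI_ex[of "\<lambda>f. f \<in> A \<and> bad {h \<in> A. R k f h}"]) blast
  have bad_B: "bad (B k)" for k
  proof (induction k)
    case 0
    show ?case using nofin by (simp add: B_0 bad_def)
  next
    case (Suc k)
    then show ?case using pick by (simp add: B_Suc)
  qed
  define s where "s k = pick k (B k)" for k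
  have s_B: "s k \<in> B k" for k using pick[OF bad_B] by (simp add: s_def)
  have B_mono: "B j \<subseteq> B i" if "i \<le> j" for i j
    using that by (induction j rule: dec_induct) (auto simp: B_Suc)
  have "\<exists>g\<in>C. \<forall>i. R i (s i) g"
  proof (rule complete)
    show "s i \<in> C" for i using s_B[of i] B_mono[of 0 i] by (auto simp: B_0)
    show "R i (s i) (s j)" if "i < j" for i j
      using s_B[of j] B_mono[of "Suc i" j] that by (auto simp: B_Suc s_def)
  qed
  then obtain g where g: "g \<in> C" "\<And>i. R i (s i) g" by blast
  then obtain U where U: "U \<in> \<U>" "g \<in> U" using \<U> by blast
  then obtain k where k: "\<forall>h\<in>C. R k g h \<longrightarrow> h \<in> U" using opn[of U g] \<U> g by blast
  have "B (Suc k) \<subseteq> \<Union> {U}"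
  proof
    fix h assume h: "h \<in> B (Suc k)"
    then have "R k (s k) h" "h \<in> C" using B_mono[of 0 "Suc k"] by (auto simp: B_Suc s_def B_0)
    then show "h \<in> \<Union> {U}" using k trans[OF sym[OF g(2)], of k h] by auto
  qed
  then show False using bad_B[of "Suc k"] U(1) unfolding bad_def by blast
qed

lemma openin_prod_topologyE:
  assumes "openin (prod_topology S T) U" "(x, y) \<in> U"
  obtains A V where "openin S A" "openin T V" "x \<in> A" "y \<in> V" "A \<times> V \<subseteq> U"
  using assms(1)[unfolded openin_prod_topology_alt, rule_format, OF assms(2)] by (elim exE conjE)

context radical_extension
begin

text \<open>Scaling by powers of \<open>D\<close> shows that base-field multiples of the integral
  closure and balls of \<open>w\<close> are cofinal in each other.\<close>

lemma openin_ext_topology: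
  "openin (ext_topology v \<iota>) U \<longleftrightarrow> (\<forall>x\<in>U. \<exists>k. \<forall>y. val_ge w (y - x) k \<longrightarrow> y \<in> U)"
proof -
  have scale: "val_ge w (\<iota> (D powi k) * y) (int n * k) \<longleftrightarrow> val_ge w y 0" for k y
    using D_nonzero by (cases "y = 0") (auto simp: val_ge_def w_mult w_\<iota> v_powi v_D)
  have eq: "(\<lambda>U. \<forall>x\<in>U. \<exists>c. c \<noteq> 0 \<and> (\<forall>y\<in>integral_closure \<iota> (valuation_ring v). x + \<iota> c * y \<in> U)) =
     (\<lambda>U. \<forall>x\<in>U. \<exists>k. \<forall>y. val_ge w (y - x) k \<longrightarrow> y \<in> U)"
  proof (intro ext ball_cong refl iffI)
    fix U :: "'e set" and x
    assume "\<exists>c. c \<noteq> 0 \<and> (\<forall>y\<in>integral_closure \<iota> (valuation_ring v). x + \<iota> c * y \<in> U)"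
    then obtain c where c: "c \<noteq> 0" "\<And>y. val_ge w y 0 \<Longrightarrow> x + \<iota> c * y \<in> U"
      unfolding integral_closure_eq by (auto simp: valuation_ring_def)
    have "y \<in> U" if "val_ge w (y - x) (w (\<iota> c))" for y
    proof -
      have "val_ge w ((y - x) / \<iota> c) 0" using that c(1) by (cases "y = x") (auto simp: val_ge_def w.v_divide)
      from c(2)[OF this] show ?thesis using c(1) by simp
    qed
    then show "\<exists>k. \<forall>y. val_ge w (y - x) k \<longrightarrow> y \<in> U" by blast
  next
    fix U :: "'e set" and x
    assume "\<exists>k. \<forall>y. val_ge w (y - x) k \<longrightarrow> y \<in> U"
    then obtain k where k: "\<And>y. val_ge w (y - x) k \<Longrightarrow> y \<in> U" by blast
    have k': "k \<le> int n * \<bar>k\<bar>" using n_pos mult_right_mono[of 1 "int n" "\<bar>k\<bar>"] by auto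
    have "x + \<iota> (D powi \<bar>k\<bar>) * y \<in> U" if "val_ge w y 0" for y
      using k[of "x + \<iota> (D powi \<bar>k\<bar>) * y"] w.val_ge_mono[OF _ k'] scale[of "\<bar>k\<bar>" y] that by simp
    then show "\<exists>c. c \<noteq> 0 \<and> (\<forall>y\<in>integral_closure \<iota> (valuation_ring v). x + \<iota> c * y \<in> U)"
      unfolding integral_closure_eq using D_nonzero
      by (intro exI[of _ "D powi \<bar>k\<bar>"]) (auto simp: valuation_ring_def)
  qed
  have "istopology (\<lambda>U. \<forall>x\<in>U. \<exists>k. \<forall>y. val_ge w (y - x) k \<longrightarrow> y \<in> U)"
    unfolding istopology_def
  proof (intro conjI allI impI ballI)
    fix S U :: "'e set" and x
    assume S: "\<forall>x\<in>S. \<exists>k. \<forall>y. val_ge w (y - x) k \<longrightarrow> y \<in> S"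
      and U: "\<forall>x\<in>U. \<exists>k. \<forall>y. val_ge w (y - x) k \<longrightarrow> y \<in> U" and x: "x \<in> S \<inter> U"
    obtain k l where kl: "\<forall>y. val_ge w (y - x) k \<longrightarrow> y \<in> S" "\<forall>y. val_ge w (y - x) l \<longrightarrow> y \<in> U"
      using S U x by blast
    have "y \<in> S \<inter> U" if "val_ge w (y - x) (max k l)" for y
      using kl w.val_ge_mono[OF that, of k] w.val_ge_mono[OF that, of l] by simp
    then show "\<exists>k. \<forall>y. val_ge w (y - x) k \<longrightarrow> y \<in> S \<inter> U" by blast
  next
    fix \<K> :: "'e set set" and x
    assume *: "\<forall>K\<in>\<K>. \<forall>x\<in>K. \<exists>k. \<forall>y. val_ge w (y - x) k \<longrightarrow> y \<in> K" "x \<in> \<Union> \<K>"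
    then obtain U where U: "U \<in> \<K>" "x \<in> U" by blast
    then obtain k where "\<forall>y. val_ge w (y - x) k \<longrightarrow> y \<in> U" using *(1) by blast
    then show "\<exists>k. \<forall>y. val_ge w (y - x) k \<longrightarrow> y \<in> \<Union> \<K>" using U(1) by blast
  qed
  then show ?thesis unfolding ext_topology_def eq by (simp add: topology_inverse')
qed

lemma openin_ball: "openin (ext_topology v \<iota>) {y. val_ge w (y - x) k}"
  unfolding openin_ext_topology
proof
  fix y assume "y \<in> {y. val_ge w (y - x) k}"
  then have "val_ge w (z - x) k" if "val_ge w (z - y) k" for z
    using w.val_ge_add[OF that, of "y - x"] by simp
  then show "\<exists>l. \<forall>z. val_ge w (z - y) l \<longrightarrow> z \<in> {y. val_ge w (y - x) k}" by blast
qed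

end

context hecke_setup
begin

text \<open>Closeness of all five coordinates. On the group it describes the topology
  (\<open>openin_TG\<close>), and it is the ultrametric relation used for compactness.\<close>

definition near :: "int \<Rightarrow> 'e2 mat \<times> 'e4 \<Rightarrow> 'e2 mat \<times> 'e4 \<Rightarrow> bool" where
  "near k g h \<longleftrightarrow> val_ge E2.w (fst h $$ (0,0) - fst g $$ (0,0)) k \<and> val_ge E2.w (fst h $$ (0,1) - fst g $$ (0,1)) k \<and>
     val_ge E2.w (fst h $$ (1,0) - fst g $$ (1,0)) k \<and> val_ge E2.w (fst h $$ (1,1) - fst g $$ (1,1)) k \<and>
     val_ge E4.w (snd h - snd g) k"

lemma near_mk: "near k (mk a b c d, z) (mk a' b' c' d', z') \<longleftrightarrow> val_ge E2.w (a' - a) k \<and> val_ge E2.w (b' - b) k \<and>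
     val_ge E2.w (c' - c) k \<and> val_ge E2.w (d' - d) k \<and> val_ge E4.w (z' - z) k"
  by (simp add: near_def)

lemma near_refl: "near k g g"
  by (simp add: near_def)

lemma near_sym: "near k g h \<Longrightarrow> near k h g"
  by (simp add: near_def E2.w.val_ge_minus_commute E4.w.val_ge_minus_commute)

lemma near_trans: "near k g h \<Longrightarrow> near k h u \<Longrightarrow> near k g u"
  unfolding near_def
  using E2.w.val_ge_add[of "fst u $$ (i,j) - fst h $$ (i,j)" k "fst h $$ (i,j) - fst g $$ (i,j)" for i j]
    E4.w.val_ge_add[of "snd u - snd h" k "snd h - snd g"] by simp

lemma near_mono: "near k g h \<Longrightarrow> l \<le> k \<Longrightarrow> near l g h"
  unfolding near_def by (blast intro: E2.w.val_ge_mono E4.w.val_ge_mono)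

text \<open>Left multiplication by a fixed \<open>g\<close> loses a bounded amount of precision,
  determined by the values of the entries of \<open>g\<close> and uniform in \<open>x\<close> and
  \<open>y\<close>.\<close>

lemma near_left_mult:
  assumes "g \<in> carrier G"
  obtains l where "\<And>x y. x \<in> carrier G \<Longrightarrow> y \<in> carrier G \<Longrightarrow> near l x y \<Longrightarrow> near k (g \<otimes>\<^bsub>G\<^esub> x) (g \<otimes>\<^bsub>G\<^esub> y)"
proof -
  obtain a b c d z where e: "g = (mk a b c d, z)" using assms by (rule G_cases)
  \<comment> \<open>A zero entry contributes an arbitrary value of the valuation at 0, which is
    harmless because its products vanish.\<close>
  define l where "l = Max {k - E2.w a, k - E2.w b, k - E2.w c, k - E2.w d, k - E4.w z}"
  have l: "k \<le> E2.w a + l" "k \<le> E2.w b + l" "k \<le> E2.w c + l" "k \<le> E2.w d + l" "k \<le> E4.w z + l"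
    unfolding l_def by (simp_all add: max_def)
  have m2: "val_ge E2.w (x * \<epsilon>) k" if "k \<le> E2.w x + l" "val_ge E2.w \<epsilon> l" for x \<epsilon>
    using that by (cases "x = 0"; cases "\<epsilon> = 0") (auto simp: val_ge_def E2.w.v_mult)
  have m4: "val_ge E4.w (x * \<epsilon>) k" if "k \<le> E4.w x + l" "val_ge E4.w \<epsilon> l" for x \<epsilon>
    using that by (cases "x = 0"; cases "\<epsilon> = 0") (auto simp: val_ge_def E4.w.v_mult)
  have sum2: "val_ge E2.w (x * \<epsilon> + y * \<delta>) k"
    if "k \<le> E2.w x + l" "val_ge E2.w \<epsilon> l" "k \<le> E2.w y + l" "val_ge E2.w \<delta> l" for x y \<epsilon> \<delta>
    using m2 that by (intro E2.w.val_ge_add)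
  have "near k (g \<otimes>\<^bsub>G\<^esub> x) (g \<otimes>\<^bsub>G\<^esub> y)" if xy: "x \<in> carrier G" "y \<in> carrier G" "near l x y" for x y
  proof -
    obtain a1 b1 c1 d1 z1 where x: "x = (mk a1 b1 c1 d1, z1)" using xy(1) by (rule G_cases)
    obtain a2 b2 c2 d2 z2 where y: "y = (mk a2 b2 c2 d2, z2)" using xy(2) by (rule G_cases)
    have d: "u * p + v * q - (u * p' + v * q') = u * (p - p') + v * (q - q')" for u v p q p' q' :: 'e2
      by (simp add: algebra_simps)
    have d': "u * p - u * p' = u * (p - p')" for u p p' :: 'e4 by (simp add: algebra_simps)
    show ?thesis using xy(3) l unfolding e x y G_mult mk_mult near_mk d d' by (intro conjI sum2 m4) blast+
  qed
  then show ?thesis using that by blast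
qed

text \<open>The first congruence subgroup lies in \<open>K\<close> because \<open>P\<close> holds
  near 1. Hence \<open>K\<close> is open.\<close>

lemma near_one_K:
  assumes "g \<in> carrier G" "near 1 \<one>\<^bsub>G\<^esub> g"
  shows "g \<in> K"
proof -
  obtain a b c d z where e: "g = (mk a b c d, z)" using assms(1) by (rule G_cases)
  have u: "val_ge E2.w (a - 1) 1" "val_ge E2.w b 1" "val_ge E2.w c 1" "val_ge E2.w (d - 1) 1" "val_ge E4.w (z - 1) 1"
    using assms(2) unfolding e G_one near_mk by auto
  have a: "a \<noteq> 0 \<and> E2.w a = 0" using unit_add[of 1 "a - 1"] u by simp
  have d: "d \<noteq> 0 \<and> E2.w d = 0" using unit_add[of 1 "d - 1"] u by simp
  have z: "z \<noteq> 0 \<and> E4.w z = 0" using E4.w.val_eq_of_close[of 1 z] u by (simp add: E4.w.val_ge_minus_commute)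
  have b: "val_ge E2.w b 0" by (rule E2.w.val_ge_mono[OF u(2)]) simp
  have "val_ge E2.w a 0" using a by (simp add: val_ge_def)
  then have "val_ge E2.w (a * (d - 1) + (a - 1) - b * c) 1"
    using E2.w.val_ge_diff[OF E2.w.val_ge_add[OF E2.w.val_ge_mult_0[OF _ u(4)] u(1)] E2.w.val_ge_mult_0[OF b u(3)]] by blast
  then have "P (a * d - b * c) z" using u by (intro P_near_1) (simp_all add: algebra_simps)
  then show ?thesis using assms(1) a b d z u unfolding e K_iff by blast
qed

lemma ex_near_coset:
  assumes g: "g \<in> carrier G"
  obtains k where "\<And>h. h \<in> carrier G \<Longrightarrow> near k g h \<Longrightarrow> inv\<^bsub>G\<^esub> g \<otimes>\<^bsub>G\<^esub> h \<in> K"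
proof -
  obtain l where "\<And>x y. x \<in> carrier G \<Longrightarrow> y \<in> carrier G \<Longrightarrow> near l x y \<Longrightarrow>
      near 1 (inv\<^bsub>G\<^esub> g \<otimes>\<^bsub>G\<^esub> x) (inv\<^bsub>G\<^esub> g \<otimes>\<^bsub>G\<^esub> y)"
    using near_left_mult[of "inv\<^bsub>G\<^esub> g" 1] g by blast
  then have "inv\<^bsub>G\<^esub> g \<otimes>\<^bsub>G\<^esub> h \<in> K" if "h \<in> carrier G" "near l g h" for h
    using that g near_one_K[of "inv\<^bsub>G\<^esub> g \<otimes>\<^bsub>G\<^esub> h"] by fastforce
  then show ?thesis using that by blast
qed

abbreviation TG where "TG \<equiv> G0_topology v \<iota>2 \<iota>4"

lemma openin_TG: "openin TG S \<longleftrightarrow> S \<subseteq> carrier G \<and> (\<forall>g\<in>S. \<exists>k. \<forall>h\<in>carrier G. near k g h \<longrightarrow> h \<in> S)"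
proof -
  define f where "f = (\<lambda>(g2, g4). (g2 $$ (0,0), g2 $$ (0,1), g2 $$ (1,0), g2 $$ (1,1), g4) :: 'e2 \<times> 'e2 \<times> 'e2 \<times> 'e2 \<times> 'e4)"
  let ?T2 = "ext_topology v \<iota>2" and ?T4 = "ext_topology v \<iota>4"
  let ?P = "prod_topology ?T2 (prod_topology ?T2 (prod_topology ?T2 (prod_topology ?T2 ?T4)))"
  have TG: "openin TG S \<longleftrightarrow> (\<exists>U. openin ?P U \<and> S = f -` U \<inter> carrier G)"
    unfolding G0_topology_def f_def by (rule openin_pullback_topology)
  have f: "f g = (fst g $$ (0,0), fst g $$ (0,1), fst g $$ (1,0), fst g $$ (1,1), snd g)" for g
    by (simp add: f_def split_def)
  show ?thesis
  proof
    assume "openin TG S"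
    then obtain U where U: "openin ?P U" "S = f -` U \<inter> carrier G" using TG by blast
    have "\<exists>k. \<forall>h\<in>carrier G. near k g h \<longrightarrow> h \<in> S" if g: "g \<in> S" for g
    proof -
      have "f g \<in> U" using g U by blast
      then obtain A B C D E where o: "openin ?T2 A" "openin ?T2 B" "openin ?T2 C" "openin ?T2 D" "openin ?T4 E"
        "f g \<in> A \<times> B \<times> C \<times> D \<times> E" "A \<times> B \<times> C \<times> D \<times> E \<subseteq> U"
      proof -
        assume that: "\<And>A B C D E. openin ?T2 A \<Longrightarrow> openin ?T2 B \<Longrightarrow> openin ?T2 C \<Longrightarrow> openin ?T2 D \<Longrightarrow> openin ?T4 E \<Longrightarrow>
            f g \<in> A \<times> B \<times> C \<times> D \<times> E \<Longrightarrow> A \<times> B \<times> C \<times> D \<times> E \<subseteq> U \<Longrightarrow> thesis"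
        note fg = \<open>f g \<in> U\<close>[unfolded f]
        obtain A V where 1: "openin ?T2 A" "openin (prod_topology ?T2 (prod_topology ?T2 (prod_topology ?T2 ?T4))) V"
          "fst g $$ (0,0) \<in> A" "(fst g $$ (0,1), fst g $$ (1,0), fst g $$ (1,1), snd g) \<in> V" "A \<times> V \<subseteq> U"
          by (rule openin_prod_topologyE[OF U(1) fg])
        obtain B V' where 2: "openin ?T2 B" "openin (prod_topology ?T2 (prod_topology ?T2 ?T4)) V'"
          "fst g $$ (0,1) \<in> B" "(fst g $$ (1,0), fst g $$ (1,1), snd g) \<in> V'" "B \<times> V' \<subseteq> V"
          by (rule openin_prod_topologyE[OF 1(2,4)])
        obtain C V'' where 3: "openin ?T2 C" "openin (prod_topology ?T2 ?T4) V''"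
          "fst g $$ (1,0) \<in> C" "(fst g $$ (1,1), snd g) \<in> V''" "C \<times> V'' \<subseteq> V'"
          by (rule openin_prod_topologyE[OF 2(2,4)])
        obtain D E where 4: "openin ?T2 D" "openin ?T4 E" "fst g $$ (1,1) \<in> D" "snd g \<in> E" "D \<times> E \<subseteq> V''"
          by (rule openin_prod_topologyE[OF 3(2,4)])
        have "C \<times> D \<times> E \<subseteq> V'" using 3(5) 4(5) by blast
        then have "B \<times> C \<times> D \<times> E \<subseteq> V" using 2(5) by blast
        then have "A \<times> B \<times> C \<times> D \<times> E \<subseteq> U" using 1(5) by blast
        then show thesis
          by (rule that[of A B C D E, rotated 6]) (use 1 2 3 4 in \<open>simp_all add: f\<close>)
      qed
      have mem: "fst g $$ (0,0) \<in> A" "fst g $$ (0,1) \<in> B" "fst g $$ (1,0) \<in> C" "fst g $$ (1,1) \<in> D" "snd g \<in> E"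
        using o(6) by (auto simp: f)
      obtain k1 where k1: "\<And>y. val_ge E2.w (y - fst g $$ (0,0)) k1 \<Longrightarrow> y \<in> A" using o(1) mem(1) unfolding E2.openin_ext_topology by blast
      obtain k2 where k2: "\<And>y. val_ge E2.w (y - fst g $$ (0,1)) k2 \<Longrightarrow> y \<in> B" using o(2) mem(2) unfolding E2.openin_ext_topology by blast
      obtain k3 where k3: "\<And>y. val_ge E2.w (y - fst g $$ (1,0)) k3 \<Longrightarrow> y \<in> C" using o(3) mem(3) unfolding E2.openin_ext_topology by blast
      obtain k4 where k4: "\<And>y. val_ge E2.w (y - fst g $$ (1,1)) k4 \<Longrightarrow> y \<in> D" using o(4) mem(4) unfolding E2.openin_ext_topology by blast
      obtain k5 where k5: "\<And>y. val_ge E4.w (y - snd g) k5 \<Longrightarrow> y \<in> E" using o(5) mem(5) unfolding E4.openin_ext_topology by blast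
      have "h \<in> S" if h: "h \<in> carrier G" "near (Max {k1, k2, k3, k4, k5}) g h" for h
      proof -
        have n: "near k g h" if "k \<in> {k1, k2, k3, k4, k5}" for k
          using that by (intro near_mono[OF h(2)] Max_ge) auto
        have "f h \<in> A \<times> B \<times> C \<times> D \<times> E"
          unfolding f using n[of k1] n[of k2] n[of k3] n[of k4] n[of k5]
          by (auto simp: near_def intro!: k1 k2 k3 k4 k5)
        then show ?thesis using o(7) h(1) U(2) by blast
      qed
      then show ?thesis by blast
    qed
    then show "S \<subseteq> carrier G \<and> (\<forall>g\<in>S. \<exists>k. \<forall>h\<in>carrier G. near k g h \<longrightarrow> h \<in> S)" using U(2) by blast
  next
    assume S: "S \<subseteq> carrier G \<and> (\<forall>g\<in>S. \<exists>k. \<forall>h\<in>carrier G. near k g h \<longrightarrow> h \<in> S)"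
    then obtain k where k: "\<And>g h. g \<in> S \<Longrightarrow> h \<in> carrier G \<Longrightarrow> near (k g) g h \<Longrightarrow> h \<in> S" by metis
    define box where "box g = {y. val_ge E2.w (y - fst g $$ (0,0)) (k g)} \<times> {y. val_ge E2.w (y - fst g $$ (0,1)) (k g)} \<times>
      {y. val_ge E2.w (y - fst g $$ (1,0)) (k g)} \<times> {y. val_ge E2.w (y - fst g $$ (1,1)) (k g)} \<times> {y. val_ge E4.w (y - snd g) (k g)}" for g
    have box: "f h \<in> box g \<longleftrightarrow> near (k g) g h" for g h by (simp add: f box_def near_def)
    have "openin ?P (box g)" for g
      unfolding box_def using E2.openin_ball E4.openin_ball by (simp add: openin_prod_Times_iff)
    then have "openin ?P (\<Union>g\<in>S. box g)" by blast
    moreover have "S = f -` (\<Union>g\<in>S. box g) \<inter> carrier G"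
    proof (intro equalityI subsetI)
      fix h assume "h \<in> S"
      then show "h \<in> f -` (\<Union>g\<in>S. box g) \<inter> carrier G" using S near_refl[of "k h" h] box[of h h] by blast
    next
      fix h assume "h \<in> f -` (\<Union>g\<in>S. box g) \<inter> carrier G"
      then obtain g where "g \<in> S" "f h \<in> box g" "h \<in> carrier G" by blast
      then show "h \<in> S" using k[of g h] box[of h g] by blast
    qed
    ultimately show "openin TG S" using TG by blast
  qed
qed

lemma topspace_TG: "topspace TG = carrier G"
proof
  show "topspace TG \<subseteq> carrier G" using openin_TG[of "topspace TG"] by simp
  have "openin TG (carrier G)" by (auto simp: openin_TG)
  then show "carrier G \<subseteq> topspace TG" by (rule openin_subset)
qed

text \<open>Precision \<open>4 * k\<close> in both extensions yields precision \<open>k\<close> in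
  the base field, because the extended valuations restrict to \<open>4 * v\<close> and
  \<open>2 * v\<close>.\<close>

lemma near_limit_N:
  assumes x: "x \<noteq> 0" "E2.w x = 0" and y: "y \<noteq> 0" "E4.w y = 0"
    and x': "val_ge E2.w (x' - x) (int (4 * k))" and y': "val_ge E4.w (y' - y) (int (4 * k))"
    and N: "N2 x * N4 y = 1"
  shows "val_ge v (N2 x' * N4 y' - 1) (int k)"
proof -
  have "val_ge E2.w ((x' - x) / x) (int (4 * k))" using x' E2.w.val_ge_divide_unit[OF x] by simp
  then have "val_ge E2.w ((x' - x) / x) (int 2 * int k)" by (rule E2.w.val_ge_mono) simp
  from E2.ext_norm_close_1[OF this] have 2: "val_ge v (N2 (x' / x) - 1) (int k)"
    using x by (simp add: diff_divide_distrib)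
  have "val_ge E4.w ((y' - y) / y) (int 4 * int k)"
    using y' y by (cases "y' = y") (auto simp: val_ge_def E4.w.v_divide)
  from E4.ext_norm_close_1[OF this] have 4: "val_ge v (N4 (y' / y) - 1) (int k)"
    using y by (simp add: diff_divide_distrib)
  have 20: "val_ge v (N2 (x' / x)) 0"
    using val_ge_add[OF val_ge_mono[OF 2, of 0], of 1] by (simp add: val_ge_1)
  have "N2 x' = N2 (x' / x) * N2 x" "N4 y' = N4 (y' / y) * N4 y"
    using x y by (simp_all flip: E2.ext_norm_mult E4.ext_norm_mult)
  then have "N2 x' * N4 y' = N2 (x' / x) * N4 (y' / y) * (N2 x * N4 y)" by (simp only: mult_ac)
  then have eq: "N2 x' * N4 y' - 1 = N2 (x' / x) * (N4 (y' / y) - 1) + (N2 (x' / x) - 1)"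
    unfolding N by (simp add: algebra_simps)
  show ?thesis unfolding eq by (rule val_ge_add[OF val_ge_mult_0[OF 20 4] 2])
qed

text \<open>The open conditions (units, \<open>P\<close>) are inherited from the approximant
  \<open>s 1\<close>. The norm equation is inherited only in the limit: it holds to precision
  \<open>k\<close> by comparison with \<open>s (4 * k)\<close>.\<close>

lemma K_near_closed:
  assumes s: "\<And>i. s i \<in> K" and e: "g = (mk a b c d, z)" and near: "\<And>i. near (int i) (s i) g"
  shows "g \<in> K"
proof -
  have ex: "\<exists>a' b' c' d' z'. s i = (mk a' b' c' d', z')" for i using K_cases[OF s[of i]] by metis
  have det: "val_ge E2.w (a * d - b * c - (a' * d' - b' * c')) (int i)"
    and close: "val_ge E2.w (a - a') (int i)" "val_ge E2.w (b - b') (int i)" "val_ge E2.w (c - c') (int i)"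
      "val_ge E2.w (d - d') (int i)" "val_ge E4.w (z - z') (int i)"
    and unit: "a' \<noteq> 0" "E2.w a' = 0" "d' \<noteq> 0" "E2.w d' = 0" "val_ge E2.w b' 0" "val_ge E2.w c' 1" "z' \<noteq> 0" "E4.w z' = 0"
      "P (a' * d' - b' * c') z'" "N2 (a' * d' - b' * c') * N4 z' = 1"
    if si: "s i = (mk a' b' c' d', z')" for i a' b' c' d' z'
  proof -
    show u: "a' \<noteq> 0" "E2.w a' = 0" "d' \<noteq> 0" "E2.w d' = 0" "val_ge E2.w b' 0" "val_ge E2.w c' 1" "z' \<noteq> 0" "E4.w z' = 0"
      "P (a' * d' - b' * c') z'" "N2 (a' * d' - b' * c') * N4 z' = 1"
      using s[of i] unfolding si K_iff by auto
    show close: "val_ge E2.w (a - a') (int i)" "val_ge E2.w (b - b') (int i)" "val_ge E2.w (c - c') (int i)"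
      "val_ge E2.w (d - d') (int i)" "val_ge E4.w (z - z') (int i)"
      using near[of i] unfolding si e near_mk by auto
    have i0: "val_ge E2.w x 0" if "val_ge E2.w x (int i)" for x using E2.w.val_ge_mono[OF that] by simp
    have I: "val_ge E2.w a' 0" "val_ge E2.w d' 0" "val_ge E2.w b' 0" "val_ge E2.w c' 0"
      using u E2.w.val_ge_mono[OF u(6), of 0] by (auto simp: val_ge_def)
    have "val_ge E2.w (c - c' + c') 0" "val_ge E2.w (d - d' + d') 0" using I close i0 by (intro E2.w.val_ge_add; simp)+
    then have I': "val_ge E2.w c 0" "val_ge E2.w d 0" by simp_all
    have "val_ge E2.w (d * (a - a') + a' * (d - d') - (c * (b - b') + b' * (c - c'))) (int i)"
      by (rule E2.w.val_ge_diff[OF E2.w.val_ge_add E2.w.val_ge_add]; rule E2.w.val_ge_mult_0) (rule I I' close)+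
    then show "val_ge E2.w (a * d - b * c - (a' * d' - b' * c')) (int i)" by (simp add: algebra_simps)
  qed
  obtain a' b' c' d' z' where s1: "s 1 = (mk a' b' c' d', z')" using ex by blast
  define \<Delta> \<Delta>' where "\<Delta> = a * d - b * c" and "\<Delta>' = a' * d' - b' * c'"
  note u = unit[OF s1] and cl = close[OF s1, simplified]
  have \<Delta>': "\<Delta>' \<noteq> 0" "E2.w \<Delta>' = 0" using K_det_unit(1)[of a' d' b' c'] u by (auto simp: \<Delta>'_def)
  have \<Delta>c: "val_ge E2.w (\<Delta> - \<Delta>') 1" using det[OF s1] by (simp add: \<Delta>_def \<Delta>'_def)
  have a: "a \<noteq> 0" "E2.w a = 0" using unit_add[of a' "a - a'"] u cl by auto
  have d: "d \<noteq> 0" "E2.w d = 0" using unit_add[of d' "d - d'"] u cl by auto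
  have \<Delta>: "\<Delta> \<noteq> 0" "E2.w \<Delta> = 0" using unit_add[of \<Delta>' "\<Delta> - \<Delta>'"] \<Delta>' \<Delta>c by auto
  have z: "z \<noteq> 0" "E4.w z = 0" using E4.w.val_eq_of_close[of z' z] u cl by (auto simp: E4.w.val_ge_minus_commute)
  have "val_ge E2.w (b - b' + b') 0" using u E2.w.val_ge_mono[OF cl(2), of 0] by (intro E2.w.val_ge_add) auto
  moreover have "val_ge E2.w (c - c' + c') 1" using u cl by (intro E2.w.val_ge_add) auto
  ultimately have bc: "val_ge E2.w b 0" "val_ge E2.w c 1" by simp_all
  have "P (\<Delta>' * (\<Delta> / \<Delta>')) (z' * (z / z'))"
  proof (rule P_mult)
    show "P (\<Delta> / \<Delta>') (z / z')"
    proof (rule P_near_1)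
      have "val_ge E2.w ((\<Delta> - \<Delta>') / \<Delta>') 1" using \<Delta>c E2.w.val_ge_divide_unit[OF \<Delta>'] by simp
      then show "val_ge E2.w (\<Delta> / \<Delta>' - 1) 1" using \<Delta>' by (simp add: diff_divide_distrib)
      have "val_ge E4.w ((z - z') / z') 1" using cl u by (cases "z = z'") (auto simp: val_ge_def E4.w.v_divide)
      then show "val_ge E4.w (z / z' - 1) 1" using u by (simp add: diff_divide_distrib)
    qed
  qed (use \<Delta> \<Delta>' z u in \<open>auto simp: E2.w.v_divide E4.w.v_divide \<Delta>'_def\<close>)
  then have P: "P \<Delta> z" using \<Delta>' u by simp
  have "val_ge v (N2 \<Delta> * N4 z - 1) (int k)" for k
  proof -
    obtain a' b' c' d' z' where sk: "s (4 * k) = (mk a' b' c' d', z')" using ex by blast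
    note u = unit[OF sk] and cl = close[OF sk]
    have "a' * d' - b' * c' \<noteq> 0 \<and> E2.w (a' * d' - b' * c') = 0" using K_det_unit(1)[of a' d' b' c'] u by blast
    then show ?thesis using near_limit_N[of "a' * d' - b' * c'" z' \<Delta> k z] det[OF sk] u cl by (simp add: \<Delta>_def)
  qed
  then have "N2 \<Delta> * N4 z - 1 = 0 \<or> int k \<le> v (N2 \<Delta> * N4 z - 1)" for k by (auto simp: val_ge_def)
  \<comment> \<open>Taking \<open>k\<close> beyond the value of
    \<open>N2 \<Delta> * N4 z - 1\<close> forces this element to be 0.\<close>
  from this[of "nat (v (N2 \<Delta> * N4 z - 1) + 1)"] have "N2 \<Delta> * N4 z = 1" by (auto split: if_splits)
  then show ?thesis unfolding e K_iff G_iff \<Delta>_def[symmetric] using \<Delta> a d z bc P by (simp add: \<Delta>_def)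
qed

lemma compactin_K: "compactin TG K"
proof (rule compactin_ultrametric[where R = "\<lambda>k. near (int k)"])
  show "K \<subseteq> topspace TG" by (simp add: topspace_TG K_subset_G)
  show "near (int k) h g" if "near (int k) g h" for k g h using that by (rule near_sym)
  show "near (int k) g u" if "near (int k) g h" "near (int k) h u" for k g h u using that by (rule near_trans)
next
  fix U g assume "openin TG U" "g \<in> U" "g \<in> K"
  then obtain k where k: "\<forall>h\<in>carrier G. near k g h \<longrightarrow> h \<in> U" unfolding openin_TG by blast
  have "near k g h" if "near (int (nat k)) g h" for h using near_mono[OF that] by simp
  then show "\<exists>k. \<forall>h\<in>K. near (int k) g h \<longrightarrow> h \<in> U" using k K_G by blast
next
  fix k :: nat
  let ?R2 = "D.reps k 0" and ?R4 = "D4.reps k 0"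
  define Q where "Q = (\<lambda>(a, b, c, d, z). (mk a b c d, z)) ` (?R2 \<times> ?R2 \<times> ?R2 \<times> ?R2 \<times> ?R4)"
  have finQ: "finite Q" by (simp add: Q_def D.finite_reps D4.finite_reps)
  have Q: "\<exists>p\<in>Q. near (int k) p h" if h: "h \<in> K" for h
  proof -
    obtain a b c d z where e: "h = (mk a b c d, z)" using h by (rule K_cases)
    have u: "val_ge E2.w a 0" "val_ge E2.w b 0" "val_ge E2.w c 0" "val_ge E2.w d 0" "val_ge E4.w z 0"
      using h E2.w.val_ge_mono[of c 1 0] unfolding e K_iff by (auto simp: val_ge_def)
    obtain a' where "a' \<in> ?R2" "val_ge E2.w (a - a') (int k)" using D.reps_ex[OF u(1), of k] by auto
    moreover obtain b' where "b' \<in> ?R2" "val_ge E2.w (b - b') (int k)" using D.reps_ex[OF u(2), of k] by auto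
    moreover obtain c' where "c' \<in> ?R2" "val_ge E2.w (c - c') (int k)" using D.reps_ex[OF u(3), of k] by auto
    moreover obtain d' where "d' \<in> ?R2" "val_ge E2.w (d - d') (int k)" using D.reps_ex[OF u(4), of k] by auto
    moreover obtain z' where "z' \<in> ?R4" "val_ge E4.w (z - z') (int k)" using D4.reps_ex[OF u(5), of k] by auto
    ultimately show ?thesis
      unfolding e by (intro bexI[of _ "(mk a' b' c' d', z')"]) (auto simp: near_mk Q_def intro!: image_eqI[of _ _ "(a', b', c', d', z')"])
  qed
  \<comment> \<open>The matrices in \<open>Q\<close> need not satisfy the group conditions. Each one
    that is close to a point of \<open>K\<close> is replaced by such a point, without loss of
    precision by the ultrametric property.\<close>
  define F where "F = (\<lambda>p. SOME h. h \<in> K \<and> near (int k) p h) ` {p \<in> Q. \<exists>h\<in>K. near (int k) p h}"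
  have some: "(SOME h. h \<in> K \<and> near (int k) p h) \<in> K \<and> near (int k) p (SOME h. h \<in> K \<and> near (int k) p h)"
    if "\<exists>h\<in>K. near (int k) p h" for p
    using that by (intro someI_ex[of "\<lambda>h. h \<in> K \<and> near (int k) p h"]) blast
  have "\<exists>f\<in>F. near (int k) f h" if h: "h \<in> K" for h
  proof -
    obtain p where p: "p \<in> Q" "near (int k) p h" using Q[OF h] by blast
    let ?f = "SOME h. h \<in> K \<and> near (int k) p h"
    have f: "near (int k) p ?f" using some[of p] p h by blast
    have "?f \<in> F" using p h by (auto simp: F_def)
    moreover have "near (int k) ?f h" using near_trans[OF near_sym[OF f] p(2)] .
    ultimately show ?thesis by blast
  qed
  moreover have "finite F" using finQ by (simp add: F_def)
  moreover have "F \<subseteq> K" unfolding F_def using some by (intro image_subsetI) blast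
  ultimately show "\<exists>F. finite F \<and> F \<subseteq> K \<and> (\<forall>h\<in>K. \<exists>f\<in>F. near (int k) f h)" by blast
next
  fix s assume s: "\<And>i. s i \<in> K" and cauchy: "\<And>i j. i < j \<Longrightarrow> near (int i) (s i) (s j)"
  have c': "near (int m) (s i) (s j)" if "m \<le> i" "m \<le> j" for m i j
  proof (cases i j rule: linorder_cases)
    case less
    show ?thesis by (rule near_mono[OF cauchy[OF less]]) (use that in simp)
  next
    case equal
    then show ?thesis by (simp add: near_refl)
  next
    case greater
    show ?thesis by (rule near_mono[OF near_sym[OF cauchy[OF greater]]]) (use that in simp)
  qed
  have lim2: "\<exists>l. \<forall>i. val_ge E2.w (l - f (s i)) (int i)"
    if f: "\<And>k g h. near k g h \<Longrightarrow> val_ge E2.w (f h - f g) k" for f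
  proof -
    have "\<exists>k. \<forall>i\<ge>k. \<forall>j\<ge>k. val_ge E2.w (f (s i) - f (s j)) m" for m
    proof (intro exI[of _ "nat m"] allI impI)
      fix i j assume "i \<ge> nat m" "j \<ge> nat m"
      then have "near (int (nat m)) (s j) (s i)" by (intro c')
      then show "val_ge E2.w (f (s i) - f (s j)) m" by (intro E2.w.val_ge_mono[OF f]) auto
    qed
    from E2.w_complete[of "\<lambda>i. f (s i)", OF complete this] obtain l where
      l: "\<And>m. \<exists>k. \<forall>i\<ge>k. val_ge E2.w (f (s i) - l) m" by blast
    have "val_ge E2.w (l - f (s i)) (int i)" for i
    proof -
      obtain k where "\<forall>j\<ge>k. val_ge E2.w (f (s j) - l) (int i)" using l by blast
      then have 1: "val_ge E2.w (f (s (max k i)) - l) (int i)" by simp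
      have "near (int i) (s i) (s (max k i))" by (intro c') auto
      from E2.w.val_ge_diff[OF f[OF this] 1] show ?thesis by simp
    qed
    then show ?thesis by blast
  qed
  have "\<exists>l. \<forall>i. val_ge E4.w (l - snd (s i)) (int i)"
  proof -
    have f: "val_ge E4.w (snd h - snd g) k" if "near k g h" for k g h using that by (simp add: near_def)
    have "\<exists>k. \<forall>i\<ge>k. \<forall>j\<ge>k. val_ge E4.w (snd (s i) - snd (s j)) m" for m
    proof (intro exI[of _ "nat m"] allI impI)
      fix i j assume "i \<ge> nat m" "j \<ge> nat m"
      then have "near (int (nat m)) (s j) (s i)" by (intro c')
      then show "val_ge E4.w (snd (s i) - snd (s j)) m" by (intro E4.w.val_ge_mono[OF f]) auto
    qed
    from E4.w_complete[of "\<lambda>i. snd (s i)", OF complete this] obtain l where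
      l: "\<And>m. \<exists>k. \<forall>i\<ge>k. val_ge E4.w (snd (s i) - l) m" by blast
    have "val_ge E4.w (l - snd (s i)) (int i)" for i
    proof -
      obtain k where "\<forall>j\<ge>k. val_ge E4.w (snd (s j) - l) (int i)" using l by blast
      then have 1: "val_ge E4.w (snd (s (max k i)) - l) (int i)" by simp
      have "near (int i) (s i) (s (max k i))" by (intro c') auto
      from E4.w.val_ge_diff[OF f[OF this] 1] show ?thesis by simp
    qed
    then show ?thesis by blast
  qed
  then obtain z where z: "\<And>i. val_ge E4.w (z - snd (s i)) (int i)" by blast
  obtain a where a: "\<And>i. val_ge E2.w (a - fst (s i) $$ (0,0)) (int i)" using lim2[of "\<lambda>g. fst g $$ (0,0)"] by (auto simp: near_def)
  obtain b where b: "\<And>i. val_ge E2.w (b - fst (s i) $$ (0,1)) (int i)" using lim2[of "\<lambda>g. fst g $$ (0,1)"] by (auto simp: near_def)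
  obtain c where c: "\<And>i. val_ge E2.w (c - fst (s i) $$ (1,0)) (int i)" using lim2[of "\<lambda>g. fst g $$ (1,0)"] by (auto simp: near_def)
  obtain d where d: "\<And>i. val_ge E2.w (d - fst (s i) $$ (1,1)) (int i)" using lim2[of "\<lambda>g. fst g $$ (1,1)"] by (auto simp: near_def)
  have near: "near (int i) (s i) (mk a b c d, z)" for i using a[of i] b[of i] c[of i] d[of i] z[of i] by (simp add: near_def)
  from K_near_closed[OF s refl near] near show "\<exists>g\<in>K. \<forall>i. near (int i) (s i) g" by blast
qed

lemma compactin_coset:
  assumes g: "g \<in> carrier G"
  shows "compactin TG ((\<lambda>x. g \<otimes>\<^bsub>G\<^esub> x) ` K)"
proof (rule image_compactin[OF compactin_K])
  show "continuous_map TG TG (\<lambda>x. g \<otimes>\<^bsub>G\<^esub> x)"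
    unfolding continuous_map_def topspace_TG
  proof (intro conjI allI impI)
    show "(\<lambda>x. g \<otimes>\<^bsub>G\<^esub> x) \<in> carrier G \<rightarrow> carrier G" using g by (simp del: G_mult)
    fix U assume U: "openin TG U"
    show "openin TG {x \<in> carrier G. g \<otimes>\<^bsub>G\<^esub> x \<in> U}" unfolding openin_TG
    proof (intro conjI ballI)
      fix x assume "x \<in> {x \<in> carrier G. g \<otimes>\<^bsub>G\<^esub> x \<in> U}"
      then have x: "x \<in> carrier G" "g \<otimes>\<^bsub>G\<^esub> x \<in> U" by auto
      obtain k where k: "\<forall>h\<in>carrier G. near k (g \<otimes>\<^bsub>G\<^esub> x) h \<longrightarrow> h \<in> U" using U x unfolding openin_TG by blast
      obtain l where l: "\<And>x y. x \<in> carrier G \<Longrightarrow> y \<in> carrier G \<Longrightarrow> near l x y \<Longrightarrow> near k (g \<otimes>\<^bsub>G\<^esub> x) (g \<otimes>\<^bsub>G\<^esub> y)"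
        using near_left_mult[OF g] by blast
      show "\<exists>k. \<forall>h\<in>carrier G. near k x h \<longrightarrow> h \<in> {x \<in> carrier G. g \<otimes>\<^bsub>G\<^esub> x \<in> U}"
        using k l x(1) g by (intro exI[of _ l]) (simp del: G_mult)
    qed auto
  qed
qed

text \<open>A right \<open>K\<close>-stable set is a union of left cosets of the open subgroup
  \<open>K\<close>, hence closed. Each coset is compact and open, so compactness means that finitely
  many cosets suffice.\<close>

lemma compact_iff:
  assumes S: "S \<subseteq> carrier G" and SK: "\<And>g k. g \<in> S \<Longrightarrow> k \<in> K \<Longrightarrow> g \<otimes>\<^bsub>G\<^esub> k \<in> S"
  shows "compactin TG (TG closure_of S) \<longleftrightarrow>
    (\<exists>F. finite F \<and> F \<subseteq> carrier G \<and> (\<forall>g\<in>S. \<exists>f\<in>F. inv\<^bsub>G\<^esub> f \<otimes>\<^bsub>G\<^esub> g \<in> K))"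
proof -
  have mem: "h \<in> (\<lambda>x. g \<otimes>\<^bsub>G\<^esub> x) ` K \<longleftrightarrow> h \<in> carrier G \<and> inv\<^bsub>G\<^esub> g \<otimes>\<^bsub>G\<^esub> h \<in> K" if "g \<in> carrier G" for g h
    using that K_G by (auto simp: G_inv_cancel simp del: G_mult intro!: image_eqI[of _ _ "inv\<^bsub>G\<^esub> g \<otimes>\<^bsub>G\<^esub> h"])
  have inv_K: "inv\<^bsub>G\<^esub> h \<otimes>\<^bsub>G\<^esub> g \<in> K" if "g \<in> carrier G" "h \<in> carrier G" "inv\<^bsub>G\<^esub> g \<otimes>\<^bsub>G\<^esub> h \<in> K" for g h
    using subgroup.m_inv_closed[OF K_subgroup that(3)] that(1,2) by (simp add: G.inv_mult_group del: G_mult)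
  have stable: "h \<in> S" if "g \<in> S" "h \<in> carrier G" "inv\<^bsub>G\<^esub> g \<otimes>\<^bsub>G\<^esub> h \<in> K" for g h
  proof -
    have "g \<in> carrier G" using that S by blast
    then show ?thesis using SK[OF that(1,3)] that by (simp add: G_inv_cancel del: G_mult)
  qed
  have "openin TG (carrier G - S)" unfolding openin_TG
  proof (intro conjI ballI)
    fix g assume g: "g \<in> carrier G - S"
    obtain k where k: "\<And>h. h \<in> carrier G \<Longrightarrow> near k g h \<Longrightarrow> inv\<^bsub>G\<^esub> g \<otimes>\<^bsub>G\<^esub> h \<in> K" using ex_near_coset g by blast
    have "h \<in> carrier G - S" if "h \<in> carrier G" "near k g h" for h
      using stable[of h g] inv_K[of g h] k[OF that] g that by blast
    then show "\<exists>k. \<forall>h\<in>carrier G. near k g h \<longrightarrow> h \<in> carrier G - S" by blast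
  qed auto
  then have closed: "closedin TG S" using S by (simp add: closedin_def topspace_TG)
  have "compactin TG S \<longleftrightarrow> (\<exists>F. finite F \<and> F \<subseteq> carrier G \<and> (\<forall>g\<in>S. \<exists>f\<in>F. inv\<^bsub>G\<^esub> f \<otimes>\<^bsub>G\<^esub> g \<in> K))"
  proof
    assume c: "compactin TG S"
    have opn: "openin TG ((\<lambda>x. g \<otimes>\<^bsub>G\<^esub> x) ` K)" if g: "g \<in> carrier G" for g
      unfolding openin_TG
    proof (intro conjI ballI)
      show "(\<lambda>x. g \<otimes>\<^bsub>G\<^esub> x) ` K \<subseteq> carrier G" using mem[OF g] by blast
      fix h assume "h \<in> (\<lambda>x. g \<otimes>\<^bsub>G\<^esub> x) ` K"
      then have h: "h \<in> carrier G" "inv\<^bsub>G\<^esub> g \<otimes>\<^bsub>G\<^esub> h \<in> K" using mem[OF g] by auto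
      obtain k where k: "\<And>u. u \<in> carrier G \<Longrightarrow> near k h u \<Longrightarrow> inv\<^bsub>G\<^esub> h \<otimes>\<^bsub>G\<^esub> u \<in> K" using ex_near_coset h(1) by blast
      have "u \<in> (\<lambda>x. g \<otimes>\<^bsub>G\<^esub> x) ` K" if u: "u \<in> carrier G" "near k h u" for u
      proof -
        have "inv\<^bsub>G\<^esub> g \<otimes>\<^bsub>G\<^esub> h \<otimes>\<^bsub>G\<^esub> (inv\<^bsub>G\<^esub> h \<otimes>\<^bsub>G\<^esub> u) \<in> K" using subgroup.m_closed[OF K_subgroup h(2) k[OF u]] .
        then show ?thesis using mem[OF g] g h(1) u(1) by (simp add: G_simps del: G_mult)
      qed
      then show "\<exists>k. \<forall>u\<in>carrier G. near k h u \<longrightarrow> u \<in> (\<lambda>x. g \<otimes>\<^bsub>G\<^esub> x) ` K" by blast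
    qed
    let ?\<U> = "(\<lambda>g. (\<lambda>x. g \<otimes>\<^bsub>G\<^esub> x) ` K) ` S"
    have oneK: "\<one>\<^bsub>G\<^esub> \<in> K" using K_subgroup by (rule subgroup.one_closed)
    have "S \<subseteq> \<Union> ?\<U>"
    proof
      fix g assume g: "g \<in> S"
      then have "g \<in> carrier G" using S by blast
      then have "g \<in> (\<lambda>x. g \<otimes>\<^bsub>G\<^esub> x) ` K" using mem[of g g] oneK by (simp del: G_mult)
      then show "g \<in> \<Union> ?\<U>" using g by blast
    qed
    moreover have "\<And>U. U \<in> ?\<U> \<Longrightarrow> openin TG U" using opn S by blast
    ultimately obtain \<F> where \<F>: "finite \<F>" "\<F> \<subseteq> ?\<U>" "S \<subseteq> \<Union> \<F>" using compactinD[OF c, of ?\<U>] by blast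
    obtain F where F: "F \<subseteq> S" "finite F" "\<F> = (\<lambda>g. (\<lambda>x. g \<otimes>\<^bsub>G\<^esub> x) ` K) ` F"
      using finite_subset_image[OF \<F>(1,2)] by blast
    have "\<exists>f\<in>F. inv\<^bsub>G\<^esub> f \<otimes>\<^bsub>G\<^esub> g \<in> K" if g: "g \<in> S" for g
    proof -
      obtain f where f: "f \<in> F" "g \<in> (\<lambda>x. f \<otimes>\<^bsub>G\<^esub> x) ` K" using \<F>(3) F(3) g by blast
      then have "f \<in> carrier G" using F(1) S by blast
      then show ?thesis using mem[of f g] f by blast
    qed
    then show "\<exists>F. finite F \<and> F \<subseteq> carrier G \<and> (\<forall>g\<in>S. \<exists>f\<in>F. inv\<^bsub>G\<^esub> f \<otimes>\<^bsub>G\<^esub> g \<in> K)" using F S by blast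
  next
    assume "\<exists>F. finite F \<and> F \<subseteq> carrier G \<and> (\<forall>g\<in>S. \<exists>f\<in>F. inv\<^bsub>G\<^esub> f \<otimes>\<^bsub>G\<^esub> g \<in> K)"
    then obtain F where F: "finite F" "F \<subseteq> carrier G" "\<forall>g\<in>S. \<exists>f\<in>F. inv\<^bsub>G\<^esub> f \<otimes>\<^bsub>G\<^esub> g \<in> K" by blast
    have "compactin TG (\<Union>f\<in>F. (\<lambda>x. f \<otimes>\<^bsub>G\<^esub> x) ` K)"
      using F compactin_coset by (intro compactin_Union) auto
    moreover have "S \<subseteq> (\<Union>f\<in>F. (\<lambda>x. f \<otimes>\<^bsub>G\<^esub> x) ` K)"
    proof
      fix g assume g: "g \<in> S"
      then obtain f where f: "f \<in> F" "inv\<^bsub>G\<^esub> f \<otimes>\<^bsub>G\<^esub> g \<in> K" using F(3) by blast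
      then have "g \<in> (\<lambda>x. f \<otimes>\<^bsub>G\<^esub> x) ` K" using mem[of f g] F(2) S g by blast
      then show "g \<in> (\<Union>f\<in>F. (\<lambda>x. f \<otimes>\<^bsub>G\<^esub> x) ` K)" using f(1) by blast
    qed
    ultimately show "compactin TG S" using closed closed_compactin by blast
  qed
  then show ?thesis using closed by (simp add: closure_of_closedin)
qed

end

section \<open>The main theorem\<close>

context hecke_setup
begin

text \<open>Elements of \<open>K\<close> in \<open>Nm\<close> fix the base alcove, so they do not
  change the distance; formally \<open>\<beta>_quotient\<close> is applied to the inverse of
  \<open>n\<close>.\<close>

lemma len_mult_KM:
  assumes n: "n \<in> Nm" and k: "k \<in> K \<inter> Nm"
  shows "len (n \<otimes>\<^bsub>G\<^esub> k) = len n"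
proof -
  have "\<beta> k = 0"
  proof -
    obtain a b c d z where e: "k = (mk a b c d, z)" using k K_cases by blast
    show ?thesis using k unfolding e by (auto simp: K_iff Nm_iff)
  qed
  moreover have "\<beta> \<one>\<^bsub>G\<^esub> = 0" by (simp add: G_one)
  moreover have "\<one>\<^bsub>G\<^esub> \<in> Nm" "inv\<^bsub>G\<^esub> n \<in> Nm"
    using Nm_subgroup n by (auto simp: subgroup.one_closed subgroup.m_inv_closed)
  ultimately show ?thesis
    using \<beta>_quotient[of "inv\<^bsub>G\<^esub> n" k] \<beta>_quotient[of "inv\<^bsub>G\<^esub> n" "\<one>\<^bsub>G\<^esub>"] n k Nm_G
    by (simp add: len_def del: G_mult)
qed

lemma hecke_pair_setup:
  assumes t: "\<And>n. n \<in> Nm \<Longrightarrow> t n \<noteq> 0"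
    "\<And>n k. n \<in> Nm \<Longrightarrow> k \<in> K \<inter> Nm \<Longrightarrow> t (n \<otimes>\<^bsub>G\<^esub> k) = t n * \<rho> k"
  shows "hecke_pair G TG K Nm \<rho> L t (\<lambda>m. xr (sg m) ` Y m)"
proof (rule hecke_pair.intro[OF group_G hecke_pair_axioms.intro])
  show "subgroup K G" "subgroup Nm G" by (rule K_subgroup Nm_subgroup)+
  show "\<rho> (k \<otimes>\<^bsub>G\<^esub> l) = \<rho> k * \<rho> l" if "k \<in> K" "l \<in> K" for k l using that by (rule \<rho>_mult)
  show "\<rho> k \<noteq> 0" if "k \<in> K" for k using that by (rule \<rho>_nonzero)
  show "n \<otimes>\<^bsub>G\<^esub> k \<otimes>\<^bsub>G\<^esub> inv\<^bsub>G\<^esub> n \<in> K \<inter> Nm" if "n \<in> Nm" "k \<in> K \<inter> Nm" for n k using that by (rule conj_KM)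
  show "\<exists>k\<in>K. \<exists>n\<in>Nm. \<exists>k'\<in>K. g = k \<otimes>\<^bsub>G\<^esub> n \<otimes>\<^bsub>G\<^esub> k'" if "g \<in> carrier G" for g
    using bruhat_decomposition[OF that] by metis
  show "inv\<^bsub>G\<^esub> m \<otimes>\<^bsub>G\<^esub> n \<in> K" if "k \<in> K" "m \<in> Nm" "n \<in> Nm" "inv\<^bsub>G\<^esub> m \<otimes>\<^bsub>G\<^esub> k \<otimes>\<^bsub>G\<^esub> n \<in> K" for k m n
    using double_coset_unique[OF that] by blast
  show "\<rho> (inv\<^bsub>G\<^esub> n \<otimes>\<^bsub>G\<^esub> k \<otimes>\<^bsub>G\<^esub> n) = \<rho> k" if "n \<in> Nm" "k \<in> K" "inv\<^bsub>G\<^esub> n \<otimes>\<^bsub>G\<^esub> k \<otimes>\<^bsub>G\<^esub> n \<in> K" for n k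
    using that by (rule conj_KNm)
  show "finite (xr (sg m) ` Y m)" for m using finite_Y by simp
  show "xr (sg m) ` Y m \<subseteq> K" for m using Y_K by blast
  show "\<rho> x = 1" if "x \<in> xr (sg m) ` Y m" for m x using that \<rho>_xr by auto
  show "\<exists>x\<in>xr (sg m) ` Y m. inv\<^bsub>G\<^esub> (x \<otimes>\<^bsub>G\<^esub> m) \<otimes>\<^bsub>G\<^esub> (k \<otimes>\<^bsub>G\<^esub> m) \<in> K" if "m \<in> Nm" "k \<in> K" for m k
    using coset_ex[OF that] by blast
  show "x = y" if "m \<in> Nm" "x \<in> xr (sg m) ` Y m" "y \<in> xr (sg m) ` Y m"
    "inv\<^bsub>G\<^esub> (x \<otimes>\<^bsub>G\<^esub> m) \<otimes>\<^bsub>G\<^esub> (y \<otimes>\<^bsub>G\<^esub> m) \<in> K" for m x y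
    using that coset_unique[OF that(1)] by blast
  show "L n \<noteq> 0" for n by (rule L_nonzero)
  show "L \<one>\<^bsub>G\<^esub> = 1" by (simp add: L_def len_def G_one)
  show "L (n \<otimes>\<^bsub>G\<^esub> k) = L n" if "n \<in> Nm" "k \<in> K \<inter> Nm" for n k using len_mult_KM[OF that] by (simp add: L_def)
  show "(\<Sum>x\<in>xr (sg m) ` Y m. \<psi> (inv\<^bsub>G\<^esub> (x \<otimes>\<^bsub>G\<^esub> m) \<otimes>\<^bsub>G\<^esub> n)) * L n =
      L m * (L (inv\<^bsub>G\<^esub> m \<otimes>\<^bsub>G\<^esub> n) * \<psi> (inv\<^bsub>G\<^esub> m \<otimes>\<^bsub>G\<^esub> n))"
    if "m \<in> Nm" "n \<in> Nm"
      "\<And>g k k'. g \<in> carrier G \<Longrightarrow> k \<in> K \<Longrightarrow> k' \<in> K \<Longrightarrow> \<psi> (k \<otimes>\<^bsub>G\<^esub> g \<otimes>\<^bsub>G\<^esub> k') = \<rho> k * \<psi> g * \<rho> k'" for m n \<psi>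
  proof -
    have inj: "inj_on (xr (sg m)) (Y m)" by (auto simp: inj_on_def xr_def)
    show ?thesis using coset_sum[OF that] by (simp add: sum.reindex[OF inj])
  qed
  show "compactin TG (TG closure_of S) \<longleftrightarrow>
      (\<exists>F. finite F \<and> F \<subseteq> carrier G \<and> (\<forall>g\<in>S. \<exists>f\<in>F. inv\<^bsub>G\<^esub> f \<otimes>\<^bsub>G\<^esub> g \<in> K))"
    if "S \<subseteq> carrier G" "\<And>g k. g \<in> S \<Longrightarrow> k \<in> K \<Longrightarrow> g \<otimes>\<^bsub>G\<^esub> k \<in> S" for S
    using that by (rule compact_iff)
qed (use t in blast)+

lemma ex_commutator:
  obtains a b c where "a \<in> Nm" "b \<in> Nm" "c \<in> K \<inter> Nm" "a \<otimes>\<^bsub>G\<^esub> b = b \<otimes>\<^bsub>G\<^esub> a \<otimes>\<^bsub>G\<^esub> c" "\<rho> c \<noteq> 1"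
proof -
  let ?u = "\<iota>2 \<zeta>"
  define a where "a = (mk 0 1 (- 1) 0 :: 'e2 mat, 1 :: 'e4)"
  \<comment> \<open>As \<open>\<theta>2\<close> has norm \<open>\<pi>\<close> and
    \<open>\<theta>4\<close> has norm \<open>\<zeta> * \<pi>\<close>, the factor
    \<open>\<zeta>\<close> in one diagonal entry balances \<open>\<theta>4 ^ 2\<close> in the norm
    equation. Conjugation by \<open>a\<close> moves it to the other entry, which produces the
    commutator \<open>tor True ?u\<close>.\<close>
  define b where "b = (mk (?u * \<theta>2) 0 0 \<theta>2, inverse (\<theta>4 ^ 2))"
  have u: "?u \<noteq> 0" by simp
  have N2: "N2 \<theta>2 = \<pi>" "N4 \<theta>4 = \<zeta> * \<pi>"
    using E2.ext_norm_\<theta> E4.ext_norm_\<theta> by (simp_all add: numeral_3_eq_3)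
  have "N4 (inverse (\<theta>4 ^ 2)) = inverse ((\<zeta> * \<pi>) ^ 2)" by (simp add: E4.ext_norm_inverse E4.ext_norm_power N2)
  moreover have "N2 (?u * \<theta>2 * \<theta>2) = (\<zeta> * \<pi>) ^ 2"
    by (simp add: E2.ext_norm_mult E2.ext_norm_\<iota> N2 power2_eq_square)
  ultimately have "N2 (?u * \<theta>2 * \<theta>2) * N4 (inverse (\<theta>4 ^ 2)) = 1" using \<pi> by simp
  then have b: "b \<in> Nm" by (simp add: b_def Nm_iff)
  have a: "a \<in> Nm" by (simp add: a_def Nm_iff)
  have c: "tor True ?u \<in> K \<inter> Nm" using tor_\<zeta> tor_Nm[OF u] by blast
  have e: "a \<otimes>\<^bsub>G\<^esub> b = b \<otimes>\<^bsub>G\<^esub> a \<otimes>\<^bsub>G\<^esub> tor True ?u"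
    by (simp add: a_def b_def tor_def)
  have "\<rho> (tor True ?u) \<noteq> 1" using tor_\<zeta>(2)[of True] by simp
  then show ?thesis using that a b c e by blast
qed

lemma rhoM_eq: "rhoM \<eta> \<iota>2 = \<rho>"
  by (simp add: rhoM_def rho0_def Let_def)

lemma stabilizer_eq_Nm:
  "stabilizer_rho G (normalizer_M0 \<iota>2 \<iota>4) (K \<inter> M0 \<iota>2 \<iota>4) (rhoM \<eta> \<iota>2) = Nm"
proof -
  have "(\<lambda>k. n \<otimes>\<^bsub>G\<^esub> k \<otimes>\<^bsub>G\<^esub> inv\<^bsub>G\<^esub> n) ` (K \<inter> Nm) = K \<inter> Nm"
    "\<forall>x\<in>K \<inter> Nm. \<rho> (inv\<^bsub>G\<^esub> n \<otimes>\<^bsub>G\<^esub> x \<otimes>\<^bsub>G\<^esub> n) = \<rho> x" if n: "n \<in> Nm" for n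
  proof -
    have nG: "n \<in> carrier G" and i: "inv\<^bsub>G\<^esub> n \<in> Nm"
      using n Nm_G Nm_subgroup by (auto simp: subgroup.m_inv_closed)
    have conj: "inv\<^bsub>G\<^esub> n \<otimes>\<^bsub>G\<^esub> k \<otimes>\<^bsub>G\<^esub> n \<in> K \<inter> Nm" if "k \<in> K \<inter> Nm" for k
      using conj_KM[OF i that] nG by simp
    show "(\<lambda>k. n \<otimes>\<^bsub>G\<^esub> k \<otimes>\<^bsub>G\<^esub> inv\<^bsub>G\<^esub> n) ` (K \<inter> Nm) = K \<inter> Nm"
    proof (intro equalityI subsetI)
      fix k assume k: "k \<in> K \<inter> Nm"
      have "k = n \<otimes>\<^bsub>G\<^esub> (inv\<^bsub>G\<^esub> n \<otimes>\<^bsub>G\<^esub> k \<otimes>\<^bsub>G\<^esub> n) \<otimes>\<^bsub>G\<^esub> inv\<^bsub>G\<^esub> n"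
        using nG k Nm_G by (simp add: G_simps del: G_mult)
      then show "k \<in> (\<lambda>k. n \<otimes>\<^bsub>G\<^esub> k \<otimes>\<^bsub>G\<^esub> inv\<^bsub>G\<^esub> n) ` (K \<inter> Nm)" using conj[OF k] by (rule image_eqI)
    qed (use conj_KM[OF n] in blast)
    show "\<forall>x\<in>K \<inter> Nm. \<rho> (inv\<^bsub>G\<^esub> n \<otimes>\<^bsub>G\<^esub> x \<otimes>\<^bsub>G\<^esub> n) = \<rho> x"
      using conj_KNm[OF n] conj by blast
  qed
  then show ?thesis unfolding stabilizer_rho_def normalizer_M0_eq K_Nm_eq_M0[symmetric] rhoM_eq by blast
qed

lemma hecke_algebra_twisted_group_algebra:
  assumes t: "\<And>n. n \<in> Nm \<Longrightarrow> t n \<noteq> 0"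
    "\<And>n k. n \<in> Nm \<Longrightarrow> k \<in> K \<inter> Nm \<Longrightarrow> t (n \<otimes>\<^bsub>G\<^esub> k) = t n * \<rho> k"
  defines "W \<equiv> (G\<lparr>carrier := Nm\<rparr>) Mod (K \<inter> Nm)"
  shows "algebra_iso (hecke_algebra G TG K \<rho>) (twisted_group_algebra W (cocycle_of G t)) \<noteq> {} \<and>
    two_cocycle W (cocycle_of G t) \<and> \<not> two_coboundary W (cocycle_of G t)"
proof -
  interpret H: hecke_pair G TG K Nm \<rho> L t "\<lambda>m. xr (sg m) ` Y m"
    by (rule hecke_pair_setup) (use t in blast)+
  obtain a b c where "a \<in> Nm" "b \<in> Nm" "c \<in> K \<inter> Nm" "a \<otimes>\<^bsub>G\<^esub> b = b \<otimes>\<^bsub>G\<^esub> a \<otimes>\<^bsub>G\<^esub> c" "\<rho> c \<noteq> 1"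
    using ex_commutator by blast
  then have "\<not> two_coboundary W (cocycle_of G t)" unfolding W_def by (rule H.not_coboundary)
  then show ?thesis using H.hecke_algebra_iso H.two_cocycle_W unfolding W_def by blast
qed

end

text \<open>The residues of \<open>x\<close> and \<open>y\<close> are those of elements \<open>a\<close> and \<open>b\<close> of the base field.\<close>

definition parahoric_cond ::
  "('f::field \<Rightarrow> int) \<Rightarrow> ('f \<Rightarrow> 'e2::field) \<Rightarrow> ('f \<Rightarrow> 'e4::field) \<Rightarrow> 'e2 \<Rightarrow> 'e4 \<Rightarrow> bool" where
  "parahoric_cond v \<iota>2 \<iota>4 x y \<longleftrightarrow> (\<exists>a b. a \<noteq> 0 \<and> v a = 0 \<and> b \<noteq> 0 \<and> v b = 0 \<and>
     val_ge (radical_extension.w v \<iota>2) (x - \<iota>2 a) 1 \<and> val_ge (radical_extension.w v \<iota>4) (y - \<iota>4 b) 1 \<and>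
     val_ge v (a * b ^ 2 - 1) 1)"

context radical_extension
begin

lemma reduction_mult:
  assumes "val_ge v a 0" "val_ge v b 0" "val_ge w (x - \<iota> a) 1" "val_ge w (y - \<iota> b) 1"
  shows "val_ge w (x * y - \<iota> (a * b)) 1"
proof -
  have b: "val_ge w (\<iota> b) 0" and "val_ge w (\<iota> a) 0" using assms by (simp_all only: val_ge_w_\<iota>_0)
  then have "val_ge w (x - \<iota> a + \<iota> a) 0" by (intro w.val_ge_add w.val_ge_mono[OF assms(3)]) auto
  then have x: "val_ge w x 0" by simp
  have "val_ge w (x * (y - \<iota> b) + \<iota> b * (x - \<iota> a)) 1"
    by (intro w.val_ge_add[OF w.val_ge_mult_0[OF x assms(4)] w.val_ge_mult_0[OF b assms(3)]])
  then show ?thesis by (simp add: algebra_simps)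
qed

lemma reduction_inverse:
  assumes "x \<noteq> 0" "w x = 0" "a \<noteq> 0" "v a = 0" "val_ge w (x - \<iota> a) 1"
  shows "val_ge w (inverse x - \<iota> (inverse a)) 1"
proof -
  have "inverse x - \<iota> (inverse a) = - ((x - \<iota> a) / (x * \<iota> a))" using assms by (simp add: field_simps)
  moreover have u: "x * \<iota> a \<noteq> 0" "w (x * \<iota> a) = 0" using assms by (simp_all add: w_mult w_\<iota>)
  ultimately show ?thesis using assms(5) by (simp only: w.val_ge_uminus w.val_ge_divide_unit[OF u])
qed

end

context hecke_setup
begin

lemma hecke_setup_parahoric: "hecke_setup v q \<pi> \<zeta> i1 \<eta> \<iota>2 \<theta>2 \<iota>4 \<theta>4 (parahoric_cond v \<iota>2 \<iota>4)"
proof unfold_locales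
  fix x y x' y'
  assume "parahoric_cond v \<iota>2 \<iota>4 x y" "parahoric_cond v \<iota>2 \<iota>4 x' y'"
  then obtain a b a' b' where
    ab: "a \<noteq> 0" "v a = 0" "b \<noteq> 0" "v b = 0" "val_ge E2.w (x - \<iota>2 a) 1" "val_ge E4.w (y - \<iota>4 b) 1" "val_ge v (a * b ^ 2 - 1) 1" and
    ab': "a' \<noteq> 0" "v a' = 0" "b' \<noteq> 0" "v b' = 0" "val_ge E2.w (x' - \<iota>2 a') 1" "val_ge E4.w (y' - \<iota>4 b') 1" "val_ge v (a' * b' ^ 2 - 1) 1"
    unfolding parahoric_cond_def by blast
  have I: "val_ge v a 0" "val_ge v b 0" "val_ge v a' 0" "val_ge v b' 0" "val_ge v (a * b ^ 2) 0"
    using ab ab' by (auto simp: val_ge_def v_mult v_power)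
  have "val_ge v (a * b ^ 2 * (a' * b' ^ 2 - 1) + (a * b ^ 2 - 1)) 1"
    by (rule val_ge_add[OF val_ge_mult_0[OF I(5) ab'(7)] ab(7)])
  then have "val_ge v (a * a' * (b * b') ^ 2 - 1) 1" by (simp add: algebra_simps power_mult_distrib)
  then show "parahoric_cond v \<iota>2 \<iota>4 (x * x') (y * y')"
    unfolding parahoric_cond_def
    using E2.reduction_mult[OF I(1,3) ab(5) ab'(5)] E4.reduction_mult[OF I(2,4) ab(6) ab'(6)] ab ab'
    by (intro exI[of _ "a * a'"] exI[of _ "b * b'"]) (simp add: v_mult)
next
  fix x y
  assume xy: "x \<noteq> 0" "E2.w x = 0" "y \<noteq> 0" "E4.w y = 0" and "parahoric_cond v \<iota>2 \<iota>4 x y"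
  then obtain a b where
    ab: "a \<noteq> 0" "v a = 0" "b \<noteq> 0" "v b = 0" "val_ge E2.w (x - \<iota>2 a) 1" "val_ge E4.w (y - \<iota>4 b) 1" "val_ge v (a * b ^ 2 - 1) 1"
    unfolding parahoric_cond_def by blast
  have "inverse a * inverse b ^ 2 - 1 = - ((a * b ^ 2 - 1) / (a * b ^ 2))" using ab by (simp add: field_simps)
  moreover have u: "a * b ^ 2 \<noteq> 0" "v (a * b ^ 2) = 0" using ab by (simp_all add: v_mult v_power)
  ultimately have "val_ge v (inverse a * inverse b ^ 2 - 1) 1"
    using ab(7) by (simp only: val_ge_uminus val_ge_divide_unit[OF u])
  then show "parahoric_cond v \<iota>2 \<iota>4 (inverse x) (inverse y)"
    unfolding parahoric_cond_def
    using E2.reduction_inverse[OF xy(1,2) ab(1,2,5)] E4.reduction_inverse[OF xy(3,4) ab(3,4,6)] ab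
    by (intro exI[of _ "inverse a"] exI[of _ "inverse b"]) (simp add: v_inverse)
next
  fix x y assume "val_ge E2.w (x - 1) 1" "val_ge E4.w (y - 1) 1"
  then show "parahoric_cond v \<iota>2 \<iota>4 x y"
    unfolding parahoric_cond_def by (intro exI[of _ 1]) simp
qed

text \<open>On \<open>K_st\<close> the determinant and the second component are units, so their
  residues are classes of base-field units \<open>x\<close> and \<open>y\<close>. Any other
  witnesses of \<open>parahoric_cond\<close> are congruent to these, and the condition depends only
  on classes.\<close>

lemma K_par_eq: "K_par v \<iota>2 \<iota>4 = {(A, z) \<in> K_st v \<iota>2 \<iota>4. parahoric_cond v \<iota>2 \<iota>4 (det A) z}"
proof -
  have "residue v \<iota>2 (det A) \<otimes>\<^bsub>residue_field v\<^esub> (residue v \<iota>4 z [^]\<^bsub>residue_field v\<^esub> (2::nat)) = \<one>\<^bsub>residue_field v\<^esub>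
      \<longleftrightarrow> parahoric_cond v \<iota>2 \<iota>4 (det A) z" if Az: "(A, z) \<in> K_st v \<iota>2 \<iota>4" for A z
  proof -
    obtain a b c d where A: "A = mk a b c d" using Az by (auto simp: K_st_def G0_def elim: mat2_cases)
    have u: "a \<noteq> 0" "E2.w a = 0" "d \<noteq> 0" "E2.w d = 0" "val_ge E2.w b 0" "val_ge E2.w c 1" "z \<noteq> 0" "E4.w z = 0"
      using Az unfolding A K_st_def iwahori_def E2.integral_closure_eq E4.integral_closure_eq
        E2.w.unit_elems_valuation_ring E4.w.unit_elems_valuation_ring E2.w.nonunits_valuation_ring
      by (auto simp: valuation_ring_def)
    have \<Delta>: "det A \<noteq> 0" "E2.w (det A) = 0" using K_det_unit(1)[OF u(1-6)] by (simp_all add: A)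
    obtain x where x: "x \<noteq> 0" "v x = 0" "val_ge E2.w (det A - \<iota>2 x) 1" using unit_reduction2[OF \<Delta>] by blast
    obtain y where y: "val_ge v y 0" "val_ge E4.w (z - \<iota>4 y) 1"
      using E4.ex_reduction[of z] u by (auto simp: val_ge_def)
    then have "\<iota>4 y \<noteq> 0 \<and> E4.w (\<iota>4 y) = 0" using E4.w.val_eq_of_close[of z "\<iota>4 y"] u by simp
    then have y0: "y \<noteq> 0" "v y = 0" by (auto simp: E4.w_\<iota>)
    have x0: "val_ge v x 0" using x by (simp add: val_ge_def)
    have res: "residue v \<iota>2 (det A) \<otimes>\<^bsub>residue_field v\<^esub> (residue v \<iota>4 z [^]\<^bsub>residue_field v\<^esub> (2::nat)) = \<one>\<^bsub>residue_field v\<^esub>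
      \<longleftrightarrow> val_ge v (x * y ^ 2 - 1) 1"
      unfolding E2.residue_res_class[OF x0 x(3)] E4.residue_res_class[OF y]
      using x0 y val_ge_power[OF y(1), of 2]
      by (simp add: pow_residue_field mult_residue_field one_residue_field res_class_eq_iff valuation_ring_def)
    have "val_ge v (x * y ^ 2 - 1) 1" if "parahoric_cond v \<iota>2 \<iota>4 (det A) z"
    proof -
      obtain x' y' where x': "x' \<noteq> 0" "v x' = 0" "val_ge E2.w (det A - \<iota>2 x') 1" "val_ge v (x' * y' ^ 2 - 1) 1"
        and y': "y' \<noteq> 0" "v y' = 0" "val_ge E4.w (z - \<iota>4 y') 1"
        using \<open>parahoric_cond v \<iota>2 \<iota>4 (det A) z\<close> unfolding parahoric_cond_def by blast
      have "val_ge E2.w (\<iota>2 (x - x')) 1" "val_ge E4.w (\<iota>4 (y - y')) 1"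
        using E2.w.val_ge_diff[OF x'(3) x(3)] E4.w.val_ge_diff[OF y'(3) y(2)] by simp_all
      then have c: "val_ge v (x - x') 1" "val_ge v (y - y') 1" by (simp_all only: E2.val_ge_w_\<iota>_1 E4.val_ge_w_\<iota>_1)
      have I: "val_ge v x' 0" "val_ge v (y ^ 2) 0" "val_ge v (y + y') 0"
        using x' y' y(1) by (auto simp: val_ge_def[of _ x'] val_ge_def[of _ y'] intro: val_ge_power val_ge_add)
      \<comment> \<open>This is \<open>x * y ^ 2 - 1\<close>, written as a sum of multiples of
        \<open>x - x'\<close>, of \<open>y - y'\<close> and of
        \<open>x' * y' ^ 2 - 1\<close>.\<close>
      have "val_ge v (y ^ 2 * (x - x') + x' * ((y + y') * (y - y')) + (x' * y' ^ 2 - 1)) 1"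
        by (rule val_ge_add[OF val_ge_add x'(4)]; rule val_ge_mult_0) (rule I c val_ge_mult_0)+
      then show ?thesis by (simp add: algebra_simps power2_eq_square)
    qed
    moreover have "parahoric_cond v \<iota>2 \<iota>4 (det A) z" if "val_ge v (x * y ^ 2 - 1) 1"
      unfolding parahoric_cond_def using that x y y0 by blast
    ultimately show ?thesis using res by blast
  qed
  then show ?thesis unfolding K_par_def by blast
qed

end

subsection \<open>Splitting fields of binomials\<close>

lemma splitting_field_generates:
  assumes "is_splitting_field \<iota> f" "range \<iota> \<subseteq> L" "{r. poly (map_poly \<iota> f) r = 0} \<subseteq> L"
    "\<forall>x\<in>L. \<forall>y\<in>L. x - y \<in> L \<and> x * y \<in> L \<and> inverse x \<in> L"
  shows "L = UNIV"
  using assms(1)[unfolded is_splitting_field_def, THEN conjunct2, THEN conjunct2, rule_format, OF assms(2,3)] assms(4)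
  by simp

lemma splitting_field_root:
  assumes "is_splitting_field \<iota> f" "degree (map_poly \<iota> f) > 0"
  obtains r where "poly (map_poly \<iota> f) r = 0"
proof -
  obtain rs where rs: "map_poly \<iota> f = Polynomial.smult (\<iota> (lead_coeff f)) (\<Prod>r\<leftarrow>rs. [:- r, 1:])"
    using assms(1) by (auto simp: is_splitting_field_def)
  then obtain r rs' where "rs = r # rs'" using assms(2) by (cases rs) auto
  then have "poly (map_poly \<iota> f) r = 0" by (simp add: rs)
  then show ?thesis using that by blast
qed

lemma (in valued_field) radical_extension_2:
  assumes E: "is_splitting_field \<iota> [:c, 0, 1:]" and c: "c \<noteq> 0" "v c = 1"
  obtains \<theta> where "radical_extension v \<iota> 2 (- c) \<theta>"
proof -
  interpret field_embedding \<iota> by (rule field_embedding.intro) (use E in \<open>simp add: is_splitting_field_def\<close>)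
  have f: "map_poly \<iota> [:c, 0, 1:] = [:\<iota> c, 0, 1:]" by (simp add: map_poly_pCons)
  have root: "poly (map_poly \<iota> [:c, 0, 1:]) r = 0 \<longleftrightarrow> r ^ 2 = \<iota> (- c)" for r
    unfolding f by (simp add: power2_eq_square eq_neg_iff_add_eq_0 add.commute)
  obtain \<theta> where \<theta>: "\<theta> ^ 2 = \<iota> (- c)"
    using splitting_field_root[OF E] root by (auto simp: f)
  have "radical_extension v \<iota> 2 (- c) \<theta>"
  proof unfold_locales
    fix L assume L: "range \<iota> \<subseteq> L" "\<theta> \<in> L" and closed: "\<forall>x\<in>L. \<forall>y\<in>L. x - y \<in> L \<and> x * y \<in> L \<and> inverse x \<in> L"
    have "0 \<in> L" using L(1) hom_simps(1) by (metis rangeI subsetD)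
    have "r \<in> L" if "r ^ 2 = \<iota> (- c)" for r
    proof -
      have "r = \<theta> \<or> r = - \<theta>" using that \<theta> by (metis power2_eq_iff)
      moreover have "0 - \<theta> \<in> L" using closed L(2) \<open>0 \<in> L\<close> by blast
      ultimately show ?thesis using L(2) by auto
    qed
    then show "L = UNIV" using root by (intro splitting_field_generates[OF E L(1) _ closed]) auto
  qed (use c \<theta> in auto)
  then show ?thesis using that by blast
qed

text \<open>All roots are \<open>\<theta>\<close> times fourth roots of unity, which lie in the base
  field thanks to \<open>i\<close>. So a subfield containing the base field and one root contains
  all roots, and the splitting field is generated by that root.\<close>

lemma (in valued_field) radical_extension_4:
  assumes E: "is_splitting_field \<iota> [:c, 0, 0, 0, 1:]" and c: "c \<noteq> 0" "v c = 1" and i: "(i :: 'f) ^ 2 = -1"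
  obtains \<theta> where "radical_extension v \<iota> 4 (- c) \<theta>"
proof -
  interpret field_embedding \<iota> by (rule field_embedding.intro) (use E in \<open>simp add: is_splitting_field_def\<close>)
  have f: "map_poly \<iota> [:c, 0, 0, 0, 1:] = [:\<iota> c, 0, 0, 0, 1:]" by (simp add: map_poly_pCons)
  have root: "poly (map_poly \<iota> [:c, 0, 0, 0, 1:]) r = 0 \<longleftrightarrow> r ^ 4 = \<iota> (- c)" for r
    unfolding f by (simp add: eval_nat_numeral eq_neg_iff_add_eq_0 add.commute mult.assoc)
  obtain \<theta> where \<theta>: "\<theta> ^ 4 = \<iota> (- c)"
    using splitting_field_root[OF E] root by (auto simp: f)
  have "radical_extension v \<iota> 4 (- c) \<theta>"
  proof unfold_locales
    fix L assume L: "range \<iota> \<subseteq> L" "\<theta> \<in> L" and closed: "\<forall>x\<in>L. \<forall>y\<in>L. x - y \<in> L \<and> x * y \<in> L \<and> inverse x \<in> L"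
    have "0 \<in> L" using L(1) hom_simps(1) by (metis rangeI subsetD)
    have neg: "- x \<in> L" if "x \<in> L" for x
    proof -
      have "0 - x \<in> L" using closed that \<open>0 \<in> L\<close> by blast
      then show ?thesis by simp
    qed
    have "\<iota> i * \<theta> \<in> L" using closed L by blast
    have "r \<in> L" if r: "r ^ 4 = \<iota> (- c)" for r
    proof -
      have i2: "\<iota> i ^ 2 = -1" using i by (metis hom_simps(2) hom_simps(6) hom_simps(9))
      have "r ^ 4 = (r ^ 2) ^ 2" "\<theta> ^ 4 = (\<theta> ^ 2) ^ 2" by (simp_all flip: power_mult)
      then have "(r ^ 2) ^ 2 = (\<theta> ^ 2) ^ 2" using r \<theta> by simp
      then have "r ^ 2 = \<theta> ^ 2 \<or> r ^ 2 = - (\<theta> ^ 2)" by (simp only: power2_eq_iff)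
      moreover have "(\<iota> i * \<theta>) ^ 2 = - (\<theta> ^ 2)" using i2 by (simp add: power_mult_distrib)
      ultimately have "r = \<theta> \<or> r = - \<theta> \<or> r = \<iota> i * \<theta> \<or> r = - (\<iota> i * \<theta>)" by (metis power2_eq_iff)
      then show ?thesis using L(2) neg \<open>\<iota> i * \<theta> \<in> L\<close> by blast
    qed
    then show "L = UNIV" using root by (intro splitting_field_generates[OF E L(1) _ closed]) auto
  qed (use c \<theta> in auto)
  then show ?thesis using that by blast
qed

theorem corollary3p9:
  fixes v :: "'f::field \<Rightarrow> int"
    and p q :: nat
    and \<pi> \<zeta> :: 'f
    and sqrt_m1 :: complex
    and \<eta> :: "'f \<Rightarrow> complex"
    and \<iota>2 :: "'f \<Rightarrow> 'e2::field"
    and \<iota>4 :: "'f \<Rightarrow> 'e4::field"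
    and K :: "('e2 mat \<times> 'e4) set"
    and T :: "'e2 mat \<times> 'e4 \<Rightarrow> complex"
  defines "G \<equiv> G0 \<iota>2 \<iota>4"
    and "KM \<equiv> K \<inter> M0 \<iota>2 \<iota>4"
    and "N \<equiv> stabilizer_rho (G0 \<iota>2 \<iota>4) (normalizer_M0 \<iota>2 \<iota>4) (K \<inter> M0 \<iota>2 \<iota>4) (rhoM \<eta> \<iota>2)"
  defines "W \<equiv> (G\<lparr>carrier := N\<rparr>) Mod KM"
    and "\<mu> \<equiv> cocycle_of G T"
  assumes F: "nonarch_local_field v"
    and p: "prime p" "of_nat p \<in> nonunits (valuation_ring v)" "odd p"
    and q: "q = card (carrier (residue_field v))" "4 dvd q - 1"
    and uniformizer: "\<pi> \<noteq> 0" "v \<pi> = 1"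
    and \<zeta>: "\<zeta> ^ (q - 1) = 1" "\<forall>k. 0 < k \<and> k < q - 1 \<longrightarrow> \<zeta> ^ k \<noteq> 1"
    and sqrt_m1: "sqrt_m1 ^ 2 = -1"
    and \<eta>_char: "\<forall>x. x \<noteq> 0 \<longrightarrow> \<eta> x \<noteq> 0"
      "\<forall>x y. x \<noteq> 0 \<longrightarrow> y \<noteq> 0 \<longrightarrow> \<eta> (x * y) = \<eta> x * \<eta> y"
    and \<eta>_values: "\<eta> \<pi> = 1" "\<forall>x \<in> nonunits (valuation_ring v). \<eta> (1 + x) = 1" "\<eta> \<zeta> = sqrt_m1"
    and E2: "is_splitting_field \<iota>2 [:\<pi>, 0, 1:]"
    and E4: "is_splitting_field \<iota>4 [:\<zeta> * \<pi>, 0, 0, 0, 1:]"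
    and K: "K = K_st v \<iota>2 \<iota>4 \<or> K = K_par v \<iota>2 \<iota>4"
    and T_nonzero: "\<forall>n\<in>N. T n \<noteq> 0"
    and T_equivariant: "\<forall>n\<in>N. \<forall>k\<in>KM. T (n \<otimes>\<^bsub>G\<^esub> k) = T n * rhoM \<eta> \<iota>2 k"
  shows "algebra_iso (hecke_algebra G (G0_topology v \<iota>2 \<iota>4) K (rho0 \<eta> \<iota>2))
           (twisted_group_algebra W \<mu>) \<noteq> {} \<and>
         two_cocycle W \<mu> \<and> \<not> two_coboundary W \<mu>"
proof -
  note F' = F[unfolded nonarch_local_field_def]
  interpret valued_field v
    by (rule valued_field.intro[OF F'[THEN conjunct1, rule_format] F'[THEN conjunct2, THEN conjunct1, rule_format]])
  interpret local_field_char v q \<pi> \<zeta> sqrt_m1 \<eta>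
  proof
    show "\<exists>l. \<forall>n. \<exists>k. \<forall>i\<ge>k. val_ge v (s i - l) n"
      if "\<forall>n. \<exists>k. \<forall>i\<ge>k. \<forall>j\<ge>k. val_ge v (s i - s j) n" for s :: "nat \<Rightarrow> 'f"
      by (rule F'[THEN conjunct2, THEN conjunct2, THEN conjunct2, THEN conjunct1, THEN spec, THEN mp, OF that])
    show "finite (carrier (residue_field v))"
      by (rule F'[THEN conjunct2, THEN conjunct2, THEN conjunct2, THEN conjunct2])
    show "\<eta> (1 + x) = 1" if "val_ge v x 1" for x
      using \<eta>_values(2) that by (simp add: nonunits_valuation_ring)
  qed (use q uniformizer \<zeta> sqrt_m1 \<eta>_char \<eta>_values in blast)+
  have c: "\<zeta> * \<pi> \<noteq> 0" "v (\<zeta> * \<pi>) = 1"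
    using uniformizer by (simp_all add: v_mult v_\<zeta>)
  obtain \<theta>2 where \<theta>2: "radical_extension v \<iota>2 2 (- \<pi>) \<theta>2"
    using radical_extension_2[OF E2 uniformizer] by blast
  obtain \<theta>4 where \<theta>4: "radical_extension v \<iota>4 4 (- (\<zeta> * \<pi>)) \<theta>4"
    using radical_extension_4[OF E4 c i0_square] by blast
  have st: "hecke_setup v q \<pi> \<zeta> sqrt_m1 \<eta> \<iota>2 \<theta>2 \<iota>4 \<theta>4 (\<lambda>_ _. True)"
    by (intro hecke_setup.intro hecke_setup_axioms.intro local_field_char_axioms \<theta>2 \<theta>4 TrueI)
  \<comment> \<open>The parahoric case is derived inside the context with trivial \<open>P\<close>,
    which already provides both extensions.\<close>
  obtain P where P: "hecke_setup v q \<pi> \<zeta> sqrt_m1 \<eta> \<iota>2 \<theta>2 \<iota>4 \<theta>4 P" "K = {(A, z) \<in> K_st v \<iota>2 \<iota>4. P (det A) z}"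
    using K
  proof
    assume "K = K_st v \<iota>2 \<iota>4"
    then show thesis using that[OF st] by simp
  next
    assume "K = K_par v \<iota>2 \<iota>4"
    then show thesis
      using that[OF hecke_setup.hecke_setup_parahoric[OF st]] hecke_setup.K_par_eq[OF st] by simp
  qed
  interpret S: hecke_setup v q \<pi> \<zeta> sqrt_m1 \<eta> \<iota>2 \<theta>2 \<iota>4 \<theta>4 P by (rule P(1))
  have K_eq: "K = S.K" using P(2) by (simp add: S.K_def)
  have KM_eq: "KM = S.K \<inter> S.Nm" by (simp add: KM_def K_eq S.K_Nm_eq_M0)
  have N_eq: "N = S.Nm" using S.stabilizer_eq_Nm by (simp add: N_def K_eq)
  have "T (n \<otimes>\<^bsub>G0 \<iota>2 \<iota>4\<^esub> k) = T n * rho0 \<eta> \<iota>2 k" if "n \<in> S.Nm" "k \<in> S.K \<inter> S.Nm" for n k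
    using T_equivariant that unfolding N_eq KM_eq G_def S.rhoM_eq by blast
  moreover have "T n \<noteq> 0" if "n \<in> S.Nm" for n using T_nonzero that unfolding N_eq by blast
  ultimately show ?thesis
    unfolding W_def \<mu>_def KM_eq N_eq G_def K_eq by (intro S.hecke_algebra_twisted_group_algebra)
qed

end
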